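(* Let $S$ be a closed coisotropic submanifold of a Jacobi manifold, equipped with a fat tubular neighborhood, so that the ambient Jacobi manifold is identified with $(NS,L,J\equiv\{-,-\})$, $L=L_{NS}=\pi^*\ell$. The bi-symbol $\Lambda_J$ of the Jacobi bi-differential operator $J$ is fiber-wise entire if and only if, for all sections $s\in\Gamma(NS)$, the Maurer-Cartan series $$MC(-s)=\sum_{k=1}^\infty\frac1{k!}\mathfrak m_k(-s,\dots,-s)$$ converges to $P(\exp I(-s)_*J)=P(\exp I(-s)_*\Lambda_J)$ in the sense of point-wise convergence.
   Context: Everything is smooth. **Multi-differential operators.** For a line bundle $L\to M$, a derivation of $L$ is an $\mathbb R$-linear $\Delta:\Gamma(L)\to\Gamma(L)$ with $\Delta(f\lambda)=\sigma(\Delta)(f)\lambda+f\Delta\lambda$ for a vector field $\sigma(\Delta)$, its symbol. $J^1L$ is the first jet bundle, $J_1L:=(J^1L)^*$. $\mathcal D^kL:=\Gamma(\wedge^kJ_1L\otimes L)$ is the space of alternating maps $\Gamma(L)^k\to\Gamma(L)$ that are first order differential operators in each entry, equivalently of $L$-valued alternating $k$-forms on $J^1L$; $\mathcal D^0L=\Gamma(L)$, $\mathcal D^1L=\mathcal DL$ the derivations. Elements of $\mathcal D^kL$ have degree $k-1$ in $(\mathcal D^\bullet L)[1]$. The Schouten-Jacobi bracket is $[\square,\square']^{SJ}:=(-1)^{kk'}\square\circ\square'-\square'\circ\square$ for $\square\in\mathcal D^{k+1}L$, $\square'\in\mathcal D^{k'+1}L$, where $(\square\circ\square')(\lambda_1,\dots,\lambda_{k+k'+1})=\sum_{\tau\in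 S_{k'+1,k}}(-1)^\tau\square(\square'(\lambda_{\tau(1)},\dots,\lambda_{\tau(k'+1)}),\lambda_{\tau(k'+2)},\dots,\lambda_{\tau(k+k'+1)})$ (sum over unshuffles). **Jacobi manifolds.** A Jacobi manifold $(M,L,J\equiv\{-,-\})$ is a manifold with a line bundle $L$ and a Lie bracket on $\Gamma(L)$ that is a first order differential operator in each entry; $J\in\mathcal D^2L$ denotes the bracket (and the associated $L$-valued 2-form on $J^1L$, $J(j^1\lambda,j^1\mu)=\{\lambda,\mu\}$); $X_\lambda$ is the symbol of $\{\lambda,-\}$. The co-symbol is the embedding $\gamma:T^*M\otimes L\to J^1L$, $\gamma(df\otimes\lambda)=j^1(f\lambda)-fj^1\lambda$. The bi-symbol is $\Lambda_J:=J\circ(\gamma\wedge\gamma):\wedge^2(T^*M\otimes L)\to L$, a section of $\wedge^2(TM\otimes L^* )\otimes L$. A submanifold $S$ is coisotropic if $\Lambda_J^\#(T^0S\otimes L)\subset TS$, where $\Lambda_J^\#(df\otimes\lambda)=X_{f\lambda}-fX_\lambda$ and $T^0S$ is the annihilator of $TS$. **Normal data.** $\ell=L|_S$, $NS=TM|_S/TS$ with projection $\pi:NS\to S$, $N_\ell S=NS\otimes\ell^*$, $N_\ell{}^*S=N^*S\otimes\ell$, embedded in $J^1L|_S$ via $\gamma$. $P:(\mathcal D^\bullet L)[1]\to\Gamma(\wedge^\bullet N_\ell S\otimes\ell)[1]$ sends $\square\in\mathcal D^kL$ to the restriction to $S$ of the $k$-form $\square$, pulled back along $\gamma:N_\ell{}^*S\to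 J^1L|_S$ (here $\Gamma(\wedge^kN_\ell S\otimes\ell)$ = $\ell$-valued alternating $k$-forms on $N_\ell{}^*S$; for $k=1$ it is $\Gamma(NS)$). Also $P$ denotes the restriction map from $\Gamma(\wedge^k(TM\otimes L^* )\otimes L)$, i.e. $L$-valued $k$-forms on $T^*M\otimes L$, to $\ell$-valued $k$-forms on $N_\ell{}^*S\subset (T^*M\otimes L)|_S$. A fat tubular neighborhood is a line bundle embedding $\tau:L_{NS}:=\pi^*\ell\hookrightarrow L$ covering a tubular neighborhood $NS\hookrightarrow M$ and restricting to the inclusion $\ell\hookrightarrow L$ over the zero section; via $\tau$ one replaces $(M,L,J)$ by the induced Jacobi structure $(L=L_{NS},J)$ on $NS$, with $S$ the zero section. **The map $I$ and the brackets.** For $\nu\in\Gamma(NS)$, $\pi^*\nu$ is the corresponding fiberwise constant vertical vector field; $\mathbb D$ is the flat connection in $L=\pi^*\ell$ along vertical vector fields with $\mathbb D_X\pi^*\lambda=0$, $\lambda\in\Gamma(\ell)$. Put $I(\nu)=\mathbb D_{\pi^*\nu}$, $I_0(\nu\otimes\varphi)=I(\nu)\otimes\pi^*\varphi$ ($\varphi\in\Gamma(\ell^* )$), $I(\lambda)=\pi^*\lambda$, $I(\xi_1\wedge\dots\wedge\xi_k\otimes\lambda)=I_0(\xi_1)\wedge\dots\wedge I_0(\xi_k)\otimes\pi^*\lambda$. Then $\mathfrak m_k(\xi_1,\dots,\xi_k):=P[\cdots[[J,I(\xi_1)]^{SJ},I(\xi_2)]^{SJ}\cdots,I(\xi_k)]^{SJ}$.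 For $s\in\Gamma(NS)$, $\exp I(s)$ is the automorphism of $L=NS\times_S\ell$, $(\nu,\lambda)\mapsto(\nu+s(x),\lambda)$, $x=\pi(\nu)$. Push-forward along a line bundle automorphism $\phi$: $(\phi_*\square)(\lambda_1,\dots,\lambda_k)=(\phi^{-1})^*(\square(\phi^*\lambda_1,\dots,\phi^*\lambda_k))$, and similarly for $\Lambda_J$ (so that $\phi_*\Lambda_J=\Lambda_{\phi_*J}$). **Fiber-wise entire.** A smooth function on a vector bundle $E\to S$ is fiber-wise entire if on each fiber $E_x$ it equals the sum of its Taylor series at the origin, which converges on the whole of $E_x$. $\Lambda_J$ is fiber-wise entire if its components in some (equivalently any) system of vector bundle coordinates on $NS$ and fiberwise constant local generator of $L$ are fiber-wise entire functions; equivalently $\Lambda_J(df_1\otimes\lambda_1,df_2\otimes\lambda_2)$ is a combination of fiberwise constant sections with fiber-wise entire coefficients, whenever $f_1,f_2$ are fiberwise linear and $\lambda_1,\lambda_2$ fiberwise constant.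
   Formalization: The "if" direction (convergence for all s implies fiber-wise entire) is claimed only when codim S ≠ 1 or dim S = 0; for hypersurfaces with dim S ≥ 1 it fails, e.g. {f,g}=(f_x g_u − f_u g_x)/(1+u²) on R², S={u=0}, where the series is always 0. *)

theory Defs
  imports "HOL-Analysis.Analysis" "HOL-Combinatorics.Permutations"
begin

section \<open>Smooth manifolds\<close>

text \<open>
  Model spaces are finite-dimensional inner product spaces (type class \<^class>\<open>real_inner\<close> plus an
  explicit finite spanning set) rather than \<^class>\<open>euclidean_space\<close>, which would exclude
  dimension 0.
\<close>

definition finite_dim :: "'a::real_vector itself \<Rightarrow> bool" where
  "finite_dim _ \<longleftrightarrow> (\<exists>B::'a set. finite B \<and> span B = UNIV)"

primrec Ck_on :: "nat \<Rightarrow> 'a::real_normed_vector set \<Rightarrow> ('a \<Rightarrow> 'c::real_normed_vector) \<Rightarrow> bool" where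
  "Ck_on 0 U f \<longleftrightarrow> continuous_on U f"
| "Ck_on (Suc k) U f \<longleftrightarrow>
     (\<exists>f'. (\<forall>x\<in>U. (f has_derivative f' x) (at x)) \<and> (\<forall>v. Ck_on k U (\<lambda>x. f' x v)))"

definition smooth_on :: "'a::real_normed_vector set \<Rightarrow> ('a \<Rightarrow> 'c::real_normed_vector) \<Rightarrow> bool" where
  "smooth_on U f \<longleftrightarrow> (\<forall>k. Ck_on k U f)"

type_synonym ('m, 'a) atlas = "('m set \<times> ('m \<Rightarrow> 'a)) set"

definition smooth_manifold :: "('m::topological_space, 'a::real_inner) atlas \<Rightarrow> bool" where
  "smooth_manifold A \<longleftrightarrow>
     Hausdorff_space (euclidean :: 'm topology) \<and> second_countable (euclidean :: 'm topology) \<and>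
     finite_dim TYPE('a) \<and>
     (\<Union>(U, \<phi>)\<in>A. U) = UNIV \<and>
     (\<forall>(U, \<phi>)\<in>A. open U \<and> open (\<phi> ` U) \<and> homeomorphism U (\<phi> ` U) \<phi> (inv_into U \<phi>)) \<and>
     (\<forall>(U, \<phi>)\<in>A. \<forall>(V, \<psi>)\<in>A. smooth_on (\<phi> ` (U \<inter> V)) (\<psi> \<circ> inv_into U \<phi>))"

definition smooth_wrt ::
  "('m, 'a::real_normed_vector) atlas \<Rightarrow> 'm set \<Rightarrow> ('m \<Rightarrow> 'c::real_normed_vector) \<Rightarrow> bool" where
  "smooth_wrt A V g \<longleftrightarrow> (\<forall>(U, \<phi>)\<in>A. smooth_on (\<phi> ` (U \<inter> V)) (g \<circ> inv_into U \<phi>))"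

definition Cinf :: "('m, 'a::real_normed_vector) atlas \<Rightarrow> ('m \<Rightarrow> real) set" where
  "Cinf A = {f. smooth_wrt A UNIV f}"

text \<open>Tangent vectors are derivations at a point; functionals on \<open>C\<^sup>\<infinity>(M)\<close> are made extensional so
  that equality of tangent vectors is equality of functions.\<close>

definition tangent :: "('m, 'a::real_normed_vector) atlas \<Rightarrow> 'm \<Rightarrow> (('m \<Rightarrow> real) \<Rightarrow> real) set" where
  "tangent A y = {v \<in> extensional (Cinf A).
     (\<forall>f\<in>Cinf A. \<forall>g\<in>Cinf A. v (\<lambda>z. f z + g z) = v f + v g) \<and>
     (\<forall>c. \<forall>f\<in>Cinf A. v (\<lambda>z. c * f z) = c * v f) \<and>
     (\<forall>f\<in>Cinf A. \<forall>g\<in>Cinf A. v (\<lambda>z. f z * g z) = f y * v g + g y * v f)}"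

text \<open>The differential of a smooth map \<open>h\<close> into the manifold with atlas \<open>A\<close>.\<close>

definition push_tan ::
  "('n, 'a::real_normed_vector) atlas \<Rightarrow> ('m \<Rightarrow> 'n) \<Rightarrow> (('m \<Rightarrow> real) \<Rightarrow> real) \<Rightarrow> (('n \<Rightarrow> real) \<Rightarrow> real)" where
  "push_tan A h v = restrict (\<lambda>f. v (f \<circ> h)) (Cinf A)"


section \<open>Vector bundles\<close>

text \<open>A trivialization over \<open>V\<close> is given by its fibre component \<open>\<Phi>\<close>; the full trivialization is
  \<open>e \<mapsto> (prj e, \<Phi> e)\<close>, and only its values on \<open>tot \<inter> prj -` V\<close> matter.\<close>

record ('t, 'm, 'f) vbundle =
  tot :: "'t set"
  prj :: "'t \<Rightarrow> 'm"
  triv :: "('m set \<times> ('t \<Rightarrow> 'f)) set"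

definition vector_bundle ::
  "('m::topological_space, 'a::real_normed_vector) atlas \<Rightarrow>
   ('t::topological_space, 'm, 'f::real_inner) vbundle \<Rightarrow> bool" where
  "vector_bundle A B \<longleftrightarrow>
     finite_dim TYPE('f) \<and>
     (\<Union>(V, \<Phi>)\<in>triv B. V) = UNIV \<and>
     (\<forall>(V, \<Phi>)\<in>triv B. open V \<and>
        (\<exists>h. homeomorphism (tot B \<inter> prj B -` V) (V \<times> UNIV) (\<lambda>e. (prj B e, \<Phi> e)) h)) \<and>
     (\<forall>(V, \<Phi>)\<in>triv B. \<forall>(W, \<Psi>)\<in>triv B. \<exists>g.
        (\<forall>x\<in>V \<inter> W. linear (g x)) \<and>
        (\<forall>u. smooth_wrt A (V \<inter> W) (\<lambda>x. g x u)) \<and>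
        (\<forall>e\<in>tot B. prj B e \<in> V \<inter> W \<longrightarrow> \<Psi> e = g (prj B e) (\<Phi> e)))"

abbreviation line_bundle ::
  "('m::topological_space, 'a::real_normed_vector) atlas \<Rightarrow>
   ('t::topological_space, 'm, real) vbundle \<Rightarrow> bool" where
  "line_bundle A L \<equiv> vector_bundle A L"

text \<open>The vector over \<open>x\<close> whose fibre coordinate is \<open>p \<Phi>\<close> in every trivialization \<open>\<Phi>\<close> around \<open>x\<close>.\<close>

definition the_vec :: "('t, 'm, 'f) vbundle \<Rightarrow> 'm \<Rightarrow> (('t \<Rightarrow> 'f) \<Rightarrow> 'f) \<Rightarrow> 't" where
  "the_vec B x p = (THE w. w \<in> tot B \<and> prj B w = x \<and> (\<forall>(V, \<Phi>)\<in>triv B. x \<in> V \<longrightarrow> \<Phi> w = p \<Phi>))"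

definition zero_vec :: "('t, 'm, 'f::real_vector) vbundle \<Rightarrow> 'm \<Rightarrow> 't" where
  "zero_vec B x = the_vec B x (\<lambda>\<Phi>. 0)"

definition add_vec :: "('t, 'm, 'f::real_vector) vbundle \<Rightarrow> 't \<Rightarrow> 't \<Rightarrow> 't" where
  "add_vec B u v = the_vec B (prj B u) (\<lambda>\<Phi>. \<Phi> u + \<Phi> v)"

definition scale_vec :: "('t, 'm, 'f::real_vector) vbundle \<Rightarrow> real \<Rightarrow> 't \<Rightarrow> 't" where
  "scale_vec B c u = the_vec B (prj B u) (\<lambda>\<Phi>. c *\<^sub>R \<Phi> u)"

definition sum_vec :: "('t, 'm, 'f::real_vector) vbundle \<Rightarrow> 'm \<Rightarrow> 'i set \<Rightarrow> ('i \<Rightarrow> 't) \<Rightarrow> 't" where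
  "sum_vec B x I u = the_vec B x (\<lambda>\<Phi>. \<Sum>i\<in>I. \<Phi> (u i))"

definition sections ::
  "('m, 'a::real_normed_vector) atlas \<Rightarrow> ('t, 'm, 'f::real_normed_vector) vbundle \<Rightarrow> ('m \<Rightarrow> 't) set" where
  "sections A B = {\<sigma>. (\<forall>x. \<sigma> x \<in> tot B \<and> prj B (\<sigma> x) = x) \<and>
     (\<forall>(V, \<Phi>)\<in>triv B. smooth_wrt A V (\<Phi> \<circ> \<sigma>))}"

definition add_sec :: "('t, 'm, 'f::real_vector) vbundle \<Rightarrow> ('m \<Rightarrow> 't) \<Rightarrow> ('m \<Rightarrow> 't) \<Rightarrow> ('m \<Rightarrow> 't)" where
  "add_sec B \<sigma> \<rho> = (\<lambda>x. add_vec B (\<sigma> x) (\<rho> x))"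

definition mult_sec :: "('t, 'm, 'f::real_vector) vbundle \<Rightarrow> ('m \<Rightarrow> real) \<Rightarrow> ('m \<Rightarrow> 't) \<Rightarrow> ('m \<Rightarrow> 't)" where
  "mult_sec B f \<sigma> = (\<lambda>x. scale_vec B (f x) (\<sigma> x))"

definition neg_sec :: "('t, 'm, 'f::real_vector) vbundle \<Rightarrow> ('m \<Rightarrow> 't) \<Rightarrow> ('m \<Rightarrow> 't)" where
  "neg_sec B \<sigma> = mult_sec B (\<lambda>_. - 1) \<sigma>"

definition sum_sec :: "('t, 'm, 'f::real_vector) vbundle \<Rightarrow> 'i set \<Rightarrow> ('i \<Rightarrow> 'm \<Rightarrow> 't) \<Rightarrow> ('m \<Rightarrow> 't)" where
  "sum_sec B I \<sigma> = (\<lambda>x. sum_vec B x I (\<lambda>i. \<sigma> i x))"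

text \<open>The total space of \<open>E\<close> as a manifold (for \<open>tot E = UNIV\<close>), and the pull-back of a bundle
  over the base of \<open>E\<close> to that total space.\<close>

definition total_atlas ::
  "('m, 'a) atlas \<Rightarrow> ('e, 'm, 'f) vbundle \<Rightarrow> ('e, 'a \<times> 'f) atlas" where
  "total_atlas A E = {(prj E -` (U \<inter> V), \<lambda>e. (\<phi> (prj E e), \<Phi> e)) | U \<phi> V \<Phi>.
     (U, \<phi>) \<in> A \<and> (V, \<Phi>) \<in> triv E}"

definition pullback :: "('e, 'm, 'f) vbundle \<Rightarrow> ('t, 'm, 'g) vbundle \<Rightarrow> ('e \<times> 't, 'e, 'g) vbundle" where
  "pullback E B = \<lparr>
     tot = {(e, b). e \<in> tot E \<and> b \<in> tot B \<and> prj E e = prj B b},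
     prj = fst,
     triv = {(prj E -` V, \<Psi> \<circ> snd) | V \<Psi>. (V, \<Psi>) \<in> triv B}\<rparr>"

definition pullback_sec :: "('e, 'm, 'f) vbundle \<Rightarrow> ('m \<Rightarrow> 't) \<Rightarrow> ('e \<Rightarrow> 'e \<times> 't)" where
  "pullback_sec E \<kappa> = (\<lambda>e. (e, \<kappa> (prj E e)))"


section \<open>Multi-differential operators and the Schouten-Jacobi bracket\<close>

text \<open>An operator with \<open>k\<close> entries is a function on lists; only lists of \<open>k\<close> smooth sections
  matter.\<close>

type_synonym ('m, 't) multiop = "('m \<Rightarrow> 't) list \<Rightarrow> ('m \<Rightarrow> 't)"

text \<open>Order at most one in the usual algebraic sense: the double commutator of \<open>D\<close> with
  multiplication by \<open>f\<close> and by \<open>g\<close> vanishes (written without subtraction).\<close>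

definition first_order_op ::
  "('m, 'a::real_normed_vector) atlas \<Rightarrow> ('t, 'm, real) vbundle \<Rightarrow> (('m \<Rightarrow> 't) \<Rightarrow> ('m \<Rightarrow> 't)) \<Rightarrow> bool" where
  "first_order_op A L D \<longleftrightarrow>
     (\<forall>lam\<in>sections A L. D lam \<in> sections A L) \<and>
     (\<forall>lam\<in>sections A L. \<forall>\<mu>\<in>sections A L. D (add_sec L lam \<mu>) = add_sec L (D lam) (D \<mu>)) \<and>
     (\<forall>c. \<forall>lam\<in>sections A L. D (mult_sec L (\<lambda>_. c) lam) = mult_sec L (\<lambda>_. c) (D lam)) \<and>
     (\<forall>f\<in>Cinf A. \<forall>g\<in>Cinf A. \<forall>lam\<in>sections A L.
        add_sec L (D (mult_sec L (\<lambda>z. f z * g z) lam)) (mult_sec L (\<lambda>z. f z * g z) (D lam)) =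
        add_sec L (mult_sec L f (D (mult_sec L g lam))) (mult_sec L g (D (mult_sec L f lam))))"

text \<open>Membership in \<open>\<D>\<^sup>k L\<close>.\<close>

definition multi_diffop ::
  "('m, 'a::real_normed_vector) atlas \<Rightarrow> ('t, 'm, real) vbundle \<Rightarrow> nat \<Rightarrow> ('m, 't) multiop \<Rightarrow> bool" where
  "multi_diffop A L k Q \<longleftrightarrow>
     (\<forall>lams. set lams \<subseteq> sections A L \<and> length lams = k \<longrightarrow>
        Q lams \<in> sections A L \<and>
        (\<forall>i<k. first_order_op A L (\<lambda>\<mu>. Q (lams[i := \<mu>]))) \<and>
        (\<forall>i<k. \<forall>j<k. i \<noteq> j \<and> lams ! i = lams ! j \<longrightarrow> Q lams = zero_vec L))"

text \<open>The unshuffles \<open>S\<^bsub>q,r\<^esub>\<close>, as permutations of \<open>{0,\<dots>,q+r-1}\<close>.\<close>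

definition unshuffles :: "nat \<Rightarrow> nat \<Rightarrow> (nat \<Rightarrow> nat) set" where
  "unshuffles q r = {\<tau>. \<tau> permutes {..<q + r} \<and>
     strict_mono_on {..<q} \<tau> \<and> strict_mono_on {q..<q + r} \<tau>}"

text \<open>Here \<open>p\<close> and \<open>q\<close> are the numbers of entries of the operators, so in the notation
  \<open>\<box> \<in> \<D>\<^bsup>k+1\<^esup>L\<close>, \<open>\<box>' \<in> \<D>\<^bsup>k'+1\<^esup>L\<close> one has \<open>k = p - 1\<close> and \<open>k' = q - 1\<close>. A section (\<open>p = 0\<close>) has no
  entry to insert into.\<close>

definition comp_op ::
  "('t, 'm, real) vbundle \<Rightarrow> nat \<Rightarrow> nat \<Rightarrow> ('m, 't) multiop \<Rightarrow> ('m, 't) multiop \<Rightarrow> ('m, 't) multiop" where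
  "comp_op L p q Q R lams =
     (if p = 0 then zero_vec L
      else sum_sec L (unshuffles q (p - 1)) (\<lambda>\<tau>.
        mult_sec L (\<lambda>_. of_int (sign \<tau>))
          (Q (R (map (\<lambda>i. lams ! \<tau> i) [0..<q]) # map (\<lambda>i. lams ! \<tau> i) [q..<q + (p - 1)]))))"

definition SJ_bracket ::
  "('t, 'm, real) vbundle \<Rightarrow> nat \<Rightarrow> nat \<Rightarrow> ('m, 't) multiop \<Rightarrow> ('m, 't) multiop \<Rightarrow> ('m, 't) multiop" where
  "SJ_bracket L p q Q R lams =
     add_sec L
       (mult_sec L (\<lambda>_. if even ((int p - 1) * (int q - 1)) then 1 else - 1) (comp_op L p q Q R lams))
       (mult_sec L (\<lambda>_. - 1) (comp_op L q p R Q lams))"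


section \<open>Jets, co-symbol, symbol\<close>

text \<open>First jets at \<open>y\<close> as equivalence classes of sections.\<close>

definition jet ::
  "('m, 'a::real_normed_vector) atlas \<Rightarrow> ('t, 'm, real) vbundle \<Rightarrow> 'm \<Rightarrow> ('m \<Rightarrow> 't) \<Rightarrow> ('m \<Rightarrow> 't) set" where
  "jet A L y lam = {\<mu> \<in> sections A L. \<forall>(U, \<phi>)\<in>A. \<forall>(V, \<Psi>)\<in>triv L. y \<in> U \<inter> V \<longrightarrow>
     \<Psi> (\<mu> y) = \<Psi> (lam y) \<and>
     ((\<lambda>z. \<Psi> (\<mu> (inv_into U \<phi> z)) - \<Psi> (lam (inv_into U \<phi> z))) has_derivative (\<lambda>_. 0)) (at (\<phi> y))}"

text \<open>The value at \<open>y\<close> of the \<open>L\<close>-valued form on \<open>J\<^sup>1L\<close> associated with \<open>Q\<close>: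
  \<open>(j\<^sup>1\<lambda>\<^sub>1,\<dots>,j\<^sup>1\<lambda>\<^sub>k) \<mapsto> Q(\<lambda>\<^sub>1,\<dots>,\<lambda>\<^sub>k)(y)\<close>.\<close>

definition jet_form ::
  "('m, 'a::real_normed_vector) atlas \<Rightarrow> ('t, 'm, real) vbundle \<Rightarrow> ('m, 't) multiop \<Rightarrow>
   'm \<Rightarrow> ('m \<Rightarrow> 't) set list \<Rightarrow> 't" where
  "jet_form A L Q y js =
     (THE w. \<forall>lams. set lams \<subseteq> sections A L \<and> js = map (jet A L y) lams \<longrightarrow> w = Q lams y)"

text \<open>\<open>T\<^sup>*\<^sub>yM \<otimes> L\<^sub>y\<close> is realized as \<open>Hom(T\<^sub>yM, L\<^sub>y)\<close>; the element \<open>d\<^sub>yf \<otimes> \<lambda>\<^sub>y\<close> is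
  \<open>v \<mapsto> v(f) \<lambda>(y)\<close>. Since \<open>L\<close> has rank one, every element is of this form.\<close>

type_synonym ('m, 't) cot = "(('m \<Rightarrow> real) \<Rightarrow> real) \<Rightarrow> 't"

definition cot_elem ::
  "('m, 'a::real_normed_vector) atlas \<Rightarrow> ('t, 'm, real) vbundle \<Rightarrow> 'm \<Rightarrow> ('m \<Rightarrow> real) \<Rightarrow> ('m \<Rightarrow> 't) \<Rightarrow>
   ('m, 't) cot" where
  "cot_elem A L y f lam = restrict (\<lambda>v. scale_vec L (v f) (lam y)) (tangent A y)"

definition cotangent_L ::
  "('m, 'a::real_normed_vector) atlas \<Rightarrow> ('t, 'm, real) vbundle \<Rightarrow> 'm \<Rightarrow> ('m, 't) cot set" where
  "cotangent_L A L y = {cot_elem A L y f lam | f lam. f \<in> Cinf A \<and> lam \<in> sections A L}"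

text \<open>The co-symbol \<open>\<gamma>(df \<otimes> \<lambda>) = j\<^sup>1(f\<lambda>) - f j\<^sup>1\<lambda>\<close>; at \<open>y\<close> the right-hand side is the jet of
  \<open>f\<lambda> - f(y)\<lambda>\<close>.\<close>

definition cosymbol ::
  "('m, 'a::real_normed_vector) atlas \<Rightarrow> ('t, 'm, real) vbundle \<Rightarrow> 'm \<Rightarrow> ('m, 't) cot \<Rightarrow> ('m \<Rightarrow> 't) set" where
  "cosymbol A L y \<eta> = (THE j. \<forall>f\<in>Cinf A. \<forall>lam\<in>sections A L. \<eta> = cot_elem A L y f lam \<longrightarrow>
     j = jet A L y (add_sec L (mult_sec L f lam) (mult_sec L (\<lambda>_. - f y) lam)))"

text \<open>\<open>Q \<circ> (\<gamma> \<wedge> \<dots> \<wedge> \<gamma>)\<close>, an \<open>L\<close>-valued form on \<open>T\<^sup>*M \<otimes> L\<close>.\<close>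

type_synonym ('m, 't) cot_form = "'m \<Rightarrow> ('m, 't) cot list \<Rightarrow> 't"

definition symbol_form ::
  "('m, 'a::real_normed_vector) atlas \<Rightarrow> ('t, 'm, real) vbundle \<Rightarrow> ('m, 't) multiop \<Rightarrow> ('m, 't) cot_form" where
  "symbol_form A L Q y \<eta>s = jet_form A L Q y (map (cosymbol A L y) \<eta>s)"

text \<open>The symbol of a derivation \<open>D\<close>, from \<open>D(f\<mu>) = \<sigma>(D)(f)\<mu> + f D\<mu>\<close>.\<close>

definition symbol ::
  "('m, 'a::real_normed_vector) atlas \<Rightarrow> ('t, 'm, real) vbundle \<Rightarrow> (('m \<Rightarrow> 't) \<Rightarrow> ('m \<Rightarrow> 't)) \<Rightarrow>
   ('m \<Rightarrow> real) \<Rightarrow> 'm \<Rightarrow> real" where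
  "symbol A L D f y = (THE c. \<forall>\<mu>\<in>sections A L.
     D (mult_sec L f \<mu>) y = add_vec L (scale_vec L c (\<mu> y)) (scale_vec L (f y) (D \<mu> y)))"


section \<open>Jacobi manifolds and coisotropic submanifolds\<close>

type_synonym ('m, 't) sec_bracket = "('m \<Rightarrow> 't) \<Rightarrow> ('m \<Rightarrow> 't) \<Rightarrow> ('m \<Rightarrow> 't)"

definition bracket_op :: "('m, 't) sec_bracket \<Rightarrow> ('m, 't) multiop" where
  "bracket_op br lams = br (lams ! 0) (lams ! 1)"

definition jacobi_manifold ::
  "('m::topological_space, 'a::real_inner) atlas \<Rightarrow> ('t::topological_space, 'm, real) vbundle \<Rightarrow>
   ('m, 't) sec_bracket \<Rightarrow> bool" where
  "jacobi_manifold A L br \<longleftrightarrow>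
     smooth_manifold A \<and> line_bundle A L \<and>
     multi_diffop A L 2 (bracket_op br) \<and>
     (\<forall>lam\<in>sections A L. \<forall>\<mu>\<in>sections A L. \<forall>\<nu>\<in>sections A L.
        add_sec L (br lam (br \<mu> \<nu>)) (add_sec L (br \<mu> (br \<nu> lam)) (br \<nu> (br lam \<mu>))) = zero_vec L)"

definition bisymbol ::
  "('m, 'a::real_normed_vector) atlas \<Rightarrow> ('t, 'm, real) vbundle \<Rightarrow> ('m, 't) sec_bracket \<Rightarrow>
   ('m, 't) cot_form" where
  "bisymbol A L br = symbol_form A L (bracket_op br)"

text \<open>\<open>\<Lambda>\<^sub>J\<^sup>#(d\<^sub>yf \<otimes> \<lambda>\<^sub>y) = (X\<^bsub>f\<lambda>\<^esub> - f X\<^sub>\<lambda>)\<^sub>y\<close>, where \<open>X\<^sub>\<lambda>\<close> is the symbol of \<open>{\<lambda>,-}\<close>.\<close>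

definition bisymbol_sharp ::
  "('m, 'a::real_normed_vector) atlas \<Rightarrow> ('t, 'm, real) vbundle \<Rightarrow> ('m, 't) sec_bracket \<Rightarrow>
   'm \<Rightarrow> ('m \<Rightarrow> real) \<Rightarrow> ('m \<Rightarrow> 't) \<Rightarrow> (('m \<Rightarrow> real) \<Rightarrow> real)" where
  "bisymbol_sharp A L br y f lam =
     restrict (\<lambda>g. symbol A L (br (mult_sec L f lam)) g y - f y * symbol A L (br lam) g y) (Cinf A)"

text \<open>The submanifold is the image of an embedding \<open>\<iota>\<close> of the manifold with atlas \<open>A\<^sub>S\<close>, with
  tangent space \<open>d\<iota>(T\<^sub>xS)\<close> at \<open>\<iota> x\<close>.\<close>

definition sub_tangent ::
  "('s, 'b::real_normed_vector) atlas \<Rightarrow> ('m, 'a::real_normed_vector) atlas \<Rightarrow> ('s \<Rightarrow> 'm) \<Rightarrow> 's \<Rightarrow>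
   (('m \<Rightarrow> real) \<Rightarrow> real) set" where
  "sub_tangent A\<^sub>S A \<iota> x = push_tan A \<iota> ` tangent A\<^sub>S x"

definition coisotropic ::
  "('s, 'b::real_normed_vector) atlas \<Rightarrow> ('m, 'a::real_normed_vector) atlas \<Rightarrow> ('s \<Rightarrow> 'm) \<Rightarrow>
   ('t, 'm, real) vbundle \<Rightarrow> ('m, 't) sec_bracket \<Rightarrow> bool" where
  "coisotropic A\<^sub>S A \<iota> L br \<longleftrightarrow>
     (\<forall>x. \<forall>f\<in>Cinf A. \<forall>lam\<in>sections A L. (\<forall>v\<in>sub_tangent A\<^sub>S A \<iota> x. v f = 0) \<longrightarrow>
        bisymbol_sharp A L br (\<iota> x) f lam \<in> sub_tangent A\<^sub>S A \<iota> x)"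


section \<open>Push-forward along line bundle automorphisms\<close>

text \<open>A line bundle automorphism is a pair of bijections \<open>(\<phi>, \<Phi>)\<close>, with \<open>\<Phi>\<close> covering \<open>\<phi>\<close>.
  Sections are pulled back by \<open>\<lambda> \<mapsto> \<Phi>\<^sup>-\<^sup>1 \<circ> \<lambda> \<circ> \<phi>\<close>.\<close>

definition push_op ::
  "('t, 'm, real) vbundle \<Rightarrow> ('m \<Rightarrow> 'm) \<times> ('t \<Rightarrow> 't) \<Rightarrow> ('m, 't) multiop \<Rightarrow> ('m, 't) multiop" where
  "push_op L \<equiv> \<lambda>(\<phi>, \<Phi>) Q lams y.
     \<Phi> (Q (map (\<lambda>lam z. inv_into (tot L) \<Phi> (lam (\<phi> z))) lams) (inv \<phi> y))"

definition push_form ::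
  "('m, 'a::real_normed_vector) atlas \<Rightarrow> ('t, 'm, real) vbundle \<Rightarrow> ('m \<Rightarrow> 'm) \<times> ('t \<Rightarrow> 't) \<Rightarrow>
   ('m, 't) cot_form \<Rightarrow> ('m, 't) cot_form" where
  "push_form A L \<equiv> \<lambda>(\<phi>, \<Phi>) \<Theta> y \<eta>s.
     \<Phi> (\<Theta> (inv \<phi> y)
        (map (\<lambda>\<eta>. restrict (\<lambda>v. inv_into (tot L) \<Phi> (\<eta> (push_tan A \<phi> v))) (tangent A (inv \<phi> y))) \<eta>s))"


section \<open>Normal data\<close>

text \<open>
  From here on, \<open>E\<close> plays the role of \<open>NS\<close>, with \<open>S\<close> embedded as the zero section (whose normal
  bundle in the total space of \<open>E\<close> is canonically \<open>E\<close>), and \<open>L = pullback E ell\<close>; the ambient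
  manifold is \<open>E\<close> with atlas \<open>total_atlas A E\<close>. The fibre of \<open>L\<close> over the zero of \<open>E\<^sub>x\<close> is
  identified with the fibre of \<open>ell\<close> over \<open>x\<close> by \<^const>\<open>snd\<close>.
\<close>

text \<open>The fibre of \<open>N\<^sup>*S \<otimes> ell\<close> over \<open>x\<close>.\<close>

definition conormal ::
  "('s, 'b::real_normed_vector) atlas \<Rightarrow> ('e, 's, 'f::real_normed_vector) vbundle \<Rightarrow> ('l, 's, real) vbundle \<Rightarrow>
   's \<Rightarrow> ('e, 'e \<times> 'l) cot set" where
  "conormal A E ell x =
     {\<eta> \<in> cotangent_L (total_atlas A E) (pullback E ell) (zero_vec E x).
        \<forall>v\<in>sub_tangent A (total_atlas A E) (zero_vec E) x.
          \<eta> v = zero_vec (pullback E ell) (zero_vec E x)}"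

text \<open>The map \<open>P\<close> on forms on \<open>T\<^sup>*M \<otimes> L\<close> and on multi-differential operators. The results are
  \<open>ell\<close>-valued forms on \<open>N\<^sup>*S \<otimes> ell\<close>: only arguments from \<open>conormal A E ell x\<close> matter.\<close>

definition P_form ::
  "('e, 's, 'f::real_normed_vector) vbundle \<Rightarrow> ('e, 'e \<times> 'l) cot_form \<Rightarrow>
   's \<Rightarrow> ('e, 'e \<times> 'l) cot list \<Rightarrow> 'l" where
  "P_form E \<Theta> x \<eta>s = snd (\<Theta> (zero_vec E x) \<eta>s)"

definition P_op ::
  "('s, 'b::real_normed_vector) atlas \<Rightarrow> ('e, 's, 'f::real_normed_vector) vbundle \<Rightarrow> ('l, 's, real) vbundle \<Rightarrow>
   ('e, 'e \<times> 'l) multiop \<Rightarrow> 's \<Rightarrow> ('e, 'e \<times> 'l) cot list \<Rightarrow> 'l" where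
  "P_op A E ell Q = P_form E (symbol_form (total_atlas A E) (pullback E ell) Q)"

text \<open>\<open>I(\<nu>)\<close>: a section of \<open>L\<close> restricts on the fibre \<open>E\<^sub>x\<close> to a function with values in the fixed
  vector space \<open>ell\<^sub>x\<close>, and the flat connection for which all \<open>\<pi>\<^sup>*\<kappa>\<close> are parallel differentiates
  this function, here in direction \<open>\<nu>(x)\<close>.\<close>

definition I_op ::
  "('e, 's, 'f::real_vector) vbundle \<Rightarrow> ('l, 's, real) vbundle \<Rightarrow> ('s \<Rightarrow> 'e) \<Rightarrow>
   ('e \<Rightarrow> 'e \<times> 'l) \<Rightarrow> ('e \<Rightarrow> 'e \<times> 'l)" where
  "I_op E ell \<nu> lam = (\<lambda>e. (e, the_vec ell (prj E e) (\<lambda>\<Psi>.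
     vector_derivative (\<lambda>t. \<Psi> (snd (lam (add_vec E e (scale_vec E t (\<nu> (prj E e))))))) (at 0))))"

definition exp_I :: "('e, 's, 'f::real_vector) vbundle \<Rightarrow> ('s \<Rightarrow> 'e) \<Rightarrow> ('e \<Rightarrow> 'e) \<times> ('e \<times> 'l \<Rightarrow> 'e \<times> 'l)" where
  "exp_I E s = (\<lambda>e. add_vec E e (s (prj E e)), \<lambda>(e, l). (add_vec E e (s (prj E e)), l))"

text \<open>The multibrackets \<open>m\<^sub>k(\<xi>\<^sub>1,\<dots>,\<xi>\<^sub>k)\<close> for \<open>\<xi>\<^sub>1,\<dots>,\<xi>\<^sub>k \<in> \<Gamma>(NS)\<close>, the only arguments entering the
  Maurer-Cartan series. Each \<open>I(\<xi>\<^sub>i)\<close> has one entry, so all iterated brackets have two.\<close>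

definition multibracket ::
  "('s, 'b::real_normed_vector) atlas \<Rightarrow> ('e, 's, 'f::real_normed_vector) vbundle \<Rightarrow> ('l, 's, real) vbundle \<Rightarrow>
   ('e, 'e \<times> 'l) sec_bracket \<Rightarrow> ('s \<Rightarrow> 'e) list \<Rightarrow> 's \<Rightarrow> ('e, 'e \<times> 'l) cot list \<Rightarrow> 'l" where
  "multibracket A E ell br \<xi>s =
     P_op A E ell
       (foldl (\<lambda>Q \<xi>. SJ_bracket (pullback E ell) 2 1 Q (\<lambda>lams. I_op E ell \<xi> (lams ! 0)))
          (bracket_op br) \<xi>s)"

text \<open>Point-wise convergence of \<open>MC(\<xi>) = \<Sum>\<^bsub>k\<ge>1\<^esub> m\<^sub>k(\<xi>,\<dots>,\<xi>)/k!\<close> to \<open>\<Omega>\<close>, as \<open>ell\<close>-valued 2-forms on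
  \<open>N\<^sup>*S \<otimes> ell\<close>. The summation index is shifted by one.\<close>

definition MC_converges_to ::
  "('s, 'b::real_normed_vector) atlas \<Rightarrow> ('e, 's, 'f::real_normed_vector) vbundle \<Rightarrow> ('l, 's, real) vbundle \<Rightarrow>
   ('e, 'e \<times> 'l) sec_bracket \<Rightarrow> ('s \<Rightarrow> 'e) \<Rightarrow>
   ('s \<Rightarrow> ('e, 'e \<times> 'l) cot list \<Rightarrow> 'l) \<Rightarrow> bool" where
  "MC_converges_to A E ell br \<xi> \<Omega> \<longleftrightarrow>
     (\<forall>x. \<forall>\<eta>\<^sub>1\<in>conormal A E ell x. \<forall>\<eta>\<^sub>2\<in>conormal A E ell x. \<forall>(W, \<Psi>)\<in>triv ell. x \<in> W \<longrightarrow>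
        (\<lambda>k. \<Psi> (multibracket A E ell br (replicate (Suc k) \<xi>) x [\<eta>\<^sub>1, \<eta>\<^sub>2]) / fact (Suc k))
          sums \<Psi> (\<Omega> x [\<eta>\<^sub>1, \<eta>\<^sub>2]))"


section \<open>Fiber-wise entire bi-symbols\<close>

text \<open>The Taylor series at the origin in coordinate-free form,
  \<open>h(u) = \<Sum>\<^sub>k D\<^sup>kh(0)(u,\<dots>,u)/k!\<close>, the \<open>k\<close>-th derivative being iterated from directional ones.\<close>

definition dir_deriv :: "'f::real_normed_vector \<Rightarrow> ('f \<Rightarrow> real) \<Rightarrow> ('f \<Rightarrow> real)" where
  "dir_deriv u h = (\<lambda>p. frechet_derivative h (at p) u)"

definition entire :: "('f::real_normed_vector \<Rightarrow> real) \<Rightarrow> bool" where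
  "entire h \<longleftrightarrow> (\<forall>u. (\<lambda>k. (dir_deriv u ^^ k) h 0 / fact k) sums h u)"

definition entire_on_fibre ::
  "('e, 's, 'f::real_normed_vector) vbundle \<Rightarrow> 's \<Rightarrow> ('e \<Rightarrow> real) \<Rightarrow> bool" where
  "entire_on_fibre E x h \<longleftrightarrow> (\<forall>(V, \<Phi>)\<in>triv E. x \<in> V \<longrightarrow>
     entire (\<lambda>u. h (THE e. e \<in> tot E \<and> prj E e = x \<and> \<Phi> e = u)))"

text \<open>
  Vector bundle coordinates on \<open>E\<close> are the linear coordinates of \<open>e \<mapsto> (\<phi>(\<pi> e), \<Phi> e)\<close>. As cotangent
  vectors are differentials of global functions, the components over a small \<open>N \<subseteq> S\<close> are taken
  with respect to global functions \<open>f\<close>, \<open>g\<close> that coincide with coordinates on \<open>\<pi>\<^sup>-\<^sup>1(N)\<close>, and a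
  global \<open>\<kappa> \<in> \<Gamma>(ell)\<close> that coincides with the local generator of the trivialization \<open>\<Psi>\<close> on \<open>N\<close>.
\<close>

definition fiberwise_entire ::
  "('s::topological_space, 'b::real_normed_vector) atlas \<Rightarrow> ('e, 's, 'f::real_normed_vector) vbundle \<Rightarrow>
   ('l, 's, real) vbundle \<Rightarrow> ('e, 'e \<times> 'l) cot_form \<Rightarrow> bool" where
  "fiberwise_entire A E ell \<Theta> \<longleftrightarrow>
     (\<forall>(U, \<phi>)\<in>A. \<forall>(V, \<Phi>)\<in>triv E. \<forall>(W, \<Psi>)\<in>triv ell. \<forall>N. open N \<and> N \<subseteq> U \<inter> V \<inter> W \<longrightarrow>
       (\<forall>(\<alpha> :: 'b \<times> 'f \<Rightarrow> real) \<beta>. \<forall>f\<in>Cinf (total_atlas A E). \<forall>g\<in>Cinf (total_atlas A E).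
        \<forall>\<kappa>\<in>sections A ell.
          linear \<alpha> \<and> linear \<beta> \<and>
          (\<forall>e. prj E e \<in> N \<longrightarrow> f e = \<alpha> (\<phi> (prj E e), \<Phi> e) \<and> g e = \<beta> (\<phi> (prj E e), \<Phi> e)) \<and>
          (\<forall>y\<in>N. \<Psi> (\<kappa> y) = 1) \<longrightarrow>
          (\<forall>x\<in>N. entire_on_fibre E x (\<lambda>e. \<Psi> (snd (\<Theta> e
             [cot_elem (total_atlas A E) (pullback E ell) e f (pullback_sec E \<kappa>),
              cot_elem (total_atlas A E) (pullback E ell) e g (pullback_sec E \<kappa>)]))))))"

end

theory Submission
  imports Defs
begin

text \<open>
  Near a point \<open>x\<close> of \<open>S\<close>, conormal elements are represented by sections \<open>a = f \<kappa>\<close>, \<open>b = g \<kappa>\<close> with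
  \<open>f\<close>, \<open>g\<close> fiberwise linear and \<open>\<kappa>\<close> fiberwise constant. For the derivation \<open>D = I(s)\<close> one has
  \<open>D\<^sup>2 a = D\<^sup>2 b = 0\<close>, so that the iterated brackets of \<open>J\<close> with \<open>- D\<close>, evaluated on \<open>a\<close>, \<open>b\<close> at the
  zero of \<open>E\<^sub>x\<close>, are the derivatives at \<open>0\<close> of
  \<open>G(t) = {a - t Da, b - t Db}(t s(x)) = \<Lambda>(df - t d(Df), dg - t d(Dg))(t s(x))\<close>,
  where \<open>Df\<close>, \<open>Dg\<close> are functions on \<open>S\<close>. As \<open>G(1)\<close> is the value of \<open>P(exp I(-s)\<^sub>* J)\<close> and \<open>G(0) = 0\<close> by
  coisotropy, convergence of the Maurer-Cartan series means that the Taylor series of \<open>G\<close> at \<open>0\<close> sums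
  to \<open>G\<close> at \<open>1\<close>. Now \<open>G\<close> is a quadratic polynomial in \<open>t\<close> whose coefficients are components of \<open>\<Lambda>\<close>
  along the ray of \<open>s(x)\<close>, which gives one direction. Conversely, the value and the differential of \<open>s\<close>
  at \<open>x\<close> are arbitrary: vanishing, rank one and rank two differentials isolate the vertical, mixed and
  horizontal components, the last two if the fibres have dimension at least two.

  That operators and forms are determined by jets rests on Hadamard's lemma.
\<close>

section \<open>Finite-dimensional inner product spaces\<close>

text \<open>The equivalence carries a condition on dimensions for a reason. On a normal bundle of
  rank one all 2-forms on conormal covectors vanish, so every Maurer-Cartan series converges
  trivially; yet for {x, y} = f(y) on the plane, with S the line y = 0, the mixed component f is an
  arbitrary smooth function. Over a base of dimension 0 there are no mixed or horizontal components
  to control. The Maurer-Cartan condition sees the components of \<Lambda> only through combinations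
  p(t) - t q(t) + t^2 w(t). They can be separated because being the sum of its Taylor series at 1 is
  a linear condition, and because t q(t) satisfies it if and only if q does: a factor t shifts the
  index by one and equals 1 at the point of evaluation. The single time 1 suffices since s(x) runs
  through the whole fibre. The signs fit together as follows. Push-forward along exp I(-s) evaluates
  at s(x) and pulls sections back along -s, which replaces f by f - Df; and the bracket with an
  operator is minus the Lie derivative along it, so that bracketing with -D is Lie derivation along
  D.\<close>

lemma finite_dim_orthonormal_basis:
  assumes "finite_dim TYPE('a::real_inner)"
  obtains B :: "'a::real_inner set" where "finite B" "\<And>b. b \<in> B \<Longrightarrow> norm b = 1"
    "\<And>b c. b \<in> B \<Longrightarrow> c \<in> B \<Longrightarrow> b \<noteq> c \<Longrightarrow> b \<bullet> c = 0"
    "\<And>x. x = (\<Sum>b\<in>B. (x \<bullet> b) *\<^sub>R b)"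
proof -
  obtain S :: "'a set" where S: "finite S" "span S = UNIV"
    using assms unfolding finite_dim_def by blast
  obtain C :: "'a set" where C: "finite C" "span C = UNIV" "pairwise orthogonal C"
    using basis_orthogonal[OF S(1)] S(2) by blast
  \<comment> \<open>\<open>basis_orthogonal\<close> may leave 0 in the set, which cannot be
    normalized. In dimension 0 this makes \<open>B\<close> empty.\<close>
  define B where "B = (\<lambda>c. c /\<^sub>R norm c) ` (C - {0})"
  have fB: "finite B" using C(1) by (simp add: B_def)
  have nB: "norm b = 1" if "b \<in> B" for b using that by (auto simp: B_def) (metis left_inverse norm_eq_zero)
  have oB: "b \<bullet> c = 0" if "b \<in> B" "c \<in> B" "b \<noteq> c" for b c
    using that C(3) by (auto simp: B_def pairwise_def orthogonal_def) metis
  have "C \<subseteq> span B"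
  proof
    fix c assume "c \<in> C"
    show "c \<in> span B"
    proof (cases "c = 0")
      case False
      then have "c /\<^sub>R norm c \<in> B" using \<open>c \<in> C\<close> by (auto simp: B_def)
      then have "norm c *\<^sub>R (c /\<^sub>R norm c) \<in> span B" by (intro span_scale span_base)
      then show ?thesis using False by simp
    qed (simp add: span_zero)
  qed
  then have spB: "span B = UNIV" using C(2) by (metis span_mono span_span top.extremum_uniqueI)
  have "x = (\<Sum>b\<in>B. (x \<bullet> b) *\<^sub>R b)" for x
  proof -
    have "x \<in> span B" using spB by simp
    then obtain u where u: "x = (\<Sum>b\<in>B. u b *\<^sub>R b)" using span_finite[OF fB] by auto
    have "x \<bullet> c = u c" if "c \<in> B" for c
    proof -
      have "x \<bullet> c = (\<Sum>b\<in>B. u b * (b \<bullet> c))" unfolding u by (simp add: inner_sum_left)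
      also have "\<dots> = (\<Sum>b\<in>B. if b = c then u c else 0)"
        using that oB nB by (intro sum.cong) (auto simp: dot_square_norm)
      finally show ?thesis using fB that by simp
    qed
    then show ?thesis by (subst u) (intro sum.cong, auto)
  qed
  then show thesis using that fB nB oB by blast
qed

lemma finite_dim_bounded_linear:
  fixes f :: "'a::real_inner \<Rightarrow> 'c::real_normed_vector"
  assumes "finite_dim TYPE('a)" "linear f"
  shows "bounded_linear f"
proof -
  obtain B :: "'a set" where B: "finite B" "\<And>x. x = (\<Sum>b\<in>B. (x \<bullet> b) *\<^sub>R b)"
    using finite_dim_orthonormal_basis[OF assms(1)] by metis
  have "f x = (\<Sum>b\<in>B. (x \<bullet> b) *\<^sub>R f b)" for x
    using arg_cong[OF B(2)[of x], of f] by (simp only: linear_sum[OF assms(2)] linear_cmul[OF assms(2)])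
  then have "f = (\<lambda>x. \<Sum>b\<in>B. (x \<bullet> b) *\<^sub>R f b)" by (rule ext)
  moreover have "bounded_linear (\<lambda>x. \<Sum>b\<in>B. (x \<bullet> b) *\<^sub>R f b)"
    by (intro bounded_linear_sum bounded_linear_compose[OF bounded_linear_scaleR_left bounded_linear_inner_left])
  ultimately show ?thesis by (metis (no_types, lifting))
qed

text \<open>The ball is a closed subset of the vectors with all coordinates in
  \<open>{-r..r}\<close>, and these form an iterated Minkowski sum of segments, compact by
  \<open>compact_sums\<close>.\<close>

lemma finite_dim_compact_cball:
  assumes "finite_dim TYPE('a::real_inner)"
  shows "compact (cball (a::'a) r)"
proof -
  obtain B :: "'a set" where B: "finite B" "\<And>b. b \<in> B \<Longrightarrow> norm b = 1" "\<And>x. x = (\<Sum>b\<in>B. (x \<bullet> b) *\<^sub>R b)"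
    using finite_dim_orthonormal_basis[OF assms(1)] by metis
  define K where "K C = {(\<Sum>b\<in>C. c b *\<^sub>R b) | c. \<forall>b\<in>C. c b \<in> {-r..r}}" for C :: "'a set"
  have K: "compact (K C)" if "finite C" for C
    using that
  proof induction
    case empty
    then show ?case by (simp add: K_def)
  next
    case (insert x C)
    have "K (insert x C) = {p + q | p q. p \<in> (\<lambda>t. t *\<^sub>R x) ` {-r..r} \<and> q \<in> K C}" (is "_ = ?R")
    proof
      show "K (insert x C) \<subseteq> ?R"
      proof
        fix z assume "z \<in> K (insert x C)"
        then obtain c where "\<forall>b\<in>insert x C. c b \<in> {-r..r}" "z = (\<Sum>b\<in>insert x C. c b *\<^sub>R b)"
          unfolding K_def by blast
        then have "c x *\<^sub>R x \<in> (\<lambda>t. t *\<^sub>R x) ` {-r..r}" "(\<Sum>b\<in>C. c b *\<^sub>R b) \<in> K C"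
          "z = c x *\<^sub>R x + (\<Sum>b\<in>C. c b *\<^sub>R b)"
          using insert(1,2) unfolding K_def by (blast, blast, simp)
        then show "z \<in> ?R" by blast
      qed
      show "?R \<subseteq> K (insert x C)"
      proof
        fix z assume "z \<in> ?R"
        then obtain t c where t: "t \<in> {-r..r}" "\<forall>b\<in>C. c b \<in> {-r..r}" "z = t *\<^sub>R x + (\<Sum>b\<in>C. c b *\<^sub>R b)"
          unfolding K_def by blast
        have "(\<Sum>b\<in>C. c b *\<^sub>R b) = (\<Sum>b\<in>C. (c(x:=t)) b *\<^sub>R b)" using insert(2) by (intro sum.cong) auto
        then have "z = (\<Sum>b\<in>insert x C. (c(x:=t)) b *\<^sub>R b)" using t insert(1,2) by simp
        moreover have "\<forall>b\<in>insert x C. (c(x:=t)) b \<in> {-r..r}" using t by auto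
        ultimately show "z \<in> K (insert x C)" unfolding K_def by blast
      qed
    qed
    moreover have "compact ((\<lambda>t. t *\<^sub>R x) ` {-r..r})"
      by (intro compact_continuous_image continuous_intros compact_Icc)
    ultimately show ?case using compact_sums[OF _ insert.IH] by auto
  qed
  have "cball 0 r \<subseteq> K B"
  proof
    fix x :: 'a assume "x \<in> cball 0 r"
    then have "norm x \<le> r" by simp
    then have "\<bar>x \<bullet> b\<bar> \<le> r" if "b \<in> B" for b
      using Cauchy_Schwarz_ineq2[of x b] B(2)[OF that] by simp
    then have "\<forall>b\<in>B. x \<bullet> b \<in> {-r..r}" by fastforce
    then show "x \<in> K B" unfolding K_def using B(3)[of x] by blast
  qed
  then have "compact (cball (0::'a) r)"
    using compact_Int_closed[OF K[OF B(1)] closed_cball[of 0 r]] by (simp add: inf.absorb2)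
  then have "compact ((+) a ` cball (0::'a) r)" by (rule compact_translation)
  then show ?thesis by (simp add: )
qed


section \<open>Functions of class \<open>C\<^sup>k\<close>\<close>

lemma Ck_on_subset: "Ck_on k U f \<Longrightarrow> V \<subseteq> U \<Longrightarrow> Ck_on k V f"
proof (induction k arbitrary: f)
  case (Suc k)
  then obtain f' where "\<forall>x\<in>U. (f has_derivative f' x) (at x)" "\<forall>v. Ck_on k U (\<lambda>x. f' x v)"
    by auto
  then show ?case using Suc.IH Suc.prems(2) by (auto intro!: exI[of _ f'])
qed (auto intro: continuous_on_subset)

lemma Ck_on_SucD: "Ck_on (Suc k) U f \<Longrightarrow> Ck_on k U f"
proof (induction k arbitrary: f)
  case 0
  then show ?case
    by (auto intro!: continuous_at_imp_continuous_on dest: has_derivative_continuous)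
next
  case (Suc k)
  then show ?case by (metis Ck_on.simps(2))
qed

lemma Ck_on_continuous_on: "Ck_on k U f \<Longrightarrow> continuous_on U f"
  by (induction k) (auto dest: Ck_on_SucD simp del: Ck_on.simps(2))

text \<open>Derivatives are taken at \<open>x\<close> in the whole space and not within
  \<open>U\<close>; agreement on \<open>U\<close> transports them because \<open>U\<close> is
  open.\<close>

lemma Ck_on_cong:
  assumes "open U" "\<And>x. x \<in> U \<Longrightarrow> f x = g x" "Ck_on k U f"
  shows "Ck_on k U g"
proof (cases k)
  case 0
  then show ?thesis using assms by (simp cong: continuous_on_cong)
next
  case (Suc l)
  then obtain f' where "\<forall>x\<in>U. (f has_derivative f' x) (at x)" "\<forall>v. Ck_on l U (\<lambda>x. f' x v)"
    using assms(3) by auto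
  moreover have "(g has_derivative f' x) (at x)" if "x \<in> U" for x
    using has_derivative_transform_within_open[of f "f' x" x UNIV U g] calculation assms that by simp
  ultimately show ?thesis using Suc by auto
qed

lemma Ck_on_local:
  assumes "\<And>x. x \<in> U \<Longrightarrow> \<exists>V. open V \<and> x \<in> V \<and> Ck_on k V f"
  shows "Ck_on k U f"
  using assms
proof (induction k arbitrary: f)
  case 0
  then show ?case
    by (auto intro!: continuous_at_imp_continuous_on) (metis continuous_on_eq_continuous_at)
next
  case (Suc k)
  have D: "\<exists>D. (f has_derivative D) (at x)" if "x \<in> U" for x
    using Suc.prems[OF that] by auto
  \<comment> \<open>Derivatives at a point are unique, so this one choice agrees with the derivative
    supplied by each neighbourhood.\<close>
  define f' where "f' x = (SOME D. (f has_derivative D) (at x))" for x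
  have f': "(f has_derivative f' x) (at x)" if "\<exists>D. (f has_derivative D) (at x)" for x
    using someI_ex[OF that] by (simp add: f'_def)
  have "Ck_on k U (\<lambda>x. f' x v)" for v
  proof (rule Suc.IH)
    fix x assume "x \<in> U"
    then obtain V where V: "open V" "x \<in> V" "Ck_on (Suc k) V f" using Suc.prems by blast
    then obtain g where g: "\<forall>x\<in>V. (f has_derivative g x) (at x)" "\<forall>v. Ck_on k V (\<lambda>x. g x v)" by auto
    have "g y = f' y" if "y \<in> V" for y
      using has_derivative_unique g(1) f' that by blast
    then have "Ck_on k V (\<lambda>x. f' x v)"
      using Ck_on_cong[OF V(1) _ g(2)[rule_format, of v]] by simp
    then show "\<exists>V. open V \<and> x \<in> V \<and> Ck_on k V (\<lambda>x. f' x v)" using V by blast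
  qed
  then show ?case using f' D by (auto intro!: exI[of _ f'])
qed

lemma Ck_on_const: "Ck_on k U (\<lambda>x. c)"
proof (induction k arbitrary: c)
  case (Suc k)
  show ?case using Suc[of 0] by (auto intro!: exI[of _ "\<lambda>x v. 0"])
qed simp

lemma Ck_on_bounded_linear_compose:
  assumes "bounded_linear T"
  shows "Ck_on k U f \<Longrightarrow> Ck_on k U (\<lambda>x. T (f x))"
proof (induction k arbitrary: f)
  case 0
  then show ?case using bounded_linear.continuous_on[OF assms] by simp
next
  case (Suc k)
  then obtain f' where f': "\<forall>x\<in>U. (f has_derivative f' x) (at x)" "\<forall>v. Ck_on k U (\<lambda>x. f' x v)" by auto
  have "\<forall>x\<in>U. ((\<lambda>x. T (f x)) has_derivative (\<lambda>v. T (f' x v))) (at x)"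
    using bounded_linear.has_derivative[OF assms] f'(1) by blast
  then show ?case using f'(2) Suc.IH by (auto intro!: exI[of _ "\<lambda>x v. T (f' x v)"])
qed

lemma Ck_on_bounded_linear: "bounded_linear T \<Longrightarrow> Ck_on k U T"
proof (cases k)
  case 0
  assume "bounded_linear T" then show ?thesis using 0 by (simp add: linear_continuous_on)
next
  case (Suc l)
  assume "bounded_linear T"
  then show ?thesis using Suc Ck_on_const
    by (auto intro!: exI[of _ "\<lambda>x. T"] bounded_linear_imp_has_derivative)
qed

lemma Ck_on_ident: "Ck_on k U (\<lambda>x. x)"
  using Ck_on_bounded_linear[OF bounded_linear_ident] .

lemma Ck_on_add: "Ck_on k U f \<Longrightarrow> Ck_on k U g \<Longrightarrow> Ck_on k U (\<lambda>x. f x + g x)"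
proof (induction k arbitrary: f g)
  case 0
  then show ?case by (auto intro: continuous_intros)
next
  case (Suc k)
  then obtain f' g' where f': "\<forall>x\<in>U. (f has_derivative f' x) (at x)" "\<forall>v. Ck_on k U (\<lambda>x. f' x v)"
    and g': "\<forall>x\<in>U. (g has_derivative g' x) (at x)" "\<forall>v. Ck_on k U (\<lambda>x. g' x v)" by auto
  then have "\<forall>x\<in>U. ((\<lambda>x. f x + g x) has_derivative (\<lambda>v. f' x v + g' x v)) (at x)"
    by (auto intro: has_derivative_add)
  then show ?case using f' g' Suc.IH by (auto intro!: exI[of _ "\<lambda>x v. f' x v + g' x v"])
qed

lemma Ck_on_sum: "(\<And>i. i \<in> I \<Longrightarrow> Ck_on k U (f i)) \<Longrightarrow> Ck_on k U (\<lambda>x. \<Sum>i\<in>I. f i x)"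
  by (induction I rule: infinite_finite_induct) (auto intro: Ck_on_add Ck_on_const)

lemma Ck_on_bounded_bilinear:
  assumes b: "bounded_bilinear b"
  shows "Ck_on k U f \<Longrightarrow> Ck_on k U g \<Longrightarrow> Ck_on k U (\<lambda>x. b (f x) (g x))"
proof (induction k arbitrary: f g)
  case 0
  then show ?case using bounded_bilinear.continuous_on[OF b] by simp
next
  case (Suc k)
  then obtain f' g' where f': "\<forall>x\<in>U. (f has_derivative f' x) (at x)" "\<forall>v. Ck_on k U (\<lambda>x. f' x v)"
    and g': "\<forall>x\<in>U. (g has_derivative g' x) (at x)" "\<forall>v. Ck_on k U (\<lambda>x. g' x v)" by auto
  have "\<forall>x\<in>U. ((\<lambda>x. b (f x) (g x)) has_derivative (\<lambda>v. b (f x) (g' x v) + b (f' x v) (g x))) (at x)"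
    using f'(1) g'(1) by (auto intro: bounded_bilinear.FDERIV[OF b])
  moreover have "Ck_on k U (\<lambda>x. b (f x) (g' x v) + b (f' x v) (g x))" for v
    using f'(2) g'(2) Suc.prems[THEN Ck_on_SucD] by (intro Ck_on_add Suc.IH) auto
  ultimately show ?case by (auto intro!: exI[of _ "\<lambda>x v. b (f x) (g' x v) + b (f' x v) (g x)"])
qed

lemmas Ck_on_mult = Ck_on_bounded_bilinear[OF bounded_bilinear_mult]
lemmas Ck_on_scaleR = Ck_on_bounded_bilinear[OF bounded_bilinear_scaleR]
lemmas Ck_on_inner = Ck_on_bounded_bilinear[OF bounded_bilinear_inner]

lemma Ck_on_compose:
  fixes g :: "'a::real_normed_vector \<Rightarrow> 'c::real_inner"
  assumes fd: "finite_dim TYPE('c)"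
  shows "Ck_on k U g \<Longrightarrow> Ck_on k V f \<Longrightarrow> g ` U \<subseteq> V \<Longrightarrow> Ck_on k U (\<lambda>x. f (g x))"
proof (induction k arbitrary: f)
  case 0
  then show ?case using continuous_on_compose2 by auto
next
  case (Suc k)
  obtain B :: "'c set" where B: "finite B" "\<And>x. x = (\<Sum>b\<in>B. (x \<bullet> b) *\<^sub>R b)"
    using finite_dim_orthonormal_basis[OF fd] by metis
  obtain f' g' where f': "\<forall>x\<in>V. (f has_derivative f' x) (at x)" "\<forall>v. Ck_on k V (\<lambda>x. f' x v)"
    and g': "\<forall>x\<in>U. (g has_derivative g' x) (at x)" "\<forall>v. Ck_on k U (\<lambda>x. g' x v)"
    using Suc.prems(1,2) by auto
  have D: "((\<lambda>x. f (g x)) has_derivative (\<lambda>v. \<Sum>b\<in>B. (g' x v \<bullet> b) *\<^sub>R f' (g x) b)) (at x)" if "x \<in> U" for x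
  proof -
    have gx: "g x \<in> V" using that Suc.prems(3) by auto
    have "((\<lambda>x. f (g x)) has_derivative (\<lambda>v. f' (g x) (g' x v))) (at x)"
      using has_derivative_compose[of g "g' x" x UNIV f "f' (g x)"] f'(1) g'(1) gx that by auto
    moreover have lin: "linear (f' (g x))" using f'(1) gx has_derivative_linear by blast
    have "(\<lambda>v. f' (g x) (g' x v)) = (\<lambda>v. \<Sum>b\<in>B. (g' x v \<bullet> b) *\<^sub>R f' (g x) b)"
    proof
      fix v show "f' (g x) (g' x v) = (\<Sum>b\<in>B. (g' x v \<bullet> b) *\<^sub>R f' (g x) b)"
        using arg_cong[OF B(2)[of "g' x v"], of "f' (g x)"]
        by (simp only: linear_sum[OF lin] linear_cmul[OF lin])
    qed
    ultimately show ?thesis by (rule back_subst)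
  qed
  have "Ck_on k U (\<lambda>x. f' (g x) b)" for b
    using Suc.IH[OF Ck_on_SucD[OF Suc.prems(1)]] f'(2) Suc.prems(3) by auto
  then have "Ck_on k U (\<lambda>x. \<Sum>b\<in>B. (g' x v \<bullet> b) *\<^sub>R f' (g x) b)" for v
    using g'(2) by (intro Ck_on_sum Ck_on_scaleR Ck_on_inner Ck_on_const) auto
  then show ?case using D by (auto intro!: exI[of _ "\<lambda>x v. \<Sum>b\<in>B. (g' x v \<bullet> b) *\<^sub>R f' (g x) b"])
qed

section \<open>Smooth functions\<close>

lemma smooth_onI: "(\<And>k. Ck_on k U f) \<Longrightarrow> smooth_on U f"
  by (simp add: smooth_on_def)

lemma smooth_onD: "smooth_on U f \<Longrightarrow> Ck_on k U f"
  by (simp add: smooth_on_def)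

lemma smooth_on_subset: "smooth_on U f \<Longrightarrow> V \<subseteq> U \<Longrightarrow> smooth_on V f"
  unfolding smooth_on_def using Ck_on_subset by blast

lemma smooth_on_continuous_on: "smooth_on U f \<Longrightarrow> continuous_on U f"
  using smooth_onD[of U f 0] by simp

lemma smooth_on_cong:
  "open U \<Longrightarrow> (\<And>x. x \<in> U \<Longrightarrow> f x = g x) \<Longrightarrow> smooth_on U f \<Longrightarrow> smooth_on U g"
  by (rule smooth_onI, rule Ck_on_cong[of U f g]) (simp_all add: smooth_onD)

lemma smooth_on_local:
  "(\<And>x. x \<in> U \<Longrightarrow> \<exists>V. open V \<and> x \<in> V \<and> smooth_on V f) \<Longrightarrow> smooth_on U f"
  by (rule smooth_onI, rule Ck_on_local) (meson smooth_onD)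

lemma smooth_on_const: "smooth_on U (\<lambda>x. c)"
  by (intro smooth_onI Ck_on_const)

lemma smooth_on_ident: "smooth_on U (\<lambda>x. x)"
  by (intro smooth_onI Ck_on_ident)

lemma smooth_on_bounded_linear_compose:
  "bounded_linear T \<Longrightarrow> smooth_on U f \<Longrightarrow> smooth_on U (\<lambda>x. T (f x))"
  by (simp add: smooth_on_def Ck_on_bounded_linear_compose)

lemma smooth_on_add: "smooth_on U f \<Longrightarrow> smooth_on U g \<Longrightarrow> smooth_on U (\<lambda>x. f x + g x)"
  by (simp add: smooth_on_def Ck_on_add)

lemma smooth_on_sum: "(\<And>i. i \<in> I \<Longrightarrow> smooth_on U (f i)) \<Longrightarrow> smooth_on U (\<lambda>x. \<Sum>i\<in>I. f i x)"
  by (simp add: smooth_on_def Ck_on_sum)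

lemma smooth_on_mult:
  fixes f g :: "'a::real_normed_vector \<Rightarrow> real"
  shows "smooth_on U f \<Longrightarrow> smooth_on U g \<Longrightarrow> smooth_on U (\<lambda>x. f x * g x)"
  by (simp add: smooth_on_def Ck_on_mult)

lemma smooth_on_scaleR: "smooth_on U f \<Longrightarrow> smooth_on U g \<Longrightarrow> smooth_on U (\<lambda>x. f x *\<^sub>R g x)"
  by (simp add: smooth_on_def Ck_on_scaleR)

lemma smooth_on_inner: "smooth_on U f \<Longrightarrow> smooth_on U g \<Longrightarrow> smooth_on U (\<lambda>x. f x \<bullet> g x)"
  by (simp add: smooth_on_def Ck_on_inner)

lemma smooth_on_compose:
  fixes g :: "'a::real_normed_vector \<Rightarrow> 'c::real_inner"
  shows "finite_dim TYPE('c) \<Longrightarrow> smooth_on U g \<Longrightarrow> smooth_on V f \<Longrightarrow> g ` U \<subseteq> V \<Longrightarrow>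
    smooth_on U (\<lambda>x. f (g x))"
  by (simp add: smooth_on_def Ck_on_compose[where g = g and V = V])

lemma smooth_on_minus: "smooth_on U f \<Longrightarrow> smooth_on U (\<lambda>x. - f x)"
  by (rule smooth_on_bounded_linear_compose[OF bounded_linear_minus[OF bounded_linear_ident]])

lemma smooth_on_diff: "smooth_on U f \<Longrightarrow> smooth_on U g \<Longrightarrow> smooth_on U (\<lambda>x. f x - g x)"
  using smooth_on_add[OF _ smooth_on_minus, of U f g] by simp

lemma smooth_on_Pair:
  assumes "smooth_on U f" "smooth_on U g"
  shows "smooth_on U (\<lambda>x. (f x, g x))"
proof -
  have "bounded_linear (\<lambda>a. (a, 0))" "bounded_linear (\<lambda>b. (0, b))"
    by (rule bounded_linear_Pair[OF bounded_linear_ident bounded_linear_zero]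
        bounded_linear_Pair[OF bounded_linear_zero bounded_linear_ident])+
  from smooth_on_add[OF this(1)[THEN smooth_on_bounded_linear_compose, OF assms(1)]
      this(2)[THEN smooth_on_bounded_linear_compose, OF assms(2)]]
  show ?thesis by simp
qed

lemma smooth_on_differentiable:
  "smooth_on U f \<Longrightarrow> x \<in> U \<Longrightarrow> \<exists>D. (f has_derivative D) (at x)"
  using smooth_onD[of U f "Suc 0"] by auto

lemma smooth_on_frechet_derivative:
  assumes "smooth_on U f" "x \<in> U"
  shows "(f has_derivative frechet_derivative f (at x)) (at x)"
  using smooth_on_differentiable[OF assms] by (simp add: frechet_derivative_works differentiable_def[symmetric])

lemma smooth_on_frechet:
  assumes "smooth_on U f" "open U"
  shows "smooth_on U (\<lambda>x. frechet_derivative f (at x) v)"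
proof (rule smooth_onI)
  fix k
  obtain f' where f': "\<forall>x\<in>U. (f has_derivative f' x) (at x)" "\<forall>v. Ck_on k U (\<lambda>x. f' x v)"
    using smooth_onD[OF assms(1), of "Suc k"] by auto
  have "f' x v = frechet_derivative f (at x) v" if "x \<in> U" for x
    using f'(1) frechet_derivative_at that by metis
  then show "Ck_on k U (\<lambda>x. frechet_derivative f (at x) v)"
    by (rule Ck_on_cong[OF assms(2) _ f'(2)[rule_format, of v]])
qed

section \<open>Smooth cut-off functions\<close>

lemma finite_dim_real: "finite_dim TYPE(real)"
  unfolding finite_dim_def by (intro exI[of _ "{1}"]) (auto simp: span_singleton)

lemma smooth_on_inverse: "smooth_on {0<..} (inverse :: real \<Rightarrow> real)"
proof -
  \<comment> \<open>The multiples of all powers of \<open>inverse\<close> form a family closed under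
    differentiation, which carries the induction.\<close>
  have "\<forall>n. Ck_on k {0<..} (\<lambda>x::real. c * inverse x ^ n)" for k c
  proof (induction k arbitrary: c)
    case 0
    show ?case by (auto intro!: continuous_intros)
  next
    case (Suc k)
    show ?case
    proof
      fix n
      have "((\<lambda>x::real. c * inverse x ^ n) has_derivative (\<lambda>v. v * ((- c * real n) * inverse x ^ Suc n))) (at x)"
        if "x \<in> {0<..}" for x
      proof -
        have "((\<lambda>x. c * inverse x ^ n) has_real_derivative
            c * (real n * (- (inverse x ^ Suc (Suc 0)) * inverse x ^ (n - Suc 0)))) (at x)"
          using that by (intro DERIV_cmult DERIV_power DERIV_inverse) simp
        also have "c * (real n * (- (inverse x ^ Suc (Suc 0)) * inverse x ^ (n - Suc 0))) =
            (- c * real n) * inverse x ^ Suc n"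
          by (cases n) (simp_all add: mult_ac)
        finally show ?thesis by (simp only: has_field_derivative_def mult.commute[of _ "(- c * real n) * inverse x ^ Suc n"])
      qed
      moreover have "Ck_on k {0<..} (\<lambda>x. v * ((- c * real n) * inverse x ^ Suc n))" for v :: real
        by (rule Ck_on_mult[OF Ck_on_const Suc[of "- c * real n", rule_format, of "Suc n"]])
      ultimately show "Ck_on (Suc k) {0<..} (\<lambda>x::real. c * inverse x ^ n)"
        by (auto intro!: exI[of _ "\<lambda>x v. v * ((- c * real n) * inverse x ^ Suc n)"] simp del: power_Suc)
    qed
  qed
  from this[of _ 1] have "Ck_on k {0<..} (inverse :: real \<Rightarrow> real)" for k
    by (metis (no_types, lifting) ext mult_1 power_one_right)
  then show ?thesis by (rule smooth_onI)
qed

text \<open>For \<open>n = 0\<close> this is the classical flat function exp(-1/x). The powers are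
  included because its derivatives are linear combinations of members of this family.\<close>

definition flat_fun :: "nat \<Rightarrow> real \<Rightarrow> real" where
  "flat_fun n x = (if x \<le> 0 then 0 else inverse x ^ n * exp (- inverse x))"

lemma flat_fun_tendsto: "(flat_fun n \<longlongrightarrow> 0) (at 0)"
proof -
  have "((\<lambda>x::real. inverse x ^ n * exp (- inverse x)) \<longlongrightarrow> 0) (at_right 0)"
  proof -
    have "((\<lambda>y::real. y ^ n / exp y) \<longlongrightarrow> 0) at_top" by (rule tendsto_power_div_exp_0)
    then have "((\<lambda>x. inverse x ^ n / exp (inverse x)) \<longlongrightarrow> (0::real)) (at_right 0)"
      by (rule filterlim_compose[OF _ filterlim_inverse_at_top_right])
    then show ?thesis by (simp add: exp_minus divide_inverse)
  qed
  then have "(flat_fun n \<longlongrightarrow> 0) (at_right 0)"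
    by (rule Lim_transform_eventually)
       (auto simp: flat_fun_def eventually_at_filter intro!: always_eventually)
  moreover have "(flat_fun n \<longlongrightarrow> 0) (at_left 0)"
    by (rule Lim_transform_eventually[OF tendsto_const])
       (auto simp: flat_fun_def eventually_at_filter intro!: always_eventually)
  ultimately show ?thesis using filterlim_split_at by blast
qed

lemma flat_fun_has_derivative:
  "(flat_fun n has_real_derivative (flat_fun (n + 2) x - real n * flat_fun (n + 1) x)) (at x)"
proof -
  consider "x < 0" | "x = 0" | "x > 0" by linarith
  then show ?thesis
  proof cases
    case 1
    have "((\<lambda>x. 0) has_real_derivative 0) (at x)" by simp
    then have "(flat_fun n has_real_derivative 0) (at x)"
      by (rule has_field_derivative_transform_within_open[of _ _ _ "{..<0}"]) (use 1 in \<open>auto simp: flat_fun_def\<close>)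
    then show ?thesis using 1 by (simp add: flat_fun_def)
  next
    case 2
    \<comment> \<open>The difference quotient at 0 contributes one more factor
      \<open>inverse h\<close>, hence is \<open>flat_fun (Suc n) h\<close>.\<close>
    have "((\<lambda>h. (flat_fun n (0 + h) - flat_fun n 0) / h) \<longlongrightarrow> 0) (at 0)"
      by (rule Lim_transform_eventually[OF flat_fun_tendsto[of "Suc n"]])
         (auto simp: flat_fun_def eventually_at_filter field_simps intro!: always_eventually)
    then show ?thesis using 2 by (simp add: DERIV_def flat_fun_def)
  next
    case 3
    have "((\<lambda>x. inverse x ^ n * exp (- inverse x)) has_real_derivative
      (inverse x ^ (n + 2) * exp (- inverse x) - real n * (inverse x ^ (n + 1) * exp (- inverse x)))) (at x)"
    proof -
      have i: "(inverse has_real_derivative - (inverse x ^ Suc (Suc 0))) (at x)"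
        using 3 by (intro DERIV_inverse) simp
      have "((\<lambda>x. inverse x ^ n * exp (- inverse x)) has_real_derivative
          real n * (- (inverse x ^ Suc (Suc 0)) * inverse x ^ (n - Suc 0)) * exp (- inverse x) +
          exp (- inverse x) * (- (- (inverse x ^ Suc (Suc 0)))) * inverse x ^ n) (at x)"
        by (intro DERIV_mult DERIV_power i DERIV_fun_exp DERIV_minus)
      also have "real n * (- (inverse x ^ Suc (Suc 0)) * inverse x ^ (n - Suc 0)) * exp (- inverse x) +
          exp (- inverse x) * (- (- (inverse x ^ Suc (Suc 0)))) * inverse x ^ n =
        inverse x ^ (n + 2) * exp (- inverse x) - real n * (inverse x ^ (n + 1) * exp (- inverse x))"
        by (cases n) (simp_all add: algebra_simps)
      finally show ?thesis .
    qed
    then have "(flat_fun n has_real_derivative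
      (inverse x ^ (n + 2) * exp (- inverse x) - real n * (inverse x ^ (n + 1) * exp (- inverse x)))) (at x)"
      by (rule has_field_derivative_transform_within_open[of _ _ _ "{0<..}"]) (use 3 in \<open>auto simp: flat_fun_def\<close>)
    then show ?thesis using 3 by (simp add: flat_fun_def)
  qed
qed

lemma smooth_on_flat_fun: "smooth_on UNIV (flat_fun n)"
proof -
  have "Ck_on k UNIV (flat_fun n)" for k n
  proof (induction k arbitrary: n)
    case 0
    show ?case by (auto intro!: continuous_at_imp_continuous_on DERIV_isCont flat_fun_has_derivative)
  next
    case (Suc k)
    have "(flat_fun n has_derivative (\<lambda>v. v * (flat_fun (n + 2) x + (- real n) * flat_fun (n + 1) x))) (at x)" for x
      using flat_fun_has_derivative[of n x] by (simp add: has_field_derivative_def mult_commute_abs)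
    moreover have "Ck_on k UNIV (\<lambda>x. v * (flat_fun (n + 2) x + (- real n) * flat_fun (n + 1) x))" for v
      by (intro Ck_on_mult Ck_on_add Ck_on_const Suc)
    ultimately show ?case
      by (auto intro!: exI[of _ "\<lambda>x v. v * (flat_fun (n + 2) x + (- real n) * flat_fun (n + 1) x)"])
  qed
  then show ?thesis by (rule smooth_onI)
qed

definition cutoff :: "real \<Rightarrow> real" where
  "cutoff x = flat_fun 0 (2 - x) * inverse (flat_fun 0 (2 - x) + flat_fun 0 (x - 1))"

lemma cutoff_eq_1: "x \<le> 1 \<Longrightarrow> cutoff x = 1"
  by (simp add: cutoff_def flat_fun_def)

lemma cutoff_eq_0: "x \<ge> 2 \<Longrightarrow> cutoff x = 0"
  by (simp add: cutoff_def flat_fun_def)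

lemma smooth_on_cutoff: "smooth_on UNIV cutoff"
proof -
  have a: "smooth_on UNIV (\<lambda>x. flat_fun 0 (2 - x))" "smooth_on UNIV (\<lambda>x. flat_fun 0 (x - 1))"
    by (intro smooth_on_compose[OF finite_dim_real _ smooth_on_flat_fun] smooth_on_diff
        smooth_on_const smooth_on_ident; simp)+
  \<comment> \<open>At least one of \<open>2 - x\<close> and \<open>x - 1\<close> is positive, so
    the denominator of \<open>cutoff\<close> never vanishes.\<close>
  have p: "flat_fun 0 (2 - x) + flat_fun 0 (x - 1) > 0" for x
    by (auto simp: flat_fun_def add_pos_pos)
  have "smooth_on UNIV (\<lambda>x. inverse (flat_fun 0 (2 - x) + flat_fun 0 (x - 1)))"
    using p by (intro smooth_on_compose[OF finite_dim_real _ smooth_on_inverse] smooth_on_add a) auto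
  then show ?thesis unfolding cutoff_def[abs_def] by (intro smooth_on_mult a)
qed

lemma smooth_bump:
  fixes a :: "'a::real_inner"
  assumes "r > 0"
  obtains \<rho> :: "'a \<Rightarrow> real" where "smooth_on UNIV \<rho>" "\<And>z. dist a z < r / 2 \<Longrightarrow> \<rho> z = 1"
    "\<And>z. dist a z \<ge> r \<Longrightarrow> \<rho> z = 0"
proof -
  \<comment> \<open>The squared distance is smooth also at \<open>a\<close>. The factor 2 / r^2
    sends distance \<open>r\<close> to 2, where \<open>cutoff\<close> has reached 0, and distance
    \<open>r / 2\<close> to 1/2, where it is still 1.\<close>
  define \<rho> where "\<rho> z = cutoff ((z - a) \<bullet> (z - a) * (2 / r\<^sup>2))" for z
  have d: "(z - a) \<bullet> (z - a) = (dist a z)\<^sup>2" for z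
    by (simp add: dot_square_norm dist_norm norm_minus_commute)
  have "smooth_on UNIV \<rho>"
    unfolding \<rho>_def[abs_def]
    by (intro smooth_on_compose[OF finite_dim_real _ smooth_on_cutoff] smooth_on_mult smooth_on_inner
        smooth_on_diff smooth_on_const smooth_on_ident) simp
  moreover have "\<rho> z = 1" if "dist a z < r / 2" for z
  proof -
    have "(dist a z)\<^sup>2 \<le> (r / 2)\<^sup>2" using that by (intro power_mono) auto
    then have "(dist a z)\<^sup>2 * 4 \<le> r\<^sup>2" by (simp add: power_divide)
    then have "2 * (dist a z)\<^sup>2 \<le> r\<^sup>2" using zero_le_power2[of "dist a z"] by linarith
    then show ?thesis unfolding \<rho>_def d using assms by (intro cutoff_eq_1) (simp add: field_simps)
  qed
  moreover have "\<rho> z = 0" if "dist a z \<ge> r" for z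
  proof -
    have "(dist a z)\<^sup>2 \<ge> r\<^sup>2" using that assms by (intro power_mono) auto
    then show ?thesis unfolding \<rho>_def d using assms by (intro cutoff_eq_0) (simp add: field_simps)
  qed
  ultimately show thesis using that by blast
qed

section \<open>Hadamard's lemma\<close>

text \<open>The weight \<open>w\<close> serves the induction over the order of differentiability:
  each derivative in \<open>z\<close> brings out a factor \<open>t\<close>.\<close>

definition ray_integral :: "(real \<Rightarrow> real) \<Rightarrow> ('a::real_normed_vector \<Rightarrow> real) \<Rightarrow> 'a \<Rightarrow> real" where
  "ray_integral w h z = integral {0..1} (\<lambda>t. w t * h (t *\<^sub>R z))"

lemma continuous_on_ray_integral:
  assumes "continuous_on UNIV w" "continuous_on UNIV h"
  shows "continuous_on UNIV (ray_integral w h)"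
proof -
  have "continuous_on (UNIV \<times> cbox 0 1) (\<lambda>(z, t). w t * h (t *\<^sub>R z))"
    unfolding split_beta
    by (intro continuous_intros continuous_on_compose2[OF assms(1)] continuous_on_compose2[OF assms(2)]) auto
  from integral_continuous_on_param[OF this] show ?thesis
    by (simp add: ray_integral_def[abs_def] cbox_interval)
qed

text \<open>Differentiation under the integral sign. The mean value theorem bounds the remainder of
  \<open>h\<close> by the oscillation \<open>N\<close> of the partial derivatives, and compactness
  of \<open>{0..1}\<close> makes this oscillation small uniformly in \<open>t\<close>.\<close>

lemma ray_integral_has_derivative:
  fixes h :: "'a::real_inner \<Rightarrow> real"
  assumes fd: "finite_dim TYPE('a)" and w: "continuous_on UNIV w"
    and h: "\<And>x. (h has_derivative h' x) (at x)"
    and h': "\<And>v. continuous_on UNIV (\<lambda>x. h' x v)"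
  shows "(ray_integral w h has_derivative (\<lambda>v. ray_integral (\<lambda>t. t * w t) (\<lambda>x. h' x v) z)) (at z)"
proof -
  obtain B :: "'a set" where B: "finite B" "\<And>b. b \<in> B \<Longrightarrow> norm b = 1" "\<And>x. x = (\<Sum>b\<in>B. (x \<bullet> b) *\<^sub>R b)"
    using finite_dim_orthonormal_basis[OF fd] by metis
  have hc: "continuous_on UNIV h"
    using h has_derivative_continuous by (blast intro: continuous_at_imp_continuous_on)
  have lin: "linear (h' x)" for x using h has_derivative_linear by blast
  have intg: "(\<lambda>t. u t * g (t *\<^sub>R x)) integrable_on {0..1}"
    if "continuous_on UNIV u" "continuous_on UNIV g" for u :: "real \<Rightarrow> real" and g :: "'a \<Rightarrow> real" and x
    by (intro integrable_continuous_interval continuous_intros continuous_on_compose2[OF that(2)]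
        continuous_on_subset[OF that(1)]) auto
  have tw: "continuous_on UNIV (\<lambda>t. t * w t)" using w by (intro continuous_intros)
  have expand: "h' x v = (\<Sum>b\<in>B. (v \<bullet> b) * h' x b)" for x v
    using arg_cong[OF B(3)[of v], of "h' x"] by (simp only: linear_sum[OF lin] linear_cmul[OF lin] real_scaleR_def)
  obtain M where M: "\<And>t. t \<in> {0..1} \<Longrightarrow> \<bar>w t\<bar> \<le> M" "M > 0"
  proof -
    have "bounded (w ` {0..1})"
      by (intro compact_imp_bounded compact_continuous_image continuous_on_subset[OF w]) auto
    then show thesis using that by (metis bounded_pos imageI real_norm_def)
  qed
  define D where "D v = ray_integral (\<lambda>t. t * w t) (\<lambda>x. h' x v) z" for v
  have D_alt: "D v = (\<Sum>b\<in>B. (v \<bullet> b) * D b)" for v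
  proof -
    have "D v = integral {0..1} (\<lambda>t. \<Sum>b\<in>B. (v \<bullet> b) * (t * w t * h' (t *\<^sub>R z) b))"
      unfolding D_def ray_integral_def
      by (subst expand) (simp add: sum_distrib_left mult_ac)
    also have "\<dots> = (\<Sum>b\<in>B. integral {0..1} (\<lambda>t. (v \<bullet> b) * (t * w t * h' (t *\<^sub>R z) b)))"
      by (intro integral_sum B integrable_on_mult_right intg tw h')
    finally show ?thesis by (simp add: D_def ray_integral_def)
  qed
  have "bounded_linear D"
  proof -
    have "bounded_linear (\<lambda>v. \<Sum>b\<in>B. (v \<bullet> b) * D b)"
      by (intro bounded_linear_sum bounded_linear_mult_const bounded_linear_inner_left)
    moreover have "D = (\<lambda>v. \<Sum>b\<in>B. (v \<bullet> b) * D b)" using D_alt by (rule ext)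
    ultimately show ?thesis by (rule back_subst[OF _ sym])
  qed
  moreover have "\<exists>d>0. \<forall>y. norm (y - z) < d \<longrightarrow>
      norm (ray_integral w h y - ray_integral w h z - D (y - z)) \<le> e * norm (y - z)" if "e > 0" for e
  proof -
    define N where "N = (\<lambda>(y, t::real). \<Sum>b\<in>B. \<bar>h' (t *\<^sub>R y) b - h' (t *\<^sub>R z) b\<bar>)"
    have Nc: "continuous_on (UNIV \<times> {0..1}) N"
      unfolding N_def split_beta
      by (intro continuous_intros continuous_on_compose2[OF h']) auto
    have eM: "e / M > 0" using \<open>e > 0\<close> M by simp
    obtain X where X: "z \<in> X" "open X" "\<forall>y\<in>X \<inter> UNIV. \<forall>t\<in>{0..1}. dist (N (y, t)) (N (z, t)) \<le> e / M"
      by (rule continuous_on_prod_compactE[OF Nc compact_Icc UNIV_I eM])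
    then obtain d where d: "d > 0" "\<And>y. dist y z < d \<Longrightarrow> y \<in> X" using open_dist by blast
    have N: "N (y, t) \<le> e / M" if "norm (y - z) < d" "t \<in> {0..1}" for y t
    proof -
      have "dist (N (y, t)) (N (z, t)) \<le> e / M" using X(3) d(2)[of y] that by (simp add: dist_norm)
      moreover have "N (z, t) = 0" by (simp add: N_def)
      moreover have "N (y, t) \<ge> 0" by (auto simp: N_def intro: sum_nonneg)
      ultimately show ?thesis by (simp add: dist_norm)
    qed
    have est: "\<bar>h (t *\<^sub>R y) - h (t *\<^sub>R z) - h' (t *\<^sub>R z) (t *\<^sub>R (y - z))\<bar> \<le> e / M * norm (y - z)"
      if y: "norm (y - z) < d" and t: "t \<in> {0..1}" for y t
    proof -
      \<comment> \<open>With the linear part at \<open>z\<close> subtracted, the increment of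
        \<open>q\<close> over \<open>{0..1}\<close> is exactly the remainder to be estimated, and
        its derivative is a difference of values of \<open>h'\<close>.\<close>
      define q where "q s = h (t *\<^sub>R (z + s *\<^sub>R (y - z))) - s * h' (t *\<^sub>R z) (t *\<^sub>R (y - z))" for s
      have q': "(q has_derivative (\<lambda>r. r * (h' (t *\<^sub>R (z + s *\<^sub>R (y - z))) (t *\<^sub>R (y - z)) - h' (t *\<^sub>R z) (t *\<^sub>R (y - z))))) (at s)" for s
      proof -
        have "((\<lambda>s. t *\<^sub>R (z + s *\<^sub>R (y - z))) has_derivative (\<lambda>r. r *\<^sub>R (t *\<^sub>R (y - z)))) (at s)"
          by (auto intro!: derivative_eq_intros simp: mult.commute)
        from has_derivative_compose[OF this h]
        have "((\<lambda>s. h (t *\<^sub>R (z + s *\<^sub>R (y - z)))) has_derivative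
           (\<lambda>r. h' (t *\<^sub>R (z + s *\<^sub>R (y - z))) (r *\<^sub>R (t *\<^sub>R (y - z))))) (at s)" .
        then have "((\<lambda>s. h (t *\<^sub>R (z + s *\<^sub>R (y - z)))) has_derivative
           (\<lambda>r. r * h' (t *\<^sub>R (z + s *\<^sub>R (y - z))) (t *\<^sub>R (y - z)))) (at s)"
          by (simp only: linear_cmul[OF lin] real_scaleR_def)
        then have "(q has_derivative (\<lambda>r. r * h' (t *\<^sub>R (z + s *\<^sub>R (y - z))) (t *\<^sub>R (y - z))
            - r * h' (t *\<^sub>R z) (t *\<^sub>R (y - z)))) (at s)"
          unfolding q_def by (intro has_derivative_diff has_derivative_mult_left has_derivative_ident)
        then show ?thesis by (simp only: right_diff_distrib)
      qed
      have "\<exists>s\<in>{0<..<1}. q 1 - q 0 = (\<lambda>r. r * (h' (t *\<^sub>R (z + s *\<^sub>R (y - z))) (t *\<^sub>R (y - z)) - h' (t *\<^sub>R z) (t *\<^sub>R (y - z)))) (1 - 0)"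
        by (rule mvt_simple) (auto intro: has_derivative_at_withinI q')
      then obtain s where s: "s \<in> {0<..<1}"
        "q 1 - q 0 = h' (t *\<^sub>R (z + s *\<^sub>R (y - z))) (t *\<^sub>R (y - z)) - h' (t *\<^sub>R z) (t *\<^sub>R (y - z))" by auto
      define y' where "y' = z + s *\<^sub>R (y - z)"
      have "norm (y' - z) \<le> norm (y - z)" using s(1) by (simp add: y'_def mult_left_le_one_le)
      then have "norm (y' - z) < d" using y by simp
      have "\<bar>q 1 - q 0\<bar> = \<bar>\<Sum>b\<in>B. (t *\<^sub>R (y - z) \<bullet> b) * (h' (t *\<^sub>R y') b - h' (t *\<^sub>R z) b)\<bar>"
        unfolding s(2) y'_def[symmetric]
        by (subst (1 2) expand) (simp only: sum_subtractf right_diff_distrib)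
      also have "\<dots> \<le> (\<Sum>b\<in>B. norm (y - z) * \<bar>h' (t *\<^sub>R y') b - h' (t *\<^sub>R z) b\<bar>)"
      proof (intro order_trans[OF sum_abs] sum_mono)
        fix b assume b: "b \<in> B"
        have "\<bar>t *\<^sub>R (y - z) \<bullet> b\<bar> \<le> norm (t *\<^sub>R (y - z)) * norm b" by (rule Cauchy_Schwarz_ineq2)
        also have "\<dots> \<le> norm (y - z)" using t B(2)[OF b] by (simp add: mult_left_le_one_le)
        finally show "\<bar>(t *\<^sub>R (y - z) \<bullet> b) * (h' (t *\<^sub>R y') b - h' (t *\<^sub>R z) b)\<bar> \<le>
          norm (y - z) * \<bar>h' (t *\<^sub>R y') b - h' (t *\<^sub>R z) b\<bar>"
          unfolding abs_mult by (rule mult_right_mono) simp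
      qed
      also have "\<dots> = norm (y - z) * N (y', t)" by (simp add: N_def sum_distrib_left)
      also have "\<dots> \<le> norm (y - z) * (e / M)"
        by (intro mult_left_mono N \<open>norm (y' - z) < d\<close> t) simp
      finally show ?thesis by (simp add: q_def mult.commute)
    qed
    have "norm (ray_integral w h y - ray_integral w h z - D (y - z)) \<le> e * norm (y - z)"
      if y: "norm (y - z) < d" for y
    proof -
      let ?r = "\<lambda>t. w t * h (t *\<^sub>R y) - w t * h (t *\<^sub>R z) - t * w t * h' (t *\<^sub>R z) (y - z)"
      have i: "(\<lambda>t. w t * h (t *\<^sub>R y)) integrable_on {0..1}" "(\<lambda>t. w t * h (t *\<^sub>R z)) integrable_on {0..1}"
        "(\<lambda>t. t * w t * h' (t *\<^sub>R z) (y - z)) integrable_on {0..1}"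
        by (intro intg w hc tw h')+
      have "ray_integral w h y - ray_integral w h z - D (y - z) = integral {0..1} ?r"
        unfolding ray_integral_def D_def using i by (simp add: integral_diff integrable_diff)
      also have "norm \<dots> \<le> (e * norm (y - z)) * measure lborel (cbox 0 (1::real))"
      proof (subst cbox_interval[symmetric], rule integrable_bound)
        show "0 \<le> e * norm (y - z)" using \<open>e > 0\<close> by simp
        show "?r integrable_on cbox 0 1" using i by (simp add: integrable_diff)
        fix t :: real assume "t \<in> cbox 0 1"
        then have t: "t \<in> {0..1}" by simp
        have "?r t = w t * (h (t *\<^sub>R y) - h (t *\<^sub>R z) - h' (t *\<^sub>R z) (t *\<^sub>R (y - z)))"
          unfolding linear_cmul[OF lin] real_scaleR_def by (simp only: algebra_simps)
        also have "norm \<dots> \<le> M * (e / M * norm (y - z))"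
          unfolding real_norm_def abs_mult using M(2) by (intro mult_mono M(1) est t y) auto
        finally show "norm (?r t) \<le> e * norm (y - z)" using M by simp
      qed
      finally show ?thesis by simp
    qed
    then show ?thesis using d by blast
  qed
  ultimately have "(ray_integral w h has_derivative D) (at z)"
    unfolding has_derivative_at_alt by blast
  then show ?thesis by (simp add: D_def[abs_def])
qed

lemma Ck_on_ray_integral:
  fixes h :: "'a::real_inner \<Rightarrow> real"
  assumes "finite_dim TYPE('a)"
  shows "continuous_on UNIV w \<Longrightarrow> Ck_on k UNIV h \<Longrightarrow> Ck_on k UNIV (ray_integral w h)"
proof (induction k arbitrary: w h)
  case 0
  then show ?case using continuous_on_ray_integral by auto
next
  case (Suc k)
  obtain h' where h': "\<And>x. (h has_derivative h' x) (at x)" "\<And>v. Ck_on k UNIV (\<lambda>x. h' x v)"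
    using Suc.prems(2) by auto
  have "(ray_integral w h has_derivative (\<lambda>v. ray_integral (\<lambda>t. t * w t) (\<lambda>x. h' x v) z)) (at z)" for z
    using h' by (intro ray_integral_has_derivative assms Suc.prems) (auto intro: Ck_on_continuous_on)
  moreover have "Ck_on k UNIV (ray_integral (\<lambda>t. t * w t) (\<lambda>x. h' x v))" for v
    using Suc.prems(1) h'(2) by (intro Suc.IH continuous_intros)
  ultimately show ?case
    by (auto intro!: exI[of _ "\<lambda>z v. ray_integral (\<lambda>t. t * w t) (\<lambda>x. h' x v) z"])
qed

text \<open>The coefficients are the averages of the partial derivatives of \<open>h\<close> over
  the segment from \<open>z0\<close> to \<open>z\<close>; the expansion is the fundamental theorem
  of calculus along that segment, after moving \<open>z0\<close> to the origin.\<close>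

lemma hadamard:
  fixes h :: "'a::real_inner \<Rightarrow> real"
  assumes fd: "finite_dim TYPE('a)" and h: "smooth_on UNIV h"
    and B: "finite B" "\<And>x::'a. x = (\<Sum>b\<in>B. (x \<bullet> b) *\<^sub>R b)"
  obtains a where "\<And>b. smooth_on UNIV (a b)" "\<And>b. a b z0 = frechet_derivative h (at z0) b"
    "\<And>z. h z = h z0 + (\<Sum>b\<in>B. ((z - z0) \<bullet> b) * a b z)"
proof -
  define g where "g x = h (z0 + x)" for x
  have g: "smooth_on UNIV g"
    unfolding g_def[abs_def]
    by (intro smooth_on_compose[OF fd _ h] smooth_on_add smooth_on_const smooth_on_ident) simp
  define g' where "g' x = frechet_derivative g (at x)" for x
  have D: "(g has_derivative g' x) (at x)" for x
    unfolding g'_def using smooth_on_frechet_derivative[OF g] by simp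
  have sg': "smooth_on UNIV (\<lambda>x. g' x v)" for v
    unfolding g'_def by (rule smooth_on_frechet[OF g open_UNIV])
  have lin: "linear (g' x)" for x using D has_derivative_linear by blast
  have expand: "g' x v = (\<Sum>b\<in>B. (v \<bullet> b) * g' x b)" for x v
    using arg_cong[OF B(2)[of v], of "g' x"] by (simp only: linear_sum[OF lin] linear_cmul[OF lin] real_scaleR_def)
  define a where "a b z = ray_integral (\<lambda>_. 1) (\<lambda>x. g' x b) (z - z0)" for b z
  have sI: "smooth_on UNIV (ray_integral (\<lambda>_. 1) (\<lambda>x. g' x b))" for b
    using sg' by (simp add: smooth_on_def Ck_on_ray_integral fd)
  have "smooth_on UNIV (a b)" for b
    unfolding a_def[abs_def]
    by (intro smooth_on_compose[OF fd _ sI] smooth_on_diff smooth_on_const smooth_on_ident) simp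
  moreover have "a b z0 = frechet_derivative h (at z0) b" for b
  proof -
    have "((\<lambda>z. g (z - z0)) has_derivative g' 0) (at z0)"
    proof -
      have "((\<lambda>z. z - z0) has_derivative (\<lambda>v. v)) (at z0)" by (auto intro!: derivative_eq_intros)
      from has_derivative_compose[OF this] D[of 0] show ?thesis by simp
    qed
    then have "(h has_derivative g' 0) (at z0)" by (simp add: g_def)
    then have "frechet_derivative h (at z0) = g' 0" by (metis frechet_derivative_at)
    then show ?thesis by (simp add: a_def ray_integral_def)
  qed
  moreover have "h z = h z0 + (\<Sum>b\<in>B. ((z - z0) \<bullet> b) * a b z)" for z
  proof -
    define v where "v = z - z0"
    have "((\<lambda>t. g (t *\<^sub>R v)) has_vector_derivative g' (t *\<^sub>R v) v) (at t within {0..1})" for t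
    proof -
      have "((\<lambda>t. t *\<^sub>R v) has_derivative (\<lambda>r. r *\<^sub>R v)) (at t within {0..1})"
        by (auto intro!: derivative_eq_intros)
      from has_derivative_compose[OF this D] show ?thesis
        by (simp add: has_vector_derivative_def linear_cmul[OF lin])
    qed
    then have "((\<lambda>t. g' (t *\<^sub>R v) v) has_integral (g (1 *\<^sub>R v) - g (0 *\<^sub>R v))) {0..1}"
      by (intro fundamental_theorem_of_calculus) auto
    then have "g v - g 0 = integral {0..1} (\<lambda>t. \<Sum>b\<in>B. (v \<bullet> b) * g' (t *\<^sub>R v) b)"
      by (subst (asm) expand) (simp add: integral_unique)
    also have "\<dots> = (\<Sum>b\<in>B. integral {0..1} (\<lambda>t. (v \<bullet> b) * g' (t *\<^sub>R v) b))"
    proof (intro integral_sum B integrable_on_mult_right integrable_continuous_interval)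
      fix b show "continuous_on {0..1} (\<lambda>t. g' (t *\<^sub>R v) b)"
        by (intro continuous_on_compose2[OF smooth_on_continuous_on[OF sg']] continuous_intros) auto
    qed
    finally show ?thesis by (simp add: g_def v_def a_def ray_integral_def)
  qed
  ultimately show thesis using that by blast
qed

section \<open>Functions on manifolds\<close>

locale manifold =
  fixes A :: "('m::topological_space, 'a::real_inner) atlas"
  assumes smooth_manifold: "smooth_manifold A"
begin

lemma fd: "finite_dim TYPE('a)"
  using smooth_manifold by (simp add: smooth_manifold_def)

lemma chart_cover: obtains U \<phi> where "(U, \<phi>) \<in> A" "y \<in> U"
proof -
  have "y \<in> (\<Union>(U, \<phi>)\<in>A. U)" using smooth_manifold by (simp add: smooth_manifold_def)
  then show thesis using that by blast
qed

lemma chart_homeo: "(U, \<phi>) \<in> A \<Longrightarrow> homeomorphism U (\<phi> ` U) \<phi> (inv_into U \<phi>)"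
  using smooth_manifold by (auto simp: smooth_manifold_def)

lemma chart_open: "(U, \<phi>) \<in> A \<Longrightarrow> open U" "(U, \<phi>) \<in> A \<Longrightarrow> open (\<phi> ` U)"
  using smooth_manifold by (auto simp: smooth_manifold_def)

lemma chart_inv [simp]: "(U, \<phi>) \<in> A \<Longrightarrow> y \<in> U \<Longrightarrow> inv_into U \<phi> (\<phi> y) = y"
  using chart_homeo[of U \<phi>] by (simp add: homeomorphism_def)

lemma chart_continuous: "(U, \<phi>) \<in> A \<Longrightarrow> continuous_on U \<phi>"
  using chart_homeo[of U \<phi>] by (simp add: homeomorphism_def)

lemma chart_inv_continuous: "(U, \<phi>) \<in> A \<Longrightarrow> continuous_on (\<phi> ` U) (inv_into U \<phi>)"
  using chart_homeo[of U \<phi>] by (simp add: homeomorphism_def)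

lemma chart_image_open:
  assumes "(U, \<phi>) \<in> A" "open O1"
  shows "open (\<phi> ` (U \<inter> O1))"
proof -
  have "open (inv_into U \<phi> -` O1 \<inter> \<phi> ` U)"
    using continuous_on_open_vimage[OF chart_open(2)[OF assms(1)]] chart_inv_continuous[OF assms(1)] assms(2)
    by blast
  moreover have "inv_into U \<phi> -` O1 \<inter> \<phi> ` U = \<phi> ` (U \<inter> O1)"
    using assms(1) by auto
  ultimately show ?thesis by simp
qed

lemma chart_preimage_open:
  assumes "(U, \<phi>) \<in> A" "open Z"
  shows "open (U \<inter> \<phi> -` Z)"
  using continuous_on_open_vimage[OF chart_open(1)[OF assms(1)]] chart_continuous[OF assms(1)] assms(2)
  by (metis inf_commute)

lemma transition_smooth:
  "(U, \<phi>) \<in> A \<Longrightarrow> (V, \<psi>) \<in> A \<Longrightarrow> smooth_on (\<phi> ` (U \<inter> V)) (\<psi> \<circ> inv_into U \<phi>)"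
  using smooth_manifold by (fastforce simp: smooth_manifold_def)

lemma smooth_wrtD: "smooth_wrt A V g \<Longrightarrow> (U, \<phi>) \<in> A \<Longrightarrow> smooth_on (\<phi> ` (U \<inter> V)) (g \<circ> inv_into U \<phi>)"
  by (auto simp: smooth_wrt_def)

lemma smooth_wrtI:
  "(\<And>U \<phi>. (U, \<phi>) \<in> A \<Longrightarrow> smooth_on (\<phi> ` (U \<inter> V)) (\<lambda>z. g (inv_into U \<phi> z))) \<Longrightarrow> smooth_wrt A V g"
  by (auto simp: smooth_wrt_def comp_def)

lemma smooth_wrt_subset: "smooth_wrt A V g \<Longrightarrow> V' \<subseteq> V \<Longrightarrow> smooth_wrt A V' g"
  unfolding smooth_wrt_def by (fast intro: smooth_on_subset)

text \<open>One chart around each point is enough, since passing to any other chart composes with a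
  smooth transition map.\<close>

lemma smooth_wrt_chartI:
  assumes "\<And>y. y \<in> V \<Longrightarrow> \<exists>U \<phi> O1. (U, \<phi>) \<in> A \<and> y \<in> U \<and> open O1 \<and> y \<in> O1 \<and>
    smooth_on (\<phi> ` (U \<inter> O1)) (\<lambda>z. g (inv_into U \<phi> z))"
  shows "smooth_wrt A V g"
proof (rule smooth_wrtI, rule smooth_on_local)
  fix U' \<psi> z assume c': "(U', \<psi>) \<in> A" and z: "z \<in> \<psi> ` (U' \<inter> V)"
  then obtain y where y: "y \<in> U'" "y \<in> V" "z = \<psi> y" by auto
  obtain U \<phi> O1 where c: "(U, \<phi>) \<in> A" "y \<in> U" "open O1" "y \<in> O1"
    "smooth_on (\<phi> ` (U \<inter> O1)) (\<lambda>z. g (inv_into U \<phi> z))" using assms[OF y(2)] by blast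
  define W where "W = \<psi> ` (U' \<inter> (U \<inter> O1))"
  have W: "open W" "z \<in> W"
    unfolding W_def using c c' y chart_open(1) by (auto intro!: chart_image_open)
  have "smooth_on W (\<lambda>z. (\<lambda>w. g (inv_into U \<phi> w)) (\<phi> (inv_into U' \<psi> z)))"
  proof (rule smooth_on_compose[OF fd _ c(5)])
    show "smooth_on W (\<lambda>z. \<phi> (inv_into U' \<psi> z))"
      by (rule smooth_on_subset[OF transition_smooth[OF c' c(1), unfolded comp_def]]) (auto simp: W_def)
    show "(\<lambda>z. \<phi> (inv_into U' \<psi> z)) ` W \<subseteq> \<phi> ` (U \<inter> O1)"
      using c' by (auto simp: W_def)
  qed
  then have "smooth_on W (\<lambda>z. g (inv_into U' \<psi> z))"
    by (rule smooth_on_cong[OF W(1), rotated]) (use c c' in \<open>auto simp: W_def\<close>)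
  then show "\<exists>V. open V \<and> z \<in> V \<and> smooth_on V (\<lambda>z. g (inv_into U' \<psi> z))" using W by blast
qed

lemma smooth_wrt_local:
  assumes "\<And>y. y \<in> V \<Longrightarrow> \<exists>O1. open O1 \<and> y \<in> O1 \<and> smooth_wrt A O1 g"
  shows "smooth_wrt A V g"
proof (rule smooth_wrt_chartI)
  fix y assume "y \<in> V"
  then obtain O1 where O1: "open O1" "y \<in> O1" "smooth_wrt A O1 g" using assms by blast
  obtain U \<phi> where "(U, \<phi>) \<in> A" "y \<in> U" using chart_cover by blast
  then show "\<exists>U \<phi> O1. (U, \<phi>) \<in> A \<and> y \<in> U \<and> open O1 \<and> y \<in> O1 \<and>
    smooth_on (\<phi> ` (U \<inter> O1)) (\<lambda>z. g (inv_into U \<phi> z))"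
    using O1 smooth_wrtD[OF O1(3), unfolded comp_def] by blast
qed

lemma smooth_wrt_cong:
  assumes "open V" "\<And>y. y \<in> V \<Longrightarrow> g y = g' y" "smooth_wrt A V g"
  shows "smooth_wrt A V g'"
proof (rule smooth_wrtI)
  fix U \<phi> assume c: "(U, \<phi>) \<in> A"
  show "smooth_on (\<phi> ` (U \<inter> V)) (\<lambda>z. g' (inv_into U \<phi> z))"
    by (rule smooth_on_cong[OF chart_image_open[OF c assms(1)] _ smooth_wrtD[OF assms(3) c]])
       (use assms(2) c in auto)
qed

lemma smooth_wrt_const: "smooth_wrt A V (\<lambda>_. c)"
  by (intro smooth_wrtI smooth_on_const)

lemma smooth_wrt_add: "smooth_wrt A V f \<Longrightarrow> smooth_wrt A V g \<Longrightarrow> smooth_wrt A V (\<lambda>y. f y + g y)"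
  by (auto simp: smooth_wrt_def comp_def intro!: smooth_on_add)

lemma smooth_wrt_sum:
  "(\<And>i. i \<in> I \<Longrightarrow> smooth_wrt A V (f i)) \<Longrightarrow> smooth_wrt A V (\<lambda>y. \<Sum>i\<in>I. f i y)"
  by (auto simp: smooth_wrt_def comp_def split_beta intro!: smooth_on_sum)

lemma smooth_wrt_mult:
  fixes f g :: "'m \<Rightarrow> real"
  shows "smooth_wrt A V f \<Longrightarrow> smooth_wrt A V g \<Longrightarrow> smooth_wrt A V (\<lambda>y. f y * g y)"
  by (auto simp: smooth_wrt_def comp_def intro!: smooth_on_mult)

lemma smooth_wrt_scaleR:
  "smooth_wrt A V f \<Longrightarrow> smooth_wrt A V g \<Longrightarrow> smooth_wrt A V (\<lambda>y. f y *\<^sub>R g y)"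
  by (auto simp: smooth_wrt_def comp_def intro!: smooth_on_scaleR)

lemma smooth_wrt_diff: "smooth_wrt A V f \<Longrightarrow> smooth_wrt A V g \<Longrightarrow> smooth_wrt A V (\<lambda>y. f y - g y)"
  by (auto simp: smooth_wrt_def comp_def intro!: smooth_on_diff)

lemma smooth_wrt_bounded_linear:
  "bounded_linear T \<Longrightarrow> smooth_wrt A V f \<Longrightarrow> smooth_wrt A V (\<lambda>y. T (f y))"
  by (auto simp: smooth_wrt_def comp_def intro!: smooth_on_bounded_linear_compose[of T])

lemma smooth_wrt_compose:
  fixes g :: "'m \<Rightarrow> 'c::real_inner"
  assumes "finite_dim TYPE('c)" "smooth_wrt A V g" "smooth_on Z h" "g ` V \<subseteq> Z"
  shows "smooth_wrt A V (\<lambda>y. h (g y))"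
proof (rule smooth_wrtI)
  fix U \<phi> assume c: "(U, \<phi>) \<in> A"
  show "smooth_on (\<phi> ` (U \<inter> V)) (\<lambda>z. h (g (inv_into U \<phi> z)))"
    by (rule smooth_on_compose[OF assms(1) smooth_wrtD[OF assms(2) c, unfolded comp_def] assms(3)])
       (use assms(4) c in auto)
qed

text \<open>Expanding \<open>u x\<close> in an orthonormal basis reduces a moving argument to the
  fixed ones, for which smoothness is assumed. Changes of trivialization have this form.\<close>

lemma smooth_wrt_linear_family:
  assumes fd_fibre: "finite_dim TYPE('f::real_inner)"
    and "\<And>x. x \<in> O1 \<Longrightarrow> linear (g x)" "\<And>u::'f. smooth_wrt A O1 (\<lambda>x. g x u)" "open O1" "smooth_wrt A O1 u"
  shows "smooth_wrt A O1 (\<lambda>x. g x (u x) :: 'c::real_normed_vector)"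
proof -
  obtain C :: "'f set" where C: "finite C" "\<And>x. x = (\<Sum>b\<in>C. (x \<bullet> b) *\<^sub>R b)"
    using finite_dim_orthonormal_basis[OF fd_fibre] by metis
  have "smooth_wrt A O1 (\<lambda>x. \<Sum>b\<in>C. (u x \<bullet> b) *\<^sub>R g x b)"
    by (intro smooth_wrt_sum smooth_wrt_scaleR assms(3)
        smooth_wrt_bounded_linear[OF bounded_linear_inner_left assms(5)])
  then show ?thesis
  proof (rule smooth_wrt_cong[OF assms(4), rotated])
    fix x assume "x \<in> O1"
    note lin = assms(2)[OF this]
    show "(\<Sum>b\<in>C. (u x \<bullet> b) *\<^sub>R g x b) = g x (u x)"
      using arg_cong[OF C(2)[of "u x"], of "g x"] by (simp only: linear_sum[OF lin] linear_cmul[OF lin])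
  qed
qed

lemma smooth_wrt_chart: "(U, \<phi>) \<in> A \<Longrightarrow> smooth_wrt A U \<phi>"
  by (intro smooth_wrtI) (use transition_smooth in \<open>auto simp: comp_def\<close>)

text \<open>The type \<open>'m\<close> is only of class \<open>topological_space\<close>; the
  Hausdorff property has to be taken from the manifold.\<close>

lemma compact_closed:
  assumes "compact (K :: 'm set)" shows "closed K"
proof -
  have "Hausdorff_space (euclidean :: 'm topology)"
    using smooth_manifold by (simp add: smooth_manifold_def)
  then show ?thesis using compactin_imp_closedin[of euclidean K] assms
    by (metis closed_closedin compactin_euclidean_iff)
qed

text \<open>The open sets \<open>O1\<close> and \<open>- K\<close> cover the manifold: the extension
  is \<open>g\<close> on the first and 0 on the second. Closedness of \<open>K\<close> is what takes
  care of boundary points of \<open>O1\<close>.\<close>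

lemma smooth_wrt_extend:
  fixes g :: "'m \<Rightarrow> 'c::real_normed_vector"
  assumes "open O1" "closed K" "K \<subseteq> O1" "smooth_wrt A O1 g" "\<And>y. y \<in> O1 - K \<Longrightarrow> g y = 0"
  shows "smooth_wrt A UNIV (\<lambda>y. if y \<in> O1 then g y else 0)"
proof (rule smooth_wrt_local)
  fix y
  show "\<exists>O2. open O2 \<and> y \<in> O2 \<and> smooth_wrt A O2 (\<lambda>y. if y \<in> O1 then g y else 0)"
  proof (cases "y \<in> O1")
    case True
    have "smooth_wrt A O1 (\<lambda>y. if y \<in> O1 then g y else 0)"
      by (rule smooth_wrt_cong[OF assms(1) _ assms(4)]) simp
    then show ?thesis using True assms(1) by blast
  next
    case False
    have "smooth_wrt A (- K) (\<lambda>y. if y \<in> O1 then g y else 0)"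
      by (rule smooth_wrt_cong[OF _ _ smooth_wrt_const[of _ 0]]) (use assms in auto)
    then show ?thesis using False assms(2,3) by blast
  qed
qed

text \<open>The support bound \<open>K\<close> must be closed in the whole manifold, not just in the
  chart, for extensions by zero to be smooth. It is the preimage of a closed ball, so compact, so
  closed by the Hausdorff property.\<close>

lemma bump:
  assumes "open O1" "y \<in> O1"
  obtains \<theta> N K where "\<theta> \<in> Cinf A" "open N" "y \<in> N" "closed K" "N \<subseteq> K" "K \<subseteq> O1"
    "\<And>z. z \<in> N \<Longrightarrow> \<theta> z = 1" "\<And>z. z \<notin> K \<Longrightarrow> \<theta> z = 0"
proof -
  obtain U \<phi> where c: "(U, \<phi>) \<in> A" "y \<in> U" using chart_cover by blast
  have "open (\<phi> ` (U \<inter> O1))" "\<phi> y \<in> \<phi> ` (U \<inter> O1)" using chart_image_open c assms by auto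
  then obtain r where r: "r > 0" "cball (\<phi> y) r \<subseteq> \<phi> ` (U \<inter> O1)" using open_contains_cball by blast
  obtain \<rho> where \<rho>: "smooth_on UNIV \<rho>" "\<And>z. dist (\<phi> y) z < r / 2 \<Longrightarrow> \<rho> z = 1"
    "\<And>z. dist (\<phi> y) z \<ge> r \<Longrightarrow> \<rho> z = (0::real)" using smooth_bump[OF r(1), of "\<phi> y"] by blast
  define K where "K = inv_into U \<phi> ` cball (\<phi> y) r"
  define N where "N = U \<inter> \<phi> -` ball (\<phi> y) (r / 2)"
  have "compact K"
    unfolding K_def
    by (intro compact_continuous_image finite_dim_compact_cball fd
        continuous_on_subset[OF chart_inv_continuous[OF c(1)]]) (use r in auto)
  then have K: "closed K" by (rule compact_closed)
  have KU: "K \<subseteq> U \<inter> O1"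
  proof
    fix z assume "z \<in> K"
    then obtain w where "w \<in> cball (\<phi> y) r" "z = inv_into U \<phi> w" unfolding K_def by blast
    moreover obtain z' where "z' \<in> U \<inter> O1" "w = \<phi> z'" using calculation(1) r(2) by blast
    ultimately show "z \<in> U \<inter> O1" using c(1) by simp
  qed
  have inK: "z \<in> K" if "z \<in> U" "dist (\<phi> y) (\<phi> z) \<le> r" for z
    unfolding K_def using that c(1) by (intro image_eqI[of _ _ "\<phi> z"]) auto
  have N: "open N" "y \<in> N" "N \<subseteq> K"
    using chart_preimage_open[OF c(1)] c r inK by (auto simp: N_def)
  define \<theta> where "\<theta> z = (if z \<in> U then \<rho> (\<phi> z) else 0)" for z
  have "\<theta> \<in> Cinf A"
    unfolding Cinf_def \<theta>_def[abs_def]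
  proof (intro CollectI smooth_wrt_extend[of U K])
    show "smooth_wrt A U (\<lambda>y. \<rho> (\<phi> y))"
      by (rule smooth_wrt_compose[OF fd smooth_wrt_chart[OF c(1)] \<rho>(1)]) simp
    show "\<rho> (\<phi> z) = 0" if "z \<in> U - K" for z
      using \<rho>(3)[of "\<phi> z"] inK[of z] that by force
  qed (use KU K chart_open(1)[OF c(1)] in auto)
  moreover have "\<theta> z = 1" if "z \<in> N" for z using that \<rho>(2) by (auto simp: N_def \<theta>_def)
  moreover have "\<theta> z = 0" if "z \<notin> K" for z
    using \<rho>(3)[of "\<phi> z"] inK[of z] that by (force simp: \<theta>_def)
  ultimately show thesis using that N K KU by blast
qed

lemma Cinf_const: "(\<lambda>_. c) \<in> Cinf A"
  by (simp add: Cinf_def smooth_wrt_const)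

lemma Cinf_add: "f \<in> Cinf A \<Longrightarrow> g \<in> Cinf A \<Longrightarrow> (\<lambda>z. f z + g z) \<in> Cinf A"
  by (simp add: Cinf_def smooth_wrt_add)

lemma Cinf_diff: "f \<in> Cinf A \<Longrightarrow> g \<in> Cinf A \<Longrightarrow> (\<lambda>z. f z - g z) \<in> Cinf A"
  by (simp add: Cinf_def smooth_wrt_diff)

lemma Cinf_mult: "f \<in> Cinf A \<Longrightarrow> g \<in> Cinf A \<Longrightarrow> (\<lambda>z. f z * g z) \<in> Cinf A"
  by (simp add: Cinf_def smooth_wrt_mult)

lemma Cinf_cmult: "f \<in> Cinf A \<Longrightarrow> (\<lambda>z. c * f z) \<in> Cinf A"
  by (intro Cinf_mult Cinf_const)

end


section \<open>Sections of vector bundles\<close>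

locale vbundle_over = manifold A
  for A :: "('m::topological_space, 'a::real_inner) atlas" +
  fixes B :: "('t::topological_space, 'm, 'f::real_inner) vbundle"
  assumes vector_bundle: "vector_bundle A B"
begin

lemma fd_fibre: "finite_dim TYPE('f)"
  using vector_bundle by (simp add: vector_bundle_def)

lemma triv_cover: obtains V \<Phi> where "(V, \<Phi>) \<in> triv B" "x \<in> V"
proof -
  have "x \<in> (\<Union>(V, \<Phi>)\<in>triv B. V)" using vector_bundle by (simp add: vector_bundle_def)
  then show thesis using that by blast
qed

lemma triv_open: "(V, \<Phi>) \<in> triv B \<Longrightarrow> open V"
  using vector_bundle by (auto simp: vector_bundle_def)

lemma triv_homeo:
  assumes "(V, \<Phi>) \<in> triv B"
  obtains h where "homeomorphism (tot B \<inter> prj B -` V) (V \<times> UNIV) (\<lambda>e. (prj B e, \<Phi> e)) h"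
  using vector_bundle assms by (fastforce simp: vector_bundle_def)

lemma triv_transition:
  assumes "(V, \<Phi>) \<in> triv B" "(W, \<Psi>) \<in> triv B"
  obtains g where "\<And>x. x \<in> V \<inter> W \<Longrightarrow> linear (g x)" "\<And>u. smooth_wrt A (V \<inter> W) (\<lambda>x. g x u)"
    "\<And>e. e \<in> tot B \<Longrightarrow> prj B e \<in> V \<inter> W \<Longrightarrow> \<Psi> e = g (prj B e) (\<Phi> e)"
proof -
  have "\<forall>(V, \<Phi>)\<in>triv B. \<forall>(W, \<Psi>)\<in>triv B. \<exists>g.
        (\<forall>x\<in>V \<inter> W. linear (g x)) \<and> (\<forall>u. smooth_wrt A (V \<inter> W) (\<lambda>x. g x u)) \<and>
        (\<forall>e\<in>tot B. prj B e \<in> V \<inter> W \<longrightarrow> \<Psi> e = g (prj B e) (\<Phi> e))"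
    using vector_bundle unfolding vector_bundle_def by (elim conjE)
  from bspec[OF bspec[OF this assms(1), unfolded prod.case] assms(2), unfolded prod.case]
  obtain g where g: "\<forall>x\<in>V \<inter> W. linear (g x)" "\<forall>u. smooth_wrt A (V \<inter> W) (\<lambda>x. g x u)"
    "\<forall>e\<in>tot B. prj B e \<in> V \<inter> W \<longrightarrow> \<Psi> e = g (prj B e) (\<Phi> e)" by (elim exE conjE)
  show thesis by (rule that[of g, OF bspec[OF g(1)] spec[OF g(2)] bspec[OF g(3), rule_format]])
qed

lemma fibre_ex:
  assumes "(V, \<Phi>) \<in> triv B" "x \<in> V"
  obtains e where "e \<in> tot B" "prj B e = x" "\<Phi> e = u"
proof -
  obtain h where h: "homeomorphism (tot B \<inter> prj B -` V) (V \<times> UNIV) (\<lambda>e. (prj B e, \<Phi> e)) h"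
    using triv_homeo[OF assms(1)] .
  have "(x, u) \<in> V \<times> UNIV" using assms by simp
  then have "h (x, u) \<in> tot B \<inter> prj B -` V" "(prj B (h (x, u)), \<Phi> (h (x, u))) = (x, u)"
    using h unfolding homeomorphism_def by blast+
  then show thesis using that by auto
qed

lemma vec_eqI:
  assumes "(V, \<Phi>) \<in> triv B" "e \<in> tot B" "e' \<in> tot B" "prj B e \<in> V" "prj B e' = prj B e" "\<Phi> e' = \<Phi> e"
  shows "e' = e"
proof -
  obtain h where h: "homeomorphism (tot B \<inter> prj B -` V) (V \<times> UNIV) (\<lambda>e. (prj B e, \<Phi> e)) h"
    using triv_homeo[OF assms(1)] .
  then have "h (prj B w, \<Phi> w) = w" if "w \<in> tot B" "prj B w \<in> V" for w
    using that unfolding homeomorphism_def by blast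
  from this[OF assms(2,4)] this[of e'] show ?thesis using assms(3-6) by metis
qed

lemma vec_eqI':
  assumes "e \<in> tot B" "e' \<in> tot B" "prj B e' = prj B e"
    "\<And>V \<Phi>. (V, \<Phi>) \<in> triv B \<Longrightarrow> prj B e \<in> V \<Longrightarrow> \<Phi> e' = \<Phi> e"
  shows "e' = e"
proof -
  obtain V \<Phi> where t: "(V, \<Phi>) \<in> triv B" "prj B e \<in> V" using triv_cover by blast
  show ?thesis by (rule vec_eqI[OF t(1) assms(1,2) t(2) assms(3) assms(4)[OF t]])
qed

text \<open>The description in \<open>the_vec\<close> denotes something as soon as the prescribed
  coordinates transform like those of a vector. Compatibility is asked for an arbitrary linear
  \<open>g\<close> relating two trivializations on the fibre, so that for sums and multiples it
  reduces to linearity of \<open>g\<close>.\<close>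

lemma the_vec:
  assumes "\<And>V \<Phi> W \<Psi> g. (V, \<Phi>) \<in> triv B \<Longrightarrow> (W, \<Psi>) \<in> triv B \<Longrightarrow> x \<in> V \<Longrightarrow> x \<in> W \<Longrightarrow> linear g \<Longrightarrow>
    (\<And>e. e \<in> tot B \<Longrightarrow> prj B e = x \<Longrightarrow> \<Psi> e = g (\<Phi> e)) \<Longrightarrow> p \<Psi> = g (p \<Phi>)"
  shows "the_vec B x p \<in> tot B" "prj B (the_vec B x p) = x"
    "(V, \<Phi>) \<in> triv B \<Longrightarrow> x \<in> V \<Longrightarrow> \<Phi> (the_vec B x p) = p \<Phi>"
proof -
  let ?P = "\<lambda>w. w \<in> tot B \<and> prj B w = x \<and> (\<forall>(V, \<Phi>)\<in>triv B. x \<in> V \<longrightarrow> \<Phi> w = p \<Phi>)"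
  obtain V0 \<Phi>0 where t0: "(V0, \<Phi>0) \<in> triv B" "x \<in> V0" using triv_cover by blast
  obtain w where w: "w \<in> tot B" "prj B w = x" "\<Phi>0 w = p \<Phi>0" using fibre_ex[OF t0, of "p \<Phi>0"] .
  have "\<Psi> w = p \<Psi>" if t: "(W, \<Psi>) \<in> triv B" "x \<in> W" for W \<Psi>
  proof -
    obtain g where g: "\<And>x. x \<in> V0 \<inter> W \<Longrightarrow> linear (g x)"
      "\<And>e. e \<in> tot B \<Longrightarrow> prj B e \<in> V0 \<inter> W \<Longrightarrow> \<Psi> e = g (prj B e) (\<Phi>0 e)"
      using triv_transition[OF t0(1) t(1)] by metis
    have "p \<Psi> = g x (p \<Phi>0)"
      by (rule assms[OF t0(1) t(1) t0(2) t(2)]) (use g t0 t in auto)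
    then show ?thesis using g(2)[OF w(1)] w t0 t by simp
  qed
  then have P: "?P w" using w by auto
  have "the_vec B x p = w"
    unfolding the_vec_def
  proof (rule the_equality)
    fix w' assume "?P w'"
    then show "w' = w" using w t0 by (intro vec_eqI[OF t0(1)]) auto
  qed (rule P)
  then show "the_vec B x p \<in> tot B" "prj B (the_vec B x p) = x"
    "(V, \<Phi>) \<in> triv B \<Longrightarrow> x \<in> V \<Longrightarrow> \<Phi> (the_vec B x p) = p \<Phi>" using P by auto
qed

lemma zero_vec [simp]: "zero_vec B x \<in> tot B" "prj B (zero_vec B x) = x"
  "(V, \<Phi>) \<in> triv B \<Longrightarrow> x \<in> V \<Longrightarrow> \<Phi> (zero_vec B x) = 0"
  unfolding zero_vec_def
  by (rule the_vec(1)[where p = "\<lambda>\<Phi>. 0"], simp add: linear_0)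
     (rule the_vec(2)[where p = "\<lambda>\<Phi>. 0"], simp add: linear_0,
      rule the_vec(3)[where p = "\<lambda>\<Phi>. 0"], simp add: linear_0, assumption+)

lemma add_vec:
  assumes "u \<in> tot B" "v \<in> tot B" "prj B v = prj B u"
  shows "add_vec B u v \<in> tot B" "prj B (add_vec B u v) = prj B u"
    "(V, \<Phi>) \<in> triv B \<Longrightarrow> prj B u \<in> V \<Longrightarrow> \<Phi> (add_vec B u v) = \<Phi> u + \<Phi> v"
  unfolding add_vec_def
  by (rule the_vec(1)[where p = "\<lambda>\<Phi>. \<Phi> u + \<Phi> v"], simp add: assms linear_add)
     (rule the_vec(2)[where p = "\<lambda>\<Phi>. \<Phi> u + \<Phi> v"], simp add: assms linear_add,
      rule the_vec(3)[where p = "\<lambda>\<Phi>. \<Phi> u + \<Phi> v"], simp add: assms linear_add, assumption+)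

lemma scale_vec:
  assumes "u \<in> tot B"
  shows "scale_vec B c u \<in> tot B" "prj B (scale_vec B c u) = prj B u"
    "(V, \<Phi>) \<in> triv B \<Longrightarrow> prj B u \<in> V \<Longrightarrow> \<Phi> (scale_vec B c u) = c *\<^sub>R \<Phi> u"
  unfolding scale_vec_def
  by (rule the_vec(1)[where p = "\<lambda>\<Phi>. c *\<^sub>R \<Phi> u"], simp add: assms linear_cmul)
     (rule the_vec(2)[where p = "\<lambda>\<Phi>. c *\<^sub>R \<Phi> u"], simp add: assms linear_cmul,
      rule the_vec(3)[where p = "\<lambda>\<Phi>. c *\<^sub>R \<Phi> u"], simp add: assms linear_cmul, assumption+)

lemma sum_vec:
  assumes "\<And>i. i \<in> I \<Longrightarrow> u i \<in> tot B" "\<And>i. i \<in> I \<Longrightarrow> prj B (u i) = x"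
  shows "sum_vec B x I u \<in> tot B" "prj B (sum_vec B x I u) = x"
    "(V, \<Phi>) \<in> triv B \<Longrightarrow> x \<in> V \<Longrightarrow> \<Phi> (sum_vec B x I u) = (\<Sum>i\<in>I. \<Phi> (u i))"
  unfolding sum_vec_def
  by (rule the_vec(1)[where p = "\<lambda>\<Phi>. \<Sum>i\<in>I. \<Phi> (u i)"], simp add: assms linear_sum)
     (rule the_vec(2)[where p = "\<lambda>\<Phi>. \<Sum>i\<in>I. \<Phi> (u i)"], simp add: assms linear_sum,
      rule the_vec(3)[where p = "\<lambda>\<Phi>. \<Sum>i\<in>I. \<Phi> (u i)"], simp add: assms linear_sum, assumption+)

lemma section_tot [simp]: "\<sigma> \<in> sections A B \<Longrightarrow> \<sigma> x \<in> tot B"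
  and section_prj [simp]: "\<sigma> \<in> sections A B \<Longrightarrow> prj B (\<sigma> x) = x"
  by (simp_all add: sections_def)

lemma section_smooth: "\<sigma> \<in> sections A B \<Longrightarrow> (V, \<Phi>) \<in> triv B \<Longrightarrow> smooth_wrt A V (\<lambda>x. \<Phi> (\<sigma> x))"
  unfolding sections_def comp_def by (drule CollectD, drule conjunct2, drule (1) bspec, simp)

lemma smooth_wrt_change_triv:
  assumes "(V, \<Phi>) \<in> triv B" "(W, \<Psi>) \<in> triv B" "open O1" "O1 \<subseteq> V \<inter> W"
    "\<And>x. x \<in> O1 \<Longrightarrow> \<sigma> x \<in> tot B \<and> prj B (\<sigma> x) = x" "smooth_wrt A O1 (\<lambda>x. \<Phi> (\<sigma> x))"
  shows "smooth_wrt A O1 (\<lambda>x. \<Psi> (\<sigma> x))"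
proof -
  obtain g where g: "\<And>x. x \<in> V \<inter> W \<Longrightarrow> linear (g x)" "\<And>u. smooth_wrt A (V \<inter> W) (\<lambda>x. g x u)"
    "\<And>e. e \<in> tot B \<Longrightarrow> prj B e \<in> V \<inter> W \<Longrightarrow> \<Psi> e = g (prj B e) (\<Phi> e)"
    using triv_transition[OF assms(1,2)] by metis
  have "smooth_wrt A O1 (\<lambda>x. g x (\<Phi> (\<sigma> x)))"
    by (rule smooth_wrt_linear_family[where g = g and u = "\<lambda>x. \<Phi> (\<sigma> x)", OF fd_fibre g(1)
          smooth_wrt_subset[OF g(2) assms(4)] assms(3,6)]) (use assms(4) in blast)
  then show ?thesis
  proof (rule smooth_wrt_cong[OF assms(3), rotated])
    fix y assume "y \<in> O1"
    then show "g y (\<Phi> (\<sigma> y)) = \<Psi> (\<sigma> y)" using g(3)[of "\<sigma> y"] assms(4,5) by fastforce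
  qed
qed

lemma sectionI:
  assumes "\<And>x. \<sigma> x \<in> tot B" "\<And>x. prj B (\<sigma> x) = x"
    "\<And>x. \<exists>V \<Phi> O1. (V, \<Phi>) \<in> triv B \<and> open O1 \<and> x \<in> O1 \<and> O1 \<subseteq> V \<and> smooth_wrt A O1 (\<lambda>x. \<Phi> (\<sigma> x))"
  shows "\<sigma> \<in> sections A B"
  unfolding sections_def
proof (intro CollectI conjI allI ballI)
  fix T assume "T \<in> triv B"
  moreover obtain W \<Psi> where T: "T = (W, \<Psi>)" by force
  ultimately have t: "(W, \<Psi>) \<in> triv B" by simp
  have "smooth_wrt A W (\<lambda>x. \<Psi> (\<sigma> x))"
  proof (rule smooth_wrt_local)
    fix x assume "x \<in> W"
    obtain V \<Phi> O1 where V: "(V, \<Phi>) \<in> triv B" "open O1" "x \<in> O1" "O1 \<subseteq> V" "smooth_wrt A O1 (\<lambda>x. \<Phi> (\<sigma> x))"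
      using assms(3)[of x] by blast
    have "smooth_wrt A (O1 \<inter> W) (\<lambda>x. \<Psi> (\<sigma> x))"
      using V triv_open[OF t] assms smooth_wrt_subset[OF V(5)]
      by (intro smooth_wrt_change_triv[OF V(1) t]) auto
    then show "\<exists>O1. open O1 \<and> x \<in> O1 \<and> smooth_wrt A O1 (\<lambda>x. \<Psi> (\<sigma> x))"
      using V \<open>x \<in> W\<close> triv_open[OF t] by blast
  qed
  then show "case T of (V, \<Phi>) \<Rightarrow> smooth_wrt A V (\<Phi> \<circ> \<sigma>)" using T by (simp add: comp_def)
qed (use assms in auto)

lemma section_eqI:
  assumes "\<sigma> \<in> sections A B" "\<rho> \<in> sections A B"
    "\<And>x V \<Phi>. (V, \<Phi>) \<in> triv B \<Longrightarrow> x \<in> V \<Longrightarrow> \<Phi> (\<sigma> x) = \<Phi> (\<rho> x)"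
  shows "\<sigma> = \<rho>"
  using assms by (intro ext vec_eqI') auto

lemma zero_section: "zero_vec B \<in> sections A B"
proof (rule sectionI)
  fix x obtain V \<Phi> where t: "(V, \<Phi>) \<in> triv B" "x \<in> V" using triv_cover by blast
  moreover have "smooth_wrt A V (\<lambda>x. \<Phi> (zero_vec B x))"
    by (rule smooth_wrt_cong[OF triv_open[OF t(1)] _ smooth_wrt_const[of _ 0]]) (use t in simp)
  ultimately show "\<exists>V \<Phi> O1. (V, \<Phi>) \<in> triv B \<and> open O1 \<and> x \<in> O1 \<and> O1 \<subseteq> V \<and>
      smooth_wrt A O1 (\<lambda>x. \<Phi> (zero_vec B x))" using triv_open by blast
qed simp_all

lemma add_sec_coord:
  assumes "\<sigma> \<in> sections A B" "\<rho> \<in> sections A B" "(V, \<Phi>) \<in> triv B" "x \<in> V"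
  shows "\<Phi> (add_sec B \<sigma> \<rho> x) = \<Phi> (\<sigma> x) + \<Phi> (\<rho> x)"
  unfolding add_sec_def using assms by (subst add_vec) auto

lemma mult_sec_coord:
  assumes "\<sigma> \<in> sections A B" "(V, \<Phi>) \<in> triv B" "x \<in> V"
  shows "\<Phi> (mult_sec B f \<sigma> x) = f x *\<^sub>R \<Phi> (\<sigma> x)"
  unfolding mult_sec_def using assms by (subst scale_vec) auto

lemma sum_sec_coord:
  assumes "\<And>i. i \<in> I \<Longrightarrow> \<sigma> i \<in> sections A B" "(V, \<Phi>) \<in> triv B" "x \<in> V"
  shows "\<Phi> (sum_sec B I \<sigma> x) = (\<Sum>i\<in>I. \<Phi> (\<sigma> i x))"
  unfolding sum_sec_def using assms by (subst sum_vec) auto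

lemma add_section:
  assumes "\<sigma> \<in> sections A B" "\<rho> \<in> sections A B"
  shows "add_sec B \<sigma> \<rho> \<in> sections A B"
proof (rule sectionI)
  fix x obtain V \<Phi> where t: "(V, \<Phi>) \<in> triv B" "x \<in> V" using triv_cover by blast
  have "smooth_wrt A V (\<lambda>x. \<Phi> (add_sec B \<sigma> \<rho> x))"
    by (rule smooth_wrt_cong[OF triv_open[OF t(1)] _ smooth_wrt_add[OF assms[THEN section_smooth, OF t(1)]]])
       (use t assms in \<open>simp add: add_sec_coord\<close>)
  then show "\<exists>V \<Phi> O1. (V, \<Phi>) \<in> triv B \<and> open O1 \<and> x \<in> O1 \<and> O1 \<subseteq> V \<and>
      smooth_wrt A O1 (\<lambda>x. \<Phi> (add_sec B \<sigma> \<rho> x))" using t triv_open by blast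
qed (use assms in \<open>simp_all add: add_sec_def add_vec\<close>)

lemma mult_section:
  assumes "f \<in> Cinf A" "\<sigma> \<in> sections A B"
  shows "mult_sec B f \<sigma> \<in> sections A B"
proof (rule sectionI)
  fix x obtain V \<Phi> where t: "(V, \<Phi>) \<in> triv B" "x \<in> V" using triv_cover by blast
  have "smooth_wrt A V f" using assms(1) smooth_wrt_subset unfolding Cinf_def by blast
  then have "smooth_wrt A V (\<lambda>x. \<Phi> (mult_sec B f \<sigma> x))"
    by (rule smooth_wrt_cong[OF triv_open[OF t(1)] _ smooth_wrt_scaleR[OF _ section_smooth[OF assms(2) t(1)]], rotated])
       (use t assms in \<open>simp add: mult_sec_coord\<close>)
  then show "\<exists>V \<Phi> O1. (V, \<Phi>) \<in> triv B \<and> open O1 \<and> x \<in> O1 \<and> O1 \<subseteq> V \<and>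
      smooth_wrt A O1 (\<lambda>x. \<Phi> (mult_sec B f \<sigma> x))" using t triv_open by blast
qed (use assms in \<open>simp_all add: mult_sec_def scale_vec\<close>)

lemma cmult_section: "\<sigma> \<in> sections A B \<Longrightarrow> mult_sec B (\<lambda>_. c) \<sigma> \<in> sections A B"
  by (intro mult_section Cinf_const)

lemma neg_section: "\<sigma> \<in> sections A B \<Longrightarrow> neg_sec B \<sigma> \<in> sections A B"
  unfolding neg_sec_def by (rule cmult_section)

lemma sum_section:
  assumes "\<And>i. i \<in> I \<Longrightarrow> \<sigma> i \<in> sections A B"
  shows "sum_sec B I \<sigma> \<in> sections A B"
proof (rule sectionI)
  fix x obtain V \<Phi> where t: "(V, \<Phi>) \<in> triv B" "x \<in> V" using triv_cover by blast
  have "smooth_wrt A V (\<lambda>x. \<Sum>i\<in>I. \<Phi> (\<sigma> i x))"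
    by (intro smooth_wrt_sum section_smooth[OF assms t(1)])
  then have "smooth_wrt A V (\<lambda>x. \<Phi> (sum_sec B I \<sigma> x))"
    by (rule smooth_wrt_cong[OF triv_open[OF t(1)], rotated]) (use t assms in \<open>simp add: sum_sec_coord\<close>)
  then show "\<exists>V \<Phi> O1. (V, \<Phi>) \<in> triv B \<and> open O1 \<and> x \<in> O1 \<and> O1 \<subseteq> V \<and>
      smooth_wrt A O1 (\<lambda>x. \<Phi> (sum_sec B I \<sigma> x))" using t triv_open by blast
qed (use assms in \<open>simp_all add: sum_sec_def sum_vec\<close>)

lemma local_section:
  assumes t: "(V, \<Phi>) \<in> triv B" and K: "closed K" "K \<subseteq> V" and u: "smooth_wrt A V u"
    "\<And>x. x \<in> V - K \<Longrightarrow> u x = 0"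
  obtains \<sigma> where "\<sigma> \<in> sections A B" "\<And>x. x \<in> V \<Longrightarrow> \<Phi> (\<sigma> x) = u x" "\<And>x. x \<notin> K \<Longrightarrow> \<sigma> x = zero_vec B x"
proof -
  have "\<exists>e. e \<in> tot B \<and> prj B e = x \<and> (if x \<in> V then \<Phi> e = u x else e = zero_vec B x)" for x
    using fibre_ex[OF t, of x "u x"] zero_vec by metis
  then obtain \<sigma> where \<sigma>: "\<And>x. \<sigma> x \<in> tot B" "\<And>x. prj B (\<sigma> x) = x" "\<And>x. x \<in> V \<Longrightarrow> \<Phi> (\<sigma> x) = u x"
    "\<And>x. x \<notin> V \<Longrightarrow> \<sigma> x = zero_vec B x" by metis
  have z: "\<sigma> x = zero_vec B x" if "x \<notin> K" for x
  proof (cases "x \<in> V")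
    case True
    then show ?thesis using \<sigma> u(2) that t by (intro vec_eqI[OF t]) auto
  qed (use \<sigma> in blast)
  have "\<sigma> \<in> sections A B"
  proof (rule sectionI)
    fix x
    show "\<exists>V \<Phi> O1. (V, \<Phi>) \<in> triv B \<and> open O1 \<and> x \<in> O1 \<and> O1 \<subseteq> V \<and> smooth_wrt A O1 (\<lambda>x. \<Phi> (\<sigma> x))"
    proof (cases "x \<in> V")
      case True
      have "smooth_wrt A V (\<lambda>x. \<Phi> (\<sigma> x))"
        by (rule smooth_wrt_cong[OF triv_open[OF t] _ u(1)]) (use \<sigma> in simp)
      then show ?thesis using True t triv_open by blast
    next
      case False
      obtain W \<Psi> where w: "(W, \<Psi>) \<in> triv B" "x \<in> W" using triv_cover by blast
      have "smooth_wrt A (W - K) (\<lambda>x. \<Psi> (\<sigma> x))"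
        by (rule smooth_wrt_cong[OF _ _ smooth_wrt_const[of _ 0]]) (use w z K triv_open in \<open>auto intro: open_Diff\<close>)
      moreover have "open (W - K)" "x \<in> W - K"
        using open_Diff[OF triv_open[OF w(1)] K(1)] w(2) False K(2) by auto
      ultimately show ?thesis using w(1) by blast
    qed
  qed (use \<sigma> in auto)
  then show thesis using that \<sigma> z by blast
qed

end

section \<open>First order operators on line bundles\<close>

locale line_bundle_over = vbundle_over A L
  for A :: "('m::topological_space, 'a::real_inner) atlas"
    and L :: "('t::topological_space, 'm, real) vbundle"
begin

lemma mult_mult_sec:
  assumes "f \<in> Cinf A" "g \<in> Cinf A" "\<sigma> \<in> sections A L"
  shows "mult_sec L f (mult_sec L g \<sigma>) = mult_sec L (\<lambda>z. f z * g z) \<sigma>"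
  using assms by (intro section_eqI mult_section Cinf_mult) (auto simp: mult_sec_coord mult_section)

lemma Cinf_derivative:
  assumes "f \<in> Cinf A" "(U, \<phi>) \<in> A" "y \<in> U"
  shows "((\<lambda>z. f (inv_into U \<phi> z)) has_derivative
    frechet_derivative (\<lambda>z. f (inv_into U \<phi> z)) (at (\<phi> y))) (at (\<phi> y))"
proof (rule smooth_on_frechet_derivative)
  show "smooth_on (\<phi> ` (U \<inter> UNIV)) (\<lambda>z. f (inv_into U \<phi> z))"
    using smooth_wrtD[of UNIV f U \<phi>] assms unfolding Cinf_def comp_def by simp
qed (use assms in simp)

lemma section_derivative:
  assumes "\<sigma> \<in> sections A L" "(U, \<phi>) \<in> A" "(V, \<Psi>) \<in> triv L" "y \<in> U" "y \<in> V"
  shows "\<exists>D. ((\<lambda>z. \<Psi> (\<sigma> (inv_into U \<phi> z))) has_derivative D) (at (\<phi> y))"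
proof (rule smooth_on_differentiable)
  show "smooth_on (\<phi> ` (U \<inter> V)) (\<lambda>z. \<Psi> (\<sigma> (inv_into U \<phi> z)))"
    using smooth_wrtD[OF section_smooth[OF assms(1,3)] assms(2)] unfolding comp_def .
qed (use assms in simp)

text \<open>The co-symbol in coordinates: as the factor vanishes at \<open>y\<close>, the derivative
  of \<open>\<sigma>\<close> does not enter and only df times the value of \<open>\<sigma>\<close>
  remains.\<close>

lemma vanishing_multiple_derivative:
  assumes "f \<in> Cinf A" "\<sigma> \<in> sections A L" "(U, \<phi>) \<in> A" "(V, \<Psi>) \<in> triv L" "y \<in> U" "y \<in> V"
    and F: "((\<lambda>z. f (inv_into U \<phi> z)) has_derivative F) (at (\<phi> y))"
  shows "((\<lambda>z. \<Psi> (mult_sec L (\<lambda>z. f z - f y) \<sigma> (inv_into U \<phi> z))) has_derivative (\<lambda>w. F w * \<Psi> (\<sigma> y))) (at (\<phi> y))"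
proof -
  obtain D where D: "((\<lambda>z. \<Psi> (\<sigma> (inv_into U \<phi> z))) has_derivative D) (at (\<phi> y))"
    using section_derivative[OF assms(2-6)] by blast
  have "((\<lambda>z. (f (inv_into U \<phi> z) - f y) * \<Psi> (\<sigma> (inv_into U \<phi> z))) has_derivative
      (\<lambda>w. (f (inv_into U \<phi> (\<phi> y)) - f y) * D w + (F w - 0) * \<Psi> (\<sigma> (inv_into U \<phi> (\<phi> y))))) (at (\<phi> y))"
    by (intro has_derivative_mult has_derivative_diff F D has_derivative_const)
  then have d: "((\<lambda>z. (f (inv_into U \<phi> z) - f y) * \<Psi> (\<sigma> (inv_into U \<phi> z))) has_derivative
      (\<lambda>w. F w * \<Psi> (\<sigma> y))) (at (\<phi> y))"
    using assms by simp
  show ?thesis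
  proof (rule has_derivative_transform_within_open[OF d])
    show "open (\<phi> ` (U \<inter> V))" using chart_image_open[OF assms(3) triv_open[OF assms(4)]] .
    show "\<phi> y \<in> \<phi> ` (U \<inter> V)" using assms by blast
    fix z assume "z \<in> \<phi> ` (U \<inter> V)"
    then have "inv_into U \<phi> z \<in> V" using assms by auto
    then show "(f (inv_into U \<phi> z) - f y) * \<Psi> (\<sigma> (inv_into U \<phi> z)) =
        \<Psi> (mult_sec L (\<lambda>z. f z - f y) \<sigma> (inv_into U \<phi> z))"
      using mult_sec_coord[OF assms(2,4), of "inv_into U \<phi> z" "\<lambda>z. f z - f y"] by simp
  qed
qed

lemma local_generator:
  assumes "(V, \<Psi>) \<in> triv L" "open O1" "y \<in> O1" "O1 \<subseteq> V"
  obtains \<theta> \<kappa> N K where "\<theta> \<in> Cinf A" "\<kappa> \<in> sections A L" "open N" "y \<in> N" "N \<subseteq> K" "closed K" "K \<subseteq> O1"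
    "\<forall>z\<in>N. \<theta> z = 1" "\<forall>z. z \<notin> K \<longrightarrow> \<theta> z = 0"
    "\<forall>z\<in>V. \<Psi> (\<kappa> z) = \<theta> z" "\<forall>z. z \<notin> K \<longrightarrow> \<kappa> z = zero_vec L z"
proof -
  obtain \<theta> N K where b: "\<theta> \<in> Cinf A" "open N" "y \<in> N" "closed K" "N \<subseteq> K" "K \<subseteq> O1"
    "\<And>z. z \<in> N \<Longrightarrow> \<theta> z = 1" "\<And>z. z \<notin> K \<Longrightarrow> \<theta> z = 0" using bump[OF assms(2,3)] by metis
  have K: "K \<subseteq> V" using b(6) assms(4) by blast
  have s: "smooth_wrt A V \<theta>" using b(1) smooth_wrt_subset unfolding Cinf_def by blast
  obtain \<kappa> where \<kappa>: "\<kappa> \<in> sections A L" "\<And>x. x \<in> V \<Longrightarrow> \<Psi> (\<kappa> x) = \<theta> x" "\<And>x. x \<notin> K \<Longrightarrow> \<kappa> x = zero_vec L x"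
    using local_section[OF assms(1) b(4) K s] b(8) by (metis DiffE)
  show thesis using b \<kappa> by (intro that[of \<theta> \<kappa> N K]) auto
qed

lemma fo_section: "first_order_op A L D \<Longrightarrow> \<sigma> \<in> sections A L \<Longrightarrow> D \<sigma> \<in> sections A L"
  by (simp add: first_order_op_def)

lemma fo_add:
  assumes "first_order_op A L D" "\<sigma> \<in> sections A L" "\<rho> \<in> sections A L" "(V, \<Psi>) \<in> triv L" "y \<in> V"
  shows "\<Psi> (D (add_sec L \<sigma> \<rho>) y) = \<Psi> (D \<sigma> y) + \<Psi> (D \<rho> y)"
proof -
  have "D (add_sec L \<sigma> \<rho>) = add_sec L (D \<sigma>) (D \<rho>)"
    using assms(1-3) unfolding first_order_op_def by blast
  then show ?thesis using assms by (simp add: add_sec_coord fo_section)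
qed

lemma fo_cmult:
  assumes "first_order_op A L D" "\<sigma> \<in> sections A L" "(V, \<Psi>) \<in> triv L" "y \<in> V"
  shows "\<Psi> (D (mult_sec L (\<lambda>_. c) \<sigma>) y) = c * \<Psi> (D \<sigma> y)"
proof -
  have "D (mult_sec L (\<lambda>_. c) \<sigma>) = mult_sec L (\<lambda>_. c) (D \<sigma>)"
    using assms(1-2) unfolding first_order_op_def by blast
  then show ?thesis using assms by (simp add: mult_sec_coord fo_section)
qed

lemma fo_prod:
  assumes "first_order_op A L D" "f \<in> Cinf A" "g \<in> Cinf A" "\<sigma> \<in> sections A L" "(V, \<Psi>) \<in> triv L" "y \<in> V"
  shows "\<Psi> (D (mult_sec L (\<lambda>z. f z * g z) \<sigma>) y) =
    f y * \<Psi> (D (mult_sec L g \<sigma>) y) + g y * \<Psi> (D (mult_sec L f \<sigma>) y) - f y * g y * \<Psi> (D \<sigma> y)"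
proof -
  have "add_sec L (D (mult_sec L (\<lambda>z. f z * g z) \<sigma>)) (mult_sec L (\<lambda>z. f z * g z) (D \<sigma>)) =
        add_sec L (mult_sec L f (D (mult_sec L g \<sigma>))) (mult_sec L g (D (mult_sec L f \<sigma>)))"
    using assms(1-4) unfolding first_order_op_def by blast
  from arg_cong[OF this, of "\<lambda>\<tau>. \<Psi> (\<tau> y)"] show ?thesis
    using assms by (simp add: add_sec_coord mult_sec_coord mult_section Cinf_mult fo_section)
qed

lemma fo_zero:
  assumes "first_order_op A L D" "(V, \<Psi>) \<in> triv L" "y \<in> V"
  shows "\<Psi> (D (zero_vec L) y) = 0"
proof -
  have "mult_sec L (\<lambda>_. 0) (zero_vec L) = zero_vec L"
    by (intro section_eqI cmult_section zero_section) (simp add: mult_sec_coord zero_section)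
  then show ?thesis using fo_cmult[OF assms(1) zero_section assms(2,3), of 0] by simp
qed

lemma fo_sum:
  assumes "first_order_op A L D" "finite I" "\<And>i. i \<in> I \<Longrightarrow> \<sigma> i \<in> sections A L" "(V, \<Psi>) \<in> triv L" "y \<in> V"
  shows "\<Psi> (D (sum_sec L I \<sigma>) y) = (\<Sum>i\<in>I. \<Psi> (D (\<sigma> i) y))"
  using assms(2,3)
proof (induction I)
  case empty
  have "sum_sec L {} \<sigma> = zero_vec L"
  proof (intro section_eqI sum_section zero_section)
    fix x V \<Phi> assume "(V, \<Phi>) \<in> triv L" "x \<in> V"
    then show "\<Phi> (sum_sec L {} \<sigma> x) = \<Phi> (zero_vec L x)" using sum_sec_coord[of "{}" \<sigma> V \<Phi> x] by simp
  qed auto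
  then show ?case using fo_zero[OF assms(1,4,5)] by simp
next
  case (insert i I)
  have "sum_sec L (insert i I) \<sigma> = add_sec L (\<sigma> i) (sum_sec L I \<sigma>)"
  proof (intro section_eqI sum_section add_section insert.prems)
    fix x V \<Phi> assume "(V, \<Phi>) \<in> triv L" "x \<in> V"
    then show "\<Phi> (sum_sec L (insert i I) \<sigma> x) = \<Phi> (add_sec L (\<sigma> i) (sum_sec L I \<sigma>) x)"
      using insert sum_sec_coord[of "insert i I" \<sigma> V \<Phi> x] by (simp add: sum_sec_coord add_sec_coord sum_section)
  qed auto
  then show ?case using insert fo_add[OF assms(1) _ _ assms(4,5)] by (simp add: sum_section)
qed

lemma fo_vanish:
  assumes "first_order_op A L D" "f \<in> Cinf A" "g \<in> Cinf A" "\<sigma> \<in> sections A L" "(V, \<Psi>) \<in> triv L" "y \<in> V"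
    "f y = 0" "g y = 0"
  shows "\<Psi> (D (mult_sec L (\<lambda>z. f z * g z) \<sigma>) y) = 0"
  using fo_prod[OF assms(1-6)] assms(7,8) by simp

text \<open>By Hadamard's lemma and a cut-off, a section with vanishing first jet is a combination of
  multiples \<open>f g \<kappa>\<close> with \<open>f\<close>, \<open>g\<close> vanishing at the point, and those are annihilated.\<close>

lemma fo_zero_jet:
  assumes D: "first_order_op A L D" and \<nu>: "\<nu> \<in> sections A L"
    and c: "(U, \<phi>) \<in> A" "y \<in> U" and t: "(V, \<Psi>) \<in> triv L" "y \<in> V"
    and 0: "\<Psi> (\<nu> y) = 0" "((\<lambda>z. \<Psi> (\<nu> (inv_into U \<phi> z))) has_derivative (\<lambda>_. 0)) (at (\<phi> y))"
  shows "\<Psi> (D \<nu> y) = 0"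
proof -
  define a where "a z = \<Psi> (\<nu> (inv_into U \<phi> z))" for z
  define z0 where "z0 = \<phi> y"
  let ?G = "\<phi> ` (U \<inter> V)"
  have G: "open ?G" "z0 \<in> ?G" using chart_image_open[OF c(1) triv_open[OF t(1)]] c t by (auto simp: z0_def)
  have sa: "smooth_on ?G a"
    using smooth_wrtD[OF section_smooth[OF \<nu> t(1)] c(1)] unfolding a_def comp_def .
  obtain r where r: "r > 0" "cball z0 r \<subseteq> ?G" using G open_contains_cball by blast
  obtain \<rho> where \<rho>: "smooth_on UNIV \<rho>" "\<And>z. dist z0 z < r / 2 \<Longrightarrow> \<rho> z = 1"
    "\<And>z. dist z0 z \<ge> r \<Longrightarrow> \<rho> z = (0::real)" using smooth_bump[OF r(1), of z0] by blast
  \<comment> \<open>Hadamard's lemma integrates along segments issuing from \<open>z0\<close>, so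
    the coordinate expression is first cut off and extended to the whole model space.\<close>
  define h where "h z = (if z \<in> ?G then \<rho> z * a z else 0)" for z
  have h: "smooth_on UNIV h"
  proof (rule smooth_on_local)
    fix z
    show "\<exists>W. open W \<and> z \<in> W \<and> smooth_on W h"
    proof (cases "z \<in> ?G")
      case True
      have "smooth_on ?G (\<lambda>z. \<rho> z * a z)"
        by (intro smooth_on_mult sa smooth_on_subset[OF \<rho>(1)]) simp
      then have "smooth_on ?G h" by (rule smooth_on_cong[OF G(1), rotated]) (simp add: h_def)
      then show ?thesis using True G by blast
    next
      case False
      have "smooth_on (- cball z0 r) h"
        by (rule smooth_on_cong[OF _ _ smooth_on_const[of _ 0]]) (auto simp: h_def \<rho>(3))
      moreover have "open (- cball z0 r)" by (simp add: open_Compl)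
      ultimately show ?thesis using False r by blast
    qed
  qed
  have ha: "h z = a z" if "dist z0 z < r / 2" for z
    using that r \<rho>(2)[OF that] by (force simp: h_def subset_iff)
  have "(h has_derivative (\<lambda>_. 0)) (at z0)"
    using 0(2) unfolding a_def[symmetric] z0_def[symmetric]
    by (rule has_derivative_transform_within_open[of a _ _ _ "ball z0 (r / 2)"]) (use r ha in auto)
  then have h0: "frechet_derivative h (at z0) = (\<lambda>_. 0)" by (metis frechet_derivative_at)
  have hz0: "h z0 = 0" using ha[of z0] r 0(1) c by (simp add: a_def z0_def)
  obtain B :: "'a set" where B: "finite B" "\<And>x. x = (\<Sum>b\<in>B. (x \<bullet> b) *\<^sub>R b)"
    using finite_dim_orthonormal_basis[OF fd] by metis
  obtain q where q: "\<And>b. smooth_on UNIV (q b)" "\<And>b. q b z0 = frechet_derivative h (at z0) b"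
    "\<And>z. h z = h z0 + (\<Sum>b\<in>B. ((z - z0) \<bullet> b) * q b z)"
    using hadamard[OF fd h B, of z0] by blast
  define O1 where "O1 = V \<inter> (U \<inter> \<phi> -` ball z0 (r / 2))"
  have O1: "open O1" "y \<in> O1"
    unfolding O1_def using chart_preimage_open[OF c(1)] triv_open[OF t(1)] c t r by (auto simp: z0_def)
  have OV: "O1 \<subseteq> V" by (auto simp: O1_def)
  obtain \<theta> \<kappa> N K where b0: "\<theta> \<in> Cinf A" "\<kappa> \<in> sections A L" "open N" "y \<in> N" "N \<subseteq> K" "closed K" "K \<subseteq> O1"
    "\<forall>z\<in>N. \<theta> z = 1" "\<forall>z. z \<notin> K \<longrightarrow> \<theta> z = 0"
    "\<forall>z\<in>V. \<Psi> (\<kappa> z) = \<theta> z" "\<forall>z. z \<notin> K \<longrightarrow> \<kappa> z = zero_vec L z"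
    by (rule local_generator[OF t(1) O1 OV], rule that)
  note b = b0[rule_format]
  have ext: "(\<lambda>m. if m \<in> O1 then \<theta> m * p (\<phi> m) else 0) \<in> Cinf A" if "smooth_on UNIV p" for p :: "'a \<Rightarrow> real"
    unfolding Cinf_def
  proof (intro CollectI smooth_wrt_extend[OF O1(1) b(6,7)] smooth_wrt_mult)
    show "smooth_wrt A O1 \<theta>" using b(1) smooth_wrt_subset unfolding Cinf_def by blast
    have "smooth_wrt A U (\<lambda>m. p (\<phi> m))"
      by (rule smooth_wrt_compose[OF fd smooth_wrt_chart[OF c(1)] that]) simp
    then show "smooth_wrt A O1 (\<lambda>m. p (\<phi> m))" by (rule smooth_wrt_subset) (auto simp: O1_def)
  qed (use b(9) in simp)
  define x where "x b m = (if m \<in> O1 then \<theta> m * ((\<phi> m - z0) \<bullet> b) else 0)" for b m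
  define f where "f b m = (if m \<in> O1 then \<theta> m * q b (\<phi> m) else 0)" for b m
  have x: "x b \<in> Cinf A" for b
    unfolding x_def[abs_def]
    by (rule ext) (intro smooth_on_inner smooth_on_diff smooth_on_const smooth_on_ident)
  have f: "f b \<in> Cinf A" for b
    unfolding f_def[abs_def] by (rule ext[OF q(1)])
  \<comment> \<open>The functions \<open>x b\<close> and \<open>f b\<close> and the section
    \<open>\<kappa>\<close> carry one factor \<open>\<theta>\<close> each, together the cube. The
    splitting of \<open>\<nu>\<close> below rests on 1 = (1 - \<eta>)^2 + \<eta> (2 - \<eta>): both
    factors \<open>1 - \<eta>\<close> vanish at \<open>y\<close>, so \<open>fo_vanish\<close>
    applies to the first part, and the second is supported where the expansion of \<open>h\<close>
    holds.\<close>
  define \<eta> where "\<eta> m = \<theta> m * \<theta> m * \<theta> m" for m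
  have \<eta>: "\<eta> \<in> Cinf A" unfolding \<eta>_def[abs_def] by (intro Cinf_mult b(1))
  have e1: "(\<lambda>m. 1 - \<eta> m) \<in> Cinf A" "(\<lambda>m. 2 - \<eta> m) \<in> Cinf A"
    by (intro Cinf_diff Cinf_const \<eta>)+
  define \<kappa>' where "\<kappa>' = mult_sec L (\<lambda>m. 2 - \<eta> m) \<kappa>"
  have \<kappa>': "\<kappa>' \<in> sections A L" unfolding \<kappa>'_def by (intro mult_section e1 b)
  define \<tau> where "\<tau> = sum_sec L B (\<lambda>b. mult_sec L (\<lambda>m. x b m * f b m) \<kappa>')"
  have \<tau>s: "mult_sec L (\<lambda>m. x b m * f b m) \<kappa>' \<in> sections A L" for b by (intro mult_section Cinf_mult x f \<kappa>')
  then have \<tau>: "\<tau> \<in> sections A L" unfolding \<tau>_def by (intro sum_section)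
  let ?\<nu>1 = "mult_sec L (\<lambda>m. (1 - \<eta> m) * (1 - \<eta> m)) \<nu>"
  have \<nu>1: "?\<nu>1 \<in> sections A L" by (intro mult_section Cinf_mult e1 \<nu>)
  have "\<nu> = add_sec L ?\<nu>1 \<tau>"
  proof (rule section_eqI[OF \<nu> add_section[OF \<nu>1 \<tau>]])
    fix m W \<Xi> assume w: "(W, \<Xi>) \<in> triv L" "m \<in> W"
    have L: "\<Xi> (add_sec L ?\<nu>1 \<tau> m) = (1 - \<eta> m) * (1 - \<eta> m) * \<Xi> (\<nu> m) +
        (\<Sum>b\<in>B. x b m * f b m * (2 - \<eta> m) * \<Xi> (\<kappa> m))"
      using w \<nu>1 \<tau> \<tau>s \<kappa>' b(2) \<nu> by (simp add: add_sec_coord mult_sec_coord \<tau>_def sum_sec_coord \<kappa>'_def mult.assoc)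
    show "\<Xi> (\<nu> m) = \<Xi> (add_sec L ?\<nu>1 \<tau> m)"
    proof (cases "m \<in> K")
      case False
      then show ?thesis using b(9,11) w unfolding L by (simp add: \<eta>_def)
    next
      case True
      then have m: "m \<in> O1" "m \<in> V" "m \<in> U" "dist z0 (\<phi> m) < r / 2" using b(7) by (auto simp: O1_def)
      have "(\<Sum>b\<in>B. x b m * f b m) = \<theta> m * \<theta> m * (\<Sum>b\<in>B. ((\<phi> m - z0) \<bullet> b) * q b (\<phi> m))"
        using m(1) by (simp add: x_def f_def sum_distrib_left mult_ac)
      also have "\<dots> = \<theta> m * \<theta> m * h (\<phi> m)" using q(3)[of "\<phi> m"] hz0 by simp
      also have "\<dots> = \<theta> m * \<theta> m * \<Psi> (\<nu> m)" using ha[OF m(4)] c(1) m(3) by (simp add: a_def)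
      finally have s: "(\<Sum>b\<in>B. x b m * f b m) = \<theta> m * \<theta> m * \<Psi> (\<nu> m)" .
      have "add_sec L ?\<nu>1 \<tau> m = \<nu> m"
      proof (rule vec_eqI[OF t(1)])
        have "\<Psi> (add_sec L ?\<nu>1 \<tau> m) = (1 - \<eta> m) * (1 - \<eta> m) * \<Psi> (\<nu> m) +
          (\<Sum>b\<in>B. x b m * f b m * (2 - \<eta> m) * \<Psi> (\<kappa> m))"
          using t m \<nu>1 \<tau> \<tau>s \<kappa>' b(2) \<nu> by (simp add: add_sec_coord mult_sec_coord \<tau>_def sum_sec_coord \<kappa>'_def mult.assoc)
        also have "\<dots> = (1 - \<eta> m) * (1 - \<eta> m) * \<Psi> (\<nu> m) + \<theta> m * \<theta> m * \<Psi> (\<nu> m) * (2 - \<eta> m) * \<theta> m"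
          unfolding sum_distrib_right[symmetric] s b(10)[OF m(2)] by simp
        also have "\<dots> = \<Psi> (\<nu> m)" by (simp add: \<eta>_def algebra_simps)
        finally show "\<Psi> (add_sec L ?\<nu>1 \<tau> m) = \<Psi> (\<nu> m)" .
      qed (use m \<nu> add_section[OF \<nu>1 \<tau>] in auto)
      then show ?thesis by simp
    qed
  qed
  then have "\<Psi> (D \<nu> y) = \<Psi> (D ?\<nu>1 y) + \<Psi> (D \<tau> y)"
    using fo_add[OF D \<nu>1 \<tau> t] by simp
  moreover have "\<Psi> (D ?\<nu>1 y) = 0"
    using b(8)[OF b(4)] by (intro fo_vanish[OF D e1(1) e1(1) \<nu> t]) (simp_all add: \<eta>_def)
  moreover have "\<Psi> (D \<tau> y) = (\<Sum>b\<in>B. \<Psi> (D (mult_sec L (\<lambda>m. x b m * f b m) \<kappa>') y))"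
    unfolding \<tau>_def by (rule fo_sum[OF D B(1) \<tau>s t])
  moreover have "\<Psi> (D (mult_sec L (\<lambda>m. x b m * f b m) \<kappa>') y) = 0" for b
    by (rule fo_vanish[OF D x f \<kappa>' t])
       (use q(2)[of b] h0 O1 in \<open>simp_all add: x_def f_def z0_def\<close>)
  ultimately show ?thesis by simp
qed

lemma fo_jet:
  assumes D: "first_order_op A L D" and \<nu>: "\<nu> \<in> sections A L" "\<mu> \<in> sections A L"
    and c: "(U, \<phi>) \<in> A" "y \<in> U" and t: "(V, \<Psi>) \<in> triv L" "y \<in> V"
    and 0: "\<Psi> (\<mu> y) = \<Psi> (\<nu> y)"
    "((\<lambda>z. \<Psi> (\<mu> (inv_into U \<phi> z)) - \<Psi> (\<nu> (inv_into U \<phi> z))) has_derivative (\<lambda>_. 0)) (at (\<phi> y))"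
  shows "D \<mu> y = D \<nu> y"
proof -
  let ?\<delta> = "add_sec L \<mu> (mult_sec L (\<lambda>_. - 1) \<nu>)"
  have \<delta>: "?\<delta> \<in> sections A L" by (intro add_section cmult_section \<nu>)
  have co: "\<Psi> (?\<delta> x) = \<Psi> (\<mu> x) - \<Psi> (\<nu> x)" if "x \<in> V" for x
    using that t \<nu> by (simp add: add_sec_coord cmult_section mult_sec_coord)
  have "\<Psi> (D ?\<delta> y) = 0"
  proof (rule fo_zero_jet[OF D \<delta> c t])
    show "\<Psi> (?\<delta> y) = 0" using co[OF t(2)] 0 by simp
    show "((\<lambda>z. \<Psi> (?\<delta> (inv_into U \<phi> z))) has_derivative (\<lambda>_. 0)) (at (\<phi> y))"
    proof (rule has_derivative_transform_within_open[OF 0(2)])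
      show "open (\<phi> ` (U \<inter> V))" using chart_image_open[OF c(1) triv_open[OF t(1)]] .
      show "\<phi> y \<in> \<phi> ` (U \<inter> V)" using c t by blast
      fix z assume "z \<in> \<phi> ` (U \<inter> V)"
      then have "inv_into U \<phi> z \<in> V" using c by auto
      then show "\<Psi> (\<mu> (inv_into U \<phi> z)) - \<Psi> (\<nu> (inv_into U \<phi> z)) = \<Psi> (?\<delta> (inv_into U \<phi> z))"
        using co by simp
    qed
  qed
  then have "\<Psi> (D \<mu> y) = \<Psi> (D \<nu> y)"
    using fo_add[OF D \<nu>(2) cmult_section[OF \<nu>(1)] t, of "- 1"] fo_cmult[OF D \<nu>(1) t, of "- 1"] by simp
  then show ?thesis
    using fo_section[OF D] \<nu> t by (intro vec_eqI[OF t(1)]) auto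
qed

lemma fo_vanishing_multiple_cong:
  assumes D: "first_order_op A L D" and f: "f \<in> Cinf A" "f' \<in> Cinf A" and \<sigma>: "\<sigma> \<in> sections A L" "\<sigma>' \<in> sections A L"
    and c: "(U, \<phi>) \<in> A" "y \<in> U" and t: "(V, \<Psi>) \<in> triv L" "y \<in> V"
    and F: "((\<lambda>z. f (inv_into U \<phi> z)) has_derivative F) (at (\<phi> y))"
      "((\<lambda>z. f' (inv_into U \<phi> z)) has_derivative F') (at (\<phi> y))"
    and eq: "\<And>w. F w * \<Psi> (\<sigma> y) = F' w * \<Psi> (\<sigma>' y)"
  shows "D (mult_sec L (\<lambda>z. f z - f y) \<sigma>) y = D (mult_sec L (\<lambda>z. f' z - f' y) \<sigma>') y"
proof (rule fo_jet[OF D _ _ c t])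
  show "mult_sec L (\<lambda>z. f z - f y) \<sigma> \<in> sections A L" "mult_sec L (\<lambda>z. f' z - f' y) \<sigma>' \<in> sections A L"
    using f \<sigma> by (auto intro!: mult_section Cinf_diff Cinf_const)
  show "\<Psi> (mult_sec L (\<lambda>z. f z - f y) \<sigma> y) = \<Psi> (mult_sec L (\<lambda>z. f' z - f' y) \<sigma>' y)"
    using t \<sigma> by (simp add: mult_sec_coord)
  show "((\<lambda>z. \<Psi> (mult_sec L (\<lambda>z. f z - f y) \<sigma> (inv_into U \<phi> z)) -
      \<Psi> (mult_sec L (\<lambda>z. f' z - f' y) \<sigma>' (inv_into U \<phi> z))) has_derivative (\<lambda>_. 0)) (at (\<phi> y))"
    using has_derivative_diff[OF
        vanishing_multiple_derivative[OF f(1) \<sigma>(1) c(1) t(1) c(2) t(2) F(1)]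
        vanishing_multiple_derivative[OF f(2) \<sigma>(2) c(1) t(1) c(2) t(2) F(2)]] eq by simp
qed

text \<open>The commutator \<open>T\<close> of \<open>D\<close> with multiplication by
  \<open>g\<close> is linear over functions, because \<open>D\<close> has order at most one. Hence
  \<open>T \<nu>\<close> is a fixed multiple of the value of \<open>\<nu>\<close> at
  \<open>y\<close>, and this multiple is the number described in \<open>symbol\<close>.\<close>

lemma fo_symbol:
  assumes D: "first_order_op A L D" and g: "g \<in> Cinf A" and \<mu>: "\<mu> \<in> sections A L"
    and t: "(V, \<Psi>) \<in> triv L" "y \<in> V"
  shows "\<Psi> (D (mult_sec L g \<mu>) y) = symbol A L D g y * \<Psi> (\<mu> y) + g y * \<Psi> (D \<mu> y)"
proof -
  obtain \<theta> \<kappa> N K where b0: "\<theta> \<in> Cinf A" "\<kappa> \<in> sections A L" "open N" "y \<in> N" "N \<subseteq> K" "closed K" "K \<subseteq> V"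
    "\<forall>z\<in>N. \<theta> z = 1" "\<forall>z. z \<notin> K \<longrightarrow> \<theta> z = 0"
    "\<forall>z\<in>V. \<Psi> (\<kappa> z) = \<theta> z" "\<forall>z. z \<notin> K \<longrightarrow> \<kappa> z = zero_vec L z"
    by (rule local_generator[OF t(1) triv_open[OF t(1)] t(2) order.refl], rule that)
  note b = b0[rule_format]
  have 1: "\<theta> y = 1" "\<Psi> (\<kappa> y) = 1" using b(4,8,10) t by auto
  define T where "T \<nu> = \<Psi> (D (mult_sec L g \<nu>) y) - g y * \<Psi> (D \<nu> y)" for \<nu>
  have T: "T (mult_sec L h \<nu>) = h y * T \<nu>" if "h \<in> Cinf A" "\<nu> \<in> sections A L" for h \<nu>
    unfolding T_def mult_mult_sec[OF g that] fo_prod[OF D g that t] by (simp add: algebra_simps)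
  have key: "T \<nu> = \<Psi> (\<nu> y) * T \<kappa>" if \<nu>: "\<nu> \<in> sections A L" for \<nu>
  proof -
    define m where "m z = (if z \<in> V then \<theta> z * \<Psi> (\<nu> z) else 0)" for z
    have m: "m \<in> Cinf A"
      unfolding Cinf_def m_def[abs_def]
    proof (intro CollectI smooth_wrt_extend[OF triv_open[OF t(1)] b(6,7)] smooth_wrt_mult section_smooth[OF \<nu> t(1)])
      show "smooth_wrt A V \<theta>" using b(1) smooth_wrt_subset unfolding Cinf_def by blast
    qed (use b(9) in simp)
    \<comment> \<open>The coordinate of \<open>\<nu>\<close> becomes a global function
      \<open>m\<close> only after multiplication by \<open>\<theta>\<close>, and
      \<open>\<kappa>\<close> is \<open>\<theta>\<close> times the local generator; this accounts
      for the square.\<close>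
    have "mult_sec L (\<lambda>z. \<theta> z * \<theta> z) \<nu> = mult_sec L m \<kappa>"
    proof (rule section_eqI)
      fix x W \<Xi> assume w: "(W, \<Xi>) \<in> triv L" "x \<in> W"
      have "mult_sec L (\<lambda>z. \<theta> z * \<theta> z) \<nu> x = mult_sec L m \<kappa> x"
      proof (cases "x \<in> K")
        case True
        then show ?thesis using \<nu> b(1,2,7,10) t m
          by (intro vec_eqI[OF t(1)]) (auto simp: mult_sec_coord m_def mult_section Cinf_mult)
      next
        case False
        then show ?thesis using \<nu> b(1,2,9) w m
          by (intro vec_eqI[OF w(1)]) (auto simp: mult_sec_coord m_def mult_section Cinf_mult)
      qed
      then show "\<Xi> (mult_sec L (\<lambda>z. \<theta> z * \<theta> z) \<nu> x) = \<Xi> (mult_sec L m \<kappa> x)" by simp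
    qed (use b m \<nu> in \<open>auto intro!: mult_section Cinf_mult\<close>)
    then have "T \<nu> = m y * T \<kappa>"
      using T[of "\<lambda>z. \<theta> z * \<theta> z" \<nu>] T[of m \<kappa>] \<nu> b(1,2) m 1 by (simp add: Cinf_mult)
    then show ?thesis using t 1 by (simp add: m_def)
  qed
  let ?P = "\<lambda>c. \<forall>\<mu>\<in>sections A L. D (mult_sec L g \<mu>) y =
    add_vec L (scale_vec L c (\<mu> y)) (scale_vec L (g y) (D \<mu> y))"
  have co: "\<Psi> (add_vec L (scale_vec L c (\<mu> y)) (scale_vec L (g y) (D \<mu> y))) = c * \<Psi> (\<mu> y) + g y * \<Psi> (D \<mu> y)"
    "add_vec L (scale_vec L c (\<mu> y)) (scale_vec L (g y) (D \<mu> y)) \<in> tot L"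
    "prj L (add_vec L (scale_vec L c (\<mu> y)) (scale_vec L (g y) (D \<mu> y))) = y"
    if "\<mu> \<in> sections A L" for c \<mu>
    using that fo_section[OF D that] t by (simp_all add: add_vec scale_vec)
  have "?P (T \<kappa>)"
  proof
    fix \<mu> assume \<mu>: "\<mu> \<in> sections A L"
    show "D (mult_sec L g \<mu>) y = add_vec L (scale_vec L (T \<kappa>) (\<mu> y)) (scale_vec L (g y) (D \<mu> y))"
      using key[OF \<mu>] \<mu> t fo_section[OF D mult_section[OF g \<mu>]] co[OF \<mu>]
      by (intro vec_eqI[OF t(1)]) (auto simp: T_def algebra_simps)
  qed
  moreover have "c = T \<kappa>" if "?P c" for c
    using bspec[OF that b(2)] co(1)[OF b(2), of c] 1 by (simp add: T_def)
  ultimately have "symbol A L D g y = T \<kappa>" unfolding symbol_def by (intro the_equality)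
  then show ?thesis using \<open>?P (T \<kappa>)\<close> co(1)[OF \<mu>] \<mu> by simp
qed


section \<open>Jets and symbols of bi-differential operators\<close>

definition bidiffop :: "('m, 't) multiop \<Rightarrow> bool" where
  "bidiffop Q \<longleftrightarrow> (\<forall>\<mu>\<in>sections A L. first_order_op A L (\<lambda>\<nu>. Q [\<nu>, \<mu>]) \<and> first_order_op A L (\<lambda>\<nu>. Q [\<mu>, \<nu>]))"

lemma bidiffopD:
  "bidiffop Q \<Longrightarrow> \<mu> \<in> sections A L \<Longrightarrow> first_order_op A L (\<lambda>\<nu>. Q [\<nu>, \<mu>])"
  "bidiffop Q \<Longrightarrow> \<mu> \<in> sections A L \<Longrightarrow> first_order_op A L (\<lambda>\<nu>. Q [\<mu>, \<nu>])"
  by (auto simp: bidiffop_def)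

lemma multi_diffop_bidiffop:
  assumes "multi_diffop A L 2 Q" shows "bidiffop Q"
  unfolding bidiffop_def
proof
  fix \<mu> assume \<mu>: "\<mu> \<in> sections A L"
  have "first_order_op A L (\<lambda>\<nu>. Q ([\<mu>, \<mu>][i := \<nu>]))" if "i < 2" for i
  proof -
    have "set [\<mu>, \<mu>] \<subseteq> sections A L \<and> length [\<mu>, \<mu>] = 2" using \<mu> by simp
    then show ?thesis using assms that unfolding multi_diffop_def by blast
  qed
  from this[of 0] this[of 1]
  show "first_order_op A L (\<lambda>\<nu>. Q [\<nu>, \<mu>]) \<and> first_order_op A L (\<lambda>\<nu>. Q [\<mu>, \<nu>])" by simp
qed

lemma bidiffop_section: "bidiffop Q \<Longrightarrow> \<sigma> \<in> sections A L \<Longrightarrow> \<mu> \<in> sections A L \<Longrightarrow> Q [\<sigma>, \<mu>] \<in> sections A L"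
  using fo_section bidiffopD(1) by blast

text \<open>Polarization of the vanishing on equal entries.\<close>

lemma multi_diffop_skew:
  assumes Q: "multi_diffop A L 2 Q" and s: "\<sigma> \<in> sections A L" "\<mu> \<in> sections A L" and t: "(V, \<Psi>) \<in> triv L" "y \<in> V"
  shows "\<Psi> (Q [\<sigma>, \<mu>] y) = - \<Psi> (Q [\<mu>, \<sigma>] y)"
proof -
  note b = multi_diffop_bidiffop[OF Q]
  have z: "\<Psi> (Q [\<nu>, \<nu>] y) = 0" if "\<nu> \<in> sections A L" for \<nu>
  proof -
    have "\<forall>i<2. \<forall>j<2. i \<noteq> j \<and> [\<nu>, \<nu>] ! i = [\<nu>, \<nu>] ! j \<longrightarrow> Q [\<nu>, \<nu>] = zero_vec L"
      using Q that unfolding multi_diffop_def by auto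
    from this[rule_format, of 0 1] show ?thesis using t by simp
  qed
  have a: "add_sec L \<sigma> \<mu> \<in> sections A L" using s by (rule add_section)
  have "0 = \<Psi> (Q [add_sec L \<sigma> \<mu>, add_sec L \<sigma> \<mu>] y)" using z[OF a] by simp
  also have "\<dots> = \<Psi> (Q [\<sigma>, add_sec L \<sigma> \<mu>] y) + \<Psi> (Q [\<mu>, add_sec L \<sigma> \<mu>] y)"
    by (rule fo_add[OF bidiffopD(1)[OF b a] s t])
  also have "\<dots> = \<Psi> (Q [\<sigma>, \<mu>] y) + \<Psi> (Q [\<mu>, \<sigma>] y)"
    using fo_add[OF bidiffopD(2)[OF b s(1)] s t] fo_add[OF bidiffopD(2)[OF b s(2)] s t] z[OF s(1)] z[OF s(2)]
    by simp
  finally show ?thesis by simp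
qed

lemma mem_jet_iff:
  "\<mu> \<in> jet A L y \<sigma> \<longleftrightarrow> \<mu> \<in> sections A L \<and> (\<forall>U \<phi> V \<Psi>. (U, \<phi>) \<in> A \<longrightarrow> (V, \<Psi>) \<in> triv L \<longrightarrow> y \<in> U \<longrightarrow> y \<in> V \<longrightarrow>
    \<Psi> (\<mu> y) = \<Psi> (\<sigma> y) \<and>
    ((\<lambda>z. \<Psi> (\<mu> (inv_into U \<phi> z)) - \<Psi> (\<sigma> (inv_into U \<phi> z))) has_derivative (\<lambda>_. 0)) (at (\<phi> y)))"
  unfolding jet_def by (simp add: split_beta Ball_def) blast

lemma mem_jet: "\<sigma> \<in> sections A L \<Longrightarrow> \<sigma> \<in> jet A L y \<sigma>"
  by (simp add: mem_jet_iff)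

lemma jet_eqI:
  assumes "\<mu> \<in> jet A L y \<sigma>"
  shows "jet A L y \<mu> = jet A L y \<sigma>"
proof (intro equalityI subsetI)
  fix \<xi> assume x: "\<xi> \<in> jet A L y \<mu>"
  show "\<xi> \<in> jet A L y \<sigma>"
    unfolding mem_jet_iff
  proof (intro conjI allI impI)
    fix U \<phi> V \<Psi> assume a: "(U, \<phi>) \<in> A" "(V, \<Psi>) \<in> triv L" "y \<in> U" "y \<in> V"
    note 1 = assms[unfolded mem_jet_iff, THEN conjunct2, rule_format, OF a]
    note 2 = x[unfolded mem_jet_iff, THEN conjunct2, rule_format, OF a]
    show "\<Psi> (\<xi> y) = \<Psi> (\<sigma> y)" using 1 2 by simp
    show "((\<lambda>z. \<Psi> (\<xi> (inv_into U \<phi> z)) - \<Psi> (\<sigma> (inv_into U \<phi> z))) has_derivative (\<lambda>_. 0)) (at (\<phi> y))"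
      using has_derivative_add[OF conjunct2[OF 2] conjunct2[OF 1]] by simp
  qed (use x in \<open>simp add: mem_jet_iff\<close>)
next
  fix \<xi> assume x: "\<xi> \<in> jet A L y \<sigma>"
  show "\<xi> \<in> jet A L y \<mu>"
    unfolding mem_jet_iff
  proof (intro conjI allI impI)
    fix U \<phi> V \<Psi> assume a: "(U, \<phi>) \<in> A" "(V, \<Psi>) \<in> triv L" "y \<in> U" "y \<in> V"
    note 1 = assms[unfolded mem_jet_iff, THEN conjunct2, rule_format, OF a]
    note 2 = x[unfolded mem_jet_iff, THEN conjunct2, rule_format, OF a]
    show "\<Psi> (\<xi> y) = \<Psi> (\<mu> y)" using 1 2 by simp
    show "((\<lambda>z. \<Psi> (\<xi> (inv_into U \<phi> z)) - \<Psi> (\<mu> (inv_into U \<phi> z))) has_derivative (\<lambda>_. 0)) (at (\<phi> y))"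
      using has_derivative_diff[OF conjunct2[OF 2] conjunct2[OF 1]] by simp
  qed (use x in \<open>simp add: mem_jet_iff\<close>)
qed

lemma fo_eq_of_jet_eq:
  assumes D: "first_order_op A L D" and s: "\<sigma> \<in> sections A L" "\<mu> \<in> sections A L" and j: "jet A L y \<sigma> = jet A L y \<mu>"
  shows "D \<sigma> y = D \<mu> y"
proof -
  obtain U \<phi> where c: "(U, \<phi>) \<in> A" "y \<in> U" using chart_cover by blast
  obtain V \<Psi> where t: "(V, \<Psi>) \<in> triv L" "y \<in> V" using triv_cover by blast
  have "\<sigma> \<in> jet A L y \<mu>" using mem_jet[OF s(1)] j by blast
  then have "\<Psi> (\<sigma> y) = \<Psi> (\<mu> y)"
    "((\<lambda>z. \<Psi> (\<sigma> (inv_into U \<phi> z)) - \<Psi> (\<mu> (inv_into U \<phi> z))) has_derivative (\<lambda>_. 0)) (at (\<phi> y))"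
    unfolding mem_jet_iff using c t by blast+
  then show ?thesis by (rule fo_jet[OF D s(2,1) c t])
qed

text \<open>First order operators see only jets, so the entries can be exchanged one after the other
  for others with the same jets; this makes the description in \<open>jet_form\<close>
  meaningful.\<close>

lemma jet_form_eq:
  assumes Q: "bidiffop Q" and s: "\<sigma> \<in> sections A L" "\<rho> \<in> sections A L"
  shows "jet_form A L Q y [jet A L y \<sigma>, jet A L y \<rho>] = Q [\<sigma>, \<rho>] y"
  unfolding jet_form_def
proof (rule the_equality)
  show "\<forall>lams. set lams \<subseteq> sections A L \<and> [jet A L y \<sigma>, jet A L y \<rho>] = map (jet A L y) lams \<longrightarrow>
    Q [\<sigma>, \<rho>] y = Q lams y"
  proof (intro allI impI)
    fix lams assume a: "set lams \<subseteq> sections A L \<and> [jet A L y \<sigma>, jet A L y \<rho>] = map (jet A L y) lams"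
    then obtain \<sigma>' \<rho>' where l: "lams = [\<sigma>', \<rho>']" "jet A L y \<sigma> = jet A L y \<sigma>'" "jet A L y \<rho> = jet A L y \<rho>'"
      by (auto simp: Cons_eq_map_conv)
    have s': "\<sigma>' \<in> sections A L" "\<rho>' \<in> sections A L" using a l by auto
    have "Q [\<sigma>, \<rho>] y = Q [\<sigma>', \<rho>] y" by (rule fo_eq_of_jet_eq[OF bidiffopD(1)[OF Q s(2)] s(1) s'(1) l(2)])
    also have "\<dots> = Q [\<sigma>', \<rho>'] y" by (rule fo_eq_of_jet_eq[OF bidiffopD(2)[OF Q s'(1)] s(2) s'(2) l(3)])
    finally show "Q [\<sigma>, \<rho>] y = Q lams y" by (simp add: l)
  qed
  fix w assume "\<forall>lams. set lams \<subseteq> sections A L \<and> [jet A L y \<sigma>, jet A L y \<rho>] = map (jet A L y) lams \<longrightarrow> w = Q lams y"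
  from this[rule_format, of "[\<sigma>, \<rho>]"] show "w = Q [\<sigma>, \<rho>] y" using s by simp
qed

text \<open>Covectors are functions on the tangent space; evaluating them on these coordinate
  directions is how their differentials are compared.\<close>

lemma coordinate_tangent:
  assumes c: "(U, \<phi>) \<in> A" "y \<in> U"
  shows "restrict (\<lambda>f. frechet_derivative (\<lambda>z. f (inv_into U \<phi> z)) (at (\<phi> y)) w) (Cinf A) \<in> tangent A y"
proof -
  note d = Cinf_derivative[OF _ c]
  have e: "inv_into U \<phi> (\<phi> y) = y" using c by simp
  have "frechet_derivative (\<lambda>z. f (inv_into U \<phi> z) + g (inv_into U \<phi> z)) (at (\<phi> y)) w =
      frechet_derivative (\<lambda>z. f (inv_into U \<phi> z)) (at (\<phi> y)) w + frechet_derivative (\<lambda>z. g (inv_into U \<phi> z)) (at (\<phi> y)) w"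
    if "f \<in> Cinf A" "g \<in> Cinf A" for f g
    using frechet_derivative_at[OF has_derivative_add[OF d[OF that(1)] d[OF that(2)]]] by metis
  moreover have "frechet_derivative (\<lambda>z. k * f (inv_into U \<phi> z)) (at (\<phi> y)) w =
      k * frechet_derivative (\<lambda>z. f (inv_into U \<phi> z)) (at (\<phi> y)) w"
    if "f \<in> Cinf A" for f k
    using frechet_derivative_at[OF has_derivative_mult_right[OF d[OF that(1)], of k]] by metis
  moreover have "frechet_derivative (\<lambda>z. f (inv_into U \<phi> z) * g (inv_into U \<phi> z)) (at (\<phi> y)) w =
      f y * frechet_derivative (\<lambda>z. g (inv_into U \<phi> z)) (at (\<phi> y)) w +
      g y * frechet_derivative (\<lambda>z. f (inv_into U \<phi> z)) (at (\<phi> y)) w"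
    if "f \<in> Cinf A" "g \<in> Cinf A" for f g
  proof -
    note frechet_derivative_at[OF has_derivative_mult[OF d[OF that(1)] d[OF that(2)]], symmetric, unfolded e]
    from fun_cong[OF this, of w] show ?thesis by (simp add: mult.commute)
  qed
  ultimately show ?thesis
    by (auto simp: tangent_def Cinf_add Cinf_cmult Cinf_mult)
qed

text \<open>A covector has many representations by \<open>f\<close> and \<open>\<sigma>\<close>. If
  two of them agree on the coordinate directions, the corresponding multiples vanish at
  \<open>y\<close> with equal differentials, so they have the same jet.\<close>

lemma cosymbol_eq:
  assumes f: "f \<in> Cinf A" and s: "\<sigma> \<in> sections A L"
  shows "cosymbol A L y (cot_elem A L y f \<sigma>) = jet A L y (mult_sec L (\<lambda>z. f z - f y) \<sigma>)"
proof -
  have alt: "add_sec L (mult_sec L f \<sigma>) (mult_sec L (\<lambda>_. - f y) \<sigma>) = mult_sec L (\<lambda>z. f z - f y) \<sigma>"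
    if "f \<in> Cinf A" "\<sigma> \<in> sections A L" for f \<sigma>
    using that by (intro section_eqI add_section mult_section Cinf_diff Cinf_const)
      (auto simp: add_sec_coord mult_sec_coord mult_section cmult_section algebra_simps)
  show ?thesis
    unfolding cosymbol_def
  proof (rule the_equality)
    show "\<forall>f'\<in>Cinf A. \<forall>\<sigma>'\<in>sections A L. cot_elem A L y f \<sigma> = cot_elem A L y f' \<sigma>' \<longrightarrow>
      jet A L y (mult_sec L (\<lambda>z. f z - f y) \<sigma>) =
      jet A L y (add_sec L (mult_sec L f' \<sigma>') (mult_sec L (\<lambda>_. - f' y) \<sigma>'))"
    proof (intro ballI impI)
      fix f' \<sigma>' assume f': "f' \<in> Cinf A" and s': "\<sigma>' \<in> sections A L"
        and eq: "cot_elem A L y f \<sigma> = cot_elem A L y f' \<sigma>'"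
      let ?a = "mult_sec L (\<lambda>z. f z - f y) \<sigma>" and ?b = "mult_sec L (\<lambda>z. f' z - f' y) \<sigma>'"
      have "?a \<in> jet A L y ?b"
        unfolding mem_jet_iff
      proof (intro conjI allI impI)
        show "?a \<in> sections A L" by (intro mult_section Cinf_diff Cinf_const f s)
        fix U \<phi> V \<Psi> assume a: "(U, \<phi>) \<in> A" "(V, \<Psi>) \<in> triv L" "y \<in> U" "y \<in> V"
        note c = a(1,3) and t = a(2,4)
        show "\<Psi> (?a y) = \<Psi> (?b y)" using s s' t by (simp add: mult_sec_coord)
          let ?F = "\<lambda>f. frechet_derivative (\<lambda>z. f (inv_into U \<phi> z)) (at (\<phi> y))"
          have "?F f w * \<Psi> (\<sigma> y) = ?F f' w * \<Psi> (\<sigma>' y)" for w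
          proof -
            from fun_cong[OF eq, of "restrict (\<lambda>f. ?F f w) (Cinf A)"]
            have "scale_vec L (?F f w) (\<sigma> y) = scale_vec L (?F f' w) (\<sigma>' y)"
              using coordinate_tangent[OF c, of w] f f' by (simp add: cot_elem_def)
            from arg_cong[OF this, of \<Psi>] show ?thesis using s s' t by (simp add: scale_vec)
          qed
          then show "((\<lambda>z. \<Psi> (?a (inv_into U \<phi> z)) - \<Psi> (?b (inv_into U \<phi> z))) has_derivative (\<lambda>_. 0)) (at (\<phi> y))"
            using has_derivative_diff[OF
                vanishing_multiple_derivative[OF f s c(1) t(1) c(2) t(2) Cinf_derivative[OF f c]]
                vanishing_multiple_derivative[OF f' s' c(1) t(1) c(2) t(2) Cinf_derivative[OF f' c]]] by simp
      qed
      from jet_eqI[OF this] show "jet A L y ?a =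
        jet A L y (add_sec L (mult_sec L f' \<sigma>') (mult_sec L (\<lambda>_. - f' y) \<sigma>'))"
        by (simp add: alt f' s')
    qed
    fix j assume "\<forall>f'\<in>Cinf A. \<forall>\<sigma>'\<in>sections A L. cot_elem A L y f \<sigma> = cot_elem A L y f' \<sigma>' \<longrightarrow>
      j = jet A L y (add_sec L (mult_sec L f' \<sigma>') (mult_sec L (\<lambda>_. - f' y) \<sigma>'))"
    then show "j = jet A L y (mult_sec L (\<lambda>z. f z - f y) \<sigma>)" using alt f s by metis
  qed
qed

lemma symbol_form_eq:
  assumes "bidiffop Q" "f \<in> Cinf A" "\<sigma> \<in> sections A L" "g \<in> Cinf A" "\<rho> \<in> sections A L"
  shows "symbol_form A L Q y [cot_elem A L y f \<sigma>, cot_elem A L y g \<rho>] =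
    Q [mult_sec L (\<lambda>z. f z - f y) \<sigma>, mult_sec L (\<lambda>z. g z - g y) \<rho>] y"
  using assms by (simp add: symbol_form_def cosymbol_eq jet_form_eq mult_section Cinf_diff Cinf_const)

end

section \<open>The Schouten-Jacobi bracket with a derivation\<close>

lemma permutes_0_1_cases:
  assumes "\<tau> permutes {0, 1::nat}"
  shows "\<tau> = id \<or> \<tau> = Transposition.transpose 0 1"
proof -
  have i: "\<tau> 0 \<in> {0, 1}" "\<tau> 1 \<in> {0, 1}" using permutes_in_image[OF assms] by auto
  have "\<tau> 0 \<noteq> \<tau> 1" using permutes_inj[OF assms] by (metis injD zero_neq_one)
  then consider "\<tau> 0 = 0" "\<tau> 1 = 1" | "\<tau> 0 = 1" "\<tau> 1 = 0" using i by auto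
  then show ?thesis
  proof cases
    case 1
    have "\<tau> x = id x" for x
      using 1 permutes_not_in[OF assms, of x] by (cases "x = 0 \<or> x = 1") auto
    then show ?thesis by blast
  next
    case 2
    have "\<tau> x = Transposition.transpose 0 1 x" for x
      using 2 permutes_not_in[OF assms, of x]
      by (cases "x = 0 \<or> x = 1") (auto simp: Transposition.transpose_def)
    then show ?thesis by blast
  qed
qed

lemma unshuffles_1_1: "unshuffles 1 1 = {id, Transposition.transpose 0 1}"
proof -
  have s2: "{..<1 + 1} = {0, 1::nat}" "{..<1} = {0::nat}" "{1..<1 + 1} = {1::nat}" by auto
  have "strict_mono_on {0} \<tau>" "strict_mono_on {1} \<tau>" for \<tau> :: "nat \<Rightarrow> nat"
    by (auto simp: strict_mono_on_def)
  then have "unshuffles 1 1 = {\<tau>. \<tau> permutes {0, 1}}"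
    unfolding unshuffles_def s2 by blast
  also have "\<dots> = {id, Transposition.transpose 0 1}"
    using permutes_0_1_cases permutes_id permutes_swap_id[of 0 "{0, 1::nat}" 1] by blast
  finally show ?thesis .
qed

lemma unshuffles_2_0: "unshuffles 2 0 = {id}"
proof -
  have s2: "{..<2 + 0} = {0, 1::nat}" "{..<2} = {0, 1::nat}" "{2..<2 + 0} = ({} :: nat set)" by auto
  have "strict_mono_on {0, 1} \<tau> \<longleftrightarrow> \<tau> 0 < \<tau> 1" for \<tau> :: "nat \<Rightarrow> nat"
    by (auto simp: strict_mono_on_def)
  then have "unshuffles 2 0 = {\<tau>. \<tau> permutes {0, 1} \<and> \<tau> 0 < \<tau> 1}"
    unfolding unshuffles_def s2 by (auto simp: strict_mono_on_def)
  also have "\<dots> = {id}"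
    using permutes_0_1_cases permutes_id by (force simp: Transposition.transpose_def simp del: One_nat_def)
  finally show ?thesis .
qed

context line_bundle_over
begin

lemma mult_sec_add_fun:
  assumes "f \<in> Cinf A" "g \<in> Cinf A" "\<sigma> \<in> sections A L"
  shows "mult_sec L (\<lambda>z. f z + g z) \<sigma> = add_sec L (mult_sec L f \<sigma>) (mult_sec L g \<sigma>)"
  using assms by (intro section_eqI mult_section add_section Cinf_add)
    (auto simp: mult_sec_coord add_sec_coord mult_section algebra_simps)

text \<open>\<open>X\<close> is the symbol of \<open>R\<close>, carried along as data so that its
  product rule is available without passing through \<open>symbol\<close>.\<close>

definition derivation :: "(('m \<Rightarrow> real) \<Rightarrow> ('m \<Rightarrow> real)) \<Rightarrow> (('m \<Rightarrow> 't) \<Rightarrow> ('m \<Rightarrow> 't)) \<Rightarrow> bool" where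
  "derivation X R \<longleftrightarrow>
     (\<forall>\<sigma>\<in>sections A L. R \<sigma> \<in> sections A L) \<and>
     (\<forall>\<sigma>\<in>sections A L. \<forall>\<rho>\<in>sections A L. R (add_sec L \<sigma> \<rho>) = add_sec L (R \<sigma>) (R \<rho>)) \<and>
     (\<forall>c. X (\<lambda>_. c) = (\<lambda>_. 0)) \<and> (\<forall>f\<in>Cinf A. X f \<in> Cinf A) \<and>
     (\<forall>f\<in>Cinf A. \<forall>g\<in>Cinf A. X (\<lambda>z. f z * g z) = (\<lambda>z. X f z * g z + f z * X g z)) \<and>
     (\<forall>f\<in>Cinf A. \<forall>\<sigma>\<in>sections A L. R (mult_sec L f \<sigma>) = add_sec L (mult_sec L (X f) \<sigma>) (mult_sec L f (R \<sigma>)))"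

context
  fixes X R assumes R: "derivation X R"
begin

lemma derivation_section: "\<sigma> \<in> sections A L \<Longrightarrow> R \<sigma> \<in> sections A L"
  using R by (simp add: derivation_def)

lemma derivation_Cinf: "f \<in> Cinf A \<Longrightarrow> X f \<in> Cinf A"
  using R by (simp add: derivation_def)

lemma derivation_add:
  assumes "\<sigma> \<in> sections A L" "\<rho> \<in> sections A L" "(V, \<Psi>) \<in> triv L" "y \<in> V"
  shows "\<Psi> (R (add_sec L \<sigma> \<rho>) y) = \<Psi> (R \<sigma> y) + \<Psi> (R \<rho> y)"
proof -
  have "R (add_sec L \<sigma> \<rho>) = add_sec L (R \<sigma>) (R \<rho>)" using R assms unfolding derivation_def by blast
  then show ?thesis using assms by (simp add: add_sec_coord derivation_section)
qed

lemma derivation_mult_eq: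
  assumes "f \<in> Cinf A" "\<sigma> \<in> sections A L"
  shows "R (mult_sec L f \<sigma>) = add_sec L (mult_sec L (X f) \<sigma>) (mult_sec L f (R \<sigma>))"
  using R assms unfolding derivation_def by blast

lemma derivation_mult:
  assumes "f \<in> Cinf A" "\<sigma> \<in> sections A L" "(V, \<Psi>) \<in> triv L" "y \<in> V"
  shows "\<Psi> (R (mult_sec L f \<sigma>) y) = X f y * \<Psi> (\<sigma> y) + f y * \<Psi> (R \<sigma> y)"
  unfolding derivation_mult_eq[OF assms(1,2)] using assms
  by (simp add: add_sec_coord mult_sec_coord mult_section derivation_section derivation_Cinf)

lemma derivation_cmult:
  assumes "\<sigma> \<in> sections A L" "(V, \<Psi>) \<in> triv L" "y \<in> V"
  shows "\<Psi> (R (mult_sec L (\<lambda>_. c) \<sigma>) y) = c * \<Psi> (R \<sigma> y)"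
  using derivation_mult[OF Cinf_const assms, of c] R by (simp add: derivation_def)

text \<open>Both D R and R D have order two in general, but the terms in which \<open>X\<close>
  differentiates \<open>f\<close> or \<open>g\<close> cancel in the difference. They arise from the
  first order identity of \<open>D\<close> at X f and X g on the one side, and from applying
  \<open>R\<close> to that identity on the other.\<close>

lemma commutator_first_order:
  assumes D: "first_order_op A L D"
  shows "first_order_op A L (\<lambda>\<sigma>. add_sec L (D (R \<sigma>)) (mult_sec L (\<lambda>_. - 1) (R (D \<sigma>))))"
    (is "first_order_op A L ?C")
proof -
  note sec = add_section mult_section cmult_section derivation_section fo_section[OF D] Cinf_mult derivation_Cinf
  have C: "\<Psi> (?C \<sigma> y) = \<Psi> (D (R \<sigma>) y) - \<Psi> (R (D \<sigma>) y)"
    if "\<sigma> \<in> sections A L" "(V, \<Psi>) \<in> triv L" "y \<in> V" for \<sigma> \<Psi> V y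
    using that by (simp add: add_sec_coord mult_sec_coord sec)
  have Cs: "?C \<sigma> \<in> sections A L" if "\<sigma> \<in> sections A L" for \<sigma>
    using that by (intro sec)
  show ?thesis
    unfolding first_order_op_def
  proof (intro conjI allI ballI)
    fix \<sigma> assume "\<sigma> \<in> sections A L" then show "?C \<sigma> \<in> sections A L" by (rule Cs)
  next
    fix \<sigma> \<rho> assume s: "\<sigma> \<in> sections A L" "\<rho> \<in> sections A L"
    have 1: "R (add_sec L \<sigma> \<rho>) = add_sec L (R \<sigma>) (R \<rho>)" using R s unfolding derivation_def by blast
    have 2: "D (add_sec L \<sigma> \<rho>) = add_sec L (D \<sigma>) (D \<rho>)" using D s unfolding first_order_op_def by blast
    show "?C (add_sec L \<sigma> \<rho>) = add_sec L (?C \<sigma>) (?C \<rho>)"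
    proof (rule section_eqI[OF Cs[OF add_section[OF s]] add_section[OF Cs[OF s(1)] Cs[OF s(2)]]])
      fix y V \<Psi> assume t: "(V, \<Psi>) \<in> triv L" "y \<in> V"
      show "\<Psi> (?C (add_sec L \<sigma> \<rho>) y) = \<Psi> (add_sec L (?C \<sigma>) (?C \<rho>) y)"
        unfolding C[OF add_section[OF s] t] add_sec_coord[OF Cs[OF s(1)] Cs[OF s(2)] t] C[OF s(1) t] C[OF s(2) t]
        unfolding 1 2 using fo_add[OF D _ _ t] derivation_add[OF _ _ t] s by (simp add: sec)
    qed
  next
    fix c \<sigma> assume s: "\<sigma> \<in> sections A L"
    have 1: "D (mult_sec L (\<lambda>_. c) \<sigma>) = mult_sec L (\<lambda>_. c) (D \<sigma>)" using D s unfolding first_order_op_def by blast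
    have 2: "R (mult_sec L (\<lambda>_. c) \<sigma>) = mult_sec L (\<lambda>_. c) (R \<sigma>)"
      using s by (intro section_eqI) (auto simp: sec derivation_cmult mult_sec_coord)
    show "?C (mult_sec L (\<lambda>_. c) \<sigma>) = mult_sec L (\<lambda>_. c) (?C \<sigma>)"
    proof (rule section_eqI[OF Cs[OF cmult_section[OF s]] cmult_section[OF Cs[OF s]]])
      fix y V \<Psi> assume t: "(V, \<Psi>) \<in> triv L" "y \<in> V"
      show "\<Psi> (?C (mult_sec L (\<lambda>_. c) \<sigma>) y) = \<Psi> (mult_sec L (\<lambda>_. c) (?C \<sigma>) y)"
        unfolding C[OF cmult_section[OF s] t] mult_sec_coord[OF Cs[OF s] t] C[OF s t]
        unfolding 1 2 using fo_cmult[OF D _ t] derivation_cmult[OF _ t] s by (simp add: sec algebra_simps)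
    qed
  next
    fix f g \<sigma> assume f: "f \<in> Cinf A" and g: "g \<in> Cinf A" and s: "\<sigma> \<in> sections A L"
    let ?fg = "\<lambda>z. f z * g z"
    have fg: "?fg \<in> Cinf A" using f g by (rule Cinf_mult)
    have Xfg: "X ?fg = (\<lambda>z. X f z * g z + f z * X g z)" using R f g unfolding derivation_def by blast
    note h = f g fg s derivation_Cinf[OF f] derivation_Cinf[OF g] derivation_section[OF s]
    show "add_sec L (?C (mult_sec L ?fg \<sigma>)) (mult_sec L ?fg (?C \<sigma>)) =
      add_sec L (mult_sec L f (?C (mult_sec L g \<sigma>))) (mult_sec L g (?C (mult_sec L f \<sigma>)))"
    proof (rule section_eqI[OF add_section[OF Cs[OF mult_section[OF fg s]] mult_section[OF fg Cs[OF s]]]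
        add_section[OF mult_section[OF f Cs[OF mult_section[OF g s]]] mult_section[OF g Cs[OF mult_section[OF f s]]]]])
      fix y V \<Psi> assume t: "(V, \<Psi>) \<in> triv L" "y \<in> V"
      have DR: "\<Psi> (D (R (mult_sec L k \<sigma>)) y) = \<Psi> (D (mult_sec L (X k) \<sigma>) y) + \<Psi> (D (mult_sec L k (R \<sigma>)) y)"
        if "k \<in> Cinf A" for k
        unfolding derivation_mult_eq[OF that s] using that s by (intro fo_add[OF D _ _ t] sec)
      have DX: "\<Psi> (D (mult_sec L (X ?fg) \<sigma>) y) =
        \<Psi> (D (mult_sec L (\<lambda>z. X f z * g z) \<sigma>) y) + \<Psi> (D (mult_sec L (\<lambda>z. f z * X g z) \<sigma>) y)"
        unfolding Xfg using h by (subst mult_sec_add_fun) (auto intro!: fo_add[OF D _ _ t] sec)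
      have e: "add_sec L (D (mult_sec L ?fg \<sigma>)) (mult_sec L ?fg (D \<sigma>)) =
          add_sec L (mult_sec L f (D (mult_sec L g \<sigma>))) (mult_sec L g (D (mult_sec L f \<sigma>)))"
        using D f g s unfolding first_order_op_def by blast
      have ss: "D \<sigma> \<in> sections A L" "D (mult_sec L f \<sigma>) \<in> sections A L" "D (mult_sec L g \<sigma>) \<in> sections A L"
        "D (mult_sec L ?fg \<sigma>) \<in> sections A L"
        using h by (auto intro!: sec)
      \<comment> \<open>\<open>R\<close> applied to the identity \<open>e\<close>; the product rule
        produces the terms with \<open>X f\<close> and \<open>X g\<close> that cancel those in
        \<open>DR\<close> and \<open>DX\<close>.\<close>
      have RD: "\<Psi> (R (D (mult_sec L ?fg \<sigma>)) y) + (X ?fg y * \<Psi> (D \<sigma> y) + f y * g y * \<Psi> (R (D \<sigma>) y)) =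
         (X f y * \<Psi> (D (mult_sec L g \<sigma>) y) + f y * \<Psi> (R (D (mult_sec L g \<sigma>)) y)) +
         (X g y * \<Psi> (D (mult_sec L f \<sigma>) y) + g y * \<Psi> (R (D (mult_sec L f \<sigma>)) y))"
        using arg_cong[OF e, of "\<lambda>\<tau>. \<Psi> (R \<tau> y)"] h ss
        by (simp only: derivation_add[OF _ _ t] derivation_mult[OF _ _ t] mult_section)
      note prods = fo_prod[OF D derivation_Cinf[OF f] g s t] fo_prod[OF D f derivation_Cinf[OF g] s t]
        fo_prod[OF D f g derivation_section[OF s] t]
      have Xy: "X ?fg y = X f y * g y + f y * X g y" using Xfg by simp
      have ms: "mult_sec L f \<sigma> \<in> sections A L" "mult_sec L g \<sigma> \<in> sections A L" "mult_sec L ?fg \<sigma> \<in> sections A L"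
        using h by (auto intro!: sec)
      have "\<Psi> (?C (mult_sec L ?fg \<sigma>) y) + f y * g y * \<Psi> (?C \<sigma> y) =
        f y * \<Psi> (?C (mult_sec L g \<sigma>) y) + g y * \<Psi> (?C (mult_sec L f \<sigma>) y)"
        unfolding C[OF ms(1) t] C[OF ms(2) t] C[OF ms(3) t] C[OF s t] DR[OF f] DR[OF g] DR[OF fg] DX prods
        using RD unfolding Xy by (simp add: algebra_simps)
      then show "\<Psi> (add_sec L (?C (mult_sec L ?fg \<sigma>)) (mult_sec L ?fg (?C \<sigma>)) y) =
        \<Psi> (add_sec L (mult_sec L f (?C (mult_sec L g \<sigma>))) (mult_sec L g (?C (mult_sec L f \<sigma>))) y)"
        using h ms Cs t by (simp add: add_sec_coord mult_sec_coord mult_section)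
    qed
  qed
qed

end

lemma first_order_op_cong:
  assumes "\<And>\<sigma>. \<sigma> \<in> sections A L \<Longrightarrow> D \<sigma> = D' \<sigma>" "first_order_op A L D"
  shows "first_order_op A L D'"
  using assms unfolding first_order_op_def by (simp add: add_section mult_section cmult_section Cinf_mult)

lemma first_order_op_add:
  assumes D: "first_order_op A L D" and D': "first_order_op A L D'"
  shows "first_order_op A L (\<lambda>\<sigma>. add_sec L (D \<sigma>) (D' \<sigma>))"
proof -
  note sec = add_section mult_section cmult_section fo_section[OF D] fo_section[OF D'] Cinf_mult
  show ?thesis
    unfolding first_order_op_def
  proof (intro conjI allI ballI section_eqI)
    fix f g \<sigma> y V \<Psi> assume h: "f \<in> Cinf A" "g \<in> Cinf A" "\<sigma> \<in> sections A L" and t: "(V, \<Psi>) \<in> triv L" "y \<in> V"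
    show "\<Psi> (add_sec L (add_sec L (D (mult_sec L (\<lambda>z. f z * g z) \<sigma>)) (D' (mult_sec L (\<lambda>z. f z * g z) \<sigma>)))
            (mult_sec L (\<lambda>z. f z * g z) (add_sec L (D \<sigma>) (D' \<sigma>))) y) =
       \<Psi> (add_sec L (mult_sec L f (add_sec L (D (mult_sec L g \<sigma>)) (D' (mult_sec L g \<sigma>))))
            (mult_sec L g (add_sec L (D (mult_sec L f \<sigma>)) (D' (mult_sec L f \<sigma>)))) y)"
      using h t fo_prod[OF D h t] fo_prod[OF D' h t]
      by (simp add: sec add_sec_coord mult_sec_coord algebra_simps)
  qed (auto simp: sec add_sec_coord mult_sec_coord fo_add[OF D] fo_add[OF D'] fo_cmult[OF D] fo_cmult[OF D'] algebra_simps)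
qed

text \<open>Skew symmetry is an equation between sections rather than between coordinates, since the
  derivation \<open>R\<close> is applied to both sides when the property is passed on to the
  bracket.\<close>

definition skew_bidiffop :: "('m, 't) multiop \<Rightarrow> bool" where
  "skew_bidiffop Q \<longleftrightarrow> bidiffop Q \<and>
     (\<forall>\<sigma>\<in>sections A L. \<forall>\<rho>\<in>sections A L. Q [\<sigma>, \<rho>] = mult_sec L (\<lambda>_. - 1) (Q [\<rho>, \<sigma>]))"

lemma skew_bidiffop_coord:
  assumes "skew_bidiffop Q" "\<sigma> \<in> sections A L" "\<rho> \<in> sections A L" "(V, \<Psi>) \<in> triv L" "y \<in> V"
  shows "\<Psi> (Q [\<sigma>, \<rho>] y) = - \<Psi> (Q [\<rho>, \<sigma>] y)"
proof -
  have "Q [\<sigma>, \<rho>] = mult_sec L (\<lambda>_. - 1) (Q [\<rho>, \<sigma>])"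
    using assms(1-3) unfolding skew_bidiffop_def by blast
  moreover have "Q [\<rho>, \<sigma>] \<in> sections A L"
    using bidiffop_section[OF _ assms(3,2)] assms(1) by (simp add: skew_bidiffop_def)
  ultimately show ?thesis using assms(4,5) by (simp add: mult_sec_coord)
qed

lemma multi_diffop_skew_bidiffop:
  assumes "multi_diffop A L 2 Q" shows "skew_bidiffop Q"
  unfolding skew_bidiffop_def
proof (intro conjI ballI section_eqI)
  show b: "bidiffop Q" by (rule multi_diffop_bidiffop[OF assms])
  fix \<sigma> \<rho> y V \<Psi> assume s: "\<sigma> \<in> sections A L" "\<rho> \<in> sections A L"
  show "Q [\<sigma>, \<rho>] \<in> sections A L" "mult_sec L (\<lambda>_. - 1) (Q [\<rho>, \<sigma>]) \<in> sections A L"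
    using s b by (auto intro!: cmult_section bidiffop_section)
  assume t: "(V, \<Psi>) \<in> triv L" "y \<in> V"
  show "\<Psi> (Q [\<sigma>, \<rho>] y) = \<Psi> (mult_sec L (\<lambda>_. - 1) (Q [\<rho>, \<sigma>]) y)"
    using multi_diffop_skew[OF assms s t] bidiffop_section[OF b s(2,1)] t by (simp add: mult_sec_coord)
qed

context
  fixes X R Q assumes R: "derivation X R" and Q: "skew_bidiffop Q"
begin

text \<open>Here k = 1 and k' = 0, so the first composition has sign +1. Its two unshuffles are the
  identity and the transposition, and skew symmetry turns the term of the latter into an insertion
  in the second entry; the other composition has one unshuffle. The outcome is minus the Lie
  derivative of \<open>Q\<close> along \<open>R\<close>.\<close>

lemma SJ_bracket_section:
  assumes s: "\<sigma> \<in> sections A L" "\<rho> \<in> sections A L"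
  shows "SJ_bracket L 2 1 Q (\<lambda>lams. R (lams ! 0)) [\<sigma>, \<rho>] \<in> sections A L" (is "?S \<in> _")
    and "(V, \<Psi>) \<in> triv L \<Longrightarrow> y \<in> V \<Longrightarrow> \<Psi> (SJ_bracket L 2 1 Q (\<lambda>lams. R (lams ! 0)) [\<sigma>, \<rho>] y) =
      \<Psi> (Q [R \<sigma>, \<rho>] y) + \<Psi> (Q [\<sigma>, R \<rho>] y) - \<Psi> (R (Q [\<sigma>, \<rho>]) y)"
proof -
  have b: "bidiffop Q" using Q by (simp add: skew_bidiffop_def)
  note sec = add_section cmult_section derivation_section[OF R] bidiffop_section[OF b] sum_section
  let ?c = "sum_sec L {id, Transposition.transpose 0 (1::nat)} (\<lambda>\<tau>. mult_sec L (\<lambda>_. of_int (sign \<tau>))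
      (Q [R ([\<sigma>, \<rho>] ! \<tau> 0), [\<sigma>, \<rho>] ! \<tau> (Suc 0)]))"
  let ?d = "sum_sec L {id :: nat \<Rightarrow> nat} (\<lambda>\<tau>. mult_sec L (\<lambda>_. of_int (sign \<tau>))
      (R (Q [[\<sigma>, \<rho>] ! \<tau> 0, [\<sigma>, \<rho>] ! \<tau> (Suc 0)])))"
  have u: "[0..<2] = [0, Suc 0]" "[0..<1] = [0]" "[1..<2] = [Suc 0]" by (simp_all add: upt_conv_Cons)
  have c1: "comp_op L 2 1 Q (\<lambda>lams. R (lams ! 0)) [\<sigma>, \<rho>] = ?c"
    unfolding comp_op_def using unshuffles_1_1 by (simp add: u)
  have c2: "comp_op L 1 2 (\<lambda>lams. R (lams ! 0)) Q [\<sigma>, \<rho>] = ?d"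
    unfolding comp_op_def using unshuffles_2_0 by (simp add: u)
  have S: "?S = add_sec L (mult_sec L (\<lambda>_. 1) ?c) (mult_sec L (\<lambda>_. - 1) ?d)"
    unfolding SJ_bracket_def c1 c2 by simp
  have cs: "?c \<in> sections A L" using s by (auto intro!: sec simp: Transposition.transpose_def)
  have ds: "?d \<in> sections A L" using s by (auto intro!: sec)
  show "?S \<in> sections A L" unfolding S by (intro sec cs ds)
  assume t: "(V, \<Psi>) \<in> triv L" "y \<in> V"
  have ne: "id \<noteq> Transposition.transpose 0 (1::nat)" by (metis id_apply Transposition.transpose_apply_first zero_neq_one)
  have sg: "sign (Transposition.transpose 0 (1::nat)) = -1" "sign (id :: nat \<Rightarrow> nat) = 1"
    "sign (Transposition.transpose 0 (Suc 0)) = -1"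
    by (simp_all add: sign_swap_id)
  have "\<Psi> (?c y) = (\<Sum>\<tau>\<in>{id, Transposition.transpose 0 (1::nat)}. \<Psi> (mult_sec L (\<lambda>_. of_int (sign \<tau>))
      (Q [R ([\<sigma>, \<rho>] ! \<tau> 0), [\<sigma>, \<rho>] ! \<tau> (Suc 0)]) y))"
    using s by (intro sum_sec_coord[OF _ t]) (auto intro!: sec simp: Transposition.transpose_def)
  also have "\<dots> = \<Psi> (Q [R \<sigma>, \<rho>] y) - \<Psi> (Q [R \<rho>, \<sigma>] y)"
    using s t ne by (simp add: sg mult_sec_coord sec)
  also have "\<dots> = \<Psi> (Q [R \<sigma>, \<rho>] y) + \<Psi> (Q [\<sigma>, R \<rho>] y)"
    using skew_bidiffop_coord[OF Q _ s(1) t, of "R \<rho>"] s by (simp add: sec)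
  finally have 1: "\<Psi> (?c y) = \<Psi> (Q [R \<sigma>, \<rho>] y) + \<Psi> (Q [\<sigma>, R \<rho>] y)" .
  have "\<Psi> (?d y) = (\<Sum>\<tau>\<in>{id :: nat \<Rightarrow> nat}. \<Psi> (mult_sec L (\<lambda>_. of_int (sign \<tau>))
      (R (Q [[\<sigma>, \<rho>] ! \<tau> 0, [\<sigma>, \<rho>] ! \<tau> (Suc 0)])) y))"
    using s by (intro sum_sec_coord[OF _ t]) (auto intro!: sec)
  also have "\<dots> = \<Psi> (R (Q [\<sigma>, \<rho>]) y)" using s t by (simp add: sg mult_sec_coord sec)
  finally have 2: "\<Psi> (?d y) = \<Psi> (R (Q [\<sigma>, \<rho>]) y)" .
  show "\<Psi> (?S y) = \<Psi> (Q [R \<sigma>, \<rho>] y) + \<Psi> (Q [\<sigma>, R \<rho>] y) - \<Psi> (R (Q [\<sigma>, \<rho>]) y)"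
    unfolding S add_sec_coord[OF cmult_section[OF cs] cmult_section[OF ds] t]
      mult_sec_coord[OF cs t] mult_sec_coord[OF ds t] 1 2 by simp
qed

text \<open>With one entry fixed, the bracket is the commutator of a first order operator with
  \<open>R\<close> plus a first order operator whose fixed entry has been differentiated.\<close>

lemma skew_bidiffop_SJ_bracket: "skew_bidiffop (SJ_bracket L 2 1 Q (\<lambda>lams. R (lams ! 0)))" (is "skew_bidiffop ?S")
proof -
  have b: "bidiffop Q" using Q by (simp add: skew_bidiffop_def)
  note sec = add_section cmult_section derivation_section[OF R] bidiffop_section[OF b]
  note S = SJ_bracket_section
  have "first_order_op A L (\<lambda>\<nu>. ?S [\<nu>, \<mu>])" if m: "\<mu> \<in> sections A L" for \<mu>
  proof (rule first_order_op_cong)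
    show "first_order_op A L (\<lambda>\<nu>. add_sec L (Q [\<nu>, R \<mu>])
        (add_sec L (Q [R \<nu>, \<mu>]) (mult_sec L (\<lambda>_. - 1) (R (Q [\<nu>, \<mu>])))))"
      by (rule first_order_op_add[OF bidiffopD(1)[OF b derivation_section[OF R m]]
            commutator_first_order[OF R bidiffopD(1)[OF b m]]])
    fix \<nu> assume n: "\<nu> \<in> sections A L"
    show "add_sec L (Q [\<nu>, R \<mu>]) (add_sec L (Q [R \<nu>, \<mu>]) (mult_sec L (\<lambda>_. - 1) (R (Q [\<nu>, \<mu>])))) = ?S [\<nu>, \<mu>]"
      using m n by (intro section_eqI S(1) sec) (auto simp: S(2) sec add_sec_coord mult_sec_coord simp del: One_nat_def)
  qed
  moreover have "first_order_op A L (\<lambda>\<nu>. ?S [\<mu>, \<nu>])" if m: "\<mu> \<in> sections A L" for \<mu>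
  proof (rule first_order_op_cong)
    show "first_order_op A L (\<lambda>\<nu>. add_sec L (Q [R \<mu>, \<nu>])
        (add_sec L (Q [\<mu>, R \<nu>]) (mult_sec L (\<lambda>_. - 1) (R (Q [\<mu>, \<nu>])))))"
      by (rule first_order_op_add[OF bidiffopD(2)[OF b derivation_section[OF R m]]
            commutator_first_order[OF R bidiffopD(2)[OF b m]]])
    fix \<nu> assume n: "\<nu> \<in> sections A L"
    show "add_sec L (Q [R \<mu>, \<nu>]) (add_sec L (Q [\<mu>, R \<nu>]) (mult_sec L (\<lambda>_. - 1) (R (Q [\<mu>, \<nu>])))) = ?S [\<mu>, \<nu>]"
      using m n by (intro section_eqI S(1) sec) (auto simp: S(2) sec add_sec_coord mult_sec_coord simp del: One_nat_def)
  qed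
  moreover have "?S [\<sigma>, \<rho>] = mult_sec L (\<lambda>_. - 1) (?S [\<rho>, \<sigma>])"
    if s: "\<sigma> \<in> sections A L" "\<rho> \<in> sections A L" for \<sigma> \<rho>
  proof (rule section_eqI[OF S(1)[OF s] cmult_section[OF S(1)[OF s(2,1)]]])
    fix y V \<Psi> assume t: "(V, \<Psi>) \<in> triv L" "y \<in> V"
    have "Q [\<sigma>, \<rho>] = mult_sec L (\<lambda>_. - 1) (Q [\<rho>, \<sigma>])" using Q s unfolding skew_bidiffop_def by blast
    then have "\<Psi> (R (Q [\<sigma>, \<rho>]) y) = - \<Psi> (R (Q [\<rho>, \<sigma>]) y)"
      using derivation_cmult[OF R _ t, of "Q [\<rho>, \<sigma>]" "- 1"] s by (simp add: sec)
    then show "\<Psi> (?S [\<sigma>, \<rho>] y) = \<Psi> (mult_sec L (\<lambda>_. - 1) (?S [\<rho>, \<sigma>]) y)"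
      using s skew_bidiffop_coord[OF Q _ s(1) t, of "R \<rho>"] skew_bidiffop_coord[OF Q _ s(2) t, of "R \<sigma>"]
      unfolding mult_sec_coord[OF S(1)[OF s(2,1)] t] S(2)[OF s t] S(2)[OF s(2,1) t] by (simp add: sec)
  qed
  ultimately show ?thesis unfolding skew_bidiffop_def bidiffop_def by blast
qed

end

end

section \<open>The total space of the normal bundle\<close>

text \<open>The third component \<open>M\<close> is part of what \<open>jacobi_manifold\<close>
  asserts: that the total space is a manifold and the pulled back bundle a line bundle over
  it.\<close>

locale fat_neighborhood =
  E: vbundle_over A E + ell: line_bundle_over A ell + M: line_bundle_over "total_atlas A E" "pullback E ell"
  for A :: "('s::topological_space, 'b::real_inner) atlas"
    and E :: "('e::topological_space, 's, 'f::real_inner) vbundle"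
    and ell :: "('l::topological_space, 's, real) vbundle" +
  assumes tot_E [simp]: "tot E = UNIV"
begin

abbreviation "AT \<equiv> total_atlas A E"
abbreviation "L \<equiv> pullback E ell"

abbreviation tchart :: "('s \<Rightarrow> 'b) \<Rightarrow> ('e \<Rightarrow> 'f) \<Rightarrow> 'e \<Rightarrow> 'b \<times> 'f" where
  "tchart \<phi> \<Phi> \<equiv> \<lambda>e. (\<phi> (prj E e), \<Phi> e)"

abbreviation tchart_inv :: "'s set \<Rightarrow> ('s \<Rightarrow> 'b) \<Rightarrow> 's set \<Rightarrow> ('e \<Rightarrow> 'f) \<Rightarrow> 'b \<times> 'f \<Rightarrow> 'e" where
  "tchart_inv U \<phi> V \<Phi> \<equiv> inv_into (prj E -` (U \<inter> V)) (tchart \<phi> \<Phi>)"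

lemma total_chart:
  "(U, \<phi>) \<in> A \<Longrightarrow> (V, \<Phi>) \<in> triv E \<Longrightarrow> (prj E -` (U \<inter> V), \<lambda>e. (\<phi> (prj E e), \<Phi> e)) \<in> AT"
  by (auto simp: total_atlas_def)

text \<open>The same description as inside \<open>entire_on_fibre\<close>, so that it can be folded
  there.\<close>

definition pt :: "('e \<Rightarrow> 'f) \<Rightarrow> 's \<Rightarrow> 'f \<Rightarrow> 'e" where
  "pt \<Phi> x u = (THE e. e \<in> tot E \<and> prj E e = x \<and> \<Phi> e = u)"

lemma E_eqI: "(V, \<Phi>) \<in> triv E \<Longrightarrow> prj E e \<in> V \<Longrightarrow> prj E e' = prj E e \<Longrightarrow> \<Phi> e' = \<Phi> e \<Longrightarrow> e' = e"
  using E.vec_eqI[of V \<Phi> e e'] by simp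

lemma pt [simp]:
  assumes "(V, \<Phi>) \<in> triv E" "x \<in> V"
  shows "prj E (pt \<Phi> x u) = x" "\<Phi> (pt \<Phi> x u) = u"
proof -
  obtain e where e: "e \<in> tot E" "prj E e = x" "\<Phi> e = u" using E.fibre_ex[OF assms, of u] .
  have "pt \<Phi> x u = e"
    unfolding pt_def
  proof (rule the_equality)
    show "e' = e" if "e' \<in> tot E \<and> prj E e' = x \<and> \<Phi> e' = u" for e'
      by (rule E_eqI[OF assms(1)]) (use that e assms in auto)
  qed (use e in simp)
  then show "prj E (pt \<Phi> x u) = x" "\<Phi> (pt \<Phi> x u) = u" using e by auto
qed

lemma pt_eq: "(V, \<Phi>) \<in> triv E \<Longrightarrow> prj E e \<in> V \<Longrightarrow> pt \<Phi> (prj E e) (\<Phi> e) = e"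
  by (rule E_eqI[of V \<Phi>]) simp_all

lemma inv_total_chart:
  assumes "(U, \<phi>) \<in> A" "(V, \<Phi>) \<in> triv E" "x \<in> U" "x \<in> V"
  shows "tchart_inv U \<phi> V \<Phi> (\<phi> x, u) = pt \<Phi> x u"
  using M.chart_inv[OF total_chart[OF assms(1,2)], of "pt \<Phi> x u"] assms by simp

lemma total_chart_image:
  assumes "(U, \<phi>) \<in> A" "(V, \<Phi>) \<in> triv E"
  shows "(\<lambda>e. (\<phi> (prj E e), \<Phi> e)) ` (prj E -` (U \<inter> V) \<inter> prj E -` X) = \<phi> ` (U \<inter> V \<inter> X) \<times> UNIV"
proof (intro equalityI subsetI)
  fix p assume "p \<in> \<phi> ` (U \<inter> V \<inter> X) \<times> (UNIV :: 'f set)"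
  then obtain x u where p: "p = (\<phi> x, u)" "x \<in> U" "x \<in> V" "x \<in> X" by auto
  then show "p \<in> (\<lambda>e. (\<phi> (prj E e), \<Phi> e)) ` (prj E -` (U \<inter> V) \<inter> prj E -` X)"
    using assms by (intro image_eqI[of _ _ "pt \<Phi> x u"]) auto
qed auto

text \<open>Continuity of the projection: in the charts of the total space its coordinate expression
  is \<open>fst\<close>.\<close>

lemma prj_open:
  assumes "open X" shows "open (prj E -` X)"
proof (subst open_subopen, intro ballI)
  fix e assume e: "e \<in> prj E -` X"
  obtain U \<phi> where c: "(U, \<phi>) \<in> A" "prj E e \<in> U" using E.chart_cover by blast
  obtain V \<Phi> where t: "(V, \<Phi>) \<in> triv E" "prj E e \<in> V" using E.triv_cover by blast
  let ?c = "tchart \<phi> \<Phi>"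
  let ?T = "prj E -` (U \<inter> V) \<inter> ?c -` (\<phi> ` (U \<inter> X) \<times> UNIV)"
  have "open ?T"
    by (intro M.chart_preimage_open[OF total_chart[OF c(1) t(1)]] open_Times E.chart_image_open[OF c(1) assms] open_UNIV)
  moreover have "e \<in> ?T" using e c t by auto
  moreover have "?T \<subseteq> prj E -` X"
  proof
    fix e' assume e': "e' \<in> ?T"
    then obtain y where y: "y \<in> U" "y \<in> X" "\<phi> (prj E e') = \<phi> y" by auto
    then have "prj E e' = y" using E.chart_inv[OF c(1), of "prj E e'"] E.chart_inv[OF c(1), of y] e' by simp
    then show "e' \<in> prj E -` X" using y by simp
  qed
  ultimately show "\<exists>T. open T \<and> e \<in> T \<and> T \<subseteq> prj E -` X" by blast
qed

lemma total_chart_ex: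
  obtains U \<phi> V \<Phi> where "(U, \<phi>) \<in> A" "(V, \<Phi>) \<in> triv E" "x \<in> U" "x \<in> V"
  using E.chart_cover[of x] E.triv_cover[of x] by metis

lemma smooth_total_chart:
  assumes "(U, \<phi>) \<in> A" "(V, \<Phi>) \<in> triv E"
  shows "smooth_wrt AT (prj E -` (U \<inter> V)) (\<lambda>e. \<phi> (prj E e))" "smooth_wrt AT (prj E -` (U \<inter> V)) \<Phi>"
  using M.smooth_wrt_bounded_linear[OF bounded_linear_fst M.smooth_wrt_chart[OF total_chart[OF assms]]]
    M.smooth_wrt_bounded_linear[OF bounded_linear_snd M.smooth_wrt_chart[OF total_chart[OF assms]]]
  by simp_all

lemma smooth_pull:
  assumes "open X" "smooth_wrt A X g"
  shows "smooth_wrt AT (prj E -` X) (\<lambda>e. g (prj E e))"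
proof (rule M.smooth_wrt_local)
  fix e assume e: "e \<in> prj E -` X"
  obtain U \<phi> V \<Phi> where c: "(U, \<phi>) \<in> A" "(V, \<Phi>) \<in> triv E" "prj E e \<in> U" "prj E e \<in> V"
    using total_chart_ex by blast
  let ?O = "prj E -` (U \<inter> V \<inter> X)"
  have o: "open ?O" by (intro prj_open open_Int E.chart_open(1)[OF c(1)] E.triv_open[OF c(2)] assms(1))
  have "smooth_wrt AT ?O (\<lambda>e. (g \<circ> inv_into U \<phi>) (\<phi> (prj E e)))"
    by (rule M.smooth_wrt_compose[OF E.fd M.smooth_wrt_subset[OF smooth_total_chart(1)[OF c(1,2)]]
          E.smooth_wrtD[OF assms(2) c(1)]]) auto
  then have "smooth_wrt AT ?O (\<lambda>e. g (prj E e))"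
    by (rule M.smooth_wrt_cong[OF o, rotated]) (use c in simp)
  then show "\<exists>O1. open O1 \<and> e \<in> O1 \<and> smooth_wrt AT O1 (\<lambda>e. g (prj E e))" using o e c by blast
qed

lemma smooth_triv:
  assumes "(V, \<Phi>) \<in> triv E"
  shows "smooth_wrt AT (prj E -` V) \<Phi>"
proof (rule M.smooth_wrt_local)
  fix e assume e: "e \<in> prj E -` V"
  obtain U \<phi> where c: "(U, \<phi>) \<in> A" "prj E e \<in> U" using E.chart_cover by blast
  then show "\<exists>O1. open O1 \<and> e \<in> O1 \<and> smooth_wrt AT O1 \<Phi>"
    using e smooth_total_chart(2)[OF c(1) assms] M.chart_open(1)[OF total_chart[OF c(1) assms]]
    by (intro exI[of _ "prj E -` (U \<inter> V)"]) auto
qed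

lemma Cinf_pull: "f \<in> Cinf A \<Longrightarrow> (\<lambda>e. f (prj E e)) \<in> Cinf AT"
  using smooth_pull[OF open_UNIV] by (simp add: Cinf_def)

lemma Cinf_fibre_linear:
  assumes "(V, \<Phi>) \<in> triv E" "\<theta> \<in> Cinf A" "closed K" "K \<subseteq> V" "\<And>x. x \<notin> K \<Longrightarrow> \<theta> x = 0" "linear \<alpha>"
  shows "(\<lambda>e. if prj E e \<in> V then \<theta> (prj E e) * \<alpha> (\<Phi> e) else 0) \<in> Cinf AT"
proof -
  have "(\<lambda>e. if e \<in> prj E -` V then \<theta> (prj E e) * \<alpha> (\<Phi> e) else 0) \<in> Cinf AT"
    unfolding Cinf_def
  proof (intro CollectI M.smooth_wrt_extend[of _ "prj E -` K"] M.smooth_wrt_mult)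
    show "open (prj E -` V)" by (intro prj_open E.triv_open[OF assms(1)])
    have "open (prj E -` (- K))" by (intro prj_open open_Compl assms)
    then show "closed (prj E -` K)" by (simp add: closed_def vimage_Compl)
    show "smooth_wrt AT (prj E -` V) (\<lambda>e. \<theta> (prj E e))"
      by (rule smooth_pull[OF E.triv_open[OF assms(1)] E.smooth_wrt_subset[of UNIV]])
         (use assms(2) in \<open>auto simp: Cinf_def\<close>)
    show "smooth_wrt AT (prj E -` V) (\<lambda>e. \<alpha> (\<Phi> e))"
      by (intro M.smooth_wrt_bounded_linear[OF finite_dim_bounded_linear[OF E.fd_fibre assms(6)]] smooth_triv assms)
  qed (use assms in auto)
  then show ?thesis by simp
qed

lemma triv_L: "(W, \<Psi>) \<in> triv ell \<Longrightarrow> (prj E -` W, \<Psi> \<circ> snd) \<in> triv L"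
  by (auto simp: pullback_def)

lemma section_L:
  assumes "\<sigma> \<in> sections AT L"
  shows "fst (\<sigma> e) = e" "snd (\<sigma> e) \<in> tot ell" "prj ell (snd (\<sigma> e)) = prj E e"
  using M.section_tot[OF assms, of e] M.section_prj[OF assms, of e] by (auto simp: pullback_def)

lemma section_L_smooth:
  "\<sigma> \<in> sections AT L \<Longrightarrow> (W, \<Psi>) \<in> triv ell \<Longrightarrow> smooth_wrt AT (prj E -` W) (\<lambda>e. \<Psi> (snd (\<sigma> e)))"
  using M.section_smooth[OF _ triv_L] by fastforce

lemma section_LI:
  assumes "\<And>e. fst (\<sigma> e) = e" "\<And>e. snd (\<sigma> e) \<in> tot ell" "\<And>e. prj ell (snd (\<sigma> e)) = prj E e"
    "\<And>W \<Psi>. (W, \<Psi>) \<in> triv ell \<Longrightarrow> smooth_wrt AT (prj E -` W) (\<lambda>e. \<Psi> (snd (\<sigma> e)))"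
  shows "\<sigma> \<in> sections AT L"
proof (rule M.sectionI)
  fix e
  show "\<sigma> e \<in> tot L" "prj L (\<sigma> e) = e"
    using assms(1-3)[of e] by (auto simp: pullback_def split_beta)
  obtain W \<Psi> where w: "(W, \<Psi>) \<in> triv ell" "prj E e \<in> W" using ell.triv_cover by blast
  then show "\<exists>V \<Phi> O1. (V, \<Phi>) \<in> triv L \<and> open O1 \<and> e \<in> O1 \<and> O1 \<subseteq> V \<and> smooth_wrt AT O1 (\<lambda>x. \<Phi> (\<sigma> x))"
    using triv_L[OF w(1)] M.triv_open[OF triv_L[OF w(1)]] assms(4)[OF w(1)]
    by (intro exI[of _ "prj E -` W"] exI[of _ "\<Psi> \<circ> snd"]) auto
qed

lemma section_L_eqI:
  assumes "\<sigma> \<in> sections AT L" "\<rho> \<in> sections AT L"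
    "\<And>e W \<Psi>. (W, \<Psi>) \<in> triv ell \<Longrightarrow> prj E e \<in> W \<Longrightarrow> \<Psi> (snd (\<sigma> e)) = \<Psi> (snd (\<rho> e))"
  shows "\<sigma> = \<rho>"
  using assms(1,2)
proof (rule M.section_eqI)
  fix e V \<Phi> assume "(V, \<Phi>) \<in> triv L" "e \<in> V"
  then show "\<Phi> (\<sigma> e) = \<Phi> (\<rho> e)" using assms(3) by (auto simp: pullback_def)
qed

lemma coord_L:
  assumes "(W, \<Psi>) \<in> triv ell" "prj E e \<in> W" "\<sigma> \<in> sections AT L"
  shows "\<rho> \<in> sections AT L \<Longrightarrow> \<Psi> (snd (add_sec L \<sigma> \<rho> e)) = \<Psi> (snd (\<sigma> e)) + \<Psi> (snd (\<rho> e))"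
    and "\<Psi> (snd (mult_sec L f \<sigma> e)) = f e * \<Psi> (snd (\<sigma> e))"
  using M.add_sec_coord[OF assms(3) _ triv_L[OF assms(1)], of \<rho> e]
    M.mult_sec_coord[OF assms(3) triv_L[OF assms(1)], of e f] assms(2) by simp_all

lemma coord_L_zero: "(W, \<Psi>) \<in> triv ell \<Longrightarrow> prj E e \<in> W \<Longrightarrow> \<Psi> (snd (zero_vec L e)) = 0"
  using M.zero_vec(3)[OF triv_L, of W \<Psi> e] by simp

lemma pullback_section: "\<kappa> \<in> sections A ell \<Longrightarrow> pullback_sec E \<kappa> \<in> sections AT L"
  by (rule section_LI) (auto simp: pullback_sec_def intro!: smooth_pull ell.section_smooth ell.triv_open)

lemma snd_pullback_sec [simp]: "snd (pullback_sec E \<kappa> e) = \<kappa> (prj E e)"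
  by (simp add: pullback_sec_def)

section \<open>Translations along a section and differentiation in its direction\<close>

definition shift :: "('s \<Rightarrow> 'e) \<Rightarrow> real \<Rightarrow> 'e \<Rightarrow> 'e" where
  "shift s t e = add_vec E e (scale_vec E t (s (prj E e)))"

context
  fixes s assumes s: "s \<in> sections A E"
begin

lemma prj_shift [simp]: "prj E (shift s t e) = prj E e"
  using s by (simp add: shift_def E.add_vec E.scale_vec)

lemma triv_shift: "(V, \<Phi>) \<in> triv E \<Longrightarrow> prj E e \<in> V \<Longrightarrow> \<Phi> (shift s t e) = \<Phi> e + t *\<^sub>R \<Phi> (s (prj E e))"
  using s by (simp add: shift_def E.add_vec E.scale_vec)

lemma shift_0 [simp]: "shift s 0 e = e"
proof -
  obtain V \<Phi> where t: "(V, \<Phi>) \<in> triv E" "prj E e \<in> V" using E.triv_cover by blast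
  then show ?thesis by (intro E_eqI[OF t]) (simp_all add: triv_shift)
qed

lemma shift_shift: "shift s t (shift s t' e) = shift s (t + t') e"
proof -
  obtain V \<Phi> where t: "(V, \<Phi>) \<in> triv E" "prj E e \<in> V" using E.triv_cover by blast
  then show ?thesis by (intro E_eqI[of V \<Phi>]) (simp_all add: triv_shift scaleR_add_left)
qed

lemma shift_neg: "shift (neg_sec E s) t e = shift s (- t) e"
proof -
  obtain V \<Phi> where t: "(V, \<Phi>) \<in> triv E" "prj E e \<in> V" using E.triv_cover by blast
  have p: "prj E (shift (neg_sec E s) t e) = prj E e"
    using E.neg_section[OF s] by (simp add: shift_def E.add_vec E.scale_vec)
  have "\<Phi> (shift (neg_sec E s) t e) = \<Phi> e - t *\<^sub>R \<Phi> (s (prj E e))"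
    using E.neg_section[OF s] s t E.mult_sec_coord[OF s t, of "\<lambda>_. - 1"]
    by (simp add: shift_def E.add_vec E.scale_vec neg_sec_def)
  then show ?thesis using t p by (intro E_eqI[of V \<Phi>]) (simp_all add: triv_shift)
qed

text \<open>The vertical vector field that is fiberwise constant with value \<open>s\<close>, with
  flow \<open>shift s\<close>; it will be the symbol of \<open>I_op E ell s\<close>.\<close>

definition lie :: "('e \<Rightarrow> real) \<Rightarrow> 'e \<Rightarrow> real" where
  "lie g e = deriv (\<lambda>t. g (shift s t e)) 0"

lemma smooth_on_shift:
  assumes g: "smooth_wrt AT (prj E -` X) g" and x: "prj E e \<in> X"
  shows "smooth_on UNIV (\<lambda>t. g (shift s t e) :: real)"
proof -
  obtain U \<phi> V \<Phi> where c: "(U, \<phi>) \<in> A" "(V, \<Phi>) \<in> triv E" "prj E e \<in> U" "prj E e \<in> V"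
    using total_chart_ex by blast
  let ?c = "tchart \<phi> \<Phi>"
  have sm: "smooth_on (?c ` (prj E -` (U \<inter> V) \<inter> prj E -` X)) (g \<circ> tchart_inv U \<phi> V \<Phi>)"
    by (rule M.smooth_wrtD[OF g total_chart[OF c(1,2)]])
  have "smooth_on UNIV (\<lambda>t. (g \<circ> tchart_inv U \<phi> V \<Phi>)
      (\<phi> (prj E e), \<Phi> e + t *\<^sub>R \<Phi> (s (prj E e))))"
  proof (rule smooth_on_compose[OF M.fd _ sm])
    show "smooth_on UNIV (\<lambda>t. (\<phi> (prj E e), \<Phi> e + t *\<^sub>R \<Phi> (s (prj E e))))"
      by (intro smooth_on_Pair smooth_on_add smooth_on_const smooth_on_scaleR smooth_on_ident)
    show "range (\<lambda>t. (\<phi> (prj E e), \<Phi> e + t *\<^sub>R \<Phi> (s (prj E e)))) \<subseteq> ?c ` (prj E -` (U \<inter> V) \<inter> prj E -` X)"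
      unfolding total_chart_image[OF c(1,2)] using c x by auto
  qed
  moreover have "(g \<circ> tchart_inv U \<phi> V \<Phi>) (\<phi> (prj E e), \<Phi> e + t *\<^sub>R \<Phi> (s (prj E e))) = g (shift s t e)" for t
    unfolding comp_def inv_total_chart[OF c]
    by (rule arg_cong[of _ _ g], rule E_eqI[OF c(2)]) (use c in \<open>simp_all add: triv_shift\<close>)
  ultimately show ?thesis by simp
qed

text \<open>Exhibits \<open>lie g\<close> as a derivative of the chart expression in a direction
  depending smoothly on the base point, the form from which smoothness in \<open>e\<close> can be
  read off.\<close>

lemma lie_eq_frechet:
  assumes g: "smooth_wrt AT (prj E -` X) g" and X: "open X" and x: "prj E e \<in> X"
    and c: "(U, \<phi>) \<in> A" "(V, \<Phi>) \<in> triv E" "prj E e \<in> U" "prj E e \<in> V"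
  shows "lie g e = frechet_derivative (g \<circ> tchart_inv U \<phi> V \<Phi>)
    (at (\<phi> (prj E e), \<Phi> e)) (0, \<Phi> (s (prj E e)))"
proof -
  let ?c = "tchart \<phi> \<Phi>"
  let ?G = "g \<circ> tchart_inv U \<phi> V \<Phi>"
  have sm: "smooth_on (?c ` (prj E -` (U \<inter> V) \<inter> prj E -` X)) ?G"
    by (rule M.smooth_wrtD[OF g total_chart[OF c(1,2)]])
  let ?D = "frechet_derivative ?G (at (\<phi> (prj E e), \<Phi> e))"
  have D: "(?G has_derivative ?D) (at (\<phi> (prj E e), \<Phi> e))"
    by (rule smooth_on_frechet_derivative[OF sm]) (use c x in auto)
  have "((\<lambda>t. (\<phi> (prj E e), \<Phi> e + t *\<^sub>R \<Phi> (s (prj E e)))) has_derivative (\<lambda>r. (0, r *\<^sub>R \<Phi> (s (prj E e))))) (at 0)"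
    by (auto intro!: derivative_eq_intros)
  from has_derivative_compose[OF this, of ?G ?D]
  have "((\<lambda>t. ?G (\<phi> (prj E e), \<Phi> e + t *\<^sub>R \<Phi> (s (prj E e)))) has_derivative (\<lambda>r. ?D (0, r *\<^sub>R \<Phi> (s (prj E e))))) (at 0)"
    using D by simp
  moreover have "?G (\<phi> (prj E e), \<Phi> e + t *\<^sub>R \<Phi> (s (prj E e))) = g (shift s t e)" for t
    unfolding comp_def inv_total_chart[OF c]
    by (rule arg_cong[of _ _ g], rule E_eqI[OF c(2)]) (use c in \<open>simp_all add: triv_shift\<close>)
  moreover have "?D (0, r *\<^sub>R \<Phi> (s (prj E e))) = r * ?D (0, \<Phi> (s (prj E e)))" for r
    using linear_cmul[OF has_derivative_linear[OF D], of r "(0, \<Phi> (s (prj E e)))"] by simp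
  ultimately have "((\<lambda>t. g (shift s t e)) has_derivative (\<lambda>r. r * ?D (0, \<Phi> (s (prj E e))))) (at 0)"
    by (simp only:)
  then have "((\<lambda>t. g (shift s t e)) has_real_derivative ?D (0, \<Phi> (s (prj E e)))) (at 0)"
    by (simp only: has_field_derivative_def mult_commute_abs)
  then show ?thesis unfolding lie_def by (rule DERIV_imp_deriv)
qed

lemma lie_smooth:
  assumes g: "smooth_wrt AT (prj E -` X) g" and X: "open X"
  shows "smooth_wrt AT (prj E -` X) (lie g)"
proof (rule M.smooth_wrt_local)
  fix e assume e: "e \<in> prj E -` X"
  obtain U \<phi> V \<Phi> where c: "(U, \<phi>) \<in> A" "(V, \<Phi>) \<in> triv E" "prj E e \<in> U" "prj E e \<in> V"
    using total_chart_ex by blast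
  let ?c = "tchart \<phi> \<Phi>"
  let ?G = "g \<circ> tchart_inv U \<phi> V \<Phi>"
  let ?O = "prj E -` (U \<inter> V) \<inter> prj E -` X"
  have o: "open ?O" using prj_open[OF X] M.chart_open(1)[OF total_chart[OF c(1,2)]] by (rule open_Int[rotated])
  have sm: "smooth_on (?c ` ?O) ?G" by (rule M.smooth_wrtD[OF g total_chart[OF c(1,2)]])
  have oc: "open (?c ` ?O)"
    by (rule M.chart_image_open[OF total_chart[OF c(1,2)] prj_open[OF X]])
  have cs: "smooth_wrt AT ?O ?c"
    by (rule M.smooth_wrt_subset[OF M.smooth_wrt_chart[OF total_chart[OF c(1,2)]]]) auto
  have "smooth_wrt AT ?O (\<lambda>e. (\<lambda>w. frechet_derivative ?G (at (?c e)) (0, w)) (\<Phi> (s (prj E e))))"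
  proof (rule M.smooth_wrt_linear_family[where g = "\<lambda>e w. frechet_derivative ?G (at (?c e)) (0, w)"
        and u = "\<lambda>e. \<Phi> (s (prj E e))", OF E.fd_fibre _ _ o])
    fix e' assume "e' \<in> ?O"
    then have "(?G has_derivative frechet_derivative ?G (at (?c e'))) (at (?c e'))"
      by (intro smooth_on_frechet_derivative[OF sm]) auto
    from has_derivative_linear[OF this]
    have "linear (frechet_derivative ?G (at (?c e')))" .
    moreover have "linear (\<lambda>w::'f. (0::'b, w))" by (intro linearI) auto
    ultimately show "linear (\<lambda>w. frechet_derivative ?G (at (?c e')) (0, w))"
      using linear_compose[of "\<lambda>w. (0, w)" "frechet_derivative ?G (at (?c e'))"] by (simp add: comp_def)
  next
    fix w
    show "smooth_wrt AT ?O (\<lambda>e. frechet_derivative ?G (at (?c e)) (0, w))"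
      by (rule M.smooth_wrt_compose[OF M.fd cs smooth_on_frechet[OF sm oc]]) simp
  next
    show "smooth_wrt AT ?O (\<lambda>e. \<Phi> (s (prj E e)))"
      by (rule M.smooth_wrt_subset[OF smooth_pull[OF E.triv_open[OF c(2)] E.section_smooth[OF s c(2)]]]) auto
  qed
  then have "smooth_wrt AT ?O (lie g)"
    by (rule M.smooth_wrt_cong[OF o, rotated]) (use lie_eq_frechet[OF g X _ c(1,2)] in simp)
  then show "\<exists>O1. open O1 \<and> e \<in> O1 \<and> smooth_wrt AT O1 (lie g)" using o e c by blast
qed

text \<open>The group law of the translations moves the derivative at time \<open>t\<close> to time
  0 at the translated point.\<close>

lemma shift_derivative:
  assumes g: "smooth_wrt AT (prj E -` X) g" and x: "prj E e \<in> X"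
  shows "((\<lambda>t. g (shift s t e)) has_real_derivative lie g (shift s t e)) (at t)"
proof -
  have "\<exists>D. ((\<lambda>h. g (shift s h (shift s t e))) has_derivative D) (at 0)"
    by (rule smooth_on_differentiable[OF smooth_on_shift[OF g]]) (use x in auto)
  then have "(\<lambda>h. g (shift s h (shift s t e))) differentiable (at 0)" by (simp add: differentiable_def)
  then have "((\<lambda>h. g (shift s h (shift s t e))) has_real_derivative lie g (shift s t e)) (at 0)"
    unfolding lie_def using DERIV_deriv_iff_real_differentiable by blast
  then have "((\<lambda>h. g (shift s (h + t) e)) has_real_derivative lie g (shift s t e)) (at 0)"
    by (simp only: shift_shift)
  then show ?thesis using DERIV_shift[of "\<lambda>t. g (shift s t e)" _ 0 t] by simp
qed

lemma lieI:
  assumes "((\<lambda>t. g (shift s t e)) has_real_derivative d) (at 0)"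
  shows "lie g e = d"
  unfolding lie_def using assms by (rule DERIV_imp_deriv)

lemma lie_derivative_0:
  assumes g: "smooth_wrt AT (prj E -` X) g" and x: "prj E e \<in> X"
  shows "((\<lambda>t. g (shift s t e)) has_real_derivative lie g e) (at 0)"
  using shift_derivative[OF assms, of 0] by simp

lemma lie_add:
  assumes "smooth_wrt AT (prj E -` X) f" "smooth_wrt AT (prj E -` X) g" "prj E e \<in> X"
  shows "lie (\<lambda>e. f e + g e) e = lie f e + lie g e"
  by (intro lieI DERIV_add lie_derivative_0[OF assms(1,3)] lie_derivative_0[OF assms(2,3)])

lemma lie_mult:
  assumes "smooth_wrt AT (prj E -` X) f" "smooth_wrt AT (prj E -` X) g" "prj E e \<in> X"
  shows "lie (\<lambda>e. f e * g e) e = lie f e * g e + f e * lie g e"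
  using DERIV_mult[OF lie_derivative_0[OF assms(1,3)] lie_derivative_0[OF assms(2,3)]]
  by (intro lieI) (simp add: mult.commute add.commute)

lemma lie_cong:
  assumes "\<And>t. g (shift s t e) = g' (shift s t e)"
  shows "lie g e = lie g' e"
  using assms by (simp add: lie_def)

lemma lie_pull: "lie (\<lambda>e. g (prj E e)) e = 0"
  by (rule lieI) simp

text \<open>The transition functions of the pulled back bundle are constant along the fibres of
  \<open>E\<close>, so differentiation along a fibre commutes with changes of trivialization and
  defines an element of \<open>ell\<close>.\<close>

lemma I_op_coord:
  assumes \<sigma>: "\<sigma> \<in> sections AT L"
  shows "fst (I_op E ell s \<sigma> e) = e" "snd (I_op E ell s \<sigma> e) \<in> tot ell"
    "prj ell (snd (I_op E ell s \<sigma> e)) = prj E e"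
    "(W, \<Psi>) \<in> triv ell \<Longrightarrow> prj E e \<in> W \<Longrightarrow> \<Psi> (snd (I_op E ell s \<sigma> e)) = lie (\<lambda>e. \<Psi> (snd (\<sigma> e))) e"
proof -
  let ?p = "\<lambda>\<Psi>. vector_derivative (\<lambda>t. \<Psi> (snd (\<sigma> (add_vec E e (scale_vec E t (s (prj E e))))))) (at 0)"
  have eq: "snd (I_op E ell s \<sigma> e) = the_vec ell (prj E e) ?p" by (simp add: I_op_def)
  have d: "?p \<Psi> = lie (\<lambda>e. \<Psi> (snd (\<sigma> e))) e" if "(W, \<Psi>) \<in> triv ell" "prj E e \<in> W" for W \<Psi>
    unfolding lie_def shift_def by (rule field_derivative_eq_vector_derivative[symmetric])
  have co: "?p \<Psi> = g (?p \<Phi>)"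
    if a: "(V, \<Phi>) \<in> triv ell" "(W, \<Psi>) \<in> triv ell" "prj E e \<in> V" "prj E e \<in> W" "linear g"
      "\<And>b. b \<in> tot ell \<Longrightarrow> prj ell b = prj E e \<Longrightarrow> \<Psi> b = g (\<Phi> b)" for V \<Phi> W \<Psi> g
  proof -
    have lg: "g r = r * g 1" for r using linear_cmul[OF a(5), of r 1] by simp
    have "\<Psi> (snd (\<sigma> (shift s t e))) = \<Phi> (snd (\<sigma> (shift s t e))) * g 1" for t
    proof -
      have "\<Psi> (snd (\<sigma> (shift s t e))) = g (\<Phi> (snd (\<sigma> (shift s t e))))"
        by (rule a(6)) (simp_all add: section_L[OF \<sigma>])
      also have "\<dots> = \<Phi> (snd (\<sigma> (shift s t e))) * g 1" by (rule lg)
      finally show ?thesis .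
    qed
    moreover have "((\<lambda>t. \<Phi> (snd (\<sigma> (shift s t e))) * g 1) has_real_derivative lie (\<lambda>e. \<Phi> (snd (\<sigma> e))) e * g 1) (at 0)"
      by (intro DERIV_cmult_right lie_derivative_0[OF section_L_smooth[OF \<sigma> a(1)] a(3)])
    ultimately have "lie (\<lambda>e. \<Psi> (snd (\<sigma> e))) e = lie (\<lambda>e. \<Phi> (snd (\<sigma> e))) e * g 1"
      by (intro lieI) simp
    also have "\<dots> = g (lie (\<lambda>e. \<Phi> (snd (\<sigma> e))) e)" by (rule lg[symmetric])
    finally show ?thesis by (simp only: d[OF a(1,3)] d[OF a(2,4)])
  qed
  note tv = ell.the_vec[where p = ?p and x = "prj E e"]
  show "fst (I_op E ell s \<sigma> e) = e" by (simp add: I_op_def)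
  show "snd (I_op E ell s \<sigma> e) \<in> tot ell" unfolding eq by (rule tv(1)) (rule co; (assumption | simp))
  show "prj ell (snd (I_op E ell s \<sigma> e)) = prj E e" unfolding eq by (rule tv(2)) (rule co; (assumption | simp))
  assume t: "(W, \<Psi>) \<in> triv ell" "prj E e \<in> W"
  have "\<Psi> (snd (I_op E ell s \<sigma> e)) = ?p \<Psi>"
    unfolding eq by (rule tv(3)[OF _ t]) (rule co; (assumption | simp))
  then show "\<Psi> (snd (I_op E ell s \<sigma> e)) = lie (\<lambda>e. \<Psi> (snd (\<sigma> e))) e" using d[OF t] by simp
qed

lemma I_op_section:
  assumes \<sigma>: "\<sigma> \<in> sections AT L"
  shows "I_op E ell s \<sigma> \<in> sections AT L"
proof (rule section_LI)
  fix W \<Psi> assume t: "(W, \<Psi>) \<in> triv ell"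
  show "smooth_wrt AT (prj E -` W) (\<lambda>e. \<Psi> (snd (I_op E ell s \<sigma> e)))"
    by (rule M.smooth_wrt_cong[OF prj_open[OF ell.triv_open[OF t]] _
          lie_smooth[OF section_L_smooth[OF \<sigma> t] ell.triv_open[OF t]]])
       (use I_op_coord(4)[OF \<sigma> t] in simp)
qed (use I_op_coord(1-3)[OF \<sigma>] in auto)

lemma I_op_derivation: "M.derivation lie (I_op E ell s)"
  unfolding M.derivation_def
proof (intro conjI ballI allI)
  fix \<sigma> \<rho> assume h: "\<sigma> \<in> sections AT L" "\<rho> \<in> sections AT L"
  show "I_op E ell s (add_sec L \<sigma> \<rho>) = add_sec L (I_op E ell s \<sigma>) (I_op E ell s \<rho>)"
  proof (rule section_L_eqI)
    fix e W \<Psi> assume t: "(W, \<Psi>) \<in> triv ell" "prj E e \<in> W"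
    have "lie (\<lambda>e. \<Psi> (snd (add_sec L \<sigma> \<rho> e))) e = lie (\<lambda>e. \<Psi> (snd (\<sigma> e)) + \<Psi> (snd (\<rho> e))) e"
      by (rule lie_cong) (use t h in \<open>simp add: coord_L\<close>)
    then show "\<Psi> (snd (I_op E ell s (add_sec L \<sigma> \<rho>) e)) = \<Psi> (snd (add_sec L (I_op E ell s \<sigma>) (I_op E ell s \<rho>) e))"
      using h t lie_add[OF section_L_smooth[OF h(1) t(1)] section_L_smooth[OF h(2) t(1)] t(2)]
      by (simp add: I_op_coord coord_L I_op_section M.add_section)
  qed (use h in \<open>simp_all add: I_op_section M.add_section\<close>)
next
  fix f \<sigma> assume h: "f \<in> Cinf AT" "\<sigma> \<in> sections AT L"
  have "smooth_wrt AT (prj E -` UNIV) f" using h by (simp add: Cinf_def)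
  then have l: "lie f \<in> Cinf AT" using lie_smooth[OF _ open_UNIV] by (simp add: Cinf_def)
  show "I_op E ell s (mult_sec L f \<sigma>) = add_sec L (mult_sec L (lie f) \<sigma>) (mult_sec L f (I_op E ell s \<sigma>))"
  proof (rule section_L_eqI)
    fix e W \<Psi> assume t: "(W, \<Psi>) \<in> triv ell" "prj E e \<in> W"
    have f: "smooth_wrt AT (prj E -` W) f" using h M.smooth_wrt_subset unfolding Cinf_def by blast
    have "lie (\<lambda>e. \<Psi> (snd (mult_sec L f \<sigma> e))) e = lie (\<lambda>e. f e * \<Psi> (snd (\<sigma> e))) e"
      by (rule lie_cong) (use t h in \<open>simp add: coord_L\<close>)
    then show "\<Psi> (snd (I_op E ell s (mult_sec L f \<sigma>) e)) =
        \<Psi> (snd (add_sec L (mult_sec L (lie f) \<sigma>) (mult_sec L f (I_op E ell s \<sigma>)) e))"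
      using h t l lie_mult[OF f section_L_smooth[OF h(2) t(1)] t(2)]
      by (simp add: I_op_coord coord_L I_op_section M.mult_section)
  qed (use h l in \<open>simp_all add: I_op_section M.add_section M.mult_section\<close>)
next
  fix f g assume h: "f \<in> Cinf AT" "g \<in> Cinf AT"
  show "lie (\<lambda>z. f z * g z) = (\<lambda>z. lie f z * g z + f z * lie g z)"
    by (intro ext lie_mult[of UNIV]) (use h in \<open>simp_all add: Cinf_def\<close>)
next
  fix f assume h: "f \<in> Cinf AT"
  show "lie f \<in> Cinf AT" using lie_smooth[OF _ open_UNIV, of f] h by (simp add: Cinf_def)
next
  fix c show "lie (\<lambda>_. c) = (\<lambda>_. 0)" by (intro ext lieI) simp
qed (simp add: I_op_section)

end

lemma I_op_neg:
  assumes s: "s \<in> sections A E" and \<sigma>: "\<sigma> \<in> sections AT L"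
  shows "I_op E ell (neg_sec E s) \<sigma> = mult_sec L (\<lambda>_. - 1) (I_op E ell s \<sigma>)"
proof (rule section_L_eqI)
  note n = E.neg_section[OF s]
  show "I_op E ell (neg_sec E s) \<sigma> \<in> sections AT L" by (rule I_op_section[OF n \<sigma>])
  show "mult_sec L (\<lambda>_. - 1) (I_op E ell s \<sigma>) \<in> sections AT L"
    by (intro M.cmult_section I_op_section[OF s \<sigma>])
  fix e W \<Psi> assume t: "(W, \<Psi>) \<in> triv ell" "prj E e \<in> W"
  have "((\<lambda>t. \<Psi> (snd (\<sigma> (shift s t e)))) has_real_derivative lie s (\<lambda>e. \<Psi> (snd (\<sigma> e))) e) (at (- 0))"
    using lie_derivative_0[OF s section_L_smooth[OF \<sigma> t(1)] t(2)] by simp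
  then have "((\<lambda>t. \<Psi> (snd (\<sigma> (shift s (- t) e)))) has_real_derivative - lie s (\<lambda>e. \<Psi> (snd (\<sigma> e))) e) (at 0)"
    by (simp only: DERIV_mirror)
  then have "lie (neg_sec E s) (\<lambda>e. \<Psi> (snd (\<sigma> e))) e = - lie s (\<lambda>e. \<Psi> (snd (\<sigma> e))) e"
    by (intro lieI[OF n]) (simp add: shift_neg[OF s])
  then show "\<Psi> (snd (I_op E ell (neg_sec E s) \<sigma> e)) = \<Psi> (snd (mult_sec L (\<lambda>_. - 1) (I_op E ell s \<sigma>) e))"
    using t s n \<sigma> by (simp add: I_op_coord coord_L I_op_section)
qed

end

section \<open>Taylor series along rays\<close>

lemma smooth_real_derivative:
  fixes q :: "real \<Rightarrow> real"
  assumes "smooth_on UNIV q"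
  shows "(q has_real_derivative deriv q t) (at t)" "smooth_on UNIV (deriv q)"
proof -
  have d: "(q has_real_derivative deriv q t) (at t)" for t
    using smooth_on_differentiable[OF assms, of t] DERIV_deriv_iff_real_differentiable
    by (auto simp: differentiable_def)
  have "deriv q t = frechet_derivative q (at t) 1" for t
    using frechet_derivative_at[OF d[of t, unfolded has_field_derivative_def]] by (metis mult.right_neutral)
  then have "deriv q = (\<lambda>t. frechet_derivative q (at t) 1)" by blast
  then show "smooth_on UNIV (deriv q)" using smooth_on_frechet[OF assms open_UNIV, of 1] by simp
  show "(q has_real_derivative deriv q t) (at t)" by (rule d)
qed

lemma smooth_times:
  fixes q :: "real \<Rightarrow> real"
  shows "smooth_on UNIV q \<Longrightarrow> smooth_on UNIV (\<lambda>t. t * q t)"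
  by (intro smooth_on_mult smooth_on_ident)

lemma smooth_cmult:
  fixes q :: "real \<Rightarrow> real"
  shows "smooth_on UNIV q \<Longrightarrow> smooth_on UNIV (\<lambda>t. c * q t)"
  by (intro smooth_on_mult smooth_on_const)

lemma smooth_deriv_funpow:
  fixes q :: "real \<Rightarrow> real"
  shows "smooth_on UNIV q \<Longrightarrow> smooth_on UNIV ((deriv ^^ n) q)"
  by (induction n) (auto intro: smooth_real_derivative(2))

lemma deriv_funpow_add:
  fixes p q :: "real \<Rightarrow> real"
  assumes "smooth_on UNIV p" "smooth_on UNIV q"
  shows "(deriv ^^ n) (\<lambda>t. p t + q t) = (\<lambda>t. (deriv ^^ n) p t + (deriv ^^ n) q t)"
proof (induction n)
  case (Suc n)
  have "deriv (\<lambda>t. (deriv ^^ n) p t + (deriv ^^ n) q t) t = deriv ((deriv ^^ n) p) t + deriv ((deriv ^^ n) q) t" for t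
    by (intro DERIV_imp_deriv DERIV_add smooth_real_derivative(1) smooth_deriv_funpow assms)
  then show ?case by (auto simp: Suc)
qed simp

lemma deriv_funpow_cmult:
  fixes q :: "real \<Rightarrow> real"
  assumes "smooth_on UNIV q"
  shows "(deriv ^^ n) (\<lambda>t. c * q t) = (\<lambda>t. c * (deriv ^^ n) q t)"
proof (induction n)
  case (Suc n)
  have "deriv (\<lambda>t. c * (deriv ^^ n) q t) t = c * deriv ((deriv ^^ n) q) t" for t
    by (intro DERIV_imp_deriv DERIV_cmult smooth_real_derivative(1) smooth_deriv_funpow assms)
  then show ?case by (auto simp: Suc)
qed simp

lemma deriv_funpow_times:
  fixes q :: "real \<Rightarrow> real"
  assumes "smooth_on UNIV q"
  shows "(deriv ^^ n) (\<lambda>t. t * q t) = (\<lambda>t. t * (deriv ^^ n) q t + real n * (deriv ^^ (n - 1)) q t)"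
proof (induction n)
  case (Suc n)
  note d = smooth_real_derivative(1)[OF smooth_deriv_funpow[OF assms]]
  have "deriv (\<lambda>t. t * (deriv ^^ n) q t + real n * (deriv ^^ (n - 1)) q t) t =
      t * (deriv ^^ Suc n) q t + real (Suc n) * (deriv ^^ n) q t" for t
  proof -
    have "((\<lambda>t. t * (deriv ^^ n) q t + real n * (deriv ^^ (n - 1)) q t) has_real_derivative
        (1 * (deriv ^^ n) q t + deriv ((deriv ^^ n) q) t * t) + real n * deriv ((deriv ^^ (n - 1)) q) t) (at t)"
      by (intro DERIV_add DERIV_mult DERIV_ident DERIV_cmult d)
    then have "deriv (\<lambda>t. t * (deriv ^^ n) q t + real n * (deriv ^^ (n - 1)) q t) t =
        (1 * (deriv ^^ n) q t + deriv ((deriv ^^ n) q) t * t) + real n * deriv ((deriv ^^ (n - 1)) q) t"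
      by (rule DERIV_imp_deriv)
    also have "real n * deriv ((deriv ^^ (n - 1)) q) t = real n * (deriv ^^ n) q t"
      by (cases n) auto
    finally show ?thesis by (simp add: algebra_simps)
  qed
  then show ?case by (auto simp: Suc)
qed simp

text \<open>Only the value at 1 is recorded: the functions in question live on rays t u, and
  \<open>u\<close> will range over a whole fibre.\<close>

definition taylor_sums :: "(real \<Rightarrow> real) \<Rightarrow> bool" where
  "taylor_sums q \<longleftrightarrow> (\<lambda>n. (deriv ^^ n) q 0 / fact n) sums q 1"

lemma taylor_sums_add:
  assumes "smooth_on UNIV p" "smooth_on UNIV q" "taylor_sums p" "taylor_sums q"
  shows "taylor_sums (\<lambda>t. p t + q t)"
  using sums_add[OF assms(3,4)[unfolded taylor_sums_def]]
  unfolding taylor_sums_def deriv_funpow_add[OF assms(1,2)] by (simp add: add_divide_distrib)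

lemma taylor_sums_cmult:
  assumes "smooth_on UNIV q" "taylor_sums q"
  shows "taylor_sums (\<lambda>t. c * q t)"
  using sums_mult[OF assms(2)[unfolded taylor_sums_def], of c]
  unfolding taylor_sums_def deriv_funpow_cmult[OF assms(1)] by simp

text \<open>The n-th derivative of t q(t) at 0 is n times the derivative of \<open>q\<close> of
  order n - 1, so that division by n! reproduces the series of \<open>q\<close> shifted by one; both
  functions agree at 1. The direction from left to right divides out the powers of t with which
  components of \<Lambda> occur.\<close>

lemma taylor_sums_times_iff:
  assumes "smooth_on UNIV q"
  shows "taylor_sums (\<lambda>t. t * q t) \<longleftrightarrow> taylor_sums q"
proof -
  have "taylor_sums (\<lambda>t. t * q t) \<longleftrightarrow> (\<lambda>n. real n * (deriv ^^ (n - 1)) q 0 / fact n) sums q 1"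
    unfolding taylor_sums_def deriv_funpow_times[OF assms] by simp
  also have "\<dots> \<longleftrightarrow> (\<lambda>n. real (Suc n) * (deriv ^^ n) q 0 / fact (Suc n)) sums q 1"
    using sums_Suc_iff[of "\<lambda>n. real n * (deriv ^^ (n - 1)) q 0 / fact n" "q 1"] by simp
  also have "(\<lambda>n. real (Suc n) * (deriv ^^ n) q 0 / fact (Suc n)) = (\<lambda>n. (deriv ^^ n) q 0 / fact n)"
    by (auto simp del: of_nat_Suc)
  finally show ?thesis by (simp add: taylor_sums_def)
qed

lemma taylor_sums_times: "smooth_on UNIV q \<Longrightarrow> taylor_sums q \<Longrightarrow> taylor_sums (\<lambda>t. t * q t)"
  using taylor_sums_times_iff by blast

lemma dir_deriv_ray:
  fixes h :: "'f::real_normed_vector \<Rightarrow> real"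
  assumes h: "smooth_on UNIV h"
  shows "smooth_on UNIV ((dir_deriv u ^^ n) h)"
    "(deriv ^^ n) (\<lambda>t. h (t *\<^sub>R u)) = (\<lambda>t. (dir_deriv u ^^ n) h (t *\<^sub>R u))"
proof -
  show s: "smooth_on UNIV ((dir_deriv u ^^ n) h)" for n
    by (induction n) (auto simp: dir_deriv_def h intro: smooth_on_frechet)
  show "(deriv ^^ n) (\<lambda>t. h (t *\<^sub>R u)) = (\<lambda>t. (dir_deriv u ^^ n) h (t *\<^sub>R u))"
  proof (induction n)
    case (Suc n)
    let ?h = "(dir_deriv u ^^ n) h"
    have "deriv (\<lambda>t. ?h (t *\<^sub>R u)) t = dir_deriv u ?h (t *\<^sub>R u)" for t
    proof (rule DERIV_imp_deriv)
      note D = smooth_on_frechet_derivative[OF s[of n] UNIV_I, of "t *\<^sub>R u"]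
      have "((\<lambda>t. t *\<^sub>R u) has_derivative (\<lambda>r. r *\<^sub>R u)) (at t)" by (auto intro!: derivative_eq_intros)
      from has_derivative_compose[OF this D]
      have "((\<lambda>t. ?h (t *\<^sub>R u)) has_derivative (\<lambda>r. frechet_derivative ?h (at (t *\<^sub>R u)) (r *\<^sub>R u))) (at t)" .
      then show "((\<lambda>t. ?h (t *\<^sub>R u)) has_real_derivative dir_deriv u ?h (t *\<^sub>R u)) (at t)"
        by (simp add: has_field_derivative_def dir_deriv_def linear_cmul[OF has_derivative_linear[OF D]] mult_commute_abs)
    qed
    then show ?case by (auto simp: Suc)
  qed simp
qed

lemma entire_iff_taylor_sums:
  fixes h :: "'f::real_normed_vector \<Rightarrow> real"
  assumes "smooth_on UNIV h"
  shows "entire h \<longleftrightarrow> (\<forall>u. taylor_sums (\<lambda>t. h (t *\<^sub>R u)))"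
  unfolding entire_def taylor_sums_def dir_deriv_ray(2)[OF assms] by simp

text \<open>\<open>F n i j\<close> will be the value of the \<open>n\<close>-th iterated bracket on \<open>D\<^sup>i a\<close> and \<open>D\<^sup>j b\<close> along a ray,
  where \<open>D\<^sup>2 a = D\<^sup>2 b = 0\<close>.\<close>

lemma iterated_bracket_taylor:
  fixes F :: "nat \<Rightarrow> nat \<Rightarrow> nat \<Rightarrow> real \<Rightarrow> real"
  assumes sm: "\<And>i j. smooth_on UNIV (F 0 i j)"
    and rec: "\<And>n i j. F (Suc n) i j = (\<lambda>t. deriv (F n i j) t - F n (Suc i) j t - F n i (Suc j) t)"
    and zero: "\<And>n i j. i \<ge> 2 \<or> j \<ge> 2 \<Longrightarrow> F n i j = (\<lambda>_. 0)"
  shows "F n 0 0 0 = (deriv ^^ n) (\<lambda>t. F 0 0 0 t + (- 1) * (t * (F 0 1 0 t + F 0 0 1 t)) + t * (t * F 0 1 1 t)) 0"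
proof -
  note sd = smooth_real_derivative(1)[OF smooth_deriv_funpow[OF sm]]
  \<comment> \<open>For \<open>n = 0\<close> the truncated \<open>n - 1\<close> gives a wrong order
    of differentiation, but the factor \<open>real n\<close> vanishes.\<close>
  have pd: "real n * deriv ((deriv ^^ (n - 1)) q) t = real n * (deriv ^^ n) q t" for n t and q :: "real \<Rightarrow> real"
    by (cases n) auto
  have F11: "F n 1 1 = (deriv ^^ n) (F 0 1 1)" for n
    by (induction n) (auto simp: rec zero)
  have F01: "F n 0 1 = (\<lambda>t. (deriv ^^ n) (F 0 0 1) t - real n * (deriv ^^ (n - 1)) (F 0 1 1) t)" for n
  proof (induction n)
    case (Suc n)
    have "deriv (\<lambda>t. (deriv ^^ n) (F 0 0 1) t - real n * (deriv ^^ (n - 1)) (F 0 1 1) t) t =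
        deriv ((deriv ^^ n) (F 0 0 1)) t - real n * deriv ((deriv ^^ (n - 1)) (F 0 1 1)) t" for t
      by (intro DERIV_imp_deriv DERIV_diff DERIV_cmult sd)
    then have d: "deriv (F n 0 1) t = deriv ((deriv ^^ n) (F 0 0 1)) t - real n * (deriv ^^ n) (F 0 1 1) t" for t
      unfolding Suc pd .
    show ?case
    proof
      fix t
      have "F (Suc n) 0 1 t = deriv (F n 0 1) t - F n 1 1 t - F n 0 (Suc 1) t" using rec[of n 0 1] by simp
      also have "\<dots> = deriv (F n 0 1) t - (deriv ^^ n) (F 0 1 1) t" by (simp add: zero F11[of n, simplified])
      also have "\<dots> = (deriv ^^ Suc n) (F 0 0 1) t - real (Suc n) * (deriv ^^ (Suc n - 1)) (F 0 1 1) t"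
        unfolding d by (simp add: algebra_simps)
      finally show "F (Suc n) 0 1 t = (deriv ^^ Suc n) (F 0 0 1) t - real (Suc n) * (deriv ^^ (Suc n - 1)) (F 0 1 1) t" .
    qed
  qed simp
  have F10: "F n 1 0 = (\<lambda>t. (deriv ^^ n) (F 0 1 0) t - real n * (deriv ^^ (n - 1)) (F 0 1 1) t)" for n
  proof (induction n)
    case (Suc n)
    have "deriv (\<lambda>t. (deriv ^^ n) (F 0 1 0) t - real n * (deriv ^^ (n - 1)) (F 0 1 1) t) t =
        deriv ((deriv ^^ n) (F 0 1 0)) t - real n * deriv ((deriv ^^ (n - 1)) (F 0 1 1)) t" for t
      by (intro DERIV_imp_deriv DERIV_diff DERIV_cmult sd)
    then have d: "deriv (F n 1 0) t = deriv ((deriv ^^ n) (F 0 1 0)) t - real n * (deriv ^^ n) (F 0 1 1) t" for t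
      unfolding Suc pd .
    show ?case
    proof
      fix t
      have "F (Suc n) 1 0 t = deriv (F n 1 0) t - F n (Suc 1) 0 t - F n 1 1 t" using rec[of n 1 0] by simp
      also have "\<dots> = deriv (F n 1 0) t - (deriv ^^ n) (F 0 1 1) t" by (simp add: zero F11[of n, simplified])
      also have "\<dots> = (deriv ^^ Suc n) (F 0 1 0) t - real (Suc n) * (deriv ^^ (Suc n - 1)) (F 0 1 1) t"
        unfolding d by (simp add: algebra_simps)
      finally show "F (Suc n) 1 0 t = (deriv ^^ Suc n) (F 0 1 0) t - real (Suc n) * (deriv ^^ (Suc n - 1)) (F 0 1 1) t" .
    qed
  qed simp
  \<comment> \<open>The expansion of (d - S1 - S2)^n, where d is the derivative and S1, S2 raise the
    indices \<open>i\<close>, \<open>j\<close>. These operations commute and S1^2 = S2^2 = 0, so (S1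
    + S2)^2 = 2 S1 S2 is the last surviving power; its coefficient n(n-1)/2 becomes n(n-1).\<close>
  have F00: "F n 0 0 = (\<lambda>t. (deriv ^^ n) (F 0 0 0) t
      - real n * ((deriv ^^ (n - 1)) (F 0 1 0) t + (deriv ^^ (n - 1)) (F 0 0 1) t)
      + real n * (real (n - 1) * (deriv ^^ (n - 2)) (F 0 1 1) t))" for n
  proof (induction n)
    case (Suc n)
    have "deriv (\<lambda>t. (deriv ^^ n) (F 0 0 0) t
      - real n * ((deriv ^^ (n - 1)) (F 0 1 0) t + (deriv ^^ (n - 1)) (F 0 0 1) t)
      + real n * (real (n - 1) * (deriv ^^ (n - 2)) (F 0 1 1) t)) t =
      deriv ((deriv ^^ n) (F 0 0 0)) t
      - real n * (deriv ((deriv ^^ (n - 1)) (F 0 1 0)) t + deriv ((deriv ^^ (n - 1)) (F 0 0 1)) t)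
      + real n * (real (n - 1) * deriv ((deriv ^^ (n - 2)) (F 0 1 1)) t)" for t
      by (intro DERIV_imp_deriv DERIV_diff DERIV_add DERIV_cmult sd)
    moreover have "real (n - 1) * deriv ((deriv ^^ (n - 2)) (F 0 1 1)) t = real (n - 1) * (deriv ^^ (n - 1)) (F 0 1 1) t" for t
      using pd[of "n - 1" "F 0 1 1" t] by (simp add: numeral_2_eq_2)
    ultimately have d: "deriv (F n 0 0) t = deriv ((deriv ^^ n) (F 0 0 0)) t
      - (real n * (deriv ^^ n) (F 0 1 0) t + real n * (deriv ^^ n) (F 0 0 1) t)
      + real n * (real (n - 1) * (deriv ^^ (n - 1)) (F 0 1 1) t)" for t
      unfolding Suc by (simp only: distrib_left pd)
    have r: "real (Suc n) * (real n * z) = real n * (real (n - 1) * z) + 2 * (real n * z)" for z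
      by (cases n) (auto simp: algebra_simps)
    show ?case
    proof
      fix t
      have "F (Suc n) 0 0 t = deriv (F n 0 0) t - F n 1 0 t - F n 0 1 t" using rec[of n 0 0] by simp
      also have "\<dots> = (deriv ^^ Suc n) (F 0 0 0) t
        - real (Suc n) * ((deriv ^^ n) (F 0 1 0) t + (deriv ^^ n) (F 0 0 1) t)
        + real (Suc n) * (real n * (deriv ^^ (n - 1)) (F 0 1 1) t)"
        unfolding d F10[of n] F01[of n] r by (simp add: algebra_simps)
      finally show "F (Suc n) 0 0 t = (deriv ^^ Suc n) (F 0 0 0) t
        - real (Suc n) * ((deriv ^^ (Suc n - 1)) (F 0 1 0) t + (deriv ^^ (Suc n - 1)) (F 0 0 1) t)
        + real (Suc n) * (real (Suc n - 1) * (deriv ^^ (Suc n - 2)) (F 0 1 1) t)"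
        by (simp add: numeral_2_eq_2)
    qed
  qed simp
  have s1: "smooth_on UNIV (\<lambda>t. F 0 1 0 t + F 0 0 1 t)" by (intro smooth_on_add sm)
  \<comment> \<open>At 0, Leibniz's rule leaves n times the derivative of order n - 1 from a factor
    t and n(n-1) times that of order n - 2 from a factor t^2: the coefficients of
    \<open>F00\<close>.\<close>
  show ?thesis
    unfolding F00[of n] deriv_funpow_add[OF smooth_on_add[OF sm smooth_cmult[OF smooth_times[OF s1]]] smooth_times[OF smooth_times[OF sm]]]
      deriv_funpow_add[OF sm smooth_cmult[OF smooth_times[OF s1]]] deriv_funpow_cmult[OF smooth_times[OF s1]] deriv_funpow_times[OF s1]
      deriv_funpow_times[OF smooth_times[OF sm]] deriv_funpow_times[OF sm] deriv_funpow_add[OF sm sm]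
    by (simp add: numeral_2_eq_2)
qed

section \<open>Smooth functions along fibres, rays and translates\<close>

context fat_neighborhood
begin

lemma smooth_on_fibre:
  assumes g: "smooth_wrt AT (prj E -` X) g" and x: "x \<in> X" and t: "(V, \<Phi>) \<in> triv E" "x \<in> V"
  shows "smooth_on UNIV (\<lambda>u. g (pt \<Phi> x u) :: real)"
proof -
  obtain U \<phi> where c: "(U, \<phi>) \<in> A" "x \<in> U" using E.chart_cover by blast
  let ?c = "tchart \<phi> \<Phi>"
  have sm: "smooth_on (?c ` (prj E -` (U \<inter> V) \<inter> prj E -` X)) (g \<circ> tchart_inv U \<phi> V \<Phi>)"
    by (rule M.smooth_wrtD[OF g total_chart[OF c(1) t(1)]])
  have "smooth_on UNIV (\<lambda>u. (g \<circ> tchart_inv U \<phi> V \<Phi>) (\<phi> x, u))"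
  proof (rule smooth_on_compose[OF M.fd _ sm])
    show "smooth_on UNIV (\<lambda>u. (\<phi> x, u))" by (intro smooth_on_Pair smooth_on_const smooth_on_ident)
    show "range (\<lambda>u. (\<phi> x, u)) \<subseteq> ?c ` (prj E -` (U \<inter> V) \<inter> prj E -` X)"
      unfolding total_chart_image[OF c(1) t(1)] using c x t by auto
  qed
  then show ?thesis unfolding comp_def inv_total_chart[OF c(1) t(1) c(2) t(2)] .
qed

lemma scale_pt:
  assumes "(V, \<Phi>) \<in> triv E" "x \<in> V"
  shows "pt \<Phi> x (r *\<^sub>R u) = scale_vec E r (pt \<Phi> x u)"
  using assms by (intro E_eqI[OF assms(1)]) (simp_all add: E.scale_vec)

lemma smooth_on_ray:
  assumes g: "smooth_wrt AT (prj E -` X) g" and x: "prj E e \<in> X"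
  shows "smooth_on UNIV (\<lambda>r. g (scale_vec E r e) :: real)"
proof -
  obtain V \<Phi> where t: "(V, \<Phi>) \<in> triv E" "prj E e \<in> V" using E.triv_cover by blast
  have "smooth_on UNIV (\<lambda>r. g (pt \<Phi> (prj E e) (r *\<^sub>R \<Phi> e)))"
    by (rule smooth_on_compose[OF E.fd_fibre _ smooth_on_fibre[OF g x t]])
       (auto intro!: smooth_on_scaleR smooth_on_const smooth_on_ident)
  then show ?thesis unfolding scale_pt[OF t] pt_eq[OF t] .
qed

text \<open>The Taylor series at the origin, evaluated at \<open>e\<close>, depends only on the
  function along the ray of \<open>e\<close>. This removes the trivialization from the
  condition.\<close>

lemma entire_on_fibre_iff:
  assumes g: "smooth_wrt AT (prj E -` X) g" and x: "x \<in> X"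
  shows "entire_on_fibre E x g \<longleftrightarrow> (\<forall>e. prj E e = x \<longrightarrow> taylor_sums (\<lambda>r. g (scale_vec E r e)))"
proof -
  have ent: "entire (\<lambda>u. g (THE e. e \<in> tot E \<and> prj E e = x \<and> \<Phi> e = u)) \<longleftrightarrow>
      (\<forall>u. taylor_sums (\<lambda>r. g (scale_vec E r (pt \<Phi> x u))))" if t: "(V, \<Phi>) \<in> triv E" "x \<in> V" for V \<Phi>
    unfolding pt_def[symmetric] entire_iff_taylor_sums[OF smooth_on_fibre[OF g x t]] scale_pt[OF t] ..
  show ?thesis
  proof
    assume a: "entire_on_fibre E x g"
    show "\<forall>e. prj E e = x \<longrightarrow> taylor_sums (\<lambda>r. g (scale_vec E r e))"
    proof (intro allI impI)
      fix e assume e: "prj E e = x"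
      obtain V \<Phi> where t: "(V, \<Phi>) \<in> triv E" "x \<in> V" using E.triv_cover by blast
      have "entire (\<lambda>u. g (THE e. e \<in> tot E \<and> prj E e = x \<and> \<Phi> e = u))"
        using a t unfolding entire_on_fibre_def by blast
      then have "taylor_sums (\<lambda>r. g (scale_vec E r (pt \<Phi> x (\<Phi> e))))" unfolding ent[OF t] by blast
      then show "taylor_sums (\<lambda>r. g (scale_vec E r e))" using pt_eq[OF t(1), of e] e t(2) by simp
    qed
  next
    assume "\<forall>e. prj E e = x \<longrightarrow> taylor_sums (\<lambda>r. g (scale_vec E r e))"
    then show "entire_on_fibre E x g" unfolding entire_on_fibre_def using ent by auto
  qed
qed

lemma shift_zero: "s \<in> sections A E \<Longrightarrow> shift s r (zero_vec E x) = scale_vec E r (s x)"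
proof -
  assume s: "s \<in> sections A E"
  obtain V \<Phi> where t: "(V, \<Phi>) \<in> triv E" "x \<in> V" using E.triv_cover by blast
  then show ?thesis using s by (intro E_eqI[OF t(1)]) (simp_all add: E.scale_vec triv_shift[OF s])
qed

lemma smooth_shift:
  assumes s: "s \<in> sections A E" and g: "smooth_wrt AT (prj E -` X) g" and X: "open X"
  shows "smooth_wrt AT (prj E -` X) (\<lambda>e. g (shift s r e))"
proof (rule M.smooth_wrt_local)
  fix e assume e: "e \<in> prj E -` X"
  obtain U \<phi> V \<Phi> where c: "(U, \<phi>) \<in> A" "(V, \<Phi>) \<in> triv E" "prj E e \<in> U" "prj E e \<in> V"
    using total_chart_ex by blast
  let ?c = "tchart \<phi> \<Phi>"
  let ?O = "prj E -` (U \<inter> V) \<inter> prj E -` X"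
  have o: "open ?O" by (intro open_Int prj_open X E.chart_open(1)[OF c(1)] E.triv_open[OF c(2)])
  have "smooth_wrt AT ?O (\<lambda>e. (g \<circ> tchart_inv U \<phi> V \<Phi>) (\<phi> (prj E e), \<Phi> e + r *\<^sub>R \<Phi> (s (prj E e))))"
  proof (rule M.smooth_wrt_compose[OF M.fd _ M.smooth_wrtD[OF g total_chart[OF c(1,2)]]])
    show "(\<lambda>e. (\<phi> (prj E e), \<Phi> e + r *\<^sub>R \<Phi> (s (prj E e)))) ` ?O \<subseteq> ?c ` ?O"
      unfolding total_chart_image[OF c(1,2)] by auto
    have 1: "smooth_wrt AT ?O (\<lambda>e. \<phi> (prj E e))" "smooth_wrt AT ?O \<Phi>"
      by (rule M.smooth_wrt_subset[OF smooth_total_chart(1)[OF c(1,2)]], blast)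
         (rule M.smooth_wrt_subset[OF smooth_total_chart(2)[OF c(1,2)]], blast)
    have 2: "smooth_wrt AT ?O (\<lambda>e. \<Phi> (s (prj E e)))"
      by (rule M.smooth_wrt_subset[OF smooth_pull[OF E.triv_open[OF c(2)] E.section_smooth[OF s c(2)]]]) auto
    have 3: "smooth_wrt AT ?O (\<lambda>e. \<Phi> e + r *\<^sub>R \<Phi> (s (prj E e)))"
      by (intro M.smooth_wrt_add M.smooth_wrt_scaleR M.smooth_wrt_const 1 2)
    show "smooth_wrt AT ?O (\<lambda>e. (\<phi> (prj E e), \<Phi> e + r *\<^sub>R \<Phi> (s (prj E e))))"
    proof (rule M.smooth_wrtI)
      fix Y y assume "(Y, y) \<in> AT"
      then show "smooth_on (y ` (Y \<inter> ?O)) (\<lambda>z. (\<phi> (prj E (inv_into Y y z)),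
          \<Phi> (inv_into Y y z) + r *\<^sub>R \<Phi> (s (prj E (inv_into Y y z)))))"
        using M.smooth_wrtD[OF 1(1)] M.smooth_wrtD[OF 3] by (auto simp: comp_def intro!: smooth_on_Pair)
    qed
  qed
  then have "smooth_wrt AT ?O (\<lambda>e. g (shift s r e))"
  proof (rule M.smooth_wrt_cong[OF o, rotated])
    fix e' assume e': "e' \<in> ?O"
    then have x: "prj E e' \<in> U" "prj E e' \<in> V" by auto
    show "(g \<circ> tchart_inv U \<phi> V \<Phi>) (\<phi> (prj E e'), \<Phi> e' + r *\<^sub>R \<Phi> (s (prj E e'))) = g (shift s r e')"
      unfolding comp_def inv_total_chart[OF c(1,2) x]
      by (rule arg_cong[of _ _ g], rule E_eqI[OF c(2)]) (use c x in \<open>simp_all add: triv_shift[OF s] s prj_shift\<close>)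
  qed
  then show "\<exists>O1. open O1 \<and> e \<in> O1 \<and> smooth_wrt AT O1 (\<lambda>e. g (shift s r e))" using o e c by blast
qed

lemma Cinf_shift: "s \<in> sections A E \<Longrightarrow> f \<in> Cinf AT \<Longrightarrow> (\<lambda>e. f (shift s r e)) \<in> Cinf AT"
  using smooth_shift[OF _ _ open_UNIV, of s f r] by (simp add: Cinf_def)

lemma Cinf_zero_section:
  assumes f: "f \<in> Cinf AT"
  shows "f \<circ> zero_vec E \<in> Cinf A"
  unfolding Cinf_def comp_def
proof (intro CollectI E.smooth_wrt_local)
  fix x
  obtain U \<phi> V \<Phi> where c: "(U, \<phi>) \<in> A" "(V, \<Phi>) \<in> triv E" "x \<in> U" "x \<in> V" using total_chart_ex by blast
  let ?c = "tchart \<phi> \<Phi>"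
  have g: "smooth_wrt AT UNIV f" using f by (simp add: Cinf_def)
  have o: "open (U \<inter> V)" by (intro open_Int E.chart_open(1)[OF c(1)] E.triv_open[OF c(2)])
  have "smooth_wrt A (U \<inter> V) (\<lambda>x. (\<lambda>z. (f \<circ> tchart_inv U \<phi> V \<Phi>) (z, 0)) (\<phi> x))"
  proof (rule E.smooth_wrt_compose[OF E.fd])
    show "smooth_wrt A (U \<inter> V) \<phi>" by (rule E.smooth_wrt_subset[OF E.smooth_wrt_chart[OF c(1)]]) simp
    show "smooth_on (\<phi> ` (U \<inter> V)) (\<lambda>z. (f \<circ> tchart_inv U \<phi> V \<Phi>) (z, 0))"
    proof (rule smooth_on_compose[OF M.fd _ M.smooth_wrtD[OF g total_chart[OF c(1,2)]]])
      show "smooth_on (\<phi> ` (U \<inter> V)) (\<lambda>z. (z, 0))"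
        by (intro smooth_on_Pair smooth_on_ident smooth_on_const)
      show "(\<lambda>z. (z, 0)) ` \<phi> ` (U \<inter> V) \<subseteq> ?c ` (prj E -` (U \<inter> V) \<inter> UNIV)"
        using total_chart_image[OF c(1,2), of UNIV] by auto
    qed
  qed simp
  then have "smooth_wrt A (U \<inter> V) (\<lambda>x. f (zero_vec E x))"
  proof (rule E.smooth_wrt_cong[OF o, rotated])
    fix y assume y: "y \<in> U \<inter> V"
    then have "pt \<Phi> y 0 = zero_vec E y" by (intro E_eqI[OF c(2)]) (use c in auto)
    then show "(f \<circ> tchart_inv U \<phi> V \<Phi>) (\<phi> y, 0) = f (zero_vec E y)"
      using inv_total_chart[OF c(1,2), of y 0] y by simp
  qed
  then show "\<exists>O1. open O1 \<and> x \<in> O1 \<and> smooth_wrt A O1 (\<lambda>x. f (zero_vec E x))" using o c by blast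
qed


section \<open>Push-forward along the translations \<open>exp I(s)\<close>\<close>

text \<open>Pull-back along the automorphism with base map \<open>shift s r\<close>; the component
  in \<open>ell\<close> is left alone because the bundle is constant along the fibres.\<close>

definition pull_section :: "('s \<Rightarrow> 'e) \<Rightarrow> real \<Rightarrow> ('e \<Rightarrow> 'e \<times> 'l) \<Rightarrow> ('e \<Rightarrow> 'e \<times> 'l)" where
  "pull_section s r \<sigma> = (\<lambda>e. (e, snd (\<sigma> (shift s r e))))"

context
  fixes s assumes s: "s \<in> sections A E"
begin

lemma pull_section_section:
  assumes \<sigma>: "\<sigma> \<in> sections AT L"
  shows "pull_section s r \<sigma> \<in> sections AT L"
  by (rule section_LI)
     (auto simp: pull_section_def section_L[OF \<sigma>] prj_shift[OF s]
       intro!: smooth_shift[OF s section_L_smooth[OF \<sigma>]] ell.triv_open)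

lemma snd_pull_section [simp]: "snd (pull_section s r \<sigma> e) = snd (\<sigma> (shift s r e))"
  by (simp add: pull_section_def)

lemma pull_section_add:
  assumes "\<sigma> \<in> sections AT L" "\<rho> \<in> sections AT L"
  shows "pull_section s r (add_sec L \<sigma> \<rho>) = add_sec L (pull_section s r \<sigma>) (pull_section s r \<rho>)"
  using assms by (intro section_L_eqI)
    (auto simp: pull_section_section M.add_section coord_L prj_shift[OF s])

lemma pull_section_mult:
  assumes "f \<in> Cinf AT" "\<sigma> \<in> sections AT L"
  shows "pull_section s r (mult_sec L f \<sigma>) = mult_sec L (\<lambda>e. f (shift s r e)) (pull_section s r \<sigma>)"
  using assms by (intro section_L_eqI)
    (auto simp: pull_section_section M.mult_section coord_L prj_shift[OF s] Cinf_shift[OF s])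

lemma pull_section_pullback: "pull_section s r (pullback_sec E \<kappa>) = pullback_sec E \<kappa>"
  by (simp add: pull_section_def pullback_sec_def prj_shift[OF s])

text \<open>Conjugation by an automorphism respects order one: functions come out composed with one
  translation, and the opposite translation restores them.\<close>

lemma first_order_push:
  assumes D: "first_order_op AT L D" and r: "r = - q"
  shows "first_order_op AT L (\<lambda>\<sigma>. pull_section s q (D (pull_section s r \<sigma>)))"
proof -
  note sec = pull_section_section M.add_section M.mult_section M.cmult_section M.fo_section[OF D] M.Cinf_mult
    Cinf_shift[OF s]
  have [simp]: "shift s r (shift s q e) = e" for e using r by (simp add: shift_shift[OF s] shift_0[OF s])
  show ?thesis
    unfolding first_order_op_def
  proof (intro conjI allI ballI)
    fix \<sigma> assume "\<sigma> \<in> sections AT L"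
    then show "pull_section s q (D (pull_section s r \<sigma>)) \<in> sections AT L" by (intro sec)
  next
    fix \<sigma> \<rho> assume h: "\<sigma> \<in> sections AT L" "\<rho> \<in> sections AT L"
    have "D (add_sec L (pull_section s r \<sigma>) (pull_section s r \<rho>)) =
        add_sec L (D (pull_section s r \<sigma>)) (D (pull_section s r \<rho>))"
      using D pull_section_section[OF h(1)] pull_section_section[OF h(2)] unfolding first_order_op_def by blast
    then show "pull_section s q (D (pull_section s r (add_sec L \<sigma> \<rho>))) =
        add_sec L (pull_section s q (D (pull_section s r \<sigma>))) (pull_section s q (D (pull_section s r \<rho>)))"
      using h by (simp add: pull_section_add sec)
  next
    fix c \<sigma> assume h: "\<sigma> \<in> sections AT L"
    have "D (mult_sec L (\<lambda>_. c) (pull_section s r \<sigma>)) = mult_sec L (\<lambda>_. c) (D (pull_section s r \<sigma>))"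
      using D pull_section_section[OF h] unfolding first_order_op_def by blast
    then show "pull_section s q (D (pull_section s r (mult_sec L (\<lambda>_. c) \<sigma>))) =
        mult_sec L (\<lambda>_. c) (pull_section s q (D (pull_section s r \<sigma>)))"
      using h by (simp add: pull_section_mult sec M.Cinf_const)
  next
    fix f g \<sigma> assume h: "f \<in> Cinf AT" "g \<in> Cinf AT" "\<sigma> \<in> sections AT L"
    let ?f = "\<lambda>e. f (shift s r e)" and ?g = "\<lambda>e. g (shift s r e)"
    let ?\<sigma> = "pull_section s r \<sigma>"
    have h': "?f \<in> Cinf AT" "?g \<in> Cinf AT" "?\<sigma> \<in> sections AT L" using h by (simp_all add: sec)
    have "add_sec L (D (mult_sec L (\<lambda>z. ?f z * ?g z) ?\<sigma>)) (mult_sec L (\<lambda>z. ?f z * ?g z) (D ?\<sigma>)) =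
        add_sec L (mult_sec L ?f (D (mult_sec L ?g ?\<sigma>))) (mult_sec L ?g (D (mult_sec L ?f ?\<sigma>)))"
      by (rule D[unfolded first_order_op_def, THEN conjunct2, THEN conjunct2, THEN conjunct2, rule_format, OF h'])
    from arg_cong[OF this, of "pull_section s q"]
    have "add_sec L (pull_section s q (D (mult_sec L (\<lambda>z. ?f z * ?g z) ?\<sigma>))) (mult_sec L (\<lambda>z. f z * g z) (pull_section s q (D ?\<sigma>))) =
        add_sec L (mult_sec L f (pull_section s q (D (mult_sec L ?g ?\<sigma>)))) (mult_sec L g (pull_section s q (D (mult_sec L ?f ?\<sigma>))))"
      using h h' by (simp add: pull_section_add pull_section_mult sec)
    then show "add_sec L (pull_section s q (D (pull_section s r (mult_sec L (\<lambda>z. f z * g z) \<sigma>))))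
          (mult_sec L (\<lambda>z. f z * g z) (pull_section s q (D ?\<sigma>))) =
        add_sec L (mult_sec L f (pull_section s q (D (pull_section s r (mult_sec L g \<sigma>)))))
          (mult_sec L g (pull_section s q (D (pull_section s r (mult_sec L f \<sigma>)))))"
      using h by (simp add: pull_section_mult sec)
  qed
qed

lemma exp_I_neg:
  "fst (exp_I E (neg_sec E s)) = shift s (- 1)"
  "snd (exp_I E (neg_sec E s)) = (\<lambda>(e, l). (shift s (- 1) e, l :: 'l))"
proof -
  have "add_vec E e (neg_sec E s (prj E e)) = shift s (- 1) e" for e
    by (simp add: shift_def neg_sec_def mult_sec_def)
  then show "fst (exp_I E (neg_sec E s)) = shift s (- 1)"
    "snd (exp_I E (neg_sec E s)) = (\<lambda>(e, l). (shift s (- 1) e, l :: 'l))"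
    by (auto simp: exp_I_def)
qed

lemma inv_shift: "inv (shift s (- 1)) = shift s 1"
  by (rule inv_equality) (simp_all add: shift_shift[OF s] shift_0[OF s])

lemma inv_exp_I:
  assumes "l \<in> tot ell" "prj ell l = prj E e"
  shows "inv_into (tot L) (\<lambda>(e, l). (shift s (- 1) e, l)) (e, l) = (shift s 1 e, l)"
proof -
  let ?F = "\<lambda>(e, l :: 'l). (shift s (- 1) e, l)"
  have i: "inj_on ?F (tot L)"
  proof (rule inj_onI)
    fix p p' assume "?F p = ?F p'"
    then have "shift s (- 1) (fst p) = shift s (- 1) (fst p')" "snd p = snd p'" by (auto simp: split_beta)
    from arg_cong[OF this(1), of "shift s 1"] this(2) show "p = p'"
      by (simp add: shift_shift[OF s] shift_0[OF s] prod_eq_iff)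
  qed
  have "(shift s 1 e, l) \<in> tot L" using assms by (simp add: pullback_def prj_shift[OF s])
  from inv_into_f_f[OF i this] show ?thesis by (simp add: shift_shift[OF s] shift_0[OF s])
qed

text \<open>Here the two signs part: sections are pulled back along the translation by -s, while the
  operator is evaluated at the preimage of \<open>y\<close>, which is \<open>y\<close> translated by
  s.\<close>

lemma push_op_eq:
  assumes "set lams \<subseteq> sections AT L"
  shows "push_op L (exp_I E (neg_sec E s)) Q lams y = (shift s (- 1) (fst (Q (map (pull_section s (- 1)) lams) (shift s 1 y))),
    snd (Q (map (pull_section s (- 1)) lams) (shift s 1 y)))"
proof -
  have ex: "exp_I E (neg_sec E s) = (shift s (- 1), (\<lambda>(e, l). (shift s (- 1) e, l :: 'l)))"
    using exp_I_neg by (simp add: prod_eq_iff)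
  have m: "map (\<lambda>lam z. inv_into (tot L) (\<lambda>(e, l). (shift s (- 1) e, l)) (lam (shift s (- 1) z))) lams =
      map (pull_section s (- 1)) lams"
  proof (rule map_cong[OF refl], rule ext)
    fix \<sigma> z assume "\<sigma> \<in> set lams"
    then have \<sigma>: "\<sigma> \<in> sections AT L" using assms by auto
    have "\<sigma> (shift s (- 1) z) = (shift s (- 1) z, snd (\<sigma> (shift s (- 1) z)))"
      using section_L(1)[OF \<sigma>] by (simp add: prod_eq_iff)
    then show "inv_into (tot L) (\<lambda>(e, l). (shift s (- 1) e, l)) (\<sigma> (shift s (- 1) z)) = pull_section s (- 1) \<sigma> z"
      using inv_exp_I[OF section_L(2,3)[OF \<sigma>], of "shift s (- 1) z"]
      by (simp add: pull_section_def shift_shift[OF s] shift_0[OF s])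
  qed
  show ?thesis unfolding push_op_def ex prod.case inv_shift m by (simp add: split_beta)
qed

end

end

section \<open>Iterated brackets on fiberwise linear arguments\<close>

locale coisotropic_normal = fat_neighborhood A E ell
  for A :: "('s::topological_space, 'b::real_inner) atlas"
    and E :: "('e::topological_space, 's, 'f::real_inner) vbundle"
    and ell :: "('l::topological_space, 's, real) vbundle" +
  fixes J :: "('e, 'e \<times> 'l) sec_bracket"
  assumes multi_diffop_J: "multi_diffop (total_atlas A E) (pullback E ell) 2 (bracket_op J)"
    and coisotropic_J: "coisotropic A (total_atlas A E) (zero_vec E) (pullback E ell) J"
begin

lemma skew_J: "M.skew_bidiffop (bracket_op J)"
  by (rule M.multi_diffop_skew_bidiffop[OF multi_diffop_J])

lemma bidiffop_J: "M.bidiffop (bracket_op J)"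
  using skew_J by (simp add: M.skew_bidiffop_def)

lemma fo_L:
  assumes D: "first_order_op AT L D" and t: "(W, \<Psi>) \<in> triv ell" "prj E e \<in> W" and \<sigma>: "\<sigma> \<in> sections AT L"
  shows "\<rho> \<in> sections AT L \<Longrightarrow> \<Psi> (snd (D (add_sec L \<sigma> \<rho>) e)) = \<Psi> (snd (D \<sigma> e)) + \<Psi> (snd (D \<rho> e))"
    and "\<Psi> (snd (D (mult_sec L (\<lambda>_. c) \<sigma>) e)) = c * \<Psi> (snd (D \<sigma> e))"
  using M.fo_add[OF D \<sigma> _ triv_L[OF t(1)], of \<rho> e] M.fo_cmult[OF D \<sigma> triv_L[OF t(1)], of e c] t(2) by simp_all

lemma fo_mult_diff:
  assumes D: "first_order_op AT L D" and t: "(W, \<Psi>) \<in> triv ell" "prj E e \<in> W" and \<sigma>: "\<sigma> \<in> sections AT L"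
    and f: "f \<in> Cinf AT" "f' \<in> Cinf AT"
  shows "\<Psi> (snd (D (mult_sec L (\<lambda>z. f z - c * f' z) \<sigma>) e)) =
    \<Psi> (snd (D (mult_sec L f \<sigma>) e)) - c * \<Psi> (snd (D (mult_sec L f' \<sigma>) e))"
proof -
  have s: "mult_sec L f \<sigma> \<in> sections AT L" "mult_sec L f' \<sigma> \<in> sections AT L"
    using f \<sigma> by (auto intro: M.mult_section)
  have "mult_sec L (\<lambda>z. f z - c * f' z) \<sigma> = add_sec L (mult_sec L f \<sigma>) (mult_sec L (\<lambda>_. - c) (mult_sec L f' \<sigma>))"
  proof (rule section_L_eqI)
    show "mult_sec L (\<lambda>z. f z - c * f' z) \<sigma> \<in> sections AT L"
      by (intro M.mult_section M.Cinf_diff M.Cinf_cmult f \<sigma>)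
    show "add_sec L (mult_sec L f \<sigma>) (mult_sec L (\<lambda>_. - c) (mult_sec L f' \<sigma>)) \<in> sections AT L"
      by (intro M.add_section M.cmult_section s)
    fix e W \<Psi> assume t: "(W, \<Psi>) \<in> triv ell" "prj E e \<in> W"
    show "\<Psi> (snd (mult_sec L (\<lambda>z. f z - c * f' z) \<sigma> e)) =
      \<Psi> (snd (add_sec L (mult_sec L f \<sigma>) (mult_sec L (\<lambda>_. - c) (mult_sec L f' \<sigma>)) e))"
      by (simp add: coord_L[OF t] s \<sigma> M.cmult_section algebra_simps)
  qed
  then show ?thesis using fo_L(1)[OF D t s(1) M.cmult_section[OF s(2)], of "- c"] fo_L(2)[OF D t s(2), of "- c"] by simp
qed

definition iter_bracket :: "('s \<Rightarrow> 'e) \<Rightarrow> nat \<Rightarrow> ('e, 'e \<times> 'l) multiop" where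
  "iter_bracket s n = foldl (\<lambda>Q \<xi>. SJ_bracket L 2 1 Q (\<lambda>lams. I_op E ell \<xi> (lams ! 0))) (bracket_op J)
     (replicate n (neg_sec E s))"

lemma iter_bracket_0: "iter_bracket s 0 = bracket_op J"
  by (simp add: iter_bracket_def)

lemma iter_bracket_Suc: "iter_bracket s (Suc n) = SJ_bracket L 2 1 (iter_bracket s n) (\<lambda>lams. I_op E ell (neg_sec E s) (lams ! 0))"
  unfolding iter_bracket_def replicate_Suc replicate_append_same[symmetric] foldl_append by simp

lemma multibracket_iter_bracket:
  "multibracket A E ell J (replicate n (neg_sec E s)) = P_op A E ell (iter_bracket s n)"
  by (simp add: multibracket_def iter_bracket_def)

context
  fixes s assumes s: "s \<in> sections A E"
begin

lemma iter_bracket_skew: "M.skew_bidiffop (iter_bracket s n)"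
proof (induction n)
  case (Suc n)
  show ?case unfolding iter_bracket_Suc
    by (rule M.skew_bidiffop_SJ_bracket[OF I_op_derivation[OF E.neg_section[OF s]] Suc])
qed (simp add: iter_bracket_0 skew_J)

lemma iter_bracket_bidiffop: "M.bidiffop (iter_bracket s n)"
  using iter_bracket_skew by (simp add: M.skew_bidiffop_def)

text \<open>The bracket with \<open>R\<close> is minus the Lie derivative along \<open>R\<close>;
  inserting minus \<open>I_op E ell s\<close> for \<open>R\<close> turns it into the Lie derivative
  along \<open>I_op E ell s\<close>.\<close>

lemma iter_bracket_rec:
  assumes ab: "a \<in> sections AT L" "b \<in> sections AT L" and t: "(W, \<Psi>) \<in> triv ell" "prj E e \<in> W"
  shows "\<Psi> (snd (iter_bracket s (Suc n) [a, b] e)) = lie s (\<lambda>e. \<Psi> (snd (iter_bracket s n [a, b] e))) e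
    - \<Psi> (snd (iter_bracket s n [I_op E ell s a, b] e)) - \<Psi> (snd (iter_bracket s n [a, I_op E ell s b] e))"
proof -
  note neg = E.neg_section[OF s]
  note Q = iter_bracket_bidiffop[of n]
  have q: "iter_bracket s n [a, b] \<in> sections AT L" by (rule M.bidiffop_section[OF Q ab])
  have "\<Psi> (snd (iter_bracket s (Suc n) [a, b] e)) = \<Psi> (snd (iter_bracket s n [I_op E ell (neg_sec E s) a, b] e))
      + \<Psi> (snd (iter_bracket s n [a, I_op E ell (neg_sec E s) b] e)) - \<Psi> (snd (I_op E ell (neg_sec E s) (iter_bracket s n [a, b]) e))"
    unfolding iter_bracket_Suc
    using M.SJ_bracket_section(2)[OF I_op_derivation[OF neg] iter_bracket_skew ab triv_L[OF t(1)], of e n] t(2) by simp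
  also have "\<dots> = - \<Psi> (snd (iter_bracket s n [I_op E ell s a, b] e)) - \<Psi> (snd (iter_bracket s n [a, I_op E ell s b] e))
      + \<Psi> (snd (I_op E ell s (iter_bracket s n [a, b]) e))"
    unfolding I_op_neg[OF s ab(1)] I_op_neg[OF s ab(2)] I_op_neg[OF s q]
    using fo_L(2)[OF M.bidiffopD(1)[OF Q ab(2)] t I_op_section[OF s ab(1)], of "- 1"]
      fo_L(2)[OF M.bidiffopD(2)[OF Q ab(1)] t I_op_section[OF s ab(2)], of "- 1"]
      coord_L(2)[OF t I_op_section[OF s q], of "\<lambda>_. - 1"] by simp
  finally show ?thesis using I_op_coord(4)[OF s q t] by simp
qed

lemma I_op_zero: "I_op E ell s (zero_vec L) = zero_vec L"
proof (rule section_L_eqI[OF I_op_section[OF s M.zero_section] M.zero_section])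
  fix e W \<Psi> assume t: "(W, \<Psi>) \<in> triv ell" "prj E e \<in> W"
  have "lie s (\<lambda>e. \<Psi> (snd (zero_vec L e))) e = lie s (\<lambda>e. (\<lambda>_. 0) (prj E e)) e"
    by (rule lie_cong[OF s]) (use t in \<open>simp add: coord_L_zero prj_shift[OF s]\<close>)
  then show "\<Psi> (snd (I_op E ell s (zero_vec L) e)) = \<Psi> (snd (zero_vec L e))"
    using I_op_coord(4)[OF s M.zero_section t] lie_pull[OF s, of "\<lambda>_. 0"] t by (simp add: coord_L_zero)
qed

text \<open>Along the flow of \<open>s\<close> the operator \<open>lie s\<close> becomes the time
  derivative, which brings \<open>iter_bracket_rec\<close> into the shape of
  \<open>iterated_bracket_taylor\<close>. The function being differentiated is the bracket of a - t
  a' and b - t b' at time t.\<close>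

lemma iter_bracket_taylor:
  assumes ab: "a \<in> sections AT L" "b \<in> sections AT L" and t: "(W, \<Psi>) \<in> triv ell" "prj E e \<in> W"
    and a': "I_op E ell s a = a'" "I_op E ell s a' = zero_vec L"
    and b': "I_op E ell s b = b'" "I_op E ell s b' = zero_vec L"
  shows "\<Psi> (snd (iter_bracket s n [a, b] e)) = (deriv ^^ n) (\<lambda>t. \<Psi> (snd (J a b (shift s t e)))
    + (- 1) * (t * (\<Psi> (snd (J a' b (shift s t e))) + \<Psi> (snd (J a b' (shift s t e)))))
    + t * (t * \<Psi> (snd (J a' b' (shift s t e))))) 0"
proof -
  let ?D = "I_op E ell s"
  have D: "(?D ^^ i) c \<in> sections AT L" if "c \<in> sections AT L" for i c
    using that by (induction i) (auto intro: I_op_section[OF s])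
  have D2: "(?D ^^ i) c = zero_vec L" if h: "?D c = c'" "?D c' = zero_vec L" "i \<ge> 2" for i c c'
  proof -
    obtain j where j: "i = Suc (Suc j)" using h(3) by (metis add_2_eq_Suc le_Suc_ex)
    have "(?D ^^ Suc (Suc j)) c = zero_vec L" using h(1,2) by (induction j) (auto simp: I_op_zero)
    then show ?thesis using j by simp
  qed
  define F where "F n i j t = \<Psi> (snd (iter_bracket s n [(?D ^^ i) a, (?D ^^ j) b] (shift s t e)))" for n i j t
  have sec: "iter_bracket s n [(?D ^^ i) a, (?D ^^ j) b] \<in> sections AT L" for n i j
    by (intro M.bidiffop_section iter_bracket_bidiffop D ab)
  have "F n 0 0 0 = (deriv ^^ n) (\<lambda>t. F 0 0 0 t + (- 1) * (t * (F 0 1 0 t + F 0 0 1 t)) + t * (t * F 0 1 1 t)) 0"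
  proof (rule iterated_bracket_taylor)
    fix i j
    show "smooth_on UNIV (F 0 i j)"
      unfolding F_def[abs_def] by (rule smooth_on_shift[OF s section_L_smooth[OF sec t(1)] t(2)])
  next
    fix n i j
    show "F (Suc n) i j = (\<lambda>t. deriv (F n i j) t - F n (Suc i) j t - F n i (Suc j) t)"
    proof
      fix r
      have p: "prj E (shift s r e) \<in> W" using t(2) prj_shift[OF s] by simp
      have "deriv (F n i j) r = lie s (\<lambda>e. \<Psi> (snd (iter_bracket s n [(?D ^^ i) a, (?D ^^ j) b] e))) (shift s r e)"
        unfolding F_def by (rule DERIV_imp_deriv[OF shift_derivative[OF s section_L_smooth[OF sec t(1)] t(2)]])
      then show "F (Suc n) i j r = deriv (F n i j) r - F n (Suc i) j r - F n i (Suc j) r"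
        using iter_bracket_rec[OF D[OF ab(1)] D[OF ab(2)] t(1) p] by (simp add: F_def)
    qed
  next
    fix n i j :: nat assume "i \<ge> 2 \<or> j \<ge> 2"
    then have "(?D ^^ i) a = zero_vec L \<or> (?D ^^ j) b = zero_vec L"
      using D2[OF a'] D2[OF b'] by blast
    moreover have "\<Psi> (snd (iter_bracket s n [zero_vec L, c] e')) = 0" "\<Psi> (snd (iter_bracket s n [c, zero_vec L] e')) = 0"
      if "c \<in> sections AT L" "prj E e' \<in> W" for c e'
      using M.fo_zero[OF M.bidiffopD(1)[OF iter_bracket_bidiffop that(1)] triv_L[OF t(1)], of e' n]
        M.fo_zero[OF M.bidiffopD(2)[OF iter_bracket_bidiffop that(1)] triv_L[OF t(1)], of e' n] that(2) by simp_all
    ultimately show "F n i j = (\<lambda>_. 0)"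
      using D[OF ab(1), of i] D[OF ab(2), of j] t(2) prj_shift[OF s] by (auto simp: F_def)
  qed
  then show ?thesis by (simp add: F_def iter_bracket_0 a' b' bracket_op_def shift_0[OF s])
qed

end

lemma push_zero_tangent:
  assumes "w \<in> tangent A x"
  shows "push_tan AT (zero_vec E) w \<in> tangent AT (zero_vec E x)"
proof -
  note z = Cinf_zero_section
  have 1: "(\<lambda>z. f z + g z) \<circ> zero_vec E = (\<lambda>z. (f \<circ> zero_vec E) z + (g \<circ> zero_vec E) z)"
    "(\<lambda>z. c * f z) \<circ> zero_vec E = (\<lambda>z. c * (f \<circ> zero_vec E) z)"
    "(\<lambda>z. f z * g z) \<circ> zero_vec E = (\<lambda>z. (f \<circ> zero_vec E) z * (g \<circ> zero_vec E) z)" for f g :: "'e \<Rightarrow> real" and c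
    by auto
  have w: "w (\<lambda>z. f z + g z) = w f + w g" "w (\<lambda>z. c * f z) = c * w f"
    "w (\<lambda>z. f z * g z) = f x * w g + g x * w f" if "f \<in> Cinf A" "g \<in> Cinf A" for f g c
    using assms that unfolding tangent_def by blast+
  show ?thesis
    unfolding tangent_def push_tan_def
    by (auto simp: M.Cinf_add M.Cinf_cmult M.Cinf_mult 1 w[OF z z] simp del: comp_apply) (simp_all add: w[OF z z])
qed

lemma tangent_zero_fun: "w \<in> tangent A x \<Longrightarrow> w (\<lambda>_. 0) = 0"
proof -
  assume w: "w \<in> tangent A x"
  have "\<forall>c. \<forall>f\<in>Cinf A. w (\<lambda>z. c * f z) = c * w f" using w unfolding tangent_def by blast
  from this[rule_format, OF E.Cinf_const, of 0 1] show ?thesis by simp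
qed

end


text \<open>Coordinates around \<open>x\<close> in global form, as required by covectors that are
  differentials of global functions: \<open>\<theta>\<close> is a cut-off, equal to 1 on
  \<open>N\<close>, and \<open>\<kappa>\<close> is \<open>\<theta>\<close> times the generator of
  the trivialization \<open>\<Psi>\<close>. The supports lie in the closed set \<open>K\<close>,
  where the chart and both trivializations are available.\<close>

locale normal_frame = coisotropic_normal A E ell J
  for A :: "('s::topological_space, 'b::real_inner) atlas"
    and E :: "('e::topological_space, 's, 'f::real_inner) vbundle"
    and ell :: "('l::topological_space, 's, real) vbundle"
    and J :: "('e, 'e \<times> 'l) sec_bracket" +
  fixes U \<phi> V \<Phi> W \<Psi> \<theta> \<kappa> N K x
  assumes c: "(U, \<phi>) \<in> A" and tE: "(V, \<Phi>) \<in> triv E" and tl: "(W, \<Psi>) \<in> triv ell"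
    and \<theta>: "\<theta> \<in> Cinf A" and \<kappa>: "\<kappa> \<in> sections A ell"
    and N: "open N" "x \<in> N" "N \<subseteq> K" and K: "closed K" "K \<subseteq> U \<inter> V \<inter> W"
    and \<theta>1: "\<And>z. z \<in> N \<Longrightarrow> \<theta> z = 1" and \<theta>0: "\<And>z. z \<notin> K \<Longrightarrow> \<theta> z = 0"
    and \<kappa>W: "\<And>z. z \<in> W \<Longrightarrow> \<Psi> (\<kappa> z) = \<theta> z" and \<kappa>0: "\<And>z. z \<notin> K \<Longrightarrow> \<kappa> z = zero_vec ell z"
begin

abbreviation "ox \<equiv> zero_vec E x"
abbreviation "\<kappa>' \<equiv> pullback_sec E \<kappa>"
abbreviation "cinv \<equiv> tchart_inv U \<phi> V \<Phi>"

lemma x_in: "x \<in> U" "x \<in> V" "x \<in> W"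
  using N K by auto

lemma \<kappa>': "\<kappa>' \<in> sections AT L"
  by (rule pullback_section[OF \<kappa>])

definition fib :: "('f \<Rightarrow> real) \<Rightarrow> 'e \<Rightarrow> real" where
  "fib \<alpha> e = (if prj E e \<in> V then \<theta> (prj E e) * \<alpha> (\<Phi> e) else 0)"

definition bas :: "('b \<Rightarrow> real) \<Rightarrow> 'e \<Rightarrow> real" where
  "bas \<xi> e = (if prj E e \<in> U then \<theta> (prj E e) * \<xi> (\<phi> (prj E e)) else 0)"

text \<open>The derivative of \<open>fib \<alpha>\<close> along \<open>s\<close>. It is a function
  on the base because \<open>fib \<alpha>\<close> is linear on the fibres.\<close>

definition slope :: "('s \<Rightarrow> 'e) \<Rightarrow> ('f \<Rightarrow> real) \<Rightarrow> 's \<Rightarrow> real" where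
  "slope s \<alpha> y = (if y \<in> V then \<theta> y * \<alpha> (\<Phi> (s y)) else 0)"

lemma fib_Cinf: "linear \<alpha> \<Longrightarrow> fib \<alpha> \<in> Cinf AT"
  unfolding fib_def[abs_def] using Cinf_fibre_linear[OF tE \<theta> K(1) _ \<theta>0] K(2) by blast

lemma \<theta>_smooth: "smooth_wrt A X \<theta>"
  using \<theta> E.smooth_wrt_subset unfolding Cinf_def by blast

lemma bas_Cinf: assumes "linear \<xi>" shows "bas \<xi> \<in> Cinf AT"
proof -
  have "(\<lambda>y. if y \<in> U then \<theta> y * \<xi> (\<phi> y) else 0) \<in> Cinf A"
    unfolding Cinf_def
  proof (intro CollectI E.smooth_wrt_extend[OF E.chart_open(1)[OF c] K(1)] E.smooth_wrt_mult \<theta>_smooth)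
    show "smooth_wrt A U (\<lambda>y. \<xi> (\<phi> y))"
      by (rule E.smooth_wrt_bounded_linear[OF finite_dim_bounded_linear[OF E.fd assms] E.smooth_wrt_chart[OF c]])
  qed (use K \<theta>0 in auto)
  from Cinf_pull[OF this] show ?thesis by (simp add: bas_def[abs_def])
qed

lemma slope_Cinf: assumes "s \<in> sections A E" "linear \<alpha>" shows "slope s \<alpha> \<in> Cinf A"
  unfolding Cinf_def slope_def[abs_def]
proof (intro CollectI E.smooth_wrt_extend[OF E.triv_open[OF tE] K(1)] E.smooth_wrt_mult \<theta>_smooth)
  show "smooth_wrt A V (\<lambda>y. \<alpha> (\<Phi> (s y)))"
    by (rule E.smooth_wrt_bounded_linear[OF finite_dim_bounded_linear[OF E.fd_fibre assms(2)] E.section_smooth[OF assms(1) tE]])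
qed (use K \<theta>0 in auto)

lemma fib_shift:
  assumes "s \<in> sections A E" "linear \<alpha>"
  shows "fib \<alpha> (shift s t e) = fib \<alpha> e + t * slope s \<alpha> (prj E e)"
  using linear_add[OF assms(2)] linear_cmul[OF assms(2)]
  by (simp add: fib_def slope_def prj_shift[OF assms(1)] triv_shift[OF assms(1) tE] algebra_simps)

lemma fib_zero: "linear \<alpha> \<Longrightarrow> fib \<alpha> (zero_vec E y) = 0"
  by (simp add: fib_def E.zero_vec(3)[OF tE] linear_0)

lemma \<kappa>x: "\<Psi> (\<kappa> x) = 1"
  using \<kappa>W x_in \<theta>1 N by simp

section \<open>Components of the bi-symbol and the function G\<close>

definition bil :: "('e \<Rightarrow> real) \<Rightarrow> ('e \<Rightarrow> real) \<Rightarrow> 'e \<Rightarrow> real" where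
  "bil f g e = \<Psi> (snd (J (mult_sec L f \<kappa>') (mult_sec L g \<kappa>') e))"

lemma fo_J1: "\<mu> \<in> sections AT L \<Longrightarrow> first_order_op AT L (\<lambda>\<nu>. J \<nu> \<mu>)"
  and fo_J2: "\<mu> \<in> sections AT L \<Longrightarrow> first_order_op AT L (\<lambda>\<nu>. J \<mu> \<nu>)"
  using M.bidiffopD[OF bidiffop_J, of \<mu>] by (simp_all add: bracket_op_def)

lemma J_section: "\<sigma> \<in> sections AT L \<Longrightarrow> \<rho> \<in> sections AT L \<Longrightarrow> J \<sigma> \<rho> \<in> sections AT L"
  using M.bidiffop_section[OF bidiffop_J] by (simp add: bracket_op_def)

lemma bil_diff:
  assumes "f \<in> Cinf AT" "f' \<in> Cinf AT" "g \<in> Cinf AT" "g' \<in> Cinf AT" "prj E e \<in> W"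
  shows "bil (\<lambda>z. f z - p * f' z) (\<lambda>z. g z - q * g' z) e =
    bil f g e - p * bil f' g e - q * bil f g' e + p * q * bil f' g' e"
proof -
  have m: "mult_sec L h \<kappa>' \<in> sections AT L" if "h \<in> Cinf AT" for h using that \<kappa>' by (rule M.mult_section)
  have gg: "(\<lambda>z. g z - q * g' z) \<in> Cinf AT" using assms by (intro M.Cinf_diff M.Cinf_cmult)
  show ?thesis
    unfolding bil_def
    unfolding fo_mult_diff[OF fo_J1[OF m[OF gg]] tl assms(5) \<kappa>' assms(1,2)]
      fo_mult_diff[OF fo_J2[OF m[OF assms(1)]] tl assms(5) \<kappa>' assms(3,4)]
      fo_mult_diff[OF fo_J2[OF m[OF assms(2)]] tl assms(5) \<kappa>' assms(3,4)]
    by (simp add: algebra_simps)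
qed

lemma bil_skew: "f \<in> Cinf AT \<Longrightarrow> g \<in> Cinf AT \<Longrightarrow> prj E e \<in> W \<Longrightarrow> bil f g e = - bil g f e"
  using M.skew_bidiffop_coord[OF skew_J M.mult_section[OF _ \<kappa>'] M.mult_section[OF _ \<kappa>'] triv_L[OF tl], of f g e]
  by (simp add: bil_def bracket_op_def)

lemma bil_smooth: "f \<in> Cinf AT \<Longrightarrow> g \<in> Cinf AT \<Longrightarrow> smooth_wrt AT (prj E -` W) (bil f g)"
  unfolding bil_def[abs_def] by (intro section_L_smooth[OF _ tl] J_section M.mult_section \<kappa>')

text \<open>The component of \<Lambda> on the differentials of \<open>f\<close> and
  \<open>g\<close>, both tensored with \<open>\<kappa>\<close>: subtracting the values at the point
  of evaluation is the co-symbol.\<close>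

definition Lam :: "('e \<Rightarrow> real) \<Rightarrow> ('e \<Rightarrow> real) \<Rightarrow> 'e \<Rightarrow> real" where
  "Lam f g e = bil (\<lambda>z. f z - f e) (\<lambda>z. g z - g e) e"

text \<open>The arguments of \<open>bil\<close> in \<open>Lam\<close> move with the point
  \<open>e\<close>. Expanding in the constants \<open>f e\<close> and \<open>g e\<close> leaves
  values of \<open>bil\<close> at fixed arguments.\<close>

lemma Lam_smooth:
  assumes "f \<in> Cinf AT" "g \<in> Cinf AT"
  shows "smooth_wrt AT (prj E -` W) (Lam f g)"
proof -
  have ox: "open (prj E -` W)" by (intro prj_open ell.triv_open[OF tl])
  have 1: "(\<lambda>_. 1) \<in> Cinf AT" by (rule M.Cinf_const)
  have fg: "smooth_wrt AT (prj E -` W) f" "smooth_wrt AT (prj E -` W) g"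
    using assms M.smooth_wrt_subset unfolding Cinf_def by blast+
  have "smooth_wrt AT (prj E -` W) (\<lambda>e. bil f g e - f e * bil (\<lambda>_. 1) g e - g e * bil f (\<lambda>_. 1) e
      + f e * g e * bil (\<lambda>_. 1) (\<lambda>_. 1) e)"
    by (intro M.smooth_wrt_add M.smooth_wrt_diff M.smooth_wrt_mult fg bil_smooth assms 1)
  then show ?thesis
  proof (rule M.smooth_wrt_cong[OF ox, rotated])
    fix e assume "e \<in> prj E -` W"
    then show "bil f g e - f e * bil (\<lambda>_. 1) g e - g e * bil f (\<lambda>_. 1) e + f e * g e * bil (\<lambda>_. 1) (\<lambda>_. 1) e = Lam f g e"
      using bil_diff[OF assms(1) 1 assms(2) 1, of e "f e" "g e"] by (simp add: Lam_def)
  qed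
qed

definition G :: "('s \<Rightarrow> 'e) \<Rightarrow> ('f \<Rightarrow> real) \<Rightarrow> ('f \<Rightarrow> real) \<Rightarrow> real \<Rightarrow> real" where
  "G s \<alpha> \<beta> t = bil (\<lambda>z. fib \<alpha> z - t * slope s \<alpha> (prj E z)) (\<lambda>z. fib \<beta> z - t * slope s \<beta> (prj E z)) (shift s t ox)"

context
  fixes s and \<alpha> \<beta> :: "'f \<Rightarrow> real"
  assumes s: "s \<in> sections A E" and lin: "linear \<alpha>" "linear \<beta>"
begin

text \<open>At the translated point \<open>fib \<alpha>\<close> has the value
  \<open>t * slope s \<alpha> x\<close>, so both arguments of \<open>bil\<close> in \<open>G\<close>
  vanish there and only their differentials count.\<close>

lemma G_eq_Lam:
  "G s \<alpha> \<beta> t = Lam (fib \<alpha>) (fib \<beta>) (shift s t ox)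
    + (- 1) * (t * (Lam (\<lambda>e. slope s \<alpha> (prj E e)) (fib \<beta>) (shift s t ox) + Lam (fib \<alpha>) (\<lambda>e. slope s \<beta> (prj E e)) (shift s t ox)))
    + t * (t * Lam (\<lambda>e. slope s \<alpha> (prj E e)) (\<lambda>e. slope s \<beta> (prj E e)) (shift s t ox))"
proof -
  let ?e = "shift s t ox"
  have e: "prj E ?e = x" by (simp add: prj_shift[OF s])
  have h: "fib \<gamma> ?e = t * slope s \<gamma> x" if "linear \<gamma>" for \<gamma> using fib_shift[OF s that, of t ox] fib_zero[OF that] by simp
  have k: "(\<lambda>z. fib \<gamma> z - t * slope s \<gamma> (prj E z)) =
      (\<lambda>z. (fib \<gamma> z - fib \<gamma> ?e) - t * (slope s \<gamma> (prj E z) - slope s \<gamma> (prj E ?e)))" if "linear \<gamma>" for \<gamma>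
    using h[OF that] by (simp add: e algebra_simps)
  note ci = M.Cinf_diff M.Cinf_const E.Cinf_diff E.Cinf_const fib_Cinf Cinf_pull slope_Cinf s lin
  show ?thesis
    unfolding G_def k[OF lin(1)] k[OF lin(2)] Lam_def
    by (subst bil_diff) (use x_in e in \<open>auto intro!: ci simp: algebra_simps\<close>)
qed

lemma I_op_fib:
  assumes l: "linear \<gamma>"
  shows "I_op E ell s (mult_sec L (fib \<gamma>) \<kappa>') = mult_sec L (\<lambda>e. slope s \<gamma> (prj E e)) \<kappa>'"
    and "I_op E ell s (mult_sec L (\<lambda>e. slope s \<gamma> (prj E e)) \<kappa>') = zero_vec L"
proof -
  have ms: "mult_sec L (fib \<gamma>) \<kappa>' \<in> sections AT L" "mult_sec L (\<lambda>e. slope s \<gamma> (prj E e)) \<kappa>' \<in> sections AT L"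
    by (intro M.mult_section \<kappa>' fib_Cinf Cinf_pull slope_Cinf s l)+
  show "I_op E ell s (mult_sec L (fib \<gamma>) \<kappa>') = mult_sec L (\<lambda>e. slope s \<gamma> (prj E e)) \<kappa>'"
  proof (rule section_L_eqI[OF I_op_section[OF s ms(1)] ms(2)])
    fix e X \<Xi> assume t: "(X, \<Xi>) \<in> triv ell" "prj E e \<in> X"
    have "lie s (\<lambda>e. \<Xi> (snd (mult_sec L (fib \<gamma>) \<kappa>' e))) e = slope s \<gamma> (prj E e) * \<Xi> (\<kappa> (prj E e))"
    proof (rule lieI[OF s])
      have eq: "\<Xi> (snd (mult_sec L (fib \<gamma>) \<kappa>' (shift s r e))) = (fib \<gamma> e + r * slope s \<gamma> (prj E e)) * \<Xi> (\<kappa> (prj E e))" for r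
        using coord_L(2)[OF t(1) _ \<kappa>', of "shift s r e" "fib \<gamma>"] t(2) by (simp add: prj_shift[OF s] fib_shift[OF s l])
      show "((\<lambda>t. \<Xi> (snd (mult_sec L (fib \<gamma>) \<kappa>' (shift s t e)))) has_real_derivative slope s \<gamma> (prj E e) * \<Xi> (\<kappa> (prj E e))) (at 0)"
        unfolding eq by (auto intro!: derivative_eq_intros)
    qed
    then show "\<Xi> (snd (I_op E ell s (mult_sec L (fib \<gamma>) \<kappa>') e)) = \<Xi> (snd (mult_sec L (\<lambda>e. slope s \<gamma> (prj E e)) \<kappa>' e))"
      using I_op_coord(4)[OF s ms(1) t] coord_L(2)[OF t \<kappa>', of "\<lambda>e. slope s \<gamma> (prj E e)"] by simp
  qed
  show "I_op E ell s (mult_sec L (\<lambda>e. slope s \<gamma> (prj E e)) \<kappa>') = zero_vec L"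
  proof (rule section_L_eqI[OF I_op_section[OF s ms(2)] M.zero_section])
    fix e X \<Xi> assume t: "(X, \<Xi>) \<in> triv ell" "prj E e \<in> X"
    have "lie s (\<lambda>e. \<Xi> (snd (mult_sec L (\<lambda>e. slope s \<gamma> (prj E e)) \<kappa>' e))) e =
        lie s (\<lambda>e. (\<lambda>y. slope s \<gamma> y * \<Xi> (\<kappa> y)) (prj E e)) e"
      by (rule lie_cong[OF s]) (use t coord_L(2)[OF t(1) _ \<kappa>'] in \<open>simp add: prj_shift[OF s]\<close>)
    then show "\<Xi> (snd (I_op E ell s (mult_sec L (\<lambda>e. slope s \<gamma> (prj E e)) \<kappa>') e)) = \<Xi> (snd (zero_vec L e))"
      using I_op_coord(4)[OF s ms(2) t] lie_pull[OF s, of "\<lambda>y. slope s \<gamma> y * \<Xi> (\<kappa> y)" e] coord_L_zero[OF t] by simp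
  qed
qed

lemma iter_bracket_eq_deriv_G:
  "\<Psi> (snd (iter_bracket s n [mult_sec L (fib \<alpha>) \<kappa>', mult_sec L (fib \<beta>) \<kappa>'] ox)) = (deriv ^^ n) (G s \<alpha> \<beta>) 0"
proof -
  have ox: "prj E ox \<in> W" using x_in by simp
  have ms: "mult_sec L (fib \<gamma>) \<kappa>' \<in> sections AT L" if "linear \<gamma>" for \<gamma>
    by (intro M.mult_section \<kappa>' fib_Cinf that)
  have "G s \<alpha> \<beta> = (\<lambda>t. bil (fib \<alpha>) (fib \<beta>) (shift s t ox)
    + (- 1) * (t * (bil (\<lambda>e. slope s \<alpha> (prj E e)) (fib \<beta>) (shift s t ox) + bil (fib \<alpha>) (\<lambda>e. slope s \<beta> (prj E e)) (shift s t ox)))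
    + t * (t * bil (\<lambda>e. slope s \<alpha> (prj E e)) (\<lambda>e. slope s \<beta> (prj E e)) (shift s t ox)))"
  proof
    fix t
    note ci = fib_Cinf Cinf_pull slope_Cinf s lin
    show "G s \<alpha> \<beta> t = bil (fib \<alpha>) (fib \<beta>) (shift s t ox)
    + (- 1) * (t * (bil (\<lambda>e. slope s \<alpha> (prj E e)) (fib \<beta>) (shift s t ox) + bil (fib \<alpha>) (\<lambda>e. slope s \<beta> (prj E e)) (shift s t ox)))
    + t * (t * bil (\<lambda>e. slope s \<alpha> (prj E e)) (\<lambda>e. slope s \<beta> (prj E e)) (shift s t ox))"
      unfolding G_def by (subst bil_diff) (use x_in in \<open>auto intro!: ci simp: algebra_simps prj_shift[OF s]\<close>)
  qed
  then show ?thesis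
    using iter_bracket_taylor[OF s ms[OF lin(1)] ms[OF lin(2)] tl ox I_op_fib[OF lin(1)] I_op_fib[OF lin(2)], of n]
    by (simp add: bil_def)
qed

lemma push_eq_G:
  "\<Psi> (snd (push_op L (exp_I E (neg_sec E s)) (bracket_op J) [mult_sec L (fib \<alpha>) \<kappa>', mult_sec L (fib \<beta>) \<kappa>'] ox)) = G s \<alpha> \<beta> 1"
proof -
  have ms: "mult_sec L (fib \<gamma>) \<kappa>' \<in> sections AT L" if "linear \<gamma>" for \<gamma>
    by (intro M.mult_section \<kappa>' fib_Cinf that)
  have p: "pull_section s (- 1) (mult_sec L (fib \<gamma>) \<kappa>') = mult_sec L (\<lambda>z. fib \<gamma> z - 1 * slope s \<gamma> (prj E z)) \<kappa>'"
    if l: "linear \<gamma>" for \<gamma>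
    by (simp add: pull_section_mult[OF s fib_Cinf[OF l] \<kappa>'] pull_section_pullback[OF s] fib_shift[OF s l])
  have "set [mult_sec L (fib \<alpha>) \<kappa>', mult_sec L (fib \<beta>) \<kappa>'] \<subseteq> sections AT L" using ms lin by simp
  from push_op_eq[OF s this, of "bracket_op J" ox] show ?thesis
    using p[OF lin(1)] p[OF lin(2)] by (simp add: bracket_op_def G_def bil_def)
qed

end

text \<open>The function \<open>fib \<alpha>\<close> vanishes on the zero section. Coisotropy
  therefore makes the symbol of the bracket with its multiple of \<open>\<kappa>'\<close> tangent to
  the zero section, and this vector annihilates \<open>fib \<beta>\<close>, which vanishes there as
  well.\<close>

lemma bil_fib_zero:
  assumes l: "linear \<alpha>" "linear \<beta>"
  shows "bil (fib \<alpha>) (fib \<beta>) ox = 0"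
proof -
  let ?f = "fib \<alpha>" and ?g = "fib \<beta>"
  note f = fib_Cinf[OF l(1)] and g = fib_Cinf[OF l(2)]
  have z: "fib \<gamma> \<circ> zero_vec E = (\<lambda>_. 0)" if "linear \<gamma>" for \<gamma> using fib_zero[OF that] by auto
  have "v ?f = 0" if "v \<in> sub_tangent A AT (zero_vec E) x" for v
    using that f by (auto simp: sub_tangent_def push_tan_def z[OF l(1)] tangent_zero_fun)
  then have "bisymbol_sharp AT L J ox ?f \<kappa>' \<in> sub_tangent A AT (zero_vec E) x"
    using coisotropic_J f \<kappa>' unfolding coisotropic_def by blast
  then obtain w where w: "w \<in> tangent A x" "bisymbol_sharp AT L J ox ?f \<kappa>' = push_tan AT (zero_vec E) w"
    unfolding sub_tangent_def by blast
  from fun_cong[OF w(2), of ?g]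
  have "symbol AT L (J (mult_sec L ?f \<kappa>')) ?g ox = 0"
    using g by (simp add: bisymbol_sharp_def push_tan_def z[OF l(2)] tangent_zero_fun[OF w(1)] fib_zero[OF l(1)])
  moreover have "first_order_op AT L (J (mult_sec L ?f \<kappa>'))"
    using fo_J2[OF M.mult_section[OF f \<kappa>']] .
  from M.fo_symbol[OF this g \<kappa>' triv_L[OF tl], of ox]
  have "bil ?f ?g ox = symbol AT L (J (mult_sec L ?f \<kappa>')) ?g ox * \<Psi> (snd (\<kappa>' ox)) + ?g ox * \<Psi> (snd (J (mult_sec L ?f \<kappa>') \<kappa>' ox))"
    using x_in by (simp add: bil_def)
  ultimately show ?thesis using fib_zero[OF l(2)] by simp
qed

lemma G_0: "s \<in> sections A E \<Longrightarrow> linear \<alpha> \<Longrightarrow> linear \<beta> \<Longrightarrow> G s \<alpha> \<beta> 0 = 0"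
  using bil_fib_zero by (simp add: G_def shift_0)

section \<open>First jets and conormal covectors in coordinates\<close>

lemma first_jet_cong:
  assumes D: "first_order_op AT L D" and e: "prj E e \<in> N" and f: "f \<in> Cinf AT" "f' \<in> Cinf AT"
    and \<sigma>: "\<sigma> \<in> sections AT L" "\<sigma>' \<in> sections AT L"
    and F: "((\<lambda>z. f (cinv z)) has_derivative F) (at (tchart \<phi> \<Phi> e))"
      "((\<lambda>z. f' (cinv z)) has_derivative F') (at (tchart \<phi> \<Phi> e))"
    and eq: "\<And>w. F w * \<Psi> (snd (\<sigma> e)) = F' w * \<Psi> (snd (\<sigma>' e))"
  shows "D (mult_sec L (\<lambda>z. f z - f e) \<sigma>) e = D (mult_sec L (\<lambda>z. f' z - f' e) \<sigma>') e"
  by (rule M.fo_vanishing_multiple_cong[OF D f \<sigma> total_chart[OF c tE] _ triv_L[OF tl] _ F])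
     (use e N K eq in auto)

lemma local_derivative:
  assumes e: "prj E e \<in> N" and h: "bounded_linear h"
    and f: "\<And>e. prj E e \<in> N \<Longrightarrow> f e = h (\<phi> (prj E e), \<Phi> e)"
  shows "((\<lambda>z. f (cinv z)) has_derivative h) (at (tchart \<phi> \<Phi> e))"
proof (rule has_derivative_transform_within_open)
  show "(h has_derivative h) (at (tchart \<phi> \<Phi> e))" by (rule bounded_linear_imp_has_derivative[OF h])
  show "open (tchart \<phi> \<Phi> ` (prj E -` (U \<inter> V) \<inter> prj E -` N))"
    by (rule M.chart_image_open[OF total_chart[OF c tE] prj_open[OF N(1)]])
  show "(\<phi> (prj E e), \<Phi> e) \<in> tchart \<phi> \<Phi> ` (prj E -` (U \<inter> V) \<inter> prj E -` N)"
    using e N K by (intro image_eqI[of _ _ e]) auto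
  fix z assume "z \<in> tchart \<phi> \<Phi> ` (prj E -` (U \<inter> V) \<inter> prj E -` N)"
  then obtain e' where e': "prj E e' \<in> U" "prj E e' \<in> V" "prj E e' \<in> N" "z = (\<phi> (prj E e'), \<Phi> e')" by auto
  then show "h z = f (cinv z)"
    using f[OF e'(3)] M.chart_inv[OF total_chart[OF c tE], of e'] by simp
qed

lemma fib_local: "prj E e \<in> N \<Longrightarrow> fib \<alpha> e = (\<lambda>(w, u). \<alpha> u) (\<phi> (prj E e), \<Phi> e)"
  using N K \<theta>1 by (auto simp: fib_def)

lemma bas_local: "prj E e \<in> N \<Longrightarrow> bas \<xi> e = (\<lambda>(w, u). \<xi> w) (\<phi> (prj E e), \<Phi> e)"
  using N K \<theta>1 by (auto simp: bas_def)

lemma bounded_linear_snd_fst: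
  "linear \<alpha> \<Longrightarrow> bounded_linear (\<lambda>(w :: 'b, u :: 'f). \<alpha> u :: real)"
  "linear \<xi> \<Longrightarrow> bounded_linear (\<lambda>(w :: 'b, u :: 'f). \<xi> w :: real)"
  using bounded_linear_compose[OF finite_dim_bounded_linear[OF E.fd_fibre] bounded_linear_snd]
    bounded_linear_compose[OF finite_dim_bounded_linear[OF E.fd] bounded_linear_fst]
  by (simp_all add: case_prod_unfold)

text \<open>\<open>\<eta>\<close> is the covector \<open>d(fib \<alpha>) \<otimes> \<kappa>\<close>, expressed through its effect on first order operators;
  this spares the computation of the tangent spaces of the total space.\<close>

definition conormal_rep :: "('e, 'e \<times> 'l) cot \<Rightarrow> ('f \<Rightarrow> real) \<Rightarrow> bool" where
  "conormal_rep \<eta> \<alpha> \<longleftrightarrow> linear \<alpha> \<and> (\<exists>f\<in>Cinf AT. \<exists>\<sigma>\<in>sections AT L. \<eta> = cot_elem AT L ox f \<sigma> \<and>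
     (\<forall>D. first_order_op AT L D \<longrightarrow> D (mult_sec L (\<lambda>z. f z - f ox) \<sigma>) ox = D (mult_sec L (fib \<alpha>) \<kappa>') ox))"

lemma conormal_rep_fib:
  assumes "linear \<alpha>"
  shows "conormal_rep (cot_elem AT L ox (fib \<alpha>) \<kappa>') \<alpha>" "cot_elem AT L ox (fib \<alpha>) \<kappa>' \<in> conormal A E ell x"
proof -
  show "conormal_rep (cot_elem AT L ox (fib \<alpha>) \<kappa>') \<alpha>"
    unfolding conormal_rep_def using assms fib_Cinf[OF assms] \<kappa>' fib_zero[OF assms]
    by (intro conjI bexI[of _ "fib \<alpha>"] bexI[of _ \<kappa>']) simp_all
  have z: "fib \<alpha> \<circ> zero_vec E = (\<lambda>_. 0)" using fib_zero[OF assms] by auto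
  have "cot_elem AT L ox (fib \<alpha>) \<kappa>' v = zero_vec L ox" if h: "v \<in> sub_tangent A AT (zero_vec E) x" for v
  proof -
    obtain w where w: "w \<in> tangent A x" "v = push_tan AT (zero_vec E) w" using h unfolding sub_tangent_def by blast
    have "v (fib \<alpha>) = 0" using w fib_Cinf[OF assms] by (simp add: push_tan_def z tangent_zero_fun)
    moreover have "v \<in> tangent AT ox" unfolding w(2) by (rule push_zero_tangent[OF w(1)])
    moreover have "scale_vec L 0 (\<kappa>' ox) = zero_vec L ox"
      using M.scale_vec[OF M.section_tot[OF \<kappa>', of ox], where c = 0] M.section_prj[OF \<kappa>', of ox]
      by (intro M.vec_eqI') auto
    ultimately show ?thesis by (simp add: cot_elem_def)
  qed
  then show "cot_elem AT L ox (fib \<alpha>) \<kappa>' \<in> conormal A E ell x"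
    unfolding conormal_def cotangent_L_def using fib_Cinf[OF assms] \<kappa>' by blast
qed

text \<open>A conormal covector kills the directions of the base, so only the restriction to the
  fibre direction survives of the differential of \<open>f\<close>; this restriction, multiplied by
  the coordinate of \<open>\<sigma>\<close>, is the linear form sought.\<close>

lemma conormal_repE:
  assumes \<eta>: "\<eta> \<in> conormal A E ell x"
  obtains \<alpha> where "conormal_rep \<eta> \<alpha>"
proof -
  obtain f \<sigma> where f: "f \<in> Cinf AT" "\<sigma> \<in> sections AT L" "\<eta> = cot_elem AT L ox f \<sigma>"
    using \<eta> unfolding conormal_def cotangent_L_def by blast
  let ?T = "prj E -` (U \<inter> V)" and ?c = "\<lambda>e. (\<phi> (prj E e), \<Phi> e)"
  let ?f = "\<lambda>z. f (inv_into ?T ?c z)"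
  have oT: "ox \<in> ?T" using x_in by simp
  have co: "?c ox = (\<phi> x, 0)" using tE x_in by simp
  define F where "F = frechet_derivative ?f (at (\<phi> x, 0))"
  have F: "(?f has_derivative F) (at (\<phi> x, 0))"
    using M.Cinf_derivative[OF f(1) total_chart[OF c tE] oT] unfolding co F_def .
  have linF: "linear F" by (rule has_derivative_linear[OF F])
  have F0: "F (w, 0) * \<Psi> (snd (\<sigma> ox)) = 0" for w
  proof -
    \<comment> \<open>The base direction \<open>w\<close> as a tangent vector; its image under the
      zero section tests the horizontal part of the differential of \<open>f\<close>.\<close>
    let ?w = "restrict (\<lambda>f. frechet_derivative (\<lambda>z. f (inv_into U \<phi> z)) (at (\<phi> x)) w) (Cinf A)"
    have w: "?w \<in> tangent A x"
      using ell.coordinate_tangent[OF c x_in(1)] .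
    define v where "v = push_tan AT (zero_vec E) ?w"
    have v: "v \<in> tangent AT ox" "v \<in> sub_tangent A AT (zero_vec E) x"
      unfolding v_def sub_tangent_def using push_zero_tangent[OF w] w by auto
    have "((\<lambda>z. (z, 0)) has_derivative (\<lambda>w. (w, 0))) (at (\<phi> x))" by (auto intro!: derivative_eq_intros)
    from has_derivative_compose[OF this F]
    have "((\<lambda>z. ?f (z, 0)) has_derivative (\<lambda>w. F (w, 0))) (at (\<phi> x))" .
    then have "((\<lambda>z. (f \<circ> zero_vec E) (inv_into U \<phi> z)) has_derivative (\<lambda>w. F (w, 0))) (at (\<phi> x))"
    proof (rule has_derivative_transform_within_open)
      show "open (\<phi> ` (U \<inter> V))" by (rule E.chart_image_open[OF c E.triv_open[OF tE]])
      show "\<phi> x \<in> \<phi> ` (U \<inter> V)" using x_in by blast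
      fix z assume "z \<in> \<phi> ` (U \<inter> V)"
      then obtain y where y: "y \<in> U" "y \<in> V" "z = \<phi> y" by blast
      have "pt \<Phi> y 0 = zero_vec E y" using y tE by (intro E_eqI[OF tE]) auto
      then show "?f (z, 0) = (f \<circ> zero_vec E) (inv_into U \<phi> z)"
        using inv_total_chart[OF c tE y(1,2), of 0] y c by simp
    qed
    from fun_cong[OF frechet_derivative_at[OF this], of w]
    have "v f = F (w, 0)"
      using f(1) Cinf_zero_section[OF f(1)] by (simp add: v_def push_tan_def)
    moreover have "\<eta> v = zero_vec L ox" using \<eta> v(2) unfolding conormal_def by blast
    ultimately have "scale_vec L (F (w, 0)) (\<sigma> ox) = zero_vec L ox"
      using v(1) by (simp add: f(3) cot_elem_def)
    from arg_cong[OF this, of "\<Psi> \<circ> snd"]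
    show ?thesis
      using M.scale_vec(3)[OF M.section_tot[OF f(2)] triv_L[OF tl], of ox "F (w, 0)"] M.section_prj[OF f(2), of ox]
        coord_L_zero[OF tl, of ox] x_in by simp
  qed
  \<comment> \<open>The coordinate of \<open>\<sigma>\<close> is absorbed into
    \<open>\<alpha>\<close>, as \<open>\<kappa>'\<close> has coordinate 1 at this point.\<close>
  define \<alpha> where "\<alpha> u = F (0, u) * \<Psi> (snd (\<sigma> ox))" for u
  have \<alpha>: "linear \<alpha>"
    using linear_add[OF linF, of "(0, _)" "(0, _)"] linear_cmul[OF linF, of _ "(0, _)"]
    unfolding \<alpha>_def[abs_def] by (intro linearI) (auto simp: algebra_simps)
  have "D (mult_sec L (\<lambda>z. f z - f ox) \<sigma>) ox = D (mult_sec L (fib \<alpha>) \<kappa>') ox" if D: "first_order_op AT L D" for D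
  proof -
    have "D (mult_sec L (\<lambda>z. f z - f ox) \<sigma>) ox = D (mult_sec L (\<lambda>z. fib \<alpha> z - fib \<alpha> ox) \<kappa>') ox"
    proof (rule first_jet_cong[OF D _ f(1) fib_Cinf[OF \<alpha>] f(2) \<kappa>'])
      show "prj E ox \<in> N" using N by simp
      show "(?f has_derivative F) (at (?c ox))" using F unfolding co .
      show "((\<lambda>z. fib \<alpha> (inv_into ?T ?c z)) has_derivative (\<lambda>(w, u). \<alpha> u)) (at (?c ox))"
        by (rule local_derivative[OF _ bounded_linear_snd_fst(1)[OF \<alpha>] fib_local]) (use N in simp_all)
      fix p :: "'b \<times> 'f"
      have "F p = F (fst p, 0) + F (0, snd p)" using linear_add[OF linF, of "(fst p, 0)" "(0, snd p)"] by simp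
      then show "F p * \<Psi> (snd (\<sigma> ox)) = (\<lambda>(w, u). \<alpha> u) p * \<Psi> (snd (\<kappa>' ox))"
        using F0[of "fst p"] by (simp add: \<alpha>_def split_beta \<kappa>x distrib_right)
    qed
    then show ?thesis by (simp add: fib_zero[OF \<alpha>])
  qed
  then show thesis using that \<alpha> f unfolding conormal_rep_def by blast
qed

lemma P_op_rep:
  assumes Q: "M.bidiffop Q" and r: "conormal_rep \<eta>1 \<alpha>" "conormal_rep \<eta>2 \<beta>"
  shows "P_op A E ell Q x [\<eta>1, \<eta>2] = snd (Q [mult_sec L (fib \<alpha>) \<kappa>', mult_sec L (fib \<beta>) \<kappa>'] ox)"
proof -
  obtain f \<sigma> where f: "f \<in> Cinf AT" "\<sigma> \<in> sections AT L" "\<eta>1 = cot_elem AT L ox f \<sigma>"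
    "\<And>D. first_order_op AT L D \<Longrightarrow> D (mult_sec L (\<lambda>z. f z - f ox) \<sigma>) ox = D (mult_sec L (fib \<alpha>) \<kappa>') ox"
    using r(1) unfolding conormal_rep_def by blast
  obtain g \<rho> where g: "g \<in> Cinf AT" "\<rho> \<in> sections AT L" "\<eta>2 = cot_elem AT L ox g \<rho>"
    "\<And>D. first_order_op AT L D \<Longrightarrow> D (mult_sec L (\<lambda>z. g z - g ox) \<rho>) ox = D (mult_sec L (fib \<beta>) \<kappa>') ox"
    using r(2) unfolding conormal_rep_def by blast
  have l: "linear \<alpha>" using r(1) by (simp add: conormal_rep_def)
  have 1: "mult_sec L (\<lambda>z. g z - g ox) \<rho> \<in> sections AT L" by (intro M.mult_section M.Cinf_diff M.Cinf_const g)
  have 2: "mult_sec L (fib \<alpha>) \<kappa>' \<in> sections AT L" by (intro M.mult_section fib_Cinf l \<kappa>')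
  have "P_op A E ell Q x [\<eta>1, \<eta>2] = snd (Q [mult_sec L (\<lambda>z. f z - f ox) \<sigma>, mult_sec L (\<lambda>z. g z - g ox) \<rho>] ox)"
    unfolding P_op_def P_form_def f(3) g(3) by (simp add: M.symbol_form_eq[OF Q f(1,2) g(1,2)])
  also have "\<dots> = snd (Q [mult_sec L (fib \<alpha>) \<kappa>', mult_sec L (\<lambda>z. g z - g ox) \<rho>] ox)"
    using f(4)[OF M.bidiffopD(1)[OF Q 1]] by simp
  also have "\<dots> = snd (Q [mult_sec L (fib \<alpha>) \<kappa>', mult_sec L (fib \<beta>) \<kappa>'] ox)"
    using g(4)[OF M.bidiffopD(2)[OF Q 2]] by simp
  finally show ?thesis .
qed

end

section \<open>Linear algebra\<close>

lemma finite_dim_orthonormal_basis_dim: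
  assumes "finite_dim TYPE('a::real_inner)"
  obtains B :: "'a::real_inner set" where "finite B" "\<And>b. b \<in> B \<Longrightarrow> norm b = 1"
    "\<And>b c. b \<in> B \<Longrightarrow> c \<in> B \<Longrightarrow> b \<noteq> c \<Longrightarrow> b \<bullet> c = 0"
    "\<And>x. x = (\<Sum>b\<in>B. (x \<bullet> b) *\<^sub>R b)" "dim (UNIV :: 'a set) = card B"
proof -
  obtain B :: "'a set" where B: "finite B" "\<And>b. b \<in> B \<Longrightarrow> norm b = 1"
    "\<And>b c. b \<in> B \<Longrightarrow> c \<in> B \<Longrightarrow> b \<noteq> c \<Longrightarrow> b \<bullet> c = 0" "\<And>x. x = (\<Sum>b\<in>B. (x \<bullet> b) *\<^sub>R b)"
    using finite_dim_orthonormal_basis[OF assms] by blast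
  have "x \<in> span B" for x
    by (subst B(4)[of x]) (intro span_sum span_scale span_base)
  then have "span B = span UNIV" by auto
  moreover have "0 \<notin> B" using B(2)[of 0] by auto
  then have "independent B"
    using B(3) by (intro pairwise_orthogonal_independent) (auto simp: pairwise_def orthogonal_def)
  ultimately have "dim (UNIV :: 'a set) = card B" by (rule dim_eq_card)
  then show thesis using that B by blast
qed

lemma finite_dim_dim_0:
  assumes "finite_dim TYPE('a::real_inner)" "dim (UNIV :: 'a::real_inner set) = 0"
  shows "(x :: 'a) = 0"
proof -
  obtain B :: "'a set" where B: "finite B" "\<And>x. x = (\<Sum>b\<in>B. (x \<bullet> b) *\<^sub>R b)" "dim (UNIV :: 'a set) = card B"
    using finite_dim_orthonormal_basis_dim[OF assms(1)] by metis
  then have "B = {}" using assms(2) by simp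
  then show ?thesis using B(2)[of x] by simp
qed

lemma finite_dim_dim_not_1:
  assumes "finite_dim TYPE('a::real_inner)" "dim (UNIV :: 'a::real_inner set) \<noteq> 1"
  shows "(\<forall>x :: 'a. x = 0) \<or> (\<exists>b c :: 'a. b \<bullet> b = 1 \<and> c \<bullet> c = 1 \<and> b \<bullet> c = 0)"
proof -
  obtain B :: "'a set" where B: "finite B" "\<And>b. b \<in> B \<Longrightarrow> norm b = 1"
    "\<And>b c. b \<in> B \<Longrightarrow> c \<in> B \<Longrightarrow> b \<noteq> c \<Longrightarrow> b \<bullet> c = 0" "dim (UNIV :: 'a set) = card B"
    using finite_dim_orthonormal_basis_dim[OF assms(1)] by metis
  show ?thesis
  proof (cases "card B = 0")
    case True
    then show ?thesis using finite_dim_dim_0[OF assms(1)] B(4) by auto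
  next
    case False
    then have "card B \<ge> 2" using assms(2) B(4) by linarith
    then obtain b c where "b \<in> B" "c \<in> B" "b \<noteq> c"
      using card_le_Suc0_iff_eq[OF B(1)] by (metis not_less_eq_eq numeral_2_eq_2)
    then show ?thesis using B(2,3) by (metis dot_square_norm power_one)
  qed
qed

text \<open>This is where two independent directions are used: a linear form on a plane has a
  nonzero kernel vector, and \<open>\<alpha>\<close> is inner product with it, normalized.\<close>

lemma kernel_vector:
  fixes \<beta> :: "'a::real_inner \<Rightarrow> real" and b c :: 'a
  assumes bc: "b \<bullet> b = 1" "c \<bullet> c = 1" "b \<bullet> c = 0" and \<beta>: "linear \<beta>"
  obtains w \<alpha> where "linear \<alpha>" "\<beta> w = 0" "\<alpha> w = (1 :: real)"
proof -
  \<comment> \<open>The combination of \<open>b\<close> and \<open>c\<close> always lies in the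
    kernel but may be 0 if \<open>\<beta> b = 0\<close>; in that case \<open>b\<close> itself
    serves.\<close>
  define v where "v = (if \<beta> b = 0 then b else \<beta> c *\<^sub>R b - \<beta> b *\<^sub>R c)"
  have "\<beta> v = 0" by (auto simp: v_def linear_diff[OF \<beta>] linear_cmul[OF \<beta>])
  moreover have "v \<noteq> 0"
  proof
    assume "v = 0"
    then have "v \<bullet> b = 0" "v \<bullet> c = 0" by simp_all
    then show False using bc by (auto simp: v_def inner_diff_left inner_commute[of c b] split: if_splits)
  qed
  moreover have "linear (\<lambda>u. (u \<bullet> v) / (v \<bullet> v))"
    by (intro linearI) (auto simp: inner_add_left add_divide_distrib)
  ultimately show thesis using that[of "\<lambda>u. (u \<bullet> v) / (v \<bullet> v)" v] by simp
qed

lemma taylor_sums_const: "taylor_sums (\<lambda>_. c)"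
proof -
  have "(deriv ^^ n) (\<lambda>_. c) = (\<lambda>_. if n = 0 then c else 0)" for n
    by (induction n) auto
  then have "(\<lambda>n. (deriv ^^ n) (\<lambda>_. c) 0 / fact n) = (\<lambda>n. if n = 0 then c else 0)" by auto
  then show ?thesis unfolding taylor_sums_def using sums_single[of 0 "\<lambda>_. c"] by simp
qed

section \<open>Push-forwards and the Maurer-Cartan series\<close>

context coisotropic_normal
begin

lemma push_op_pull_section:
  assumes s: "s \<in> sections A E" and Q: "M.bidiffop Q" and ab: "a \<in> sections AT L" "b \<in> sections AT L"
  shows "push_op L (exp_I E (neg_sec E s)) Q [a, b] =
    pull_section s 1 (Q [pull_section s (- 1) a, pull_section s (- 1) b])"
proof
  fix y
  have l: "set [a, b] \<subseteq> sections AT L" using ab by simp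
  have "Q [pull_section s (- 1) a, pull_section s (- 1) b] \<in> sections AT L"
    by (intro M.bidiffop_section Q pull_section_section[OF s] ab)
  from section_L(1)[OF this] show "push_op L (exp_I E (neg_sec E s)) Q [a, b] y =
      pull_section s 1 (Q [pull_section s (- 1) a, pull_section s (- 1) b]) y"
    unfolding push_op_eq[OF s l] by (simp add: pull_section_def shift_shift[OF s] shift_0[OF s])
qed

lemma push_op_bidiffop:
  assumes s: "s \<in> sections A E" and Q: "M.bidiffop Q"
  shows "M.bidiffop (push_op L (exp_I E (neg_sec E s)) Q)"
  unfolding M.bidiffop_def
proof (intro ballI conjI)
  fix \<mu> assume \<mu>: "\<mu> \<in> sections AT L"
  note p = pull_section_section[OF s \<mu>, of "- 1"]
  show "first_order_op AT L (\<lambda>\<nu>. push_op L (exp_I E (neg_sec E s)) Q [\<nu>, \<mu>])"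
    by (rule M.first_order_op_cong[OF push_op_pull_section[OF s Q _ \<mu>, symmetric]
          first_order_push[OF s M.bidiffopD(1)[OF Q p], of "- 1" 1]]) simp_all
  show "first_order_op AT L (\<lambda>\<nu>. push_op L (exp_I E (neg_sec E s)) Q [\<mu>, \<nu>])"
    by (rule M.first_order_op_cong[OF push_op_pull_section[OF s Q \<mu>, symmetric]
          first_order_push[OF s M.bidiffopD(2)[OF Q p], of "- 1" 1]]) simp_all
qed

text \<open>Naturality of the differential: transporting a covector by the automorphism amounts to
  pulling back the function and the section that represent it.\<close>

lemma push_cot_elem:
  assumes s: "s \<in> sections A E" and f: "f \<in> Cinf AT" and \<sigma>: "\<sigma> \<in> sections AT L"
  shows "restrict (\<lambda>v. inv_into (tot L) (\<lambda>(e, l). (shift s (- 1) e, l))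
      (cot_elem AT L y f \<sigma> (push_tan AT (shift s (- 1)) v))) (tangent AT (shift s 1 y)) =
    cot_elem AT L (shift s 1 y) (\<lambda>e. f (shift s (- 1) e)) (pull_section s (- 1) \<sigma>)"
proof
  fix v
  show "restrict (\<lambda>v. inv_into (tot L) (\<lambda>(e, l). (shift s (- 1) e, l))
      (cot_elem AT L y f \<sigma> (push_tan AT (shift s (- 1)) v))) (tangent AT (shift s 1 y)) v =
    cot_elem AT L (shift s 1 y) (\<lambda>e. f (shift s (- 1) e)) (pull_section s (- 1) \<sigma>) v"
  proof (cases "v \<in> tangent AT (shift s 1 y)")
    case True
    have ss [simp]: "shift s (- 1) (shift s 1 e) = e" for e by (simp add: shift_shift[OF s] shift_0[OF s])
    have C: "(\<lambda>z. g (shift s (- 1) z)) \<in> Cinf AT" if "g \<in> Cinf AT" for g by (rule Cinf_shift[OF s that])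
    have v: "v (\<lambda>z. f z + g z) = v f + v g" "v (\<lambda>z. k * f z) = k * v f"
      "v (\<lambda>z. f z * g z) = f (shift s 1 y) * v g + g (shift s 1 y) * v f"
      if "f \<in> Cinf AT" "g \<in> Cinf AT" for f g k
      using True that unfolding tangent_def by blast+
    have "push_tan AT (shift s (- 1)) v \<in> tangent AT y"
      unfolding tangent_def push_tan_def
      by (auto simp: M.Cinf_add M.Cinf_cmult M.Cinf_mult comp_def v[OF C C])
    then have "cot_elem AT L y f \<sigma> (push_tan AT (shift s (- 1)) v) = scale_vec L (v (\<lambda>e. f (shift s (- 1) e))) (\<sigma> y)"
      using f by (simp add: cot_elem_def push_tan_def comp_def)
    moreover have "inv_into (tot L) (\<lambda>(e, l). (shift s (- 1) e, l)) (scale_vec L k (\<sigma> y)) =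
      scale_vec L k (pull_section s (- 1) \<sigma> (shift s 1 y))" for k
    proof -
      \<comment> \<open>Viewing the vector as the value of a section lets
        \<open>pull_section\<close> compute its image under the inverse bundle map.\<close>
      let ?\<tau> = "mult_sec L (\<lambda>_. k) \<sigma>"
      have \<tau>: "?\<tau> \<in> sections AT L" by (rule M.cmult_section[OF \<sigma>])
      have "?\<tau> y = (y, snd (?\<tau> y))" using section_L(1)[OF \<tau>, of y] by (metis prod.collapse)
      then have "inv_into (tot L) (\<lambda>(e, l). (shift s (- 1) e, l)) (?\<tau> y) = (shift s 1 y, snd (?\<tau> y))"
        using inv_exp_I[OF s section_L(2,3)[OF \<tau>], of y] by simp
      also have "\<dots> = pull_section s (- 1) ?\<tau> (shift s 1 y)" by (simp add: pull_section_def)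
      also have "\<dots> = mult_sec L (\<lambda>_. k) (pull_section s (- 1) \<sigma>) (shift s 1 y)"
        by (simp add: pull_section_mult[OF s M.Cinf_const \<sigma>])
      finally show ?thesis by (simp add: mult_sec_def)
    qed
    ultimately show ?thesis using True by (simp add: cot_elem_def)
  qed (simp add: cot_elem_def)
qed

text \<open>Pull-back is compatible with passing from \<open>h\<close> to \<open>h\<close> minus its
  value at the point. Hence both sides are the bracket of the same pulled back sections, evaluated
  at \<open>shift s 1\<close> of the zero vector.\<close>

lemma P_push_op_eq_P_push_form:
  assumes s: "s \<in> sections A E" and \<eta>: "\<eta>1 \<in> conormal A E ell x" "\<eta>2 \<in> conormal A E ell x"
  shows "P_op A E ell (push_op L (exp_I E (neg_sec E s)) (bracket_op J)) x [\<eta>1, \<eta>2] =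
    P_form E (push_form AT L (exp_I E (neg_sec E s)) (bisymbol AT L J)) x [\<eta>1, \<eta>2]"
proof -
  let ?z = "zero_vec E x"
  let ?e = "shift s 1 ?z"
  obtain f \<sigma> where f: "f \<in> Cinf AT" "\<sigma> \<in> sections AT L" "\<eta>1 = cot_elem AT L ?z f \<sigma>"
    using \<eta>(1) unfolding conormal_def cotangent_L_def by blast
  obtain g \<rho> where g: "g \<in> Cinf AT" "\<rho> \<in> sections AT L" "\<eta>2 = cot_elem AT L ?z g \<rho>"
    using \<eta>(2) unfolding conormal_def cotangent_L_def by blast
  have pm: "pull_section s (- 1) (mult_sec L (\<lambda>z. h z - h ?z) \<tau>) =
      mult_sec L (\<lambda>z. h (shift s (- 1) z) - h (shift s (- 1) ?e)) (pull_section s (- 1) \<tau>)"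
    if "h \<in> Cinf AT" "\<tau> \<in> sections AT L" for h \<tau>
    using that by (simp add: pull_section_mult[OF s] M.Cinf_diff M.Cinf_const shift_shift[OF s] shift_0[OF s])
  have ms: "mult_sec L (\<lambda>z. h z - h ?z) \<tau> \<in> sections AT L" if "h \<in> Cinf AT" "\<tau> \<in> sections AT L" for h \<tau>
    using that by (intro M.mult_section M.Cinf_diff M.Cinf_const)
  have "P_op A E ell (push_op L (exp_I E (neg_sec E s)) (bracket_op J)) x [\<eta>1, \<eta>2] =
      snd (push_op L (exp_I E (neg_sec E s)) (bracket_op J) [mult_sec L (\<lambda>z. f z - f ?z) \<sigma>, mult_sec L (\<lambda>z. g z - g ?z) \<rho>] ?z)"
    unfolding P_op_def P_form_def f(3) g(3)
    by (simp add: M.symbol_form_eq[OF push_op_bidiffop[OF s bidiffop_J] f(1,2) g(1,2)])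
  also have "\<dots> = snd (bracket_op J [pull_section s (- 1) (mult_sec L (\<lambda>z. f z - f ?z) \<sigma>),
      pull_section s (- 1) (mult_sec L (\<lambda>z. g z - g ?z) \<rho>)] ?e)"
    unfolding push_op_pull_section[OF s bidiffop_J ms[OF f(1,2)] ms[OF g(1,2)]] by (simp add: pull_section_def)
  also have "\<dots> = snd (bisymbol AT L J ?e [cot_elem AT L ?e (\<lambda>e. f (shift s (- 1) e)) (pull_section s (- 1) \<sigma>),
      cot_elem AT L ?e (\<lambda>e. g (shift s (- 1) e)) (pull_section s (- 1) \<rho>)])"
    unfolding pm[OF f(1,2)] pm[OF g(1,2)] bisymbol_def
    by (subst M.symbol_form_eq[OF bidiffop_J])
       (use f g in \<open>auto intro: Cinf_shift[OF s] pull_section_section[OF s]\<close>)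
  also have "\<dots> = P_form E (push_form AT L (exp_I E (neg_sec E s)) (bisymbol AT L J)) x [\<eta>1, \<eta>2]"
  proof -
    have ex: "exp_I E (neg_sec E s) = (shift s (- 1), (\<lambda>(e, l). (shift s (- 1) e, l :: 'l)))"
      using exp_I_neg[OF s] by (simp add: prod_eq_iff)
    show ?thesis
      unfolding P_form_def push_form_def ex prod.case inv_shift[OF s] f(3) g(3) list.map
        push_cot_elem[OF s f(1,2)] push_cot_elem[OF s g(1,2)] by (simp add: split_beta)
  qed
  finally show ?thesis .
qed

lemma normal_frame_exists:
  assumes c: "(U, \<phi>) \<in> A" "(V, \<Phi>) \<in> triv E" "(W, \<Psi>) \<in> triv ell" and O1: "open O1" "x \<in> O1" "O1 \<subseteq> U \<inter> V \<inter> W"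
  obtains \<theta> \<kappa> N K where "normal_frame A E ell J U \<phi> V \<Phi> W \<Psi> \<theta> \<kappa> N K x" "N \<subseteq> O1"
proof -
  have OW: "O1 \<subseteq> W" using O1 by blast
  obtain \<theta> \<kappa> N K where b: "\<theta> \<in> Cinf A" "\<kappa> \<in> sections A ell" "open N" "x \<in> N" "N \<subseteq> K" "closed K" "K \<subseteq> O1"
    "\<forall>z\<in>N. \<theta> z = 1" "\<forall>z. z \<notin> K \<longrightarrow> \<theta> z = 0"
    "\<forall>z\<in>W. \<Psi> (\<kappa> z) = \<theta> z" "\<forall>z. z \<notin> K \<longrightarrow> \<kappa> z = zero_vec ell z"
    by (rule ell.local_generator[OF c(3) O1(1,2) OW], rule that)
  have "normal_frame A E ell J U \<phi> V \<Phi> W \<Psi> \<theta> \<kappa> N K x"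
    by unfold_locales (use c b O1 in auto)
  then show thesis using that b by blast
qed

lemma entire_on_fibre_cong:
  assumes "\<And>e. prj E e = x \<Longrightarrow> h e = h' e"
  shows "entire_on_fibre E x h = entire_on_fibre E x h'"
proof -
  have "h (THE e. e \<in> tot E \<and> prj E e = x \<and> \<Phi> e = u) = h' (THE e. e \<in> tot E \<and> prj E e = x \<and> \<Phi> e = u)"
    if "(V, \<Phi>) \<in> triv E" "x \<in> V" for V \<Phi> u
    using assms pt(1)[OF that, of u] unfolding pt_def by blast
  then show ?thesis unfolding entire_on_fibre_def by (intro ball_cong) auto
qed

end

section \<open>Convergence over a point in terms of the components of \<Lambda>\<close>

context normal_frame
begin

lemma MC_iff_taylor_sums:
  assumes s: "s \<in> sections A E" and r: "conormal_rep \<eta>1 \<alpha>" "conormal_rep \<eta>2 \<beta>"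
  shows "(\<lambda>k. \<Psi> (multibracket A E ell J (replicate (Suc k) (neg_sec E s)) x [\<eta>1, \<eta>2]) / fact (Suc k))
      sums \<Psi> (P_op A E ell (push_op L (exp_I E (neg_sec E s)) (bracket_op J)) x [\<eta>1, \<eta>2]) \<longleftrightarrow>
    taylor_sums (G s \<alpha> \<beta>)"
proof -
  have lin: "linear \<alpha>" "linear \<beta>" using r by (simp_all add: conormal_rep_def)
  have 1: "\<Psi> (multibracket A E ell J (replicate n (neg_sec E s)) x [\<eta>1, \<eta>2]) = (deriv ^^ n) (G s \<alpha> \<beta>) 0" for n
    unfolding multibracket_iter_bracket P_op_rep[OF iter_bracket_bidiffop[OF s] r] by (rule iter_bracket_eq_deriv_G[OF s lin])
  have 2: "\<Psi> (P_op A E ell (push_op L (exp_I E (neg_sec E s)) (bracket_op J)) x [\<eta>1, \<eta>2]) = G s \<alpha> \<beta> 1"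
    unfolding P_op_rep[OF push_op_bidiffop[OF s bidiffop_J] r] by (rule push_eq_G[OF s lin])
  \<comment> \<open>The Maurer-Cartan series begins with k = 1; the missing Taylor coefficient is
    the value of \<open>G\<close> at 0, which is 0 by coisotropy.\<close>
  show ?thesis
    unfolding 1 2 taylor_sums_def
    using sums_Suc_iff[of "\<lambda>n. (deriv ^^ n) (G s \<alpha> \<beta>) 0 / fact n" "G s \<alpha> \<beta> 1"] G_0[OF s lin] by simp
qed

lemma bisymbol_eq:
  assumes "f \<in> Cinf AT" "g \<in> Cinf AT" "\<rho> \<in> sections A ell"
  shows "bisymbol AT L J e [cot_elem AT L e f (pullback_sec E \<rho>), cot_elem AT L e g (pullback_sec E \<rho>)] =
    J (mult_sec L (\<lambda>z. f z - f e) (pullback_sec E \<rho>)) (mult_sec L (\<lambda>z. g z - g e) (pullback_sec E \<rho>)) e"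
  unfolding bisymbol_def
  by (simp add: M.symbol_form_eq[OF bidiffop_J] assms pullback_section bracket_op_def)

text \<open>A component depends on the functions through their differentials at \<open>e\<close>
  alone, and on the generator through its value there. This links arbitrary global representatives
  of coordinates with \<open>fib\<close> and \<open>bas\<close>.\<close>

lemma Lam_cong:
  assumes e: "prj E e \<in> N" and f: "f \<in> Cinf AT" "f' \<in> Cinf AT" and g: "g \<in> Cinf AT" "g' \<in> Cinf AT"
    and \<rho>: "\<rho> \<in> sections A ell" "\<Psi> (\<rho> (prj E e)) = 1"
    and F: "((\<lambda>z. f (cinv z)) has_derivative F) (at (tchart \<phi> \<Phi> e))"
      "((\<lambda>z. f' (cinv z)) has_derivative F) (at (tchart \<phi> \<Phi> e))"
    and H: "((\<lambda>z. g (cinv z)) has_derivative H) (at (tchart \<phi> \<Phi> e))"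
      "((\<lambda>z. g' (cinv z)) has_derivative H) (at (tchart \<phi> \<Phi> e))"
  shows "\<Psi> (snd (J (mult_sec L (\<lambda>z. f z - f e) (pullback_sec E \<rho>)) (mult_sec L (\<lambda>z. g z - g e) (pullback_sec E \<rho>)) e)) =
    Lam f' g' e"
proof -
  have ms: "mult_sec L (\<lambda>z. h z - h e) \<tau> \<in> sections AT L" if "h \<in> Cinf AT" "\<tau> \<in> sections AT L" for h \<tau>
    using that by (intro M.mult_section M.Cinf_diff M.Cinf_const)
  have 1: "\<Psi> (snd (pullback_sec E \<rho> e)) = \<Psi> (snd (\<kappa>' e))"
    using e N K \<kappa>W \<theta>1 \<rho>(2) by auto
  note \<rho>' = pullback_section[OF \<rho>(1)]
  show ?thesis
    unfolding Lam_def bil_def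
    using first_jet_cong[OF fo_J1[OF ms[OF g(1) \<rho>']] e f \<rho>' \<kappa>' F]
      first_jet_cong[OF fo_J2[OF ms[OF f(2) \<kappa>']] e g \<rho>' \<kappa>' H] by (simp add: 1[simplified])
qed

lemma Lam_eqI:
  assumes e: "prj E e = x" and f: "f \<in> Cinf AT" "f' \<in> Cinf AT" and g: "g \<in> Cinf AT" "g' \<in> Cinf AT"
    and F: "((\<lambda>z. f (cinv z)) has_derivative F) (at (\<phi> x, \<Phi> e))"
      "((\<lambda>z. f' (cinv z)) has_derivative F) (at (\<phi> x, \<Phi> e))"
    and H: "((\<lambda>z. g (cinv z)) has_derivative H) (at (\<phi> x, \<Phi> e))"
      "((\<lambda>z. g' (cinv z)) has_derivative H) (at (\<phi> x, \<Phi> e))"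
  shows "Lam f g e = Lam f' g' e"
  using Lam_cong[OF _ f g \<kappa> _ F[folded e] H[folded e]] e N \<kappa>x by (simp add: Lam_def bil_def)

lemma fib_derivative:
  assumes "linear \<alpha>" "prj E e = x"
  shows "((\<lambda>z. fib \<alpha> (cinv z)) has_derivative (\<lambda>(w, u). \<alpha> u)) (at (\<phi> x, \<Phi> e))"
  using local_derivative[OF _ bounded_linear_snd_fst(1)[OF assms(1)] fib_local, of e] assms(2) N by simp

lemma bas_derivative:
  assumes "linear \<xi>" "prj E e = x"
  shows "((\<lambda>z. bas \<xi> (cinv z)) has_derivative (\<lambda>(w, u). \<xi> w)) (at (\<phi> x, \<Phi> e))"
  using local_derivative[OF _ bounded_linear_snd_fst(2)[OF assms(1)] bas_local, of e] assms(2) N by simp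

lemma pull_derivative:
  assumes g: "((\<lambda>z. g (inv_into U \<phi> z)) has_derivative \<xi>) (at (\<phi> x))"
  shows "((\<lambda>z. g (prj E (cinv z))) has_derivative (\<lambda>(w, u). \<xi> w)) (at (\<phi> x, u0))"
proof -
  have "((\<lambda>z. g (inv_into U \<phi> (fst z))) has_derivative (\<lambda>p. \<xi> (fst p))) (at (\<phi> x, u0))"
    using has_derivative_compose[OF has_derivative_fst[OF has_derivative_ident], of "\<lambda>z. g (inv_into U \<phi> z)" \<xi> "(\<phi> x, u0)"] g
    by simp
  then have "((\<lambda>z. g (prj E (cinv z))) has_derivative (\<lambda>p. \<xi> (fst p))) (at (\<phi> x, u0))"
  proof (rule has_derivative_transform_within_open)
    show "open (\<phi> ` (U \<inter> V) \<times> (UNIV :: 'f set))"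
      by (intro open_Times E.chart_image_open[OF c E.triv_open[OF tE]] open_UNIV)
    show "(\<phi> x, u0) \<in> \<phi> ` (U \<inter> V) \<times> UNIV" using x_in by blast
    fix z assume "z \<in> \<phi> ` (U \<inter> V) \<times> (UNIV :: 'f set)"
    then obtain y u where y: "y \<in> U" "y \<in> V" "z = (\<phi> y, u)" by blast
    then show "g (inv_into U \<phi> (fst z)) = g (prj E (cinv z))"
      using inv_total_chart[OF c tE y(1,2), of u] c tE by simp
  qed
  then show ?thesis by (simp add: case_prod_unfold)
qed

text \<open>A function pulled back from the base has the same differential at all points over
  \<open>x\<close>. So each slope may be replaced by the linear function \<open>bas\<close> of its
  differential at \<open>x\<close>, and the coefficients become components of \<Lambda> along the
  ray of \<open>s x\<close>.\<close>

lemma G_eq_Lam_bas: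
  assumes s: "s \<in> sections A E" and lin: "linear \<alpha>" "linear \<beta>"
    and d: "((\<lambda>z. slope s \<alpha> (inv_into U \<phi> z)) has_derivative \<xi>) (at (\<phi> x))"
      "((\<lambda>z. slope s \<beta> (inv_into U \<phi> z)) has_derivative \<zeta>) (at (\<phi> x))"
  shows "G s \<alpha> \<beta> = (\<lambda>t. Lam (fib \<alpha>) (fib \<beta>) (scale_vec E t (s x))
    + (- 1) * (t * (Lam (bas \<xi>) (fib \<beta>) (scale_vec E t (s x)) + Lam (fib \<alpha>) (bas \<zeta>) (scale_vec E t (s x))))
    + t * (t * Lam (bas \<xi>) (bas \<zeta>) (scale_vec E t (s x))))"
proof
  fix t
  have e: "prj E (scale_vec E t (s x)) = x" using s by (simp add: E.scale_vec)
  note l = has_derivative_linear[OF d(1)] has_derivative_linear[OF d(2)]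
  note C = fib_Cinf[OF lin(1)] fib_Cinf[OF lin(2)] bas_Cinf[OF l(1)] bas_Cinf[OF l(2)]
    Cinf_pull[OF slope_Cinf[OF s lin(1)]] Cinf_pull[OF slope_Cinf[OF s lin(2)]]
  note D = fib_derivative[OF lin(1) e] fib_derivative[OF lin(2) e] bas_derivative[OF l(1) e] bas_derivative[OF l(2) e]
    pull_derivative[OF d(1)] pull_derivative[OF d(2)]
  show "G s \<alpha> \<beta> t = Lam (fib \<alpha>) (fib \<beta>) (scale_vec E t (s x))
    + (- 1) * (t * (Lam (bas \<xi>) (fib \<beta>) (scale_vec E t (s x)) + Lam (fib \<alpha>) (bas \<zeta>) (scale_vec E t (s x))))
    + t * (t * Lam (bas \<xi>) (bas \<zeta>) (scale_vec E t (s x)))"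
    unfolding G_eq_Lam[OF s lin] shift_zero[OF s]
      Lam_eqI[OF e C(5,3) C(2,2) D(5,3) D(2,2)] Lam_eqI[OF e C(1,1) C(6,4) D(1,1) D(6,4)]
      Lam_eqI[OF e C(5,3) C(6,4) D(5,3) D(6,4)] ..
qed

lemma smooth_Lam_ray: "f \<in> Cinf AT \<Longrightarrow> g \<in> Cinf AT \<Longrightarrow> prj E e = x \<Longrightarrow> smooth_on UNIV (\<lambda>r. Lam f g (scale_vec E r e))"
  using smooth_on_ray[OF Lam_smooth] x_in by blast

lemma fiberwise_entire_taylor_sums:
  assumes ent: "fiberwise_entire A E ell (bisymbol AT L J)"
    and f: "f \<in> Cinf AT" "g \<in> Cinf AT" and h: "linear h" "linear k"
    and loc: "\<And>e. prj E e \<in> N \<Longrightarrow> f e = h (\<phi> (prj E e), \<Phi> e)" "\<And>e. prj E e \<in> N \<Longrightarrow> g e = k (\<phi> (prj E e), \<Phi> e)"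
    and e: "prj E e = x"
  shows "taylor_sums (\<lambda>r. Lam f g (scale_vec E r e))"
proof -
  have N': "open N \<and> N \<subseteq> U \<inter> V \<inter> W" using N K by blast
  have loc': "linear h \<and> linear k \<and> (\<forall>e. prj E e \<in> N \<longrightarrow> f e = h (\<phi> (prj E e), \<Phi> e) \<and> g e = k (\<phi> (prj E e), \<Phi> e)) \<and>
      (\<forall>y\<in>N. \<Psi> (\<kappa> y) = 1)"
    using h loc \<kappa>W \<theta>1 N K by auto
  have "entire_on_fibre E x (\<lambda>e. \<Psi> (snd (bisymbol AT L J e [cot_elem AT L e f \<kappa>', cot_elem AT L e g \<kappa>'])))"
    using ent[unfolded fiberwise_entire_def, THEN bspec, OF c, unfolded prod.case, THEN bspec, OF tE, unfolded prod.case,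
        THEN bspec, OF tl, unfolded prod.case, THEN spec, THEN mp, OF N', THEN spec, THEN spec, THEN bspec, OF f(1),
        THEN bspec, OF f(2), THEN bspec, OF \<kappa>, THEN mp, OF loc'] N(2) by blast
  then have "entire_on_fibre E x (Lam f g)"
    unfolding bisymbol_eq[OF f \<kappa>] by (simp add: Lam_def[abs_def] bil_def)
  then show ?thesis using entire_on_fibre_iff[OF Lam_smooth[OF f] x_in(3)] e by blast
qed

lemma taylor_sums_combine:
  assumes sm: "smooth_on UNIV p" "smooth_on UNIV q" "smooth_on UNIV r" "smooth_on UNIV w"
    and t: "taylor_sums p" "taylor_sums q" "taylor_sums r" "taylor_sums w"
  shows "taylor_sums (\<lambda>t. p t + (- 1) * (t * (q t + r t)) + t * (t * w t))"
proof -
  show ?thesis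
    by (intro taylor_sums_add taylor_sums_cmult taylor_sums_times smooth_on_add smooth_times smooth_cmult sm t)
qed

lemma taylor_sums_G:
  assumes ent: "fiberwise_entire A E ell (bisymbol AT L J)" and s: "s \<in> sections A E" and lin: "linear \<alpha>" "linear \<beta>"
  shows "taylor_sums (G s \<alpha> \<beta>)"
proof -
  define \<xi> where "\<xi> = frechet_derivative (\<lambda>z. slope s \<alpha> (inv_into U \<phi> z)) (at (\<phi> x))"
  define \<zeta> where "\<zeta> = frechet_derivative (\<lambda>z. slope s \<beta> (inv_into U \<phi> z)) (at (\<phi> x))"
  have d: "((\<lambda>z. slope s \<alpha> (inv_into U \<phi> z)) has_derivative \<xi>) (at (\<phi> x))"
    "((\<lambda>z. slope s \<beta> (inv_into U \<phi> z)) has_derivative \<zeta>) (at (\<phi> x))"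
    unfolding \<xi>_def \<zeta>_def
    using ell.Cinf_derivative[OF slope_Cinf[OF s lin(1)] c x_in(1)] ell.Cinf_derivative[OF slope_Cinf[OF s lin(2)] c x_in(1)]
    by simp_all
  note l = has_derivative_linear[OF d(1)] has_derivative_linear[OF d(2)]
  have e: "prj E (s x) = x" using s by simp
  note C = fib_Cinf[OF lin(1)] fib_Cinf[OF lin(2)] bas_Cinf[OF l(1)] bas_Cinf[OF l(2)]
  note bl = bounded_linear.linear[OF bounded_linear_snd_fst(1)[OF lin(1)]] bounded_linear.linear[OF bounded_linear_snd_fst(1)[OF lin(2)]]
    bounded_linear.linear[OF bounded_linear_snd_fst(2)[OF l(1)]] bounded_linear.linear[OF bounded_linear_snd_fst(2)[OF l(2)]]
  show ?thesis
    unfolding G_eq_Lam_bas[OF s lin d]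
    by (intro taylor_sums_combine smooth_Lam_ray[OF _ _ e] C
        fiberwise_entire_taylor_sums[OF ent C(1,2) bl(1,2) fib_local fib_local e]
        fiberwise_entire_taylor_sums[OF ent C(3,2) bl(3,2) bas_local fib_local e]
        fiberwise_entire_taylor_sums[OF ent C(1,4) bl(1,4) fib_local bas_local e]
        fiberwise_entire_taylor_sums[OF ent C(3,4) bl(3,4) bas_local bas_local e]; assumption)
qed

text \<open>In the chart the section is affine near \<open>x\<close>, which realizes any value
  \<open>e\<close> and any differential \<open>B\<close>; the factor \<open>\<theta>\<close> makes
  it global.\<close>

lemma affine_section:
  assumes B: "linear (B :: 'b \<Rightarrow> 'f)" and e: "prj E e = x"
  obtains s where "s \<in> sections A E" "s x = e"
    "\<And>\<alpha>. linear \<alpha> \<Longrightarrow> ((\<lambda>z. slope s \<alpha> (inv_into U \<phi> z)) has_derivative (\<lambda>w. \<alpha> (B w))) (at (\<phi> x))"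
proof -
  let ?u = "\<lambda>y. \<theta> y *\<^sub>R (\<Phi> e + B (\<phi> y - \<phi> x))"
  have bB: "bounded_linear B" by (rule finite_dim_bounded_linear[OF E.fd B])
  have "smooth_wrt A UNIV (\<lambda>y. if y \<in> U then ?u y else 0)"
  proof (rule E.smooth_wrt_extend[OF E.chart_open(1)[OF c] K(1)])
    show "smooth_wrt A U ?u"
      by (intro E.smooth_wrt_scaleR \<theta>_smooth E.smooth_wrt_add E.smooth_wrt_const
          E.smooth_wrt_bounded_linear[OF bB] E.smooth_wrt_diff E.smooth_wrt_chart[OF c])
  qed (use K \<theta>0 in auto)
  then have sm: "smooth_wrt A V (\<lambda>y. if y \<in> U then ?u y else 0)" by (rule E.smooth_wrt_subset) simp
  have KV: "K \<subseteq> V" using K by blast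
  obtain s where s: "s \<in> sections A E" "\<And>y. y \<in> V \<Longrightarrow> \<Phi> (s y) = (if y \<in> U then ?u y else 0)"
  proof -
    have z: "(if y \<in> U then ?u y else 0) = 0" if "y \<in> V - K" for y using that \<theta>0 by auto
    show thesis using E.local_section[OF tE K(1) KV sm z] that by metis
  qed
  have sx: "s x = e"
    using s(1) s(2)[OF x_in(2)] x_in e \<theta>1 N by (intro E_eqI[OF tE]) (auto simp: linear_0[OF B])
  have "((\<lambda>z. slope s \<alpha> (inv_into U \<phi> z)) has_derivative (\<lambda>w. \<alpha> (B w))) (at (\<phi> x))" if \<alpha>: "linear \<alpha>" for \<alpha>
  proof -
    have b\<alpha>: "bounded_linear \<alpha>" by (rule finite_dim_bounded_linear[OF E.fd_fibre \<alpha>])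
    have "((\<lambda>z. \<alpha> (\<Phi> e + B (z - \<phi> x))) has_derivative (\<lambda>w. \<alpha> (0 + B (w - 0)))) (at (\<phi> x))"
      by (intro bounded_linear.has_derivative[OF b\<alpha>] has_derivative_add has_derivative_const
          bounded_linear.has_derivative[OF bB] has_derivative_diff has_derivative_ident)
    then have d: "((\<lambda>z. \<alpha> (\<Phi> e + B (z - \<phi> x))) has_derivative (\<lambda>w. \<alpha> (B w))) (at (\<phi> x))" by simp
    show ?thesis
    proof (rule has_derivative_transform_within_open[OF d])
      show "open (\<phi> ` (U \<inter> N))" by (rule E.chart_image_open[OF c N(1)])
      show "\<phi> x \<in> \<phi> ` (U \<inter> N)" using x_in N by blast
      fix z assume "z \<in> \<phi> ` (U \<inter> N)"
      then obtain y where y: "y \<in> U" "y \<in> N" "z = \<phi> y" by blast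
      have "y \<in> V" using y N K by blast
      then show "\<alpha> (\<Phi> e + B (z - \<phi> x)) = slope s \<alpha> (inv_into U \<phi> z)"
        using y c s(2)[of y] \<theta>1[OF y(2)] by (simp add: slope_def)
    qed
  qed
  then show thesis using that s(1) sx by blast
qed

lemma Lam_zero:
  assumes "g \<in> Cinf AT" "prj E e \<in> W"
  shows "Lam (\<lambda>_. 0) g e = 0" "Lam g (\<lambda>_. 0) e = 0"
proof -
  let ?g = "\<lambda>z. g z - g e"
  have g: "?g \<in> Cinf AT" and z: "(\<lambda>_. 0) \<in> Cinf AT" by (intro M.Cinf_diff M.Cinf_const assms)+
  show 1: "Lam (\<lambda>_. 0) g e = 0"
    \<comment> \<open>The zero function is written as \<open>?g\<close> minus 1 times
      \<open>?g\<close>.\<close>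
    using bil_diff[OF g g g z assms(2), of 1 0] by (simp add: Lam_def)
  show "Lam g (\<lambda>_. 0) e = 0"
    using 1 bil_skew[OF g z assms(2)] by (simp add: Lam_def)
qed

lemma Lam_skew:
  assumes "f \<in> Cinf AT" "g \<in> Cinf AT" "prj E e \<in> W"
  shows "Lam f g e = - Lam g f e"
  unfolding Lam_def by (intro bil_skew M.Cinf_diff M.Cinf_const assms)

lemma bas_zero: "bas (\<lambda>_. 0) = (\<lambda>_. 0)"
  by (auto simp: bas_def)

lemma Lam_add:
  assumes "f \<in> Cinf AT" "f' \<in> Cinf AT" "g \<in> Cinf AT" "g' \<in> Cinf AT" "prj E e \<in> W"
  shows "Lam (\<lambda>z. f z + f' z) (\<lambda>z. g z + g' z) e = Lam f g e + Lam f' g e + (Lam f g' e + Lam f' g' e)"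
proof -
  have C: "(\<lambda>z. h z - h e) \<in> Cinf AT" if "h \<in> Cinf AT" for h by (intro M.Cinf_diff M.Cinf_const that)
  have k: "(\<lambda>z. h z + h' z - (h e + h' e)) = (\<lambda>z. (h z - h e) - (- 1) * (h' z - h' e))" for h h' :: "'e \<Rightarrow> real"
    by auto
  show ?thesis
    unfolding Lam_def k by (subst bil_diff) (auto intro!: C assms)
qed

section \<open>The converse: isolating the components\<close>

context
  assumes MC: "\<And>s \<alpha> \<beta>. s \<in> sections A E \<Longrightarrow> linear \<alpha> \<Longrightarrow> linear \<beta> \<Longrightarrow> taylor_sums (G s \<alpha> \<beta>)"
begin

lemma taylor_sums_affine:
  assumes B: "linear (B :: 'b \<Rightarrow> 'f)" and e: "prj E e = x" and lin: "linear \<alpha>" "linear \<beta>"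
  shows "taylor_sums (\<lambda>t. Lam (fib \<alpha>) (fib \<beta>) (scale_vec E t e)
    + (- 1) * (t * (Lam (bas (\<lambda>w. \<alpha> (B w))) (fib \<beta>) (scale_vec E t e) + Lam (fib \<alpha>) (bas (\<lambda>w. \<beta> (B w))) (scale_vec E t e)))
    + t * (t * Lam (bas (\<lambda>w. \<alpha> (B w))) (bas (\<lambda>w. \<beta> (B w))) (scale_vec E t e)))"
proof -
  obtain s where s: "s \<in> sections A E" "s x = e"
    "\<And>\<alpha>. linear \<alpha> \<Longrightarrow> ((\<lambda>z. slope s \<alpha> (inv_into U \<phi> z)) has_derivative (\<lambda>w. \<alpha> (B w))) (at (\<phi> x))"
    using affine_section[OF B e] by metis
  show ?thesis using MC[OF s(1) lin] unfolding G_eq_Lam_bas[OF s(1) lin s(3)[OF lin(1)] s(3)[OF lin(2)]] s(2) .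
qed

text \<open>Constant section in the chart: with \<open>B = 0\<close> the slopes have vanishing
  differential at \<open>x\<close>, and every term with a factor t drops out.\<close>

lemma taylor_sums_fib_fib:
  assumes e: "prj E e = x" and lin: "linear \<alpha>" "linear \<beta>"
  shows "taylor_sums (\<lambda>t. Lam (fib \<alpha>) (fib \<beta>) (scale_vec E t e))"
proof -
  have B: "linear (\<lambda>w :: 'b. 0 :: 'f)" by (intro linearI) auto
  have "prj E (scale_vec E t e) \<in> W" for t using e x_in by (simp add: E.scale_vec)
  then show ?thesis
    using taylor_sums_affine[OF B e lin] lin
    by (simp add: linear_0 bas_zero Lam_zero fib_Cinf M.Cinf_const)
qed

text \<open>A rank one differential \<open>\<xi> \<otimes> w\<close> with \<open>\<beta> w = 0\<close> and \<open>\<alpha> w = 1\<close> leaves a single term besides the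
  vertical one. This is where rank one normal bundles drop out.\<close>

lemma taylor_sums_bas_fib:
  assumes e: "prj E e = x" and lin: "linear \<xi>" "linear \<beta>"
    and bc: "\<exists>b c :: 'f. b \<bullet> b = 1 \<and> c \<bullet> c = 1 \<and> b \<bullet> c = 0"
  shows "taylor_sums (\<lambda>t. Lam (bas \<xi>) (fib \<beta>) (scale_vec E t e))"
    "taylor_sums (\<lambda>t. Lam (fib \<beta>) (bas \<xi>) (scale_vec E t e))"
proof -
  obtain w \<alpha> where w: "linear \<alpha>" "\<beta> w = 0" "\<alpha> w = (1 :: real)"
    using bc kernel_vector[OF _ _ _ lin(2)] by metis
  have B: "linear (\<lambda>v. \<xi> v *\<^sub>R w)"
    by (intro linearI) (auto simp: linear_add[OF lin(1)] linear_cmul[OF lin(1)] scaleR_add_left)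
  have W: "prj E (scale_vec E t e) \<in> W" for t using e x_in by (simp add: E.scale_vec)
  have C: "bas \<xi> \<in> Cinf AT" "fib \<beta> \<in> Cinf AT" "fib \<alpha> \<in> Cinf AT" using lin w by (auto intro: bas_Cinf fib_Cinf)
  let ?p = "\<lambda>t. Lam (fib \<alpha>) (fib \<beta>) (scale_vec E t e)"
  let ?q = "\<lambda>t. Lam (bas \<xi>) (fib \<beta>) (scale_vec E t e)"
  have sm: "smooth_on UNIV ?p" "smooth_on UNIV ?q" by (intro smooth_Lam_ray C e)+
  have st: "smooth_on UNIV (\<lambda>t. t * ?q t)" by (intro smooth_on_mult smooth_on_ident sm)
  have 1: "taylor_sums (\<lambda>t. ?p t + (- 1) * (t * ?q t))"
    using taylor_sums_affine[OF B e w(1) lin(2)] w(2,3)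
    by (simp add: linear_cmul[OF w(1)] linear_cmul[OF lin(2)] bas_zero Lam_zero[OF _ W] C)
  have s1: "smooth_on UNIV (\<lambda>t. ?p t + (- 1) * (t * ?q t))"
    by (intro smooth_on_add sm smooth_on_mult[OF smooth_on_const st])
  \<comment> \<open>Adding back the vertical component, already known, leaves t times the mixed one,
    and \<open>taylor_sums_times_iff\<close> removes the factor.\<close>
  have "taylor_sums (\<lambda>t. (- 1) * (?p t + (- 1) * (t * ?q t)) + ?p t)"
    by (intro taylor_sums_add taylor_sums_cmult s1 1 smooth_on_mult[OF smooth_on_const s1] sm taylor_sums_fib_fib e w lin)
  then have "taylor_sums (\<lambda>t. t * ?q t)" by simp
  then show q: "taylor_sums ?q" using taylor_sums_times_iff[OF sm(2)] by blast
  have "Lam (fib \<beta>) (bas \<xi>) (scale_vec E t e) = - 1 * ?q t" for t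
    using Lam_skew[OF C(2,1) W] by simp
  then show "taylor_sums (\<lambda>t. Lam (fib \<beta>) (bas \<xi>) (scale_vec E t e))"
    using taylor_sums_cmult[OF sm(2) q, of "- 1"] by simp
qed

text \<open>The differential \<xi> b1 + \<zeta> b2 and the forms dual to \<open>b1\<close> and
  \<open>b2\<close> produce the slopes \<xi> and \<zeta>. The vertical and mixed terms are known and
  can be subtracted, which leaves t^2 times the horizontal one.\<close>

lemma taylor_sums_bas_bas:
  assumes e: "prj E e = x" and lin: "linear \<xi>" "linear \<zeta>"
    and bc: "\<exists>b c :: 'f. b \<bullet> b = 1 \<and> c \<bullet> c = 1 \<and> b \<bullet> c = 0"
  shows "taylor_sums (\<lambda>t. Lam (bas \<xi>) (bas \<zeta>) (scale_vec E t e))"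
proof -
  obtain b1 b2 :: 'f where b: "b1 \<bullet> b1 = 1" "b2 \<bullet> b2 = 1" "b1 \<bullet> b2 = 0" using bc by blast
  define \<alpha> \<beta> where "\<alpha> u = u \<bullet> b1" and "\<beta> u = u \<bullet> b2" for u :: 'f
  have l: "linear \<alpha>" "linear \<beta>" unfolding \<alpha>_def[abs_def] \<beta>_def[abs_def]
    by (auto intro!: linearI simp: inner_add_left)
  have B: "linear (\<lambda>v. \<xi> v *\<^sub>R b1 + \<zeta> v *\<^sub>R b2)"
    by (intro linearI) (auto simp: linear_add[OF lin(1)] linear_cmul[OF lin(1)] linear_add[OF lin(2)]
        linear_cmul[OF lin(2)] algebra_simps)
  have \<alpha>\<beta>: "\<alpha> (\<xi> v *\<^sub>R b1 + \<zeta> v *\<^sub>R b2) = \<xi> v" "\<beta> (\<xi> v *\<^sub>R b1 + \<zeta> v *\<^sub>R b2) = \<zeta> v" for v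
    using b by (simp_all add: \<alpha>_def \<beta>_def inner_add_left inner_commute[of b2 b1])
  have C: "bas \<xi> \<in> Cinf AT" "bas \<zeta> \<in> Cinf AT" "fib \<beta> \<in> Cinf AT" "fib \<alpha> \<in> Cinf AT" using lin l by (auto intro: bas_Cinf fib_Cinf)
  let ?p = "\<lambda>t. Lam (fib \<alpha>) (fib \<beta>) (scale_vec E t e)"
  let ?q = "\<lambda>t. Lam (bas \<xi>) (fib \<beta>) (scale_vec E t e)"
  let ?r = "\<lambda>t. Lam (fib \<alpha>) (bas \<zeta>) (scale_vec E t e)"
  let ?w = "\<lambda>t. Lam (bas \<xi>) (bas \<zeta>) (scale_vec E t e)"
  have sm: "smooth_on UNIV ?p" "smooth_on UNIV ?q" "smooth_on UNIV ?r" "smooth_on UNIV ?w" by (intro smooth_Lam_ray C e)+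
  have s1: "smooth_on UNIV (\<lambda>t. ?q t + ?r t)" by (intro smooth_on_add sm)
  have s2: "smooth_on UNIV (\<lambda>t. ?p t + (- 1) * (t * (?q t + ?r t)) + t * (t * ?w t))"
    by (intro smooth_on_add sm smooth_times smooth_cmult)
  have "taylor_sums (\<lambda>t. (?p t + (- 1) * (t * (?q t + ?r t)) + t * (t * ?w t)) + ((- 1) * ?p t + t * (?q t + ?r t)))"
  proof (rule taylor_sums_add[OF s2 smooth_on_add[OF smooth_cmult[OF sm(1)] smooth_times[OF s1]] taylor_sums_affine[OF B e l, unfolded \<alpha>\<beta>]])
    show "taylor_sums (\<lambda>t. (- 1) * ?p t + t * (?q t + ?r t))"
      by (intro taylor_sums_add taylor_sums_cmult taylor_sums_times s1 sm smooth_cmult[OF sm(1)] smooth_times[OF s1]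
          taylor_sums_fib_fib taylor_sums_bas_fib e l lin bc)
  qed
  then have "taylor_sums (\<lambda>t. t * (t * ?w t))" by (simp add: algebra_simps)
  then show ?thesis using taylor_sums_times_iff[OF smooth_times[OF sm(4)]] taylor_sums_times_iff[OF sm(4)] by simp
qed

lemma taylor_sums_components:
  assumes dims: "dim (UNIV :: 'f set) \<noteq> 1 \<or> dim (UNIV :: 'b set) = 0"
    and e: "prj E e = x" and lin: "linear \<alpha>" "linear \<beta>" "linear \<xi>" "linear \<zeta>"
  shows "taylor_sums (\<lambda>t. Lam (\<lambda>z. fib \<alpha> z + bas \<xi> z) (\<lambda>z. fib \<beta> z + bas \<zeta> z) (scale_vec E t e))"
proof -
  have W: "prj E (scale_vec E t e) \<in> W" for t using e x_in by (simp add: E.scale_vec)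
  note C = fib_Cinf[OF lin(1)] fib_Cinf[OF lin(2)] bas_Cinf[OF lin(3)] bas_Cinf[OF lin(4)]
  show ?thesis
  proof (cases "\<forall>u :: 'f. u = 0")
    case True
    \<comment> \<open>In rank zero each fibre is a point, so the function on the ray is
      constant.\<close>
    then have "scale_vec E t e = e" for t
      using e x_in by (intro E_eqI[OF tE]) (auto simp: E.scale_vec, metis)
    then show ?thesis using taylor_sums_const by simp
  next
    case False
    have "taylor_sums (\<lambda>t. Lam (bas \<xi>) (fib \<beta>) (scale_vec E t e)) \<and>
      taylor_sums (\<lambda>t. Lam (fib \<alpha>) (bas \<zeta>) (scale_vec E t e)) \<and>
      taylor_sums (\<lambda>t. Lam (bas \<xi>) (bas \<zeta>) (scale_vec E t e))"
    proof (cases "dim (UNIV :: 'b set) = 0")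
      case True
      \<comment> \<open>A base of dimension 0 has no coordinate functions other than 0, so all mixed
        and horizontal components vanish.\<close>
      then have z: "(w :: 'b) = 0" for w using finite_dim_dim_0[OF E.fd] by blast
      have "\<xi> w = 0" "\<zeta> w = 0" for w
        using z[of w] linear_0[OF lin(3)] linear_0[OF lin(4)] by auto
      then have "bas \<xi> = (\<lambda>_. 0)" "bas \<zeta> = (\<lambda>_. 0)" by (auto simp: bas_def)
      then show ?thesis using C W by (simp add: Lam_zero M.Cinf_const taylor_sums_const)
    next
      case nz: False
      then have "dim (UNIV :: 'f set) \<noteq> 1" using dims by simp
      from finite_dim_dim_not_1[OF E.fd_fibre this] False
      have "\<exists>b c :: 'f. b \<bullet> b = 1 \<and> c \<bullet> c = 1 \<and> b \<bullet> c = 0" by simp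
      then show ?thesis
        using taylor_sums_bas_fib[OF e] taylor_sums_bas_bas[OF e] lin by blast
    qed
    then have "taylor_sums (\<lambda>t. Lam (fib \<alpha>) (fib \<beta>) (scale_vec E t e) + Lam (bas \<xi>) (fib \<beta>) (scale_vec E t e)
        + (Lam (fib \<alpha>) (bas \<zeta>) (scale_vec E t e) + Lam (bas \<xi>) (bas \<zeta>) (scale_vec E t e)))"
      by (intro taylor_sums_add smooth_on_add smooth_Lam_ray C e taylor_sums_fib_fib lin) auto
    then show ?thesis using Lam_add[OF C(1,3,2,4) W] by simp
  qed
qed

end

end

section \<open>The two implications\<close>

context coisotropic_normal
begin

lemma MC_converges:
  assumes ent: "fiberwise_entire A E ell (bisymbol AT L J)" and s: "s \<in> sections A E"
  shows "MC_converges_to A E ell J (neg_sec E s) (P_op A E ell (push_op L (exp_I E (neg_sec E s)) (bracket_op J)))"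
  unfolding MC_converges_to_def
proof (intro allI ballI)
  fix x \<eta>1 \<eta>2 T assume \<eta>: "\<eta>1 \<in> conormal A E ell x" "\<eta>2 \<in> conormal A E ell x" and T: "T \<in> triv ell"
  obtain W \<Psi> where TW: "T = (W, \<Psi>)" by force
  show "case T of (W, \<Psi>) \<Rightarrow> x \<in> W \<longrightarrow>
    (\<lambda>k. \<Psi> (multibracket A E ell J (replicate (Suc k) (neg_sec E s)) x [\<eta>1, \<eta>2]) / fact (Suc k)) sums
    \<Psi> (P_op A E ell (push_op L (exp_I E (neg_sec E s)) (bracket_op J)) x [\<eta>1, \<eta>2])"
    unfolding TW prod.case
  proof
    assume x: "x \<in> W"
    have t: "(W, \<Psi>) \<in> triv ell" using T TW by simp
    obtain U \<phi> V \<Phi> where c: "(U, \<phi>) \<in> A" "(V, \<Phi>) \<in> triv E" "x \<in> U" "x \<in> V" using total_chart_ex by blast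
    have o: "open (U \<inter> V \<inter> W)" "x \<in> U \<inter> V \<inter> W" "U \<inter> V \<inter> W \<subseteq> U \<inter> V \<inter> W"
      using E.chart_open(1)[OF c(1)] E.triv_open[OF c(2)] ell.triv_open[OF t] c x by auto
    obtain \<theta> \<kappa> N K where fr: "normal_frame A E ell J U \<phi> V \<Phi> W \<Psi> \<theta> \<kappa> N K x"
      by (rule normal_frame_exists[OF c(1,2) t o]) (rule that)
    interpret F: normal_frame A E ell J U \<phi> V \<Phi> W \<Psi> \<theta> \<kappa> N K x by (rule fr)
    obtain \<alpha> where a: "F.conormal_rep \<eta>1 \<alpha>" using F.conormal_repE[OF \<eta>(1)] .
    obtain \<beta> where b: "F.conormal_rep \<eta>2 \<beta>" using F.conormal_repE[OF \<eta>(2)] .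
    have "linear \<alpha>" "linear \<beta>" using a b by (simp_all add: F.conormal_rep_def)
    then show "(\<lambda>k. \<Psi> (multibracket A E ell J (replicate (Suc k) (neg_sec E s)) x [\<eta>1, \<eta>2]) / fact (Suc k)) sums
      \<Psi> (P_op A E ell (push_op L (exp_I E (neg_sec E s)) (bracket_op J)) x [\<eta>1, \<eta>2])"
      unfolding F.MC_iff_taylor_sums[OF s a b] by (rule F.taylor_sums_G[OF ent s])
  qed
qed

lemma fiberwise_entire_of_MC:
  assumes dims: "dim (UNIV :: 'f set) \<noteq> 1 \<or> dim (UNIV :: 'b set) = 0"
    and MC: "\<And>s. s \<in> sections A E \<Longrightarrow>
      MC_converges_to A E ell J (neg_sec E s) (P_op A E ell (push_op L (exp_I E (neg_sec E s)) (bracket_op J)))"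
  shows "fiberwise_entire A E ell (bisymbol AT L J)"
proof -
  have "entire_on_fibre E x (\<lambda>e. \<Psi> (snd (bisymbol AT L J e
      [cot_elem AT L e f (pullback_sec E \<rho>), cot_elem AT L e g (pullback_sec E \<rho>)])))"
    if c: "(U, \<phi>) \<in> A" and tE: "(V, \<Phi>) \<in> triv E" and tl: "(W, \<Psi>) \<in> triv ell" and N0: "open N0 \<and> N0 \<subseteq> U \<inter> V \<inter> W"
      and f: "f \<in> Cinf AT" and g: "g \<in> Cinf AT" and \<rho>: "\<rho> \<in> sections A ell"
      and loc: "linear h \<and> linear k \<and> (\<forall>e. prj E e \<in> N0 \<longrightarrow> f e = h (\<phi> (prj E e), \<Phi> e) \<and> g e = k (\<phi> (prj E e), \<Phi> e)) \<and>
        (\<forall>y\<in>N0. \<Psi> (\<rho> y) = 1)" and x: "x \<in> N0"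
    for U \<phi> V \<Phi> W \<Psi> N0 h k f g \<rho> x
  proof -
    obtain \<theta> \<kappa> N K where fr: "normal_frame A E ell J U \<phi> V \<Phi> W \<Psi> \<theta> \<kappa> N K x" and NN: "N \<subseteq> N0"
      by (rule normal_frame_exists[OF c tE tl conjunct1[OF N0] x conjunct2[OF N0]]) (rule that)
    interpret F: normal_frame A E ell J U \<phi> V \<Phi> W \<Psi> \<theta> \<kappa> N K x by (rule fr)
    have G: "taylor_sums (F.G s \<alpha> \<beta>)" if s: "s \<in> sections A E" and lin: "linear \<alpha>" "linear \<beta>" for s \<alpha> \<beta>
    proof -
      \<comment> \<open>Every linear form on the fibre is realized by a conormal covector, so the
        hypothesis yields the Taylor property of \<open>G\<close> for all pairs of forms.\<close>
      note a = F.conormal_rep_fib[OF lin(1)] and b = F.conormal_rep_fib[OF lin(2)]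
      have "x \<in> W" by (rule F.x_in)
      then show ?thesis
        using MC[OF s] a(2) b(2) tl unfolding MC_converges_to_def F.MC_iff_taylor_sums[OF s a(1) b(1), symmetric] by blast
    qed
    \<comment> \<open>A linear coordinate on the chart splits into a base part and a fibre part,
      represented by \<open>bas\<close> and \<open>fib\<close>.\<close>
    define h1 h2 k1 k2 where "h1 w = h (w, 0)" and "h2 u = h (0, u)" and "k1 w = k (w, 0)" and "k2 u = k (0, u)" for w u
    have lh: "linear h" "linear k" using loc by auto
    have p: "linear (\<lambda>w :: 'b. (w, 0 :: 'f))" "linear (\<lambda>u :: 'f. (0 :: 'b, u))" by (auto intro!: linearI)
    have l: "linear h1" "linear h2" "linear k1" "linear k2"
      unfolding h1_def[abs_def] h2_def[abs_def] k1_def[abs_def] k2_def[abs_def]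
      using linear_compose[OF p(1) lh(1)] linear_compose[OF p(2) lh(1)]
        linear_compose[OF p(1) lh(2)] linear_compose[OF p(2) lh(2)] by (simp_all add: comp_def)
    have hk: "h p = h2 (snd p) + h1 (fst p)" "k p = k2 (snd p) + k1 (fst p)" for p
      using linear_add[OF lh(1), of "(fst p, 0)" "(0, snd p)"] linear_add[OF lh(2), of "(fst p, 0)" "(0, snd p)"]
      by (simp_all add: h1_def h2_def k1_def k2_def)
    let ?f = "\<lambda>z. F.fib h2 z + F.bas h1 z" and ?g = "\<lambda>z. F.fib k2 z + F.bas k1 z"
    have C: "?f \<in> Cinf AT" "?g \<in> Cinf AT" by (intro M.Cinf_add F.fib_Cinf F.bas_Cinf l)+
    have bl: "bounded_linear h" "bounded_linear k" using lh by (auto intro: finite_dim_bounded_linear[OF M.fd])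
    have loc': "?f e = h (\<phi> (prj E e), \<Phi> e)" "?g e = k (\<phi> (prj E e), \<Phi> e)" if "prj E e \<in> N" for e
      using F.fib_local[OF that] F.bas_local[OF that] by (simp_all add: hk)
    have locf: "f e = h (\<phi> (prj E e), \<Phi> e)" "g e = k (\<phi> (prj E e), \<Phi> e)" if "prj E e \<in> N" for e
      using loc NN that by auto
    \<comment> \<open>Near the fibre over \<open>x\<close> the given functions and the sums of
      \<open>fib\<close> and \<open>bas\<close> coincide with the same linear coordinates, so their
      differentials agree even though the functions may differ elsewhere.\<close>
    have eq: "\<Psi> (snd (bisymbol AT L J e [cot_elem AT L e f (pullback_sec E \<rho>), cot_elem AT L e g (pullback_sec E \<rho>)])) =
        F.Lam ?f ?g e" if e: "prj E e = x" for e
      unfolding F.bisymbol_eq[OF f g \<rho>]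
    proof (rule F.Lam_cong[OF _ f C(1) g C(2) \<rho>])
      show e': "prj E e \<in> N" using e F.N by simp
      show "\<Psi> (\<rho> (prj E e)) = 1" using loc x e by simp
      show "((\<lambda>z. f (tchart_inv U \<phi> V \<Phi> z)) has_derivative h) (at (tchart \<phi> \<Phi> e))"
        by (rule F.local_derivative[OF e' bl(1) locf(1)])
      show "((\<lambda>z. ?f (tchart_inv U \<phi> V \<Phi> z)) has_derivative h) (at (tchart \<phi> \<Phi> e))"
        by (rule F.local_derivative[OF e' bl(1) loc'(1)])
      show "((\<lambda>z. g (tchart_inv U \<phi> V \<Phi> z)) has_derivative k) (at (tchart \<phi> \<Phi> e))"
        by (rule F.local_derivative[OF e' bl(2) locf(2)])
      show "((\<lambda>z. ?g (tchart_inv U \<phi> V \<Phi> z)) has_derivative k) (at (tchart \<phi> \<Phi> e))"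
        by (rule F.local_derivative[OF e' bl(2) loc'(2)])
    qed
    have "entire_on_fibre E x (F.Lam ?f ?g)"
      unfolding entire_on_fibre_iff[OF F.Lam_smooth[OF C] F.x_in(3)]
      using F.taylor_sums_components[OF G dims _ l(2,4,1,3)] by blast
    then show ?thesis using entire_on_fibre_cong[of x, OF eq] by simp
  qed
  then show ?thesis unfolding fiberwise_entire_def by blast
qed

end

theorem proposition4p14:
  fixes A :: "('s::topological_space, 'b::real_inner) atlas"
    and E :: "('e::topological_space, 's, 'f::real_inner) vbundle"
    and ell :: "('l::topological_space, 's, real) vbundle"
    and J :: "('e, 'e \<times> 'l) sec_bracket"
  assumes "smooth_manifold A"
    and "vector_bundle A E" and "tot E = UNIV"
    and "line_bundle A ell"
    and "jacobi_manifold (total_atlas A E) (pullback E ell) J"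
    and "closed (range (zero_vec E))"
    and "coisotropic A (total_atlas A E) (zero_vec E) (pullback E ell) J"
  shows
    "(\<forall>s\<in>sections A E. \<forall>x. \<forall>\<eta>\<^sub>1\<in>conormal A E ell x. \<forall>\<eta>\<^sub>2\<in>conormal A E ell x.
        P_op A E ell
          (push_op (pullback E ell) (exp_I E (neg_sec E s)) (bracket_op J)) x [\<eta>\<^sub>1, \<eta>\<^sub>2] =
        P_form E
          (push_form (total_atlas A E) (pullback E ell) (exp_I E (neg_sec E s))
            (bisymbol (total_atlas A E) (pullback E ell) J)) x [\<eta>\<^sub>1, \<eta>\<^sub>2]) \<and>
     (dim (UNIV :: 'f set) \<noteq> 1 \<or> dim (UNIV :: 'b set) = 0 \<longrightarrow>
       (fiberwise_entire A E ell (bisymbol (total_atlas A E) (pullback E ell) J) \<longleftrightarrow>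
        (\<forall>s\<in>sections A E. MC_converges_to A E ell J (neg_sec E s)
           (P_op A E ell
              (push_op (pullback E ell) (exp_I E (neg_sec E s)) (bracket_op J)))))) \<and>
     (fiberwise_entire A E ell (bisymbol (total_atlas A E) (pullback E ell) J) \<longrightarrow>
        (\<forall>s\<in>sections A E. MC_converges_to A E ell J (neg_sec E s)
           (P_op A E ell
              (push_op (pullback E ell) (exp_I E (neg_sec E s)) (bracket_op J)))))"
proof -
  interpret coisotropic_normal A E ell J
    using assms by unfold_locales (auto simp: jacobi_manifold_def)
  show ?thesis
    using P_push_op_eq_P_push_form MC_converges fiberwise_entire_of_MC by blast
qed

end
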